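(* Let $N\ge1$, $n\ge1$, and let $\Omega\subset\mathbb{R}^N$ be a bounded $C^2$ domain. For $1\le i\le n$ let $F_i:\mathbb{R}^N\times\mathbb{S}^N(\mathbb{R})\to\mathbb{R}$, $F_i=F_i(p,X)$, and $f_i:\mathbb{R}^n\times\mathbb{R}^N\to\mathbb{R}$, $f_i=f_i(\mathbf{u},p)$ (no dependence on $x$). Assume that each $F_i(p,X)$ is continuously differentiable in $X$, and that conditions $(H_0)$, $(H_1)$, $(H_2)$, $(H_4)$, $(H_5)$ listed in the context hold for all $1\le i\le n$. Let $u_1,\dots,u_n\in C^2(\overline{\Omega})$ satisfy, for every $1\le i\le n$, $$F_i(Du_i,D^2u_i)+f_i(u_1,\dots,u_n,Du_i)=0\ \text{ in }\Omega,\qquad u_i>0\ \text{ in }\Omega,\qquad u_i=0\ \text{ on }\partial\Omega,$$ and assume that for every $1\le i\le n$ there is a constant $c_i$ with $\partial_\nu u_i=c_i$ on $\partial\Omega$, where $\nu$ is the unit interior normal to $\partial\Omega$. Then $\Omega$ is a ball and, for all $1\le i\le n$, $u_i$ is radially symmetric (about the center of this ball) and $\partial_r u_i<0$ at every point of $\Omega$ other than the center, where $r$ is the distance to the center.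
   Context: $\mathbb{S}^N(\mathbb{R})$ is the space of real symmetric $N\times N$ matrices. For constants $0<\alpha_i\le\beta_i$, the Pucci extremal operators are $\mathcal{M}_i^+(X)=\sup_{\alpha_i I\le A\le\beta_i I}\mathrm{tr}(AX)$ and $\mathcal{M}_i^-(X)=\inf_{\alpha_i I\le A\le\beta_i I}\mathrm{tr}(AX)$, where $A$ ranges over symmetric matrices. Write $\mathbf{u}=(u_1,\dots,u_n)\in\mathbb{R}^n$, $p\in\mathbb{R}^N$, $X\in\mathbb{S}^N(\mathbb{R})$, and $\mathcal{F}_i(\mathbf{u},p,X)=F_i(p,X)+f_i(\mathbf{u},p)$. $\overline{B}_\sigma$ denotes the closed ball of radius $\sigma$ centered at $0$ (in $\mathbb{R}^N$ or $\mathbb{R}^n$ according to the variable). $(H_0)$ $\mathcal{F}_i(\mathbf{u},Qp,Q^tXQ)=\mathcal{F}_i(\mathbf{u},p,X)$ for every orthogonal $N\times N$ matrix $Q$ and all $\mathbf{u},p,X$. $(H_1)$ For some constants $0<\alpha_i\le\beta_i$ and $\gamma\ge 0$: $\mathcal{M}_i^-(X-Y)-\gamma|p-q|\le F_i(p,X)-F_i(q,Y)\le\mathcal{M}_i^+(X-Y)+\gamma|p-q|$ for all $X,Y\in\mathbb{S}^N(\mathbb{R})$, $p,q\in\mathbb{R}^N$; and $F_i(0,0)=0$. $(H_2)$ For every $\sigma>0$ there is $\mu_\sigma\ge 0$ such that $|f_i(\mathbf{u},p)-f_i(\mathbf{u},q)|\le\mu_\sigma|p-q|$ for all $p,q\in\overline{B}_\sigma$,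 $\mathbf{u}\in\overline{B}_\sigma$. $(H_4)$ $f_i=f_{i,1}+f_{i,2}$, where $f_{i,1}$ is uniformly locally Lipschitz in the component $u_i$, and $f_{i,2}$ is nondecreasing in $u_i$, whenever the remaining components $u_j$ ($j\ne i$) and $p$ are fixed. (Uniformly locally Lipschitz: for $\mathbf{u}$ and $p$ in bounded sets, the Lipschitz constant in $u_i$ may be chosen independent of $p$ and of the $u_j$, $j\neq i$.) $(H_5)$ For every $j\ne i$, the map $u_j\mapsto f_i(u_1,\dots,u_n,p)$ is nondecreasing when $p$ and all $u_l$, $l\ne j$, are fixed. *)

theory Defs
  imports "HOL-Analysis.Analysis"
begin

section \<open>Symmetric matrices and Pucci operators\<close>

definition sym_matrices :: "(real^'N^'N) set" where
  "sym_matrices = {X. transpose X = X}"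

definition loewner_le :: "real^'N^'N \<Rightarrow> real^'N^'N \<Rightarrow> bool" where
  "loewner_le A B \<longleftrightarrow> (\<forall>x. x \<bullet> (A *v x) \<le> x \<bullet> (B *v x))"

text \<open>\<^term>\<open>mat a\<close> is the scalar matrix \<open>a I\<close>.\<close>

definition pucci_class :: "real \<Rightarrow> real \<Rightarrow> (real^'N^'N) set" where
  "pucci_class \<alpha> \<beta> = {A \<in> sym_matrices. loewner_le (mat \<alpha>) A \<and> loewner_le A (mat \<beta>)}"

definition pucci_plus :: "real \<Rightarrow> real \<Rightarrow> real^'N^'N \<Rightarrow> real" where
  "pucci_plus \<alpha> \<beta> X = (SUP A\<in>pucci_class \<alpha> \<beta>. trace (A ** X))"

definition pucci_minus :: "real \<Rightarrow> real \<Rightarrow> real^'N^'N \<Rightarrow> real" where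
  "pucci_minus \<alpha> \<beta> X = (INF A\<in>pucci_class \<alpha> \<beta>. trace (A ** X))"


section \<open>Structural conditions for a single equation\<close>

text \<open>The nonlinearity \<open>F\<close> is a function on all square matrices, but only its values
  on \<^const>\<open>sym_matrices\<close> are ever constrained or used.\<close>

definition H0 ::
  "(real^'N \<Rightarrow> real^'N^'N \<Rightarrow> real) \<Rightarrow> (real^'n \<Rightarrow> real^'N \<Rightarrow> real) \<Rightarrow> bool" where
  "H0 F f \<longleftrightarrow> (\<forall>Q v p. \<forall>X\<in>sym_matrices. orthogonal_matrix Q \<longrightarrow>
     F (Q *v p) (transpose Q ** X ** Q) + f v (Q *v p) = F p X + f v p)"

definition H1 :: "(real^'N \<Rightarrow> real^'N^'N \<Rightarrow> real) \<Rightarrow> bool" where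
  "H1 F \<longleftrightarrow>
     (\<exists>\<alpha> \<beta> \<gamma>. 0 < \<alpha> \<and> \<alpha> \<le> \<beta> \<and> 0 \<le> \<gamma> \<and>
        (\<forall>p q. \<forall>X\<in>sym_matrices. \<forall>Y\<in>sym_matrices.
           pucci_minus \<alpha> \<beta> (X - Y) - \<gamma> * norm (p - q) \<le> F p X - F q Y \<and>
           F p X - F q Y \<le> pucci_plus \<alpha> \<beta> (X - Y) + \<gamma> * norm (p - q))) \<and>
     F 0 0 = 0"

definition H2 :: "(real^'n \<Rightarrow> real^'N \<Rightarrow> real) \<Rightarrow> bool" where
  "H2 f \<longleftrightarrow> (\<forall>\<sigma>>0. \<exists>\<mu>\<ge>0. \<forall>p\<in>cball 0 \<sigma>. \<forall>q\<in>cball 0 \<sigma>. \<forall>v\<in>cball 0 \<sigma>.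
     \<bar>f v p - f v q\<bar> \<le> \<mu> * norm (p - q))"

definition agree_except :: "'n \<Rightarrow> real^'n \<Rightarrow> real^'n \<Rightarrow> bool" where
  "agree_except j v w \<longleftrightarrow> (\<forall>l. l \<noteq> j \<longrightarrow> v $ l = w $ l)"

definition nondecreasing_in :: "'n \<Rightarrow> (real^'n \<Rightarrow> real^'N \<Rightarrow> real) \<Rightarrow> bool" where
  "nondecreasing_in j g \<longleftrightarrow>
     (\<forall>p v w. agree_except j v w \<longrightarrow> v $ j \<le> w $ j \<longrightarrow> g v p \<le> g w p)"

definition unif_loc_lipschitz_in :: "'n \<Rightarrow> (real^'n \<Rightarrow> real^'N \<Rightarrow> real) \<Rightarrow> bool" where
  "unif_loc_lipschitz_in j g \<longleftrightarrow>
     (\<forall>V P. bounded V \<longrightarrow> bounded P \<longrightarrow>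
        (\<exists>L\<ge>0. \<forall>p\<in>P. \<forall>v\<in>V. \<forall>w\<in>V. agree_except j v w \<longrightarrow>
           \<bar>g v p - g w p\<bar> \<le> L * \<bar>v $ j - w $ j\<bar>))"

definition H4 :: "'n \<Rightarrow> (real^'n \<Rightarrow> real^'N \<Rightarrow> real) \<Rightarrow> bool" where
  "H4 i f \<longleftrightarrow> (\<exists>f1 f2. (\<forall>v p. f v p = f1 v p + f2 v p) \<and>
     unif_loc_lipschitz_in i f1 \<and> nondecreasing_in i f2)"

definition H5 :: "'n \<Rightarrow> (real^'n \<Rightarrow> real^'N \<Rightarrow> real) \<Rightarrow> bool" where
  "H5 i f \<longleftrightarrow> (\<forall>j. j \<noteq> i \<longrightarrow> nondecreasing_in j f)"

text \<open>For each fixed \<open>p\<close>, the map \<open>X \<mapsto> F p X\<close> is continuously differentiable on the linear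
  space of symmetric matrices.  The derivative is taken within that subspace; how
  \<open>D X\<close> acts off the subspace is immaterial.\<close>

definition C1_in_matrix :: "(real^'N \<Rightarrow> real^'N^'N \<Rightarrow> real) \<Rightarrow> bool" where
  "C1_in_matrix F \<longleftrightarrow>
     (\<forall>p. \<exists>D :: real^'N^'N \<Rightarrow> (real^'N^'N, real) blinfun.
        (\<forall>X\<in>sym_matrices. (F p has_derivative blinfun_apply (D X)) (at X within sym_matrices)) \<and>
        continuous_on sym_matrices D)"


section \<open>Functions of class \<open>C\<^sup>2\<close>\<close>

definition grad :: "(real^'N \<Rightarrow> real) \<Rightarrow> real^'N \<Rightarrow> real^'N" where
  "grad u x = (\<chi> k. frechet_derivative u (at x) (axis k 1))"

definition hessian :: "(real^'N \<Rightarrow> real) \<Rightarrow> real^'N \<Rightarrow> real^'N^'N" where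
  "hessian u x = jacobian (grad u) (at x)"

definition C2_on :: "(real^'N) set \<Rightarrow> (real^'N \<Rightarrow> real) \<Rightarrow> bool" where
  "C2_on S u \<longleftrightarrow> open S \<and> (\<forall>x\<in>S. u differentiable at x \<and> grad u differentiable at x) \<and>
     continuous_on S (hessian u)"

text \<open>\<open>C\<^sup>2\<close> up to the boundary: all derivatives of order at most two extend continuously
  from \<open>\<Omega>\<close> to its closure.\<close>

definition C2_closure :: "(real^'N) set \<Rightarrow> (real^'N \<Rightarrow> real) \<Rightarrow> bool" where
  "C2_closure \<Omega> u \<longleftrightarrow> C2_on \<Omega> u \<and> continuous_on (closure \<Omega>) u \<and>
     (\<exists>G. continuous_on (closure \<Omega>) G \<and> (\<forall>x\<in>\<Omega>. G x = grad u x)) \<and>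
     (\<exists>H. continuous_on (closure \<Omega>) H \<and> (\<forall>x\<in>\<Omega>. H x = hessian u x))"


section \<open>Domains of class \<open>C\<^sup>2\<close> and normal derivatives\<close>

text \<open>Near each boundary point, \<open>\<Omega>\<close> lies strictly above the graph of a \<open>C\<^sup>2\<close> function in the
  direction of some unit vector \<open>e\<close>.  The graph function only sees the component of
  \<open>x\<close> orthogonal to \<open>e\<close>, so it is really a function of \<open>N - 1\<close> variables.\<close>

definition C2_boundary :: "(real^'N) set \<Rightarrow> bool" where
  "C2_boundary \<Omega> \<longleftrightarrow>
     (\<forall>x0\<in>frontier \<Omega>. \<exists>e r \<phi>. norm e = 1 \<and> r > 0 \<and> C2_on UNIV \<phi> \<and>
        \<Omega> \<inter> ball x0 r = {x \<in> ball x0 r. \<phi> (x - (x \<bullet> e) *\<^sub>R e) < x \<bullet> e})"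

definition bounded_C2_domain :: "(real^'N) set \<Rightarrow> bool" where
  "bounded_C2_domain \<Omega> \<longleftrightarrow>
     open \<Omega> \<and> connected \<Omega> \<and> \<Omega> \<noteq> {} \<and> bounded \<Omega> \<and> C2_boundary \<Omega>"

text \<open>A unit vector orthogonal to the velocities at \<open>x\<close> of all curves in the boundary
  and pointing into \<open>\<Omega>\<close>; for a \<open>C\<^sup>2\<close> domain there is exactly one.\<close>

definition interior_unit_normal :: "(real^'N) set \<Rightarrow> real^'N \<Rightarrow> real^'N \<Rightarrow> bool" where
  "interior_unit_normal \<Omega> x \<nu> \<longleftrightarrow> norm \<nu> = 1 \<and>
     (\<forall>g v. g (0::real) = x \<longrightarrow> range g \<subseteq> frontier \<Omega> \<longrightarrow>
        (g has_vector_derivative v) (at 0) \<longrightarrow> v \<bullet> \<nu> = 0) \<and>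
     (\<exists>\<delta>>0. \<forall>t. 0 < t \<and> t < \<delta> \<longrightarrow> x + t *\<^sub>R \<nu> \<in> \<Omega>)"

text \<open>One-sided, so that only values of \<open>u\<close> in the closure of \<open>\<Omega>\<close> matter.\<close>

definition has_normal_deriv ::
  "(real^'N) set \<Rightarrow> (real^'N \<Rightarrow> real) \<Rightarrow> real^'N \<Rightarrow> real \<Rightarrow> bool" where
  "has_normal_deriv \<Omega> u x c \<longleftrightarrow>
     (\<forall>\<nu>. interior_unit_normal \<Omega> x \<nu> \<longrightarrow>
        ((\<lambda>t. u (x + t *\<^sub>R \<nu>)) has_real_derivative c) (at_right 0))"


section \<open>Radial functions\<close>

definition radially_symmetric_on ::
  "(real^'N) set \<Rightarrow> real^'N \<Rightarrow> (real^'N \<Rightarrow> real) \<Rightarrow> bool" where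
  "radially_symmetric_on S x0 u \<longleftrightarrow> (\<exists>\<phi>. \<forall>x\<in>S. u x = \<phi> (dist x x0))"

definition has_radial_deriv ::
  "real^'N \<Rightarrow> (real^'N \<Rightarrow> real) \<Rightarrow> real^'N \<Rightarrow> real \<Rightarrow> bool" where
  "has_radial_deriv x0 u x d \<longleftrightarrow>
     ((\<lambda>r. u (x0 + r *\<^sub>R sgn (x - x0))) has_real_derivative d) (at (dist x x0))"

end

theory Submission
  imports Defs
begin

text \<open>
  Moving planes, after Serrin. Fix a unit vector \<open>e\<close>, extend every \<open>u\<^sub>i\<close> by \<open>0\<close>, and lower the plane
  \<open>{x. x \<bullet> e = l}\<close> as long as the reflected functions dominate the functions themselves in the cap cut off by the plane.
  By invariance of the equations under reflections and cooperativity of the system, the differences are supersolutions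
  of Pucci's minimal operator, hence either vanish or are positive with linear growth at the plane.
  At a limiting position where no difference vanishes, there are points below the plane approaching some \<open>p\<close> where
  the reflection decreases \<open>u\<^sub>i\<close>. Positivity, the Hopf lemma and the Neumann condition leave only the
  case that \<open>p\<close> is a boundary point of the plane with \<open>\<nu> \<bullet> e = 0\<close>. This corner is excluded by barriers of
  degree less than the order of vanishing of the difference: if \<open>c\<^sub>i > 0\<close> the barrier is built from \<open>u\<^sub>i\<close> itself, whose
  Neumann data control the sign of the normal derivative on the boundary. If \<open>c\<^sub>i = 0\<close> the Hessian at the boundary
  is \<open>b \<nu> \<otimes> \<nu>\<close> with \<open>b > 0\<close>, and the reflected equation is additionally rotated by a small angle: the first
  order effect of the rotation absorbs the terms of the barrier in which the mixed coefficient \<open>e \<bullet> A \<nu>\<close> enters.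
  Consequently the limiting plane is a plane of symmetry, in every direction \<open>e\<close>. All these planes contain a maximum
  point of \<open>u\<^sub>i\<close>, which is therefore the centre, and the negative slope at the plane gives strict radial monotonicity.
\<close>

section \<open>Rank one matrices and traces\<close>

text \<open>What shapes the corner analysis is that \<open>H1\<close> controls nothing but
  ellipticity: in the inequality for a difference every matrix \<open>A\<close> of the class may
  occur, with \<open>e \<bullet> (A *v \<nu>)\<close> of either sign and no smallness near the
  corner. The natural barrier, a product of the distances to the plane and to the boundary, has a
  Hessian close to the symmetric product of \<open>e\<close> and \<open>\<nu>\<close>; its trace
  against \<open>A\<close> is twice this mixed coefficient and may be negative. If
  \<open>c i > 0\<close>, a large multiple of the squared distance to the plane outweighs the mixed
  term, but the barrier is then positive on the boundary, so that normal slopes have to be compared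
  there instead of values. If \<open>c i = 0\<close>, first order boundary data carry no
  information; the mixed term is not estimated but cancelled, by tuning the angle of the rotation to
  the derivative of the barrier, simultaneously for all \<open>A\<close>.\<close>

definition outer :: "real^'N \<Rightarrow> real^'N \<Rightarrow> real^'N^'N" where
  "outer a b = (\<chi> i j. a $ i * b $ j)"

lemma outer_mult: "outer a b *v h = (b \<bullet> h) *\<^sub>R a"
  by (simp add: outer_def matrix_vector_mult_def vec_eq_iff inner_vec_def
      sum_distrib_right sum_distrib_left mult_ac)

lemma norm_outer: "norm (outer a b) = norm a * norm b"
proof -
  have "outer a b $ i = (a $ i) *\<^sub>R b" for i
    by (simp add: outer_def vec_eq_iff)
  then have "norm (outer a b) = L2_set (\<lambda>i. \<bar>a $ i\<bar> * norm b) UNIV"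
    unfolding norm_vec_def[of "outer a b"] by (simp only: norm_scaleR)
  also have "\<dots> = L2_set (\<lambda>i. \<bar>a $ i\<bar>) UNIV * norm b"
    by (simp add: L2_set_left_distrib)
  finally show ?thesis by (simp add: norm_vec_def[of a])
qed

lemma trace_outer: "trace (A ** outer a b) = b \<bullet> (A *v a)"
  by (simp add: trace_def outer_def matrix_matrix_mult_def matrix_vector_mult_def inner_vec_def
      sum_distrib_left sum_distrib_right mult_ac)

lemma trace_scaleR: "trace (c *\<^sub>R A) = c * trace (A :: real^'N^'N)"
  by (simp add: trace_def sum_distrib_left)

lemma matrix_mult_scaleR_right: "A ** (c *\<^sub>R B) = c *\<^sub>R (A ** (B :: real^'N^'N))"
  by (simp add: matrix_matrix_mult_def vec_eq_iff sum_distrib_left mult_ac)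

lemma matrix_mult_diff_right: "A ** (B - C) = A ** B - A ** (C :: real^'N^'N)"
  by (simp add: matrix_matrix_mult_def vec_eq_iff sum_subtractf right_diff_distrib)

lemma matrix_mult_diff_left: "(A - B) ** C = A ** C - B ** (C :: real^'N^'N)"
  by (simp add: matrix_matrix_mult_def vec_eq_iff sum_subtractf left_diff_distrib)

lemmas trace_simps = matrix_add_ldistrib matrix_mult_diff_right matrix_mult_scaleR_right
  trace_add trace_sub trace_scaleR trace_outer

lemma matrix_vector_scaleR_left: "(c *\<^sub>R A) *v x = c *\<^sub>R (A *v (x :: real^'N))"
  by (simp add: matrix_vector_mult_def vec_eq_iff sum_distrib_left mult_ac)

lemma mat_scale_vec: "mat c *v x = c *\<^sub>R (x :: real^'N)"
  by (simp add: matrix_vector_mult_def mat_def vec_eq_iff if_distrib[where f="\<lambda>z. z * _"] cong: if_cong)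

lemma inner_transpose: "x \<bullet> (A *v y) = (transpose A *v x) \<bullet> (y :: real^'N)"
  by (simp add: dot_lmul_matrix)

lemma norm_transpose: "norm (transpose B) = norm (B :: real^'N^'N)"
proof -
  have "(norm (transpose B))\<^sup>2 = (norm B)\<^sup>2"
    unfolding power2_norm_eq_inner inner_vec_def transpose_def by (simp, subst sum.swap, simp)
  then show ?thesis by simp
qed

lemma norm_matrix_mult: "norm (A ** B) \<le> norm A * norm (B :: real^'N^'N)"
proof -
  have c: "\<bar>(A ** B) $ i $ j\<bar> \<le> norm (A $ i) * norm (transpose B $ j)" for i j
  proof -
    have "(A ** B) $ i $ j = A $ i \<bullet> transpose B $ j"
      by (simp add: matrix_matrix_mult_def inner_vec_def transpose_def)
    then show ?thesis using Cauchy_Schwarz_ineq2 by metis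
  qed
  have r: "norm ((A ** B) $ i) \<le> norm (A $ i) * norm (transpose B)" for i
  proof -
    have "norm ((A ** B) $ i) \<le> L2_set (\<lambda>j. norm (A $ i) * norm (transpose B $ j)) UNIV"
      unfolding norm_vec_def[of "(A ** B) $ i"] by (intro L2_set_mono) (use c in auto)
    also have "\<dots> = norm (A $ i) * norm (transpose B)"
      by (simp add: L2_set_right_distrib norm_vec_def[of "transpose B"])
    finally show ?thesis .
  qed
  have "norm (A ** B) \<le> L2_set (\<lambda>i. norm (A $ i) * norm (transpose B)) UNIV"
    unfolding norm_vec_def[of "A ** B"] by (intro L2_set_mono) (use r in auto)
  also have "\<dots> = norm A * norm (transpose B)"
    by (simp add: L2_set_left_distrib norm_vec_def[of A])
  finally show ?thesis by (simp add: norm_transpose)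
qed

lemma norm_matrix_vector: "norm (A *v x) \<le> norm A * norm (x :: real^'N)"
proof -
  have "norm (A *v x) \<le> L2_set (\<lambda>i. norm (A $ i) * norm x) UNIV"
    unfolding norm_vec_def[of "A *v x"]
    by (intro L2_set_mono) (auto simp: matrix_vector_mul_component Cauchy_Schwarz_ineq2)
  also have "\<dots> = norm A * norm x"
    by (simp add: L2_set_left_distrib norm_vec_def[of A])
  finally show ?thesis .
qed

text \<open>Symmetric elimination: subtracting the outer square of the row \<open>A $ k\<close>,
  divided by the root of its pivot, clears that row, disturbs no row that is already zero, and keeps
  the form nonnegative by completing the square. The number of nonzero rows is the induction
  measure.\<close>

lemma psd_decomp:
  fixes A :: "real^'N^'N"
  assumes "transpose A = A" "\<And>h. 0 \<le> h \<bullet> (A *v h)"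
  shows "\<exists>V. A = sum_list (map (\<lambda>v. outer v v) V)"
  using assms
proof (induction "card {k. A $ k \<noteq> 0}" arbitrary: A rule: less_induct)
  case less
  have symA: "A $ i $ j = A $ j $ i" for i j
    using less.prems(1) by (metis transpose_def vec_lambda_beta)
  have sa: "x \<bullet> (A *v y) = y \<bullet> (A *v x)" for x y
    using less.prems(1) by (metis inner_commute inner_transpose)
  show ?case
  proof (cases "\<exists>k. A $ k \<noteq> 0")
    case False
    then have "A = 0" by (simp add: vec_eq_iff)
    then show ?thesis by (intro exI[of _ "[]"]) simp
  next
    case True
    then obtain k where k: "A $ k \<noteq> 0" by blast
    let ?e = "axis k (1::real)"
    let ?a = "A $ k"
    have Ae: "A *v ?e = ?a"
      by (simp add: matrix_vector_mult_basis column_def vec_eq_iff symA)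
    have ip: "?e \<bullet> x = x $ k" for x by (simp add: inner_axis' )
    have q: "0 \<le> t^2 * A$k$k + 2 * t * (?a \<bullet> x) + x \<bullet> (A *v x)" for t x
    proof -
      have "0 \<le> (t *\<^sub>R ?e + x) \<bullet> (A *v (t *\<^sub>R ?e + x))" by (rule less.prems(2))
      also have "\<dots> = t^2 * A$k$k + 2 * t * (?a \<bullet> x) + x \<bullet> (A *v x)"
        by (simp add: matrix_vector_right_distrib matrix_vector_mult_scaleR Ae inner_add_left
            inner_add_right ip sa[of ?e x] sa[of x ?e] inner_commute power2_eq_square algebra_simps)
           (metis Ae inner_commute ip sa)
      finally show ?thesis .
    qed
    have pos: "A$k$k > 0"
    proof (rule ccontr)
      assume "\<not> A$k$k > 0"
      moreover have "0 \<le> A$k$k" using less.prems(2)[of ?e] by (simp add: Ae ip)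
      ultimately have z: "A$k$k = 0" by simp
      have n: "?a \<bullet> ?a > 0" using k by simp
      \<comment> \<open>With a zero pivot the polynomial \<open>q\<close> at \<open>x = ?a\<close>
        has degree one in \<open>t\<close> and positive slope, so a sufficiently negative
        \<open>t\<close> makes it negative.\<close>
      define Qa where "Qa = ?a \<bullet> (A *v ?a)"
      have "0 \<le> 2 * (-(Qa + 1) / (?a \<bullet> ?a)) * (?a \<bullet> ?a) + Qa"
        using q[of "-(Qa + 1) / (?a \<bullet> ?a)" "?a"] z by (simp add: Qa_def)
      moreover have "2 * (-(Qa + 1) / (?a \<bullet> ?a)) * (?a \<bullet> ?a) = - 2 * (Qa + 1)" using n by simp
      ultimately have "0 \<le> - 2 * (Qa + 1) + Qa" by linarith
      moreover have "Qa \<ge> 0" unfolding Qa_def by (rule less.prems(2))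
      ultimately show False by argo
    qed
    let ?v = "(1 / sqrt (A$k$k)) *\<^sub>R ?a"
    let ?B = "A - outer ?v ?v"
    have vv: "outer ?v ?v $ i $ j = A$k$i * A$k$j / A$k$k" for i j
      using pos by (simp add: outer_def field_simps)
    have "transpose ?B = ?B"
      using symA by (simp add: vec_eq_iff transpose_def vv mult.commute)
    moreover have "0 \<le> h \<bullet> (?B *v h)" for h
    proof -
      have "h \<bullet> (outer ?v ?v *v h) = (?a \<bullet> h)^2 / A$k$k"
        using pos by (simp add: outer_mult power2_eq_square inner_commute field_simps)
      \<comment> \<open>The \<open>t\<close> inserted below minimises \<open>q\<close>; the minimum
        is the form of the Schur complement.\<close>
      moreover have "0 \<le> h \<bullet> (A *v h) - (?a \<bullet> h)^2 / A$k$k"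
        using q[of "-(?a \<bullet> h) / A$k$k" h] pos by (simp add: power2_eq_square field_simps)
      ultimately show ?thesis
        by (simp add: matrix_vector_mult_diff_rdistrib inner_diff_right)
    qed
    moreover have "card {i. ?B $ i \<noteq> 0} < card {i. A $ i \<noteq> 0}"
    proof (rule psubset_card_mono)
      show "{i. ?B $ i \<noteq> 0} \<subset> {i. A $ i \<noteq> 0}"
      proof
        show "{i. ?B $ i \<noteq> 0} \<subseteq> {i. A $ i \<noteq> 0}"
        proof (rule subsetI, rule ccontr)
          fix i assume "i \<in> {i. ?B $ i \<noteq> 0}" "i \<notin> {i. A $ i \<noteq> 0}"
          then have "?B $ i \<noteq> 0" "A $ i = 0" by auto
          moreover have "?B $ i $ j = 0" for j
            using \<open>A $ i = 0\<close> symA[of k i] vv[of i j] by simp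
          ultimately show False by (simp add: vec_eq_iff)
        qed
        have "?B $ k = 0" using vv[of k] pos by (simp add: vec_eq_iff)
        then show "{i. ?B $ i \<noteq> 0} \<noteq> {i. A $ i \<noteq> 0}" using k by blast
      qed
    qed simp
    ultimately obtain V where V: "?B = sum_list (map (\<lambda>v. outer v v) V)"
      using less.hyps[of ?B] by blast
    have "A = ?B + outer ?v ?v" by simp
    then show ?thesis using V
      by (intro exI[of _ "?v # V"]) (simp add: add.commute)
  qed
qed

text \<open>Each rank one summand of \<open>A\<close> turns the trace into a value of the quadratic
  form of \<open>Z\<close>.\<close>

lemma trace_psd_mult:
  fixes A Z :: "real^'N^'N"
  assumes "transpose A = A" "\<And>h. 0 \<le> h \<bullet> (A *v h)" "\<And>h. 0 \<le> h \<bullet> (Z *v h)"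
  shows "0 \<le> trace (A ** Z)"
proof -
  obtain V where V: "A = sum_list (map (\<lambda>v. outer v v) V)"
    using psd_decomp assms(1,2) by blast
  have "0 \<le> trace (Z ** sum_list (map (\<lambda>v. outer v v) V))"
  proof (induction V)
    case Nil
    have "Z ** (0::real^'N^'N) = 0" by (simp add: matrix_matrix_mult_def vec_eq_iff)
    then show ?case by (simp add: trace_def)
  next
    case (Cons v V)
    then show ?case
      using assms(3)[of v] by (simp add: matrix_add_ldistrib trace_add trace_outer)
  qed
  then show ?thesis using trace_mul_sym[of A Z] V by metis
qed

section \<open>The class of elliptic matrices\<close>

lemma pucci_classD:
  assumes "A \<in> pucci_class \<alpha> \<beta>"
  shows "transpose A = A" "\<alpha> * (x \<bullet> x) \<le> x \<bullet> (A *v x)" "x \<bullet> (A *v x) \<le> \<beta> * (x \<bullet> x)"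
    "x \<bullet> (A *v y) = y \<bullet> (A *v x)"
proof -
  show s: "transpose A = A" "\<alpha> * (x \<bullet> x) \<le> x \<bullet> (A *v x)" "x \<bullet> (A *v x) \<le> \<beta> * (x \<bullet> x)"
    using assms by (auto simp: pucci_class_def sym_matrices_def loewner_le_def mat_scale_vec)
  show "x \<bullet> (A *v y) = y \<bullet> (A *v x)"
    using s(1) by (metis inner_commute inner_transpose)
qed

lemma pucci_class_nonempty:
  assumes "\<alpha> \<le> \<beta>"
  shows "mat \<alpha> \<in> pucci_class \<alpha> \<beta>"
proof -
  show ?thesis
    using assms by (auto simp: pucci_class_def sym_matrices_def loewner_le_def mat_scale_vec mult_right_mono transpose_mat)
qed

text \<open>Polarisation: the form is nonnegative at \<open>a + b\<close> and at
  \<open>a - b\<close>, which bounds twice the mixed term by the sum of the diagonal terms, at most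
  \<open>2 * \<beta>\<close> for unit vectors.\<close>

lemma pucci_class_bilinear:
  assumes "A \<in> pucci_class \<alpha> \<beta>" "0 < \<alpha>"
  shows "\<bar>a \<bullet> (A *v b)\<bar> \<le> \<beta> * norm a * norm b"
proof -
  have D: "\<And>x. 0 \<le> x \<bullet> (A *v x)"
    using pucci_classD(2)[OF assms(1)] assms(2) by (meson inner_ge_zero mult_nonneg_nonneg less_imp_le order_trans)
  have unit: "\<bar>a \<bullet> (A *v b)\<bar> \<le> \<beta>" if "norm a = 1" "norm b = 1" for a b
  proof -
    have 1: "0 \<le> (a + b) \<bullet> (A *v (a + b))" "0 \<le> (a - b) \<bullet> (A *v (a - b))" by (rule D)+
    have 2: "a \<bullet> (A *v a) \<le> \<beta>" "b \<bullet> (A *v b) \<le> \<beta>"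
      using pucci_classD(3)[OF assms(1), of a] pucci_classD(3)[OF assms(1), of b] that
      by (simp_all add: dot_square_norm)
    have 3: "b \<bullet> (A *v a) = a \<bullet> (A *v b)" by (rule pucci_classD(4)[OF assms(1)])
    show ?thesis using 1 2 3
      by (simp add: matrix_vector_right_distrib matrix_vector_mult_diff_distrib inner_add_left inner_add_right
          inner_diff_left inner_diff_right abs_le_iff)
  qed
  show ?thesis
  proof (cases "a = 0 \<or> b = 0")
    case True then show ?thesis by auto
  next
    case False
    have "a \<bullet> (A *v b) = norm a * norm b * (sgn a \<bullet> (A *v sgn b))"
      using False by (simp add: sgn_div_norm matrix_vector_mult_scaleR divide_simps)
    moreover have "\<bar>sgn a \<bullet> (A *v sgn b)\<bar> \<le> \<beta>"
      using False by (intro unit) (auto simp: norm_sgn)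
    ultimately show ?thesis
      using mult_left_mono[of "\<bar>sgn a \<bullet> (A *v sgn b)\<bar>" \<beta> "norm a * norm b"]
      by (simp add: abs_mult mult_ac)
  qed
qed

lemma pucci_class_trace:
  assumes "A \<in> pucci_class \<alpha> \<beta>" "0 < \<alpha>"
  shows "\<bar>trace (A ** Z)\<bar> \<le> (real CARD('N))\<^sup>2 * \<beta> * norm (Z :: real^'N^'N)"
proof -
  have a: "\<bar>A $ i $ j\<bar> \<le> \<beta>" for i j
  proof -
    have "A $ i $ j = axis i 1 \<bullet> (A *v axis j 1)"
      by (simp add: matrix_vector_mult_basis column_def inner_axis')
    then show ?thesis using pucci_class_bilinear[OF assms, of "axis i 1" "axis j 1"] by simp
  qed
  have z: "\<bar>Z $ i $ j\<bar> \<le> norm Z" for i j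
    using component_le_norm_cart[of "Z $ i" j] Finite_Cartesian_Product.norm_nth_le[of Z i] by linarith
  have b0: "0 \<le> \<beta>" using a[of undefined undefined] by linarith
  have "\<bar>trace (A ** Z)\<bar> \<le> (\<Sum>i\<in>UNIV. \<Sum>j\<in>UNIV. \<bar>A $ i $ j * Z $ j $ i\<bar>)"
    unfolding trace_def matrix_matrix_mult_def
    by (simp, rule order_trans[OF sum_abs], intro sum_mono, rule sum_abs)
  also have "\<dots> \<le> (\<Sum>i\<in>(UNIV::'N set). \<Sum>j\<in>(UNIV::'N set). \<beta> * norm Z)"
    by (intro sum_mono) (auto simp: abs_mult intro!: mult_mono a z b0)
  also have "\<dots> = (real CARD('N))\<^sup>2 * \<beta> * norm Z" by (simp add: power2_eq_square)
  finally show ?thesis .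
qed

lemma pucci_minus_ge:
  fixes X :: "real^'N^'N"
  assumes "\<alpha> \<le> \<beta>" "\<And>A. A \<in> pucci_class \<alpha> \<beta> \<Longrightarrow> t \<le> trace (A ** X)"
  shows "t \<le> pucci_minus \<alpha> \<beta> X"
  unfolding pucci_minus_def using pucci_class_nonempty[OF assms(1)]
  by (intro cINF_greatest) (use assms(2) in auto)

lemma pucci_minus_ge_norm:
  fixes X :: "real^'N^'N"
  assumes "0 < \<alpha>" "\<alpha> \<le> \<beta>"
  shows "- ((real CARD('N))\<^sup>2 * \<beta> * norm X) \<le> pucci_minus \<alpha> \<beta> X"
proof (rule pucci_minus_ge[OF assms(2)])
  fix A :: "real^'N^'N" assume "A \<in> pucci_class \<alpha> \<beta>"
  then show "- ((real CARD('N))\<^sup>2 * \<beta> * norm X) \<le> trace (A ** X)"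
    using pucci_class_trace[OF _ assms(1), of A \<beta> X] by linarith
qed

lemma trace_class_mono:
  fixes X Y :: "real^'N^'N"
  assumes "A \<in> pucci_class \<alpha> \<beta>" "0 < \<alpha>" "\<And>h. h \<bullet> (Y *v h) \<le> h \<bullet> (X *v h)"
  shows "trace (A ** Y) \<le> trace (A ** X)"
proof -
  have "0 \<le> trace (A ** (X - Y))"
  proof (rule trace_psd_mult)
    show "transpose A = A" by (rule pucci_classD(1)[OF assms(1)])
    show "0 \<le> h \<bullet> (A *v h)" for h
      using pucci_classD(2)[OF assms(1)] assms(2) by (meson inner_ge_zero mult_nonneg_nonneg less_imp_le order_trans)
    show "0 \<le> h \<bullet> ((X - Y) *v h)" for h
      using assms(3)[of h] by (simp add: matrix_vector_mult_diff_rdistrib inner_diff_right)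
  qed
  then show ?thesis by (simp add: trace_simps)
qed

text \<open>Conjugation permutes the test matrices, so an infimum over the class does not notice a
  rotation of its argument. This allows a rotated equation to be compared with an unrotated
  one.\<close>

lemma pucci_class_conj:
  fixes A Q :: "real^'N^'N"
  assumes "A \<in> pucci_class \<alpha> \<beta>" "orthogonal_matrix Q"
  shows "Q ** A ** transpose Q \<in> pucci_class \<alpha> \<beta>"
proof -
  have n: "(transpose Q *v x) \<bullet> (transpose Q *v x) = x \<bullet> x" for x
  proof -
    have "(transpose Q *v x) \<bullet> (transpose Q *v x) = x \<bullet> (Q *v (transpose Q *v x))"
      by (metis inner_transpose)
    also have "\<dots> = x \<bullet> x"
      using assms(2) by (simp add: orthogonal_matrix_def matrix_vector_mul_assoc del: transpose_matrix_vector)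
    finally show ?thesis .
  qed
  have q: "x \<bullet> ((Q ** A ** transpose Q) *v x) = (transpose Q *v x) \<bullet> (A *v (transpose Q *v x))" for x
    by (metis inner_transpose matrix_vector_mul_assoc)
  have "transpose (Q ** A ** transpose Q) = Q ** A ** transpose Q"
    using pucci_classD(1)[OF assms(1)] by (simp add: matrix_transpose_mul matrix_mul_assoc)
  then show ?thesis
    using pucci_classD(2,3)[OF assms(1), of "transpose Q *v x" for x]
    unfolding pucci_class_def sym_matrices_def loewner_le_def mem_Collect_eq q mat_scale_vec inner_scaleR_right n by blast
qed

section \<open>Functions with prescribed gradient and Hessian\<close>

text \<open>Carrying both derivatives as explicit functions lets barriers be differentiated by
  rules. The Hessian \<open>X\<close> is just the pointwise derivative of the gradient; its symmetry
  is derived in \<open>jet_symmetric\<close>.\<close>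

definition jet :: "(real^'N \<Rightarrow> real) \<Rightarrow> (real^'N \<Rightarrow> real^'N) \<Rightarrow> (real^'N \<Rightarrow> real^'N^'N) \<Rightarrow> (real^'N) set \<Rightarrow> bool"
  where "jet w p X D \<longleftrightarrow> open D \<and>
    (\<forall>x\<in>D. (w has_derivative (\<lambda>h. p x \<bullet> h)) (at x) \<and> (p has_derivative (\<lambda>h. X x *v h)) (at x))"

lemma jetD:
  assumes "jet w p X D"
  shows "open D" "x \<in> D \<Longrightarrow> (w has_derivative (\<lambda>h. p x \<bullet> h)) (at x)"
    "x \<in> D \<Longrightarrow> (p has_derivative (\<lambda>h. X x *v h)) (at x)"
  using assms by (auto simp: jet_def)

lemma jet_subset: "jet w p X D \<Longrightarrow> D' \<subseteq> D \<Longrightarrow> open D' \<Longrightarrow> jet w p X D'"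
  by (auto simp: jet_def)

lemma jet_continuous_on: "jet w p X D \<Longrightarrow> continuous_on D w"
  unfolding jet_def using has_derivative_continuous continuous_at_imp_continuous_on by blast

lemma jet_add:
  assumes "jet w p X D" "jet w' p' X' D"
  shows "jet (\<lambda>x. w x + w' x) (\<lambda>x. p x + p' x) (\<lambda>x. X x + X' x) D"
  unfolding jet_def
proof (intro conjI ballI)
  show "open D" using assms(1) by (rule jetD)
  fix x assume x: "x \<in> D"
  note d = jetD(2,3)[OF assms(1) x] jetD(2,3)[OF assms(2) x]
  show "((\<lambda>x. w x + w' x) has_derivative (\<bullet>) (p x + p' x)) (at x)"
    using has_derivative_add[OF d(1,3)]
    by (rule has_derivative_eq_rhs) (auto simp: fun_eq_iff inner_add_left)
  show "((\<lambda>x. p x + p' x) has_derivative (*v) (X x + X' x)) (at x)"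
    using has_derivative_add[OF d(2,4)]
    by (rule has_derivative_eq_rhs) (auto simp: fun_eq_iff matrix_vector_mult_add_rdistrib matrix_vector_mult_diff_rdistrib)
qed

lemma jet_diff:
  assumes "jet w p X D" "jet w' p' X' D"
  shows "jet (\<lambda>x. w x - w' x) (\<lambda>x. p x - p' x) (\<lambda>x. X x - X' x) D"
  unfolding jet_def
proof (intro conjI ballI)
  show "open D" using assms(1) by (rule jetD)
  fix x assume x: "x \<in> D"
  note d = jetD(2,3)[OF assms(1) x] jetD(2,3)[OF assms(2) x]
  show "((\<lambda>x. w x - w' x) has_derivative (\<bullet>) (p x - p' x)) (at x)"
    using has_derivative_diff[OF d(1,3)]
    by (rule has_derivative_eq_rhs) (auto simp: fun_eq_iff inner_diff_left)
  show "((\<lambda>x. p x - p' x) has_derivative (*v) (X x - X' x)) (at x)"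
    using has_derivative_diff[OF d(2,4)]
    by (rule has_derivative_eq_rhs) (auto simp: fun_eq_iff matrix_vector_mult_add_rdistrib matrix_vector_mult_diff_rdistrib)
qed

lemma jet_mult:
  assumes "jet w p X D" "jet w' p' X' D"
  shows "jet (\<lambda>x. w x * w' x) (\<lambda>x. w x *\<^sub>R p' x + w' x *\<^sub>R p x)
    (\<lambda>x. w x *\<^sub>R X' x + w' x *\<^sub>R X x + outer (p' x) (p x) + outer (p x) (p' x)) D"
  unfolding jet_def
proof (intro conjI ballI)
  show "open D" using assms(1) by (rule jetD)
  fix x assume x: "x \<in> D"
  note d = jetD(2,3)[OF assms(1) x] jetD(2,3)[OF assms(2) x]
  show "((\<lambda>x. w x * w' x) has_derivative (\<bullet>) (w x *\<^sub>R p' x + w' x *\<^sub>R p x)) (at x)"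
    using has_derivative_mult[OF d(1,3)]
    by (rule has_derivative_eq_rhs) (auto simp: fun_eq_iff inner_add_left mult_ac)
  show "((\<lambda>x. w x *\<^sub>R p' x + w' x *\<^sub>R p x) has_derivative
      (*v) (w x *\<^sub>R X' x + w' x *\<^sub>R X x + outer (p' x) (p x) + outer (p x) (p' x))) (at x)"
    using has_derivative_add[OF has_derivative_scaleR[OF d(1,4)] has_derivative_scaleR[OF d(3,2)]]
    by (rule has_derivative_eq_rhs)
      (auto simp: fun_eq_iff matrix_vector_mult_add_rdistrib matrix_vector_scaleR_left outer_mult)
qed

lemma jet_compose:
  assumes "jet w p X D"
    and "\<And>x. x \<in> D \<Longrightarrow> (\<psi> has_real_derivative \<psi>1 (w x)) (at (w x))"
    and "\<And>x. x \<in> D \<Longrightarrow> (\<psi>1 has_real_derivative \<psi>2 (w x)) (at (w x))"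
  shows "jet (\<lambda>x. \<psi> (w x)) (\<lambda>x. \<psi>1 (w x) *\<^sub>R p x)
    (\<lambda>x. \<psi>1 (w x) *\<^sub>R X x + \<psi>2 (w x) *\<^sub>R outer (p x) (p x)) D"
  unfolding jet_def
proof (intro conjI ballI)
  show "open D" using assms(1) by (rule jetD)
  fix x assume x: "x \<in> D"
  note d = jetD(2,3)[OF assms(1) x]
  have c: "((\<lambda>x. \<psi> (w x)) has_derivative (\<lambda>h. \<psi>1 (w x) * (p x \<bullet> h))) (at x)"
    "((\<lambda>x. \<psi>1 (w x)) has_derivative (\<lambda>h. \<psi>2 (w x) * (p x \<bullet> h))) (at x)"
    using diff_chain_at[OF d(1) has_field_derivative_imp_has_derivative[OF assms(2)[OF x]]]
      diff_chain_at[OF d(1) has_field_derivative_imp_has_derivative[OF assms(3)[OF x]]]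
    by (simp_all add: o_def)
  show "((\<lambda>x. \<psi> (w x)) has_derivative (\<bullet>) (\<psi>1 (w x) *\<^sub>R p x)) (at x)"
    using c(1) by (rule has_derivative_eq_rhs) (auto simp: fun_eq_iff)
  show "((\<lambda>x. \<psi>1 (w x) *\<^sub>R p x) has_derivative
      (*v) (\<psi>1 (w x) *\<^sub>R X x + \<psi>2 (w x) *\<^sub>R outer (p x) (p x))) (at x)"
    using has_derivative_scaleR[OF c(2) d(2)]
    by (rule has_derivative_eq_rhs)
      (auto simp: fun_eq_iff matrix_vector_mult_add_rdistrib matrix_vector_scaleR_left outer_mult)
qed

lemma jet_affine:
  fixes D :: "(real^'N) set"
  shows "open D \<Longrightarrow> jet (\<lambda>x. (x - b) \<bullet> a) (\<lambda>x. a) (\<lambda>x. 0) D"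
  unfolding jet_def
proof (intro conjI ballI)
  fix x :: "real^'N"
  show "((\<lambda>x. (x - b) \<bullet> a) has_derivative (\<bullet>) a) (at x)"
    by (auto intro!: derivative_eq_intros simp: fun_eq_iff inner_commute)
  show "((\<lambda>x. a) has_derivative (*v) 0) (at x)"
    by (rule has_derivative_eq_rhs[OF has_derivative_const]) (simp add: fun_eq_iff)
qed

lemma jet_const:
  fixes D :: "(real^'N) set"
  shows "open D \<Longrightarrow> jet (\<lambda>x. c) (\<lambda>x. 0) (\<lambda>x. 0) D"
  unfolding jet_def
proof (intro conjI ballI)
  fix x :: "real^'N"
  show "((\<lambda>x. c) has_derivative (\<bullet>) 0) (at x)"
    by (rule has_derivative_eq_rhs[OF has_derivative_const]) (simp add: fun_eq_iff)
  show "((\<lambda>x. 0) has_derivative (*v) 0) (at x)"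
    by (rule has_derivative_eq_rhs[OF has_derivative_const]) (simp add: fun_eq_iff)
qed

lemma jet_sq:
  fixes D :: "(real^'N) set"
  shows "open D \<Longrightarrow> jet (\<lambda>x. (x - b) \<bullet> (x - b)) (\<lambda>x. 2 *\<^sub>R (x - b)) (\<lambda>x. mat 2) D"
  unfolding jet_def
proof (intro conjI ballI)
  fix x :: "real^'N"
  show "((\<lambda>x. (x - b) \<bullet> (x - b)) has_derivative (\<bullet>) (2 *\<^sub>R (x - b))) (at x)"
    by (auto intro!: derivative_eq_intros simp: fun_eq_iff inner_commute inner_diff_left inner_diff_right)
  show "((\<lambda>x. 2 *\<^sub>R (x - b)) has_derivative (*v) (mat 2)) (at x)"
    by (auto intro!: derivative_eq_intros simp: fun_eq_iff mat_scale_vec)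
qed

lemma jet_cmult:
  assumes "jet w p X D"
  shows "jet (\<lambda>x. c * w x) (\<lambda>x. c *\<^sub>R p x) (\<lambda>x. c *\<^sub>R X x) D"
  using jet_mult[OF jet_const[OF jetD(1)[OF assms], of c] assms]
  by (simp add: outer_def zero_vec_def[symmetric])

section \<open>Reflections in hyperplanes\<close>

definition mirror :: "real^'N \<Rightarrow> real \<Rightarrow> real^'N \<Rightarrow> real^'N" where
  "mirror e l x = x - (2 * (x \<bullet> e - l)) *\<^sub>R e"

definition mirror_mat :: "real^'N \<Rightarrow> real^'N^'N" where
  "mirror_mat e = mat 1 - 2 *\<^sub>R outer e e"

lemma mirror_mat_mult: "mirror_mat e *v h = h - (2 * (h \<bullet> e)) *\<^sub>R e"
  by (simp add: mirror_mat_def matrix_vector_mult_diff_rdistrib matrix_vector_scaleR_left outer_mult inner_commute)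

lemma transpose_mirror_mat: "transpose (mirror_mat e) = mirror_mat e"
  by (auto simp: mirror_mat_def transpose_def vec_eq_iff outer_def mat_def mult.commute)

context
  fixes e :: "real^'N" and l :: real
  assumes e: "norm e = 1"
begin

lemma ee: "e \<bullet> e = 1"
  using e by (simp add: dot_square_norm)

lemma mirror_inner: "mirror e l x \<bullet> e = 2 * l - x \<bullet> e"
  by (simp add: mirror_def inner_diff_left ee algebra_simps)

lemma mirror_mirror [simp]: "mirror e l (mirror e l x) = x"
proof -
  have "2 * (2 * l - x \<bullet> e - l) = - (2 * (x \<bullet> e - l))" by simp
  then show ?thesis
    unfolding mirror_def[of e l "mirror e l x"] mirror_inner by (simp only: scaleR_minus_left) (simp add: mirror_def)
qed

lemma mirror_diff: "mirror e l x - mirror e l y = mirror_mat e *v (x - y)"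
  by (simp add: mirror_def mirror_mat_mult inner_diff_left algebra_simps)

lemma mirror_mat_mirror_mat: "mirror_mat e *v (mirror_mat e *v h) = h"
proof -
  have "(mirror_mat e *v h) \<bullet> e = - (h \<bullet> e)"
    by (simp add: mirror_mat_mult inner_diff_left ee)
  then show ?thesis by (simp add: mirror_mat_mult[of e "mirror_mat e *v h"]) (simp add: mirror_mat_mult)
qed

lemma mirror_mat_inner: "(mirror_mat e *v a) \<bullet> b = a \<bullet> (mirror_mat e *v b)"
  by (simp add: mirror_mat_mult inner_diff_left inner_diff_right inner_commute algebra_simps)

lemma norm_mirror_mat: "norm (mirror_mat e *v h) = norm h"
proof -
  have "(mirror_mat e *v h) \<bullet> (mirror_mat e *v h) = h \<bullet> h"
    by (simp add: mirror_mat_inner mirror_mat_mirror_mat)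
  then show ?thesis by (simp add: norm_eq)
qed

lemma dist_mirror: "dist (mirror e l x) (mirror e l y) = dist x y"
  by (simp add: dist_norm mirror_diff norm_mirror_mat)

lemma orthogonal_mirror_mat: "orthogonal_matrix (mirror_mat e)"
  by (simp add: orthogonal_matrix transpose_mirror_mat matrix_eq mirror_mat_mirror_mat flip: matrix_vector_mul_assoc)

lemma continuous_mirror: "continuous_on S (mirror e l)"
  unfolding mirror_def by (intro continuous_intros)

lemma mirror_fixed: "x \<bullet> e = l \<Longrightarrow> mirror e l x = x"
  by (simp add: mirror_def)

lemma jet_mirror:
  assumes "jet w p X D"
  shows "jet (\<lambda>x. w (mirror e l x)) (\<lambda>x. mirror_mat e *v p (mirror e l x))
    (\<lambda>x. mirror_mat e ** X (mirror e l x) ** mirror_mat e) (mirror e l -` D)"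
  unfolding jet_def
proof (intro conjI ballI)
  show "open (mirror e l -` D)"
    using continuous_mirror[of UNIV] jetD(1)[OF assms] by (simp add: continuous_on_open_vimage)
  fix x assume "x \<in> mirror e l -` D"
  then have x: "mirror e l x \<in> D" by simp
  note d = jetD(2,3)[OF assms x]
  have r: "(mirror e l has_derivative (*v) (mirror_mat e)) (at x)"
    unfolding mirror_def
    by (auto intro!: derivative_eq_intros simp: fun_eq_iff mirror_mat_mult)
  show "((\<lambda>x. w (mirror e l x)) has_derivative (\<bullet>) (mirror_mat e *v p (mirror e l x))) (at x)"
    using diff_chain_at[OF r d(1)]
    by (simp add: o_def mirror_mat_inner[abs_def])
  have "((\<lambda>x. p (mirror e l x)) has_derivative (\<lambda>h. X (mirror e l x) *v (mirror_mat e *v h))) (at x)"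
    using diff_chain_at[OF r d(2)] by (simp add: o_def)
  from bounded_linear.has_derivative[OF matrix_vector_mul_bounded_linear this, of "mirror_mat e"]
  show "((\<lambda>x. mirror_mat e *v p (mirror e l x)) has_derivative
      (*v) (mirror_mat e ** X (mirror e l x) ** mirror_mat e)) (at x)"
    by (simp add: matrix_vector_mul_assoc matrix_mul_assoc)
qed

end

section \<open>Symmetry of the Hessian and the second derivative test\<close>

text \<open>The mixed second difference compares \<open>w\<close> along two parallel segments; the
  mean value theorem reduces it to \<open>p\<close> at two points, where differentiability of
  \<open>p\<close> at the single point \<open>x\<close> suffices. The estimate is uniform in
  \<open>a\<close> and \<open>b\<close>, so that they may be exchanged.\<close>

lemma jet_symmetric_bound:
  fixes x :: "real^'N"
  assumes j: "jet w p X D" and x: "x \<in> D" and \<epsilon>: "\<epsilon> > 0"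
  shows "\<exists>d>0. \<forall>t a b. 0 < t \<longrightarrow> t * (norm a + norm b) < d \<longrightarrow>
    \<bar>(w (x + t *\<^sub>R a + t *\<^sub>R b) - w (x + t *\<^sub>R a) - w (x + t *\<^sub>R b) + w x) - t\<^sup>2 * (a \<bullet> (X x *v b))\<bar>
      \<le> t\<^sup>2 * (2 * \<epsilon> * (norm a + norm b)\<^sup>2)"
proof -
  obtain d0 where d0: "d0 > 0" "ball x d0 \<subseteq> D" using jetD(1)[OF j] x open_contains_ball by blast
  obtain d1 where d1: "d1 > 0"
    "\<And>y. norm (y - x) < d1 \<Longrightarrow> norm (p y - p x - X x *v (y - x)) \<le> \<epsilon> * norm (y - x)"
    using jetD(3)[OF j x] \<epsilon> unfolding has_derivative_at_alt by blast
  show ?thesis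
  proof (intro exI[of _ "min d0 d1"] conjI allI impI)
    show "0 < min d0 d1" using d0 d1 by simp
    fix t :: real and a b :: "real^'N"
    assume t: "0 < t" and tb: "t * (norm a + norm b) < min d0 d1"
    let ?N = "norm a + norm b"
    have inb: "norm ((x + s *\<^sub>R a + r *\<^sub>R b) - x) \<le> t * ?N" if "0 \<le> s" "s \<le> t" "0 \<le> r" "r \<le> t" for s r
    proof -
      have "norm (s *\<^sub>R a + r *\<^sub>R b) \<le> s * norm a + r * norm b"
        using norm_triangle_ineq[of "s *\<^sub>R a" "r *\<^sub>R b"] that by simp
      also have "\<dots> \<le> t * norm a + t * norm b" using that by (intro add_mono mult_right_mono) auto
      finally show ?thesis by (simp add: algebra_simps)
    qed
    have inD: "x + s *\<^sub>R a + r *\<^sub>R b \<in> D" if "0 \<le> s" "s \<le> t" "0 \<le> r" "r \<le> t" for s r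
    proof -
      have "x + s *\<^sub>R a + r *\<^sub>R b \<in> ball x d0"
        unfolding mem_ball dist_norm norm_minus_commute[of x] using inb[OF that] tb by linarith
      then show ?thesis using d0(2) by blast
    qed
    let ?\<Phi> = "\<lambda>s. w (x + s *\<^sub>R a + t *\<^sub>R b) - w (x + s *\<^sub>R a)"
    have der: "(?\<Phi> has_real_derivative (p (x + s *\<^sub>R a + t *\<^sub>R b) \<bullet> a - p (x + s *\<^sub>R a) \<bullet> a)) (at s)"
      if "0 \<le> s" "s \<le> t" for s
    proof -
      have 1: "((\<lambda>s. w (x + s *\<^sub>R a + c)) has_real_derivative (p (x + s *\<^sub>R a + c) \<bullet> a)) (at s)"
        if "x + s *\<^sub>R a + c \<in> D" for c
      proof -
        have "((\<lambda>s. x + s *\<^sub>R a + c) has_derivative (\<lambda>h. h *\<^sub>R a)) (at s)"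
          by (auto intro!: derivative_eq_intros)
        from diff_chain_at[OF this jetD(2)[OF j that]] show ?thesis
          unfolding has_field_derivative_def o_def
          by (rule has_derivative_eq_rhs) (auto simp: fun_eq_iff)
      qed
      show ?thesis using 1[of "t *\<^sub>R b"] 1[of 0] inD[of s t] inD[of s 0] that t
        by (auto intro!: DERIV_diff)
    qed
    obtain z where z: "0 < z" "z < t"
      "?\<Phi> t - ?\<Phi> 0 = (t - 0) * (p (x + z *\<^sub>R a + t *\<^sub>R b) \<bullet> a - p (x + z *\<^sub>R a) \<bullet> a)"
      using MVT2[OF t, of ?\<Phi> "\<lambda>s. p (x + s *\<^sub>R a + t *\<^sub>R b) \<bullet> a - p (x + s *\<^sub>R a) \<bullet> a"] der by blast
    let ?y1 = "x + z *\<^sub>R a + t *\<^sub>R b" and ?y2 = "x + z *\<^sub>R a + 0 *\<^sub>R b"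
    let ?r = "\<lambda>y. p y - p x - X x *v (y - x)"
    have r: "norm (?r y) \<le> \<epsilon> * (t * ?N)" if "norm (y - x) \<le> t * ?N" for y
    proof -
      have "norm (?r y) \<le> \<epsilon> * norm (y - x)" using that tb by (intro d1(2)) auto
      also have "\<dots> \<le> \<epsilon> * (t * ?N)" using that \<epsilon> by simp
      finally show ?thesis .
    qed
    have r12: "norm (?r ?y1) \<le> \<epsilon> * (t * ?N)" "norm (?r ?y2) \<le> \<epsilon> * (t * ?N)"
      using r[OF inb[of z t]] r[OF inb[of z 0]] z t by simp_all
    have pd: "p ?y1 - p ?y2 = t *\<^sub>R (X x *v b) + (?r ?y1 - ?r ?y2)"
      by (simp add: matrix_vector_mult_diff_distrib matrix_vector_right_distrib matrix_vector_mult_scaleR)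
    have "?\<Phi> t - ?\<Phi> 0 = t * ((p ?y1 - p ?y2) \<bullet> a)"
      using z(3) by (simp add: inner_diff_left)
    then have "?\<Phi> t - ?\<Phi> 0 = t * ((t *\<^sub>R (X x *v b) + (?r ?y1 - ?r ?y2)) \<bullet> a)"
      unfolding pd .
    then have "?\<Phi> t - ?\<Phi> 0 - t\<^sup>2 * (a \<bullet> (X x *v b)) = t * ((?r ?y1 - ?r ?y2) \<bullet> a)"
      by (simp add: inner_add_left power2_eq_square inner_commute algebra_simps)
    then have "\<bar>?\<Phi> t - ?\<Phi> 0 - t\<^sup>2 * (a \<bullet> (X x *v b))\<bar> = t * \<bar>(?r ?y1 - ?r ?y2) \<bullet> a\<bar>"
      using t by (simp add: abs_mult)
    also have "\<dots> \<le> t * ((\<epsilon> * (t * ?N) + \<epsilon> * (t * ?N)) * ?N)"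
    proof (intro mult_left_mono)
      have "\<bar>(?r ?y1 - ?r ?y2) \<bullet> a\<bar> \<le> norm (?r ?y1 - ?r ?y2) * norm a" by (rule Cauchy_Schwarz_ineq2)
      also have "\<dots> \<le> (\<epsilon> * (t * ?N) + \<epsilon> * (t * ?N)) * ?N"
      proof (intro mult_mono)
        show "norm (?r ?y1 - ?r ?y2) \<le> \<epsilon> * (t * ?N) + \<epsilon> * (t * ?N)"
          using norm_triangle_ineq4[of "?r ?y1" "?r ?y2"] r12 by linarith
        show "0 \<le> \<epsilon> * (t * ?N) + \<epsilon> * (t * ?N)" using \<epsilon> t by simp
      qed auto
      finally show "\<bar>(?r ?y1 - ?r ?y2) \<bullet> a\<bar> \<le> (\<epsilon> * (t * ?N) + \<epsilon> * (t * ?N)) * ?N" .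
    qed (use t in auto)
    also have "\<dots> = t\<^sup>2 * (2 * \<epsilon> * ?N\<^sup>2)" by (simp add: power2_eq_square algebra_simps)
    finally show "\<bar>(w (x + t *\<^sub>R a + t *\<^sub>R b) - w (x + t *\<^sub>R a) - w (x + t *\<^sub>R b) + w x) - t\<^sup>2 * (a \<bullet> (X x *v b))\<bar>
      \<le> t\<^sup>2 * (2 * \<epsilon> * (norm a + norm b)\<^sup>2)" by (simp add: algebra_simps)
  qed
qed

lemma jet_symmetric:
  fixes x :: "real^'N"
  assumes j: "jet w p X D" and x: "x \<in> D"
  shows "transpose (X x) = X x"
proof -
  have s: "a \<bullet> (X x *v b) = b \<bullet> (X x *v a)" for a b
  proof (rule ccontr)
    assume ne: "a \<bullet> (X x *v b) \<noteq> b \<bullet> (X x *v a)"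
    let ?N = "norm a + norm b" and ?\<delta> = "\<bar>a \<bullet> (X x *v b) - b \<bullet> (X x *v a)\<bar>"
    define P where "P = ?N\<^sup>2 + 1"
    \<comment> \<open>The second difference does not change when \<open>a\<close> and
      \<open>b\<close> are exchanged. With this \<open>\<epsilon>\<close> the two errors together
      are at most half of the asymmetry; the summand 1 in \<open>P\<close> keeps the denominator
      positive.\<close>
    define \<epsilon> where "\<epsilon> = ?\<delta> / (8 * P)"
    have N0: "P > 0" by (simp add: P_def add_nonneg_pos)
    have \<epsilon>: "\<epsilon> > 0" using ne N0 by (simp add: \<epsilon>_def)
    obtain d where d: "d > 0" "\<And>t a b. 0 < t \<Longrightarrow> t * (norm a + norm b) < d \<Longrightarrow>
      \<bar>(w (x + t *\<^sub>R a + t *\<^sub>R b) - w (x + t *\<^sub>R a) - w (x + t *\<^sub>R b) + w x) - t\<^sup>2 * (a \<bullet> (X x *v b))\<bar>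
      \<le> t\<^sup>2 * (2 * \<epsilon> * (norm a + norm b)\<^sup>2)" using jet_symmetric_bound[OF j x \<epsilon>] by blast
    define M where "M = ?N + 1"
    define t where "t = d / M / 2"
    have N1: "M > 0" by (simp add: M_def add_nonneg_pos)
    have t: "t > 0" using d(1) N1 by (simp add: t_def)
    have "t * ?N \<le> t * M" using t by (simp add: M_def)
    also have "\<dots> = d / 2" using N1 by (simp add: t_def)
    finally have tN: "t * ?N < d" using d(1) by simp
    have tN': "t * (norm b + norm a) < d" using tN by (simp add: add.commute)
    have eq: "x + t *\<^sub>R b + t *\<^sub>R a = x + t *\<^sub>R a + t *\<^sub>R b" by simp
    have "t\<^sup>2 * ?\<delta> \<le> 2 * (t\<^sup>2 * (2 * \<epsilon> * ?N\<^sup>2))"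
      using d(2)[OF t tN] d(2)[OF t tN'] unfolding eq right_diff_distrib[symmetric] abs_mult
      by (simp add: add.commute[of "norm b"] abs_if right_diff_distrib split: if_splits)
    then have "t\<^sup>2 * ?\<delta> \<le> t\<^sup>2 * (4 * \<epsilon> * ?N\<^sup>2)" by (simp add: algebra_simps)
    then have "?\<delta> \<le> 4 * \<epsilon> * ?N\<^sup>2" using t by (simp add: mult_le_cancel_left_pos)
    also have "\<dots> \<le> 4 * \<epsilon> * P" using \<epsilon> by (simp add: P_def)
    also have "\<dots> = ?\<delta> / 2" using N0 by (simp add: \<epsilon>_def)
    finally show False using ne by simp
  qed
  have "X x $ i $ k = X x $ k $ i" for i k
    using s[of "axis i 1" "axis k 1"] by (simp add: matrix_vector_mult_basis column_def inner_axis')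
  then show ?thesis by (simp add: vec_eq_iff transpose_def)
qed

lemma jet_local_min:
  fixes x :: "real^'N"
  assumes j: "jet w p X D" and x: "x \<in> D" and min: "\<And>y. y \<in> D \<Longrightarrow> w x \<le> w y"
  shows "p x = 0" "0 \<le> h \<bullet> (X x *v h)"
proof -
  have "(\<lambda>h. p x \<bullet> h) = (\<lambda>h. 0)"
    by (rule differential_zero_maxmin[OF x jetD(1)[OF j] jetD(2)[OF j x]]) (use min in auto)
  then show p0: "p x = 0" by (metis inner_eq_zero_iff)
  show "0 \<le> h \<bullet> (X x *v h)"
  proof (rule ccontr)
    assume neg: "\<not> 0 \<le> h \<bullet> (X x *v h)"
    obtain d0 where d0: "d0 > 0" "ball x d0 \<subseteq> D" using jetD(1)[OF j] x open_contains_ball by blast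
    have l: "((\<lambda>t. x + t *\<^sub>R h) has_derivative (\<lambda>s. s *\<^sub>R h)) (at t)" for t
      by (auto intro!: derivative_eq_intros)
    have "((\<lambda>t. p (x + t *\<^sub>R h)) has_derivative (\<lambda>s. X x *v (s *\<^sub>R h))) (at 0)"
      using diff_chain_at[OF l[of 0], of p "\<lambda>h. X x *v h"] jetD(3)[OF j x] by (simp add: o_def)
    then have "((\<lambda>t. h \<bullet> p (x + t *\<^sub>R h)) has_derivative (\<lambda>s. h \<bullet> (X x *v (s *\<^sub>R h)))) (at 0)"
      by (rule has_derivative_inner_right)
    then have "((\<lambda>t. h \<bullet> p (x + t *\<^sub>R h)) has_real_derivative (h \<bullet> (X x *v h))) (at 0)"
      unfolding has_field_derivative_def
      by (rule has_derivative_eq_rhs) (auto simp: matrix_vector_mult_scaleR)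
    from DERIV_neg_dec_right[OF this] neg obtain d where d: "d > 0"
      "\<And>t. 0 < t \<Longrightarrow> t < d \<Longrightarrow> h \<bullet> p (x + t *\<^sub>R h) < 0" by (auto simp: p0)
    define M where "M = norm h + 1"
    define t where "t = min (d / 2) (d0 / (2 * M))"
    have h1: "M > 0" by (simp add: M_def add_nonneg_pos)
    have t: "0 < t" "t < d" using d(1) d0(1) h1 by (auto simp: t_def)
    have tn: "t * norm h < d0"
    proof -
      have "t * norm h \<le> t * M" using t by (simp add: M_def)
      also have "\<dots> \<le> d0 / (2 * M) * M" using h1 by (intro mult_right_mono) (auto simp: t_def)
      also have "\<dots> = d0 / 2" using h1 by simp
      finally show ?thesis using d0 by simp
    qed
    have inD: "x + s *\<^sub>R h \<in> D" if "0 \<le> s" "s \<le> t" for s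
    proof -
      have "s * norm h \<le> t * norm h" using that by (intro mult_right_mono) auto
      then show ?thesis using tn that d0(2) by (auto simp: dist_norm)
    qed
    have "((\<lambda>t. w (x + t *\<^sub>R h)) has_real_derivative (h \<bullet> p (x + s *\<^sub>R h))) (at s)" if "0 \<le> s" "s \<le> t" for s
      using diff_chain_at[OF l[of s] jetD(2)[OF j inD[OF that]]]
      unfolding has_field_derivative_def o_def
      by (rule has_derivative_eq_rhs) (auto simp: inner_commute)
    from MVT2[OF t(1) this] obtain z where z: "0 < z" "z < t"
      "w (x + t *\<^sub>R h) - w (x + 0 *\<^sub>R h) = (t - 0) * (h \<bullet> p (x + z *\<^sub>R h))" by blast
    have "h \<bullet> p (x + z *\<^sub>R h) < 0" using d(2) z t by simp
    then have "w (x + t *\<^sub>R h) < w x" using z(3) mult_pos_neg[OF t(1)] by fastforce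
    then show False using min[OF inD[of t]] t by simp
  qed
qed

section \<open>Supersolutions\<close>

text \<open>This covers all linear inequalities with leading coefficients in the class and lower
  order coefficients bounded by \<open>K\<close>, without naming them. Since \<open>w\<close> is
  nonnegative, the term \<open>K * w\<close> allows zero order coefficients of either sign.\<close>

definition supersol :: "real \<Rightarrow> real \<Rightarrow> real \<Rightarrow> (real^'N \<Rightarrow> real) \<Rightarrow> (real^'N \<Rightarrow> real^'N) \<Rightarrow>
    (real^'N \<Rightarrow> real^'N^'N) \<Rightarrow> (real^'N) set \<Rightarrow> bool" where
  "supersol \<alpha> \<beta> K w p X D \<longleftrightarrow> 0 < \<alpha> \<and> \<alpha> \<le> \<beta> \<and> 0 \<le> K \<and> jet w p X D \<and>
     (\<forall>x\<in>D. 0 \<le> w x \<and> pucci_minus \<alpha> \<beta> (X x) \<le> K * (norm (p x) + w x))"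

lemma supersolD:
  assumes "supersol \<alpha> \<beta> K w p X D"
  shows "0 < \<alpha>" "\<alpha> \<le> \<beta>" "0 \<le> K" "jet w p X D" "open D" "x \<in> D \<Longrightarrow> 0 \<le> w x"
    "x \<in> D \<Longrightarrow> pucci_minus \<alpha> \<beta> (X x) \<le> K * (norm (p x) + w x)"
  using assms by (auto simp: supersol_def jet_def)

lemma supersol_subset: "supersol \<alpha> \<beta> K w p X D \<Longrightarrow> D' \<subseteq> D \<Longrightarrow> open D' \<Longrightarrow> supersol \<alpha> \<beta> K w p X D'"
  by (auto simp: supersol_def intro: jet_subset)

text \<open>At a minimum of \<open>w - \<epsilon> * \<phi>\<close> the gradients agree and the
  Hessian of \<open>w\<close> dominates that of \<open>\<epsilon> * \<phi>\<close>, so a strict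
  subsolution \<open>\<phi>\<close> contradicts the inequality for \<open>w\<close>. The contact
  value must be nonpositive in order that \<open>w\<close> may be replaced by
  \<open>\<epsilon> * \<phi>\<close> in the zero order term.\<close>

lemma no_touching:
  assumes s: "supersol \<alpha> \<beta> K w p X D" and j: "jet \<phi> q Z D" and x: "x \<in> D" and \<epsilon>: "\<epsilon> > 0"
    and min: "\<And>y. y \<in> D \<Longrightarrow> w x - \<epsilon> * \<phi> x \<le> w y - \<epsilon> * \<phi> y" and below: "w x \<le> \<epsilon> * \<phi> x"
    and t: "K * (norm (q x) + \<phi> x) < t"
    and A: "\<And>A. A \<in> pucci_class \<alpha> \<beta> \<Longrightarrow> t \<le> trace (A ** Z x)"
  shows False
proof -
  note sd = supersolD[OF s]
  note m = jet_local_min[OF jet_diff[OF sd(4) jet_cmult[OF j, of \<epsilon>]] x min]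
  have p: "p x = \<epsilon> *\<^sub>R q x" using m(1) by simp
  have "\<epsilon> * t \<le> trace (A ** X x)" if AA: "A \<in> pucci_class \<alpha> \<beta>" for A
  proof -
    have "trace (A ** (\<epsilon> *\<^sub>R Z x)) \<le> trace (A ** X x)"
    proof (rule trace_class_mono[OF AA sd(1)])
      show "h \<bullet> (\<epsilon> *\<^sub>R Z x *v h) \<le> h \<bullet> (X x *v h)" for h
        using m(2)[of h] by (simp add: matrix_vector_mult_diff_rdistrib inner_diff_right)
    qed
    moreover have "\<epsilon> * t \<le> \<epsilon> * trace (A ** Z x)" using A[OF AA] \<epsilon> by simp
    ultimately show ?thesis by (simp add: trace_simps)
  qed
  then have "\<epsilon> * t \<le> pucci_minus \<alpha> \<beta> (X x)" by (rule pucci_minus_ge[OF sd(2)])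
  also have "\<dots> \<le> K * (norm (p x) + w x)" by (rule sd(7)[OF x])
  also have "\<dots> \<le> K * (\<epsilon> * norm (q x) + \<epsilon> * \<phi> x)"
    using below \<epsilon> sd(3) by (intro mult_left_mono add_mono) (auto simp: p)
  also have "\<dots> = \<epsilon> * (K * (norm (q x) + \<phi> x))" by (simp add: algebra_simps)
  also have "\<dots> < \<epsilon> * t" using t \<epsilon> by simp
  finally show False by simp
qed

lemma trace_mult_mat: "trace (A ** mat c) = c * trace (A :: real^'N^'N)"
proof -
  have "(mat c :: real^'N^'N) = c *\<^sub>R mat 1" by (simp add: vec_eq_iff mat_def)
  then show ?thesis by (simp add: trace_simps)
qed

lemma pucci_class_trace_id:
  assumes "A \<in> pucci_class \<alpha> \<beta>"
  shows "trace (A :: real^'N^'N) \<le> real CARD('N) * \<beta>"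
proof -
  have "A $ i $ i \<le> \<beta>" for i
    using pucci_classD(3)[OF assms, of "axis i 1"]
    by (simp add: matrix_vector_mult_basis column_def inner_axis' inner_axis)
  then have "trace A \<le> (\<Sum>i\<in>(UNIV::'N set). \<beta>)" unfolding trace_def by (intro sum_mono)
  then show ?thesis by simp
qed

text \<open>The left side has literally the shape that the jet rules produce for the barrier of
  \<open>hopf\<close>; the same holds for the matrix in \<open>barrier_trace\<close>.\<close>

lemma barrier_gradient:
  "0 - 2 *\<^sub>R d + k *\<^sub>R (s *\<^sub>R (0 - 2 *\<^sub>R d) + s *\<^sub>R (0 - 2 *\<^sub>R d)) = - (2 * (1 + 2 * (k * s))) *\<^sub>R (d :: real^'N)"
  by (simp add: vec_eq_iff algebra_simps)

lemma barrier_trace: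
  fixes A :: "real^'N^'N"
  shows "trace (A ** (0 - mat 2 + k *\<^sub>R (s *\<^sub>R (0 - mat 2) + s *\<^sub>R (0 - mat 2)
      + outer (0 - 2 *\<^sub>R d) (0 - 2 *\<^sub>R d) + outer (0 - 2 *\<^sub>R d) (0 - 2 *\<^sub>R d))))
    = 8 * k * (d \<bullet> (A *v d)) - 2 * (1 + 2 * (k * s)) * trace A"
proof -
  have "(0 - mat 2 + k *\<^sub>R (s *\<^sub>R (0 - mat 2) + s *\<^sub>R (0 - mat 2)
      + outer (0 - 2 *\<^sub>R d) (0 - 2 *\<^sub>R d) + outer (0 - 2 *\<^sub>R d) (0 - 2 *\<^sub>R d)))
    = (8 * k) *\<^sub>R outer d d - (2 * (1 + 2 * (k * s))) *\<^sub>R (mat 1 :: real^'N^'N)"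
    by (simp add: vec_eq_iff outer_def mat_def algebra_simps)
  then show ?thesis by (simp only: trace_simps matrix_mul_rid)
qed

text \<open>The barrier is \<open>s + k s\<^sup>2\<close> with \<open>s = r\<^sup>2 - |x - z|\<^sup>2\<close>; it is a strict subsolution where
  \<open>k s \<le> 1\<close>, as \<open>k\<close> is large. Working on balls of radius \<open>r < \<rho>\<close> avoids any assumption
  on \<open>w\<close> at the boundary of \<open>ball z \<rho>\<close>.\<close>

lemma hopf:
  fixes z :: "real^'N"
  assumes s: "supersol \<alpha> \<beta> K w p X D" and B: "ball z \<rho> \<subseteq> D" and \<rho>: "\<rho> > 0"
    and pos: "\<And>x. x \<in> ball z \<rho> \<Longrightarrow> 0 < w x"
  shows "\<exists>c>0. \<forall>x\<in>ball z \<rho>. c * (\<rho>\<^sup>2 - (x - z) \<bullet> (x - z)) \<le> w x"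
proof -
  note sd = supersolD[OF s]
  define N where "N = real CARD('N)"
  have N1: "N \<ge> 1" unfolding N_def by (simp add: Suc_leI)
  \<comment> \<open>The three summands give \<open>k \<ge> 1\<close>, a layer outside
    \<open>?I\<close> in which the squared distance to \<open>z\<close> is at least half of
    \<open>\<rho>\<^sup>2\<close>, and a radial second derivative that outweighs all other terms in
    this layer.\<close>
  define k where "k = 1 + 2 / \<rho>\<^sup>2 + (6 * N * \<beta> + K * (6 * \<rho> + 2)) / (\<alpha> * \<rho>\<^sup>2)"
  have \<beta>0: "\<beta> > 0" using sd(1,2) by simp
  have Q0: "6 * N * \<beta> + K * (6 * \<rho> + 2) \<ge> 0" using N1 \<beta>0 sd(3) \<rho> by simp
  have k1: "k \<ge> 1" using \<rho> sd(1) Q0 by (simp add: k_def)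
  have k2: "1 / k \<le> \<rho>\<^sup>2 / 2"
  proof -
    have "2 / \<rho>\<^sup>2 \<le> k" using \<rho> sd(1) Q0 by (simp add: k_def)
    then show ?thesis using k1 \<rho> by (simp add: field_simps)
  qed
  have k3: "6 * N * \<beta> + K * (6 * \<rho> + 2) < 2 * k * \<alpha> * \<rho>\<^sup>2"
  proof -
    have p: "\<alpha> * \<rho>\<^sup>2 > 0" using sd(1) \<rho> by simp
    have "(6 * N * \<beta> + K * (6 * \<rho> + 2)) / (\<alpha> * \<rho>\<^sup>2) < k" using \<rho> by (simp add: k_def add_pos_nonneg)
    then have "6 * N * \<beta> + K * (6 * \<rho> + 2) < k * (\<alpha> * \<rho>\<^sup>2)" using p by (simp add: divide_less_eq)
    also have "\<dots> \<le> 2 * k * \<alpha> * \<rho>\<^sup>2" using k1 p by simp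
    finally show ?thesis .
  qed
  let ?I = "cball z (sqrt (\<rho>\<^sup>2 - 1 / (2*k)))"
  have io: "\<rho>\<^sup>2 - 1 / (2*k) < \<rho>\<^sup>2" "0 < \<rho>\<^sup>2 - 1 / (2*k)"
  proof -
    show "\<rho>\<^sup>2 - 1 / (2*k) < \<rho>\<^sup>2" using k1 by simp
    have "1 / (2*k) < 1 / k" using k1 by (simp add: field_simps)
    also note k2
    also have "\<rho>\<^sup>2 / 2 < \<rho>\<^sup>2" using \<rho> by simp
    finally show "0 < \<rho>\<^sup>2 - 1 / (2*k)" by simp
  qed
  have Isub: "?I \<subseteq> ball z \<rho>"
    using io \<rho> real_sqrt_less_mono[OF io(1)] by auto
  have "continuous_on ?I w"
    using jet_continuous_on[OF sd(4)] Isub B continuous_on_subset by blast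
  moreover have "?I \<noteq> {}" using io by simp
  ultimately obtain xm where xm: "xm \<in> ?I" "\<And>x. x \<in> ?I \<Longrightarrow> w xm \<le> w x"
    using continuous_attains_inf[of ?I w] by auto
  define m where "m = w xm"
  have m0: "m > 0" using pos xm(1) Isub m_def by blast
  \<comment> \<open>On the inner ball \<open>?I\<close> the barrier is at most the denominator, so
    \<open>\<epsilon>\<close> times the barrier does not exceed the minimum \<open>m\<close> of
    \<open>w\<close> there.\<close>
  define \<epsilon> where "\<epsilon> = m / (\<rho>\<^sup>2 + k * (\<rho>\<^sup>2)\<^sup>2)"
  have den: "\<rho>\<^sup>2 + k * (\<rho>\<^sup>2)\<^sup>2 > 0" using \<rho> k1 by (simp add: add_pos_nonneg)
  have \<epsilon>: "\<epsilon> > 0" using m0 den by (simp add: \<epsilon>_def)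
  have main: "\<epsilon> * (r\<^sup>2 - (x - z) \<bullet> (x - z)) \<le> w x" if r: "0 < r" "r < \<rho>" and x: "x \<in> cball z r" for r x
  proof -
    let ?s = "\<lambda>x. r\<^sup>2 - (x - z) \<bullet> (x - z)"
    let ?\<phi> = "\<lambda>x. ?s x + k * (?s x * ?s x)"
    have C: "cball z r \<subseteq> ball z \<rho>" using r by auto
    have cont: "continuous_on (cball z r) (\<lambda>x. w x - \<epsilon> * ?\<phi> x)"
      using jet_continuous_on[OF sd(4)] C B continuous_on_subset
      by (intro continuous_intros) blast
    obtain y where y: "y \<in> cball z r" "\<And>x. x \<in> cball z r \<Longrightarrow> w y - \<epsilon> * ?\<phi> y \<le> w x - \<epsilon> * ?\<phi> x"
      using continuous_attains_inf[OF compact_cball _ cont] r by fastforce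
    have yz: "norm (y - z) \<le> r" using y(1) by (simp add: dist_norm norm_minus_commute)
    have sy: "0 \<le> ?s y" using power_mono[OF yz, of 2] by (simp add: power2_norm_eq_inner)
    \<comment> \<open>A negative minimum is impossible on the sphere, where the barrier vanishes and
      \<open>w > 0\<close>, and on \<open>?I\<close> by the choice of \<open>\<epsilon>\<close>; in
      the layer between them \<open>no_touching\<close> applies.\<close>
    have "0 \<le> w y - \<epsilon> * ?\<phi> y"
    proof (rule ccontr)
      assume neg: "\<not> 0 \<le> w y - \<epsilon> * ?\<phi> y"
      have wy: "0 < w y" using pos y(1) C by blast
      have sp: "?s y > 0" using neg wy sy by (cases "?s y = 0") auto
      have yball: "y \<in> ball z r"
        using sp r power_mono[of r "norm (y - z)" 2]
        by (auto simp: dist_norm norm_minus_commute power2_norm_eq_inner not_less[symmetric])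
      have sle: "?s y \<le> \<rho>\<^sup>2"
        using r power_mono[of r \<rho> 2] inner_ge_zero[of "y - z"] by linarith
      have yI: "y \<notin> ?I"
      proof
        assume "y \<in> ?I"
        then have "m \<le> w y" using xm m_def by blast
        moreover have "?\<phi> y \<le> \<rho>\<^sup>2 + k * (\<rho>\<^sup>2)\<^sup>2"
          unfolding power2_eq_square[of "\<rho>\<^sup>2"] using sle sy k1 by (intro add_mono mult_left_mono mult_mono) auto
        then have "\<epsilon> * ?\<phi> y \<le> m" using mult_left_mono[of _ _ \<epsilon>] \<epsilon> den by (fastforce simp: \<epsilon>_def)
        ultimately show False using neg by linarith
      qed
      have far: "\<rho>\<^sup>2 - 1 / (2*k) < (y - z) \<bullet> (y - z)"
      proof -
        have "sqrt (\<rho>\<^sup>2 - 1 / (2*k)) < norm (y - z)" using yI by (simp add: dist_norm norm_minus_commute)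
        then show ?thesis using io by (simp add: norm_eq_sqrt_inner)
      qed
      have ks: "k * ?s y \<le> 1"
      proof -
        have "?s y < 1 / (2 * k)" using far r power_mono[of r \<rho> 2] by linarith
        then have "?s y < 1 / k" using k1 sp by (simp add: field_simps)
        then show ?thesis using k1 by (simp add: field_simps)
      qed
      have far2: "\<rho>\<^sup>2 / 2 \<le> (y - z) \<bullet> (y - z)"
      proof -
        have "1 / (2*k) \<le> 1 / k" using k1 by (simp add: field_simps)
        then show ?thesis using far k2 by linarith
      qed
      have o: "open (ball z r)" by simp
      note j1 = jet_diff[OF jet_const[OF o, of "r\<^sup>2"] jet_sq[OF o, of z]]
      note j = jet_add[OF j1 jet_cmult[OF jet_mult[OF j1 j1], of k]]
      define t where "t = 8 * k * \<alpha> * ((y - z) \<bullet> (y - z)) - 6 * N * \<beta>"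
      show False
      proof (rule no_touching[OF supersol_subset[OF s _ o] j yball \<epsilon>, where t = t])
        show "ball z r \<subseteq> D" using ball_subset_cball[of z r] C B by blast
        show "w y - \<epsilon> * ?\<phi> y \<le> w x - \<epsilon> * ?\<phi> x" if "x \<in> ball z r" for x
          using y(2) that by auto
        show "w y \<le> \<epsilon> * ?\<phi> y" using neg by linarith
        have sc: "0 - 2 *\<^sub>R (y - z) + k *\<^sub>R (?s y *\<^sub>R (0 - 2 *\<^sub>R (y - z)) + ?s y *\<^sub>R (0 - 2 *\<^sub>R (y - z)))
          = - (2 * (1 + 2 * (k * ?s y))) *\<^sub>R (y - z)"
          by (rule barrier_gradient)
        have "norm (0 - 2 *\<^sub>R (y - z) + k *\<^sub>R (?s y *\<^sub>R (0 - 2 *\<^sub>R (y - z)) + ?s y *\<^sub>R (0 - 2 *\<^sub>R (y - z)))) \<le> 6 * \<rho>"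
        proof -
          have "0 \<le> k * ?s y" using sp k1 by simp
          then have "\<bar>- (2 * (1 + 2 * (k * ?s y)))\<bar> \<le> 6" using ks by (simp add: abs_if)
          then have "\<bar>- (2 * (1 + 2 * (k * ?s y)))\<bar> * norm (y - z) \<le> 6 * \<rho>"
            using yz r by (intro mult_mono) auto
          then show ?thesis by (simp only: sc norm_scaleR)
        qed
        moreover have "?\<phi> y \<le> 2"
        proof -
          have "?s y \<le> k * ?s y" using k1 sp by simp
          then have s1: "?s y \<le> 1" using ks by linarith
          have "k * (?s y * ?s y) = (k * ?s y) * ?s y" by simp
          also have "\<dots> \<le> 1 * 1" using ks s1 sp k1 by (intro mult_mono) auto
          finally show ?thesis using s1 by simp
        qed
        ultimately have "K * (norm (0 - 2 *\<^sub>R (y - z) + k *\<^sub>R (?s y *\<^sub>R (0 - 2 *\<^sub>R (y - z)) + ?s y *\<^sub>R (0 - 2 *\<^sub>R (y - z)))) + ?\<phi> y)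
          \<le> K * (6 * \<rho> + 2)" using sd(3) by (intro mult_left_mono add_mono)
        also have "\<dots> < 8 * k * \<alpha> * (\<rho>\<^sup>2 / 2) - 6 * N * \<beta>"
        proof -
          define q where "q = k * \<alpha> * \<rho>\<^sup>2"
          have "q > 0" using k1 sd(1) \<rho> by (simp add: q_def)
          moreover have "2 * k * \<alpha> * \<rho>\<^sup>2 = 2 * q" "8 * k * \<alpha> * (\<rho>\<^sup>2 / 2) = 4 * q" by (simp_all add: q_def)
          ultimately show ?thesis using k3 by linarith
        qed
        also have "\<dots> \<le> t" unfolding t_def using far2 k1 sd(1) by (intro diff_right_mono mult_left_mono) auto
        finally show "K * (norm (0 - 2 *\<^sub>R (y - z) + k *\<^sub>R (?s y *\<^sub>R (0 - 2 *\<^sub>R (y - z)) + ?s y *\<^sub>R (0 - 2 *\<^sub>R (y - z)))) + ?\<phi> y) < t" .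
        fix A :: "real^'N^'N" assume A: "A \<in> pucci_class \<alpha> \<beta>"
        have "trace (A ** (0 - mat 2 + k *\<^sub>R (?s y *\<^sub>R (0 - mat 2) + ?s y *\<^sub>R (0 - mat 2)
             + outer (0 - 2 *\<^sub>R (y - z)) (0 - 2 *\<^sub>R (y - z)) + outer (0 - 2 *\<^sub>R (y - z)) (0 - 2 *\<^sub>R (y - z)))))
          = 8 * k * ((y - z) \<bullet> (A *v (y - z))) - 2 * (1 + 2 * (k * ?s y)) * trace A"
          by (rule barrier_trace)
        moreover have "8 * k * (\<alpha> * ((y - z) \<bullet> (y - z))) \<le> 8 * k * ((y - z) \<bullet> (A *v (y - z)))"
          using pucci_classD(2)[OF A, of "y - z"] k1 by (intro mult_left_mono) auto
        moreover have "2 * (1 + 2 * (k * ?s y)) * trace A \<le> 6 * (N * \<beta>)"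
        proof -
          have "2 * (1 + 2 * (k * ?s y)) * trace A \<le> 2 * (1 + 2 * (k * ?s y)) * (N * \<beta>)"
            using pucci_class_trace_id[OF A] sp k1 N_def by (intro mult_left_mono) auto
          also have "\<dots> \<le> 6 * (N * \<beta>)" using ks N1 \<beta>0 by (intro mult_right_mono) auto
          finally show ?thesis .
        qed
        ultimately show "t \<le> trace (A ** (0 - mat 2 + k *\<^sub>R (?s y *\<^sub>R (0 - mat 2) + ?s y *\<^sub>R (0 - mat 2)
             + outer (0 - 2 *\<^sub>R (y - z)) (0 - 2 *\<^sub>R (y - z)) + outer (0 - 2 *\<^sub>R (y - z)) (0 - 2 *\<^sub>R (y - z)))))"
          by (simp add: t_def mult_ac)
      qed
    qed
    then have "0 \<le> w x - \<epsilon> * ?\<phi> x" using y(2)[OF x] by linarith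
    moreover have "\<epsilon> * ?s x \<le> \<epsilon> * ?\<phi> x" using \<epsilon> k1 by (intro mult_left_mono) auto
    ultimately show ?thesis by linarith
  qed
  show ?thesis
  proof (intro exI[of _ \<epsilon>] conjI ballI \<epsilon>)
    fix x assume x: "x \<in> ball z \<rho>"
    have "((\<lambda>r. \<epsilon> * (r\<^sup>2 - (x - z) \<bullet> (x - z))) \<longlongrightarrow> \<epsilon> * (\<rho>\<^sup>2 - (x - z) \<bullet> (x - z))) (at_left \<rho>)"
      by (intro tendsto_intros)
    moreover have "\<forall>\<^sub>F r in at_left \<rho>. \<epsilon> * (r\<^sup>2 - (x - z) \<bullet> (x - z)) \<le> w x"
    proof -
      have "\<forall>\<^sub>F r in at_left \<rho>. r \<in> {max (dist z x) (\<rho>/2)<..<\<rho>}"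
        using x \<rho> by (intro eventually_at_leftI[of "max (dist z x) (\<rho>/2)"]) auto
      then show ?thesis
        by eventually_elim (rule main, use \<rho> in auto)
    qed
    ultimately show "\<epsilon> * (\<rho>\<^sup>2 - (x - z) \<bullet> (x - z)) \<le> w x"
      by (rule tendsto_upperbound) simp
  qed
qed

text \<open>The point \<open>y\<close> is typically on the boundary of \<open>D\<close>, where
  nothing is known about \<open>w\<close>. Along the normal the quadratic bound of
  \<open>hopf\<close> becomes linear, since \<open>\<rho>\<^sup>2 - (t - \<rho>)\<^sup>2\<close> is
  at least \<open>\<rho> * t\<close>.\<close>

lemma hopf_normal:
  assumes s: "supersol \<alpha> \<beta> K w p X D" and B: "ball (y + \<rho> *\<^sub>R \<nu>) \<rho> \<subseteq> D" and \<rho>: "\<rho> > 0" and \<nu>: "norm \<nu> = 1"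
    and pos: "\<And>x. x \<in> ball (y + \<rho> *\<^sub>R \<nu>) \<rho> \<Longrightarrow> 0 < w x"
  shows "\<exists>c>0. \<forall>t. 0 < t \<longrightarrow> t < \<rho> \<longrightarrow> y + t *\<^sub>R \<nu> \<in> D \<and> c * t \<le> w (y + t *\<^sub>R \<nu>)"
proof -
  obtain c where c: "c > 0" "\<And>x. x \<in> ball (y + \<rho> *\<^sub>R \<nu>) \<rho> \<Longrightarrow>
    c * (\<rho>\<^sup>2 - (x - (y + \<rho> *\<^sub>R \<nu>)) \<bullet> (x - (y + \<rho> *\<^sub>R \<nu>))) \<le> w x"
    using hopf[OF s B \<rho> pos] by blast
  have \<nu>1: "\<nu> \<bullet> \<nu> = 1" using \<nu> by (simp add: dot_square_norm)
  show ?thesis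
  proof (intro exI[of _ "c * \<rho>"] conjI allI impI)
    show "0 < c * \<rho>" using c \<rho> by simp
    fix t assume t: "0 < t" "t < \<rho>"
    have d: "y + t *\<^sub>R \<nu> - (y + \<rho> *\<^sub>R \<nu>) = (t - \<rho>) *\<^sub>R \<nu>" by (simp add: algebra_simps)
    have b: "y + t *\<^sub>R \<nu> \<in> ball (y + \<rho> *\<^sub>R \<nu>) \<rho>"
    proof -
      have "dist (y + \<rho> *\<^sub>R \<nu>) (y + t *\<^sub>R \<nu>) = norm ((t - \<rho>) *\<^sub>R \<nu>)"
        by (metis d dist_commute dist_norm)
      then show ?thesis using t \<nu> by simp
    qed
    then show "y + t *\<^sub>R \<nu> \<in> D" using B by blast
    have "c * \<rho> * t \<le> c * (\<rho>\<^sup>2 - (t - \<rho>)\<^sup>2)"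
    proof -
      have "\<rho>\<^sup>2 - (t - \<rho>)\<^sup>2 - \<rho> * t = t * (\<rho> - t)" by (simp add: power2_eq_square algebra_simps)
      moreover have "t * (\<rho> - t) \<ge> 0" using t by simp
      ultimately have "\<rho> * t \<le> \<rho>\<^sup>2 - (t - \<rho>)\<^sup>2" by linarith
      then show ?thesis using c(1) by (simp add: mult.assoc)
    qed
    also have "\<dots> \<le> w (y + t *\<^sub>R \<nu>)" using c(2)[OF b] unfolding d by (simp add: \<nu>1 power2_eq_square)
    finally show "c * \<rho> * t \<le> w (y + t *\<^sub>R \<nu>)" .
  qed
qed

text \<open>If the zero set were not open, a ball around a nearby point with \<open>w > 0\<close>
  could be enlarged until it touches the zero set at some \<open>a\<close>. There Hopf gives a
  positive slope, while \<open>a\<close> is an interior minimum with zero gradient.\<close>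

lemma strong_max_principle:
  assumes s: "supersol \<alpha> \<beta> K w p X D" and con: "connected D" and x0: "x0 \<in> D" "w x0 = 0" and x: "x \<in> D"
  shows "w x = 0"
proof (rule ccontr)
  assume wx: "w x \<noteq> 0"
  note sd = supersolD[OF s]
  have cont: "continuous_on D w" by (rule jet_continuous_on[OF sd(4)])
  let ?Z = "{x\<in>D. w x = 0}"
  have closed: "closedin (top_of_set D) ?Z"
    using continuous_closedin_preimage_constant[OF cont] by simp
  moreover have "openin (top_of_set D) ?Z"
  proof -
    have "open ?Z"
      unfolding open_contains_ball
    proof
      fix y assume y: "y \<in> ?Z"
      then obtain r where r: "r > 0" "ball y r \<subseteq> D" using sd(5) open_contains_ball by blast
      have "ball y (r/2) \<subseteq> ?Z"
      proof (rule ccontr)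
        assume "\<not> ball y (r/2) \<subseteq> ?Z"
        then obtain z where z: "z \<in> ball y (r/2)" "w z \<noteq> 0" "z \<in> D"
          using r subset_ball[of "r/2" r y] by fastforce
        have yz: "dist z y < r/2" using z by (simp add: dist_commute)
        \<comment> \<open>Zeros farther from \<open>z\<close> than \<open>y\<close> are discarded,
          so that the closest zero and the ball it determines stay inside
          \<open>ball y r\<close>.\<close>
        let ?C = "cball z (dist z y) \<inter> {x. x \<in> D \<and> w x = 0}"
        have cbD: "cball z (dist z y) \<subseteq> ball y r"
        proof
          fix x assume "x \<in> cball z (dist z y)"
          then have "dist z x \<le> dist z y" by simp
          then show "x \<in> ball y r" using yz dist_triangle[of y x z] by (simp add: dist_commute)
        qed
        have "?C = {x \<in> cball z (dist z y). w x = 0}" using cbD r by auto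
        moreover have "closed {x \<in> cball z (dist z y). w x = 0}"
          by (rule continuous_closed_preimage_constant)
            (use cont cbD r continuous_on_subset in \<open>blast, simp\<close>)
        ultimately have "closed ?C" by simp
        moreover have "?C \<noteq> {}" using y by auto
        ultimately obtain a where a: "a \<in> ?C" "\<And>b. b \<in> ?C \<Longrightarrow> dist z a \<le> dist z b"
          using distance_attains_inf by blast
        define \<rho> where "\<rho> = dist z a"
        have az: "a \<noteq> z" using a z by auto
        have \<rho>: "\<rho> > 0" using az by (simp add: \<rho>_def)
        have \<rho>le: "\<rho> \<le> dist z y" using a by (simp add: \<rho>_def)
        define \<nu> where "\<nu> = (1/\<rho>) *\<^sub>R (z - a)"
        have \<nu>: "norm \<nu> = 1" using \<rho> by (simp add: \<nu>_def \<rho>_def dist_norm)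
        have ctr: "a + \<rho> *\<^sub>R \<nu> = z" using \<rho> by (simp add: \<nu>_def)
        have BD: "ball z \<rho> \<subseteq> D" using \<rho>le cbD r by fastforce
        have "0 < w x" if "x \<in> ball z \<rho>" for x
        proof -
          have "x \<notin> ?C" using a(2)[of x] that by (auto simp: \<rho>_def)
          moreover have "x \<in> cball z (dist z y)" using that \<rho>le by auto
          ultimately have "w x \<noteq> 0" using that BD by auto
          then show ?thesis using sd(6)[of x] that BD by force
        qed
        then obtain c where c: "c > 0" "\<And>t. 0 < t \<Longrightarrow> t < \<rho> \<Longrightarrow> c * t \<le> w (a + t *\<^sub>R \<nu>)"
          using hopf_normal[OF s, of a \<rho> \<nu>] BD \<rho> \<nu> by (auto simp: ctr)
        have aD: "a \<in> D" "w a = 0" using a by auto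
        have pa: "p a = 0"
          by (rule jet_local_min(1)[OF sd(4) aD(1)]) (use aD sd(6) in auto)
        have "((\<lambda>t. a + t *\<^sub>R \<nu>) has_derivative (\<lambda>h. h *\<^sub>R \<nu>)) (at 0)" by (auto intro!: derivative_eq_intros)
        from diff_chain_at[OF this, of w "\<lambda>h. p a \<bullet> h"] jetD(2)[OF sd(4) aD(1)]
        have "((\<lambda>t. w (a + t *\<^sub>R \<nu>)) has_real_derivative 0) (at 0)"
          by (simp add: o_def pa has_field_derivative_def lambda_zero[symmetric])
        then have "((\<lambda>t. (w (a + t *\<^sub>R \<nu>) - w a) / t) \<longlongrightarrow> 0) (at_right 0)"
          using aD(2) DERIV_subset[of _ _ 0 UNIV "{0<..}"] by (fastforce simp: has_field_derivative_iff)
        moreover have "\<forall>\<^sub>F t in at_right 0. c \<le> (w (a + t *\<^sub>R \<nu>) - w a) / t"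
        proof -
          have "\<forall>\<^sub>F t in at_right 0. t \<in> {0<..<\<rho>}" using \<rho> by (intro eventually_at_rightI) auto
          then show ?thesis by eventually_elim (use c aD in \<open>auto simp: field_simps\<close>)
        qed
        ultimately have "c \<le> 0" by (rule tendsto_lowerbound) simp
        then show False using c by simp
      qed
      then show "\<exists>\<epsilon>>0. ball y \<epsilon> \<subseteq> ?Z" using r by (intro exI[of _ "r/2"]) auto
    qed
    then show ?thesis by (auto intro: open_subset)
  qed
  ultimately have "?Z = {} \<or> ?Z = D" using con unfolding connected_clopen by blast
  then have "?Z = D" using x0 by blast
  then show False using x wx by auto
qed

section \<open>Consequences of the structural conditions\<close>

text \<open>Monotonicity is available one coordinate at a time, so the coordinates are switched from
  \<open>a\<close> to \<open>b\<close> one after the other; \<open>i\<close> is never switched,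
  hence the equality there.\<close>

lemma nondecreasing_chain:
  fixes g :: "real^'n::finite \<Rightarrow> real^'N \<Rightarrow> real"
  assumes mono: "\<And>j. j \<noteq> i \<Longrightarrow> nondecreasing_in j g" and le: "\<And>j. a $ j \<le> b $ j" and eq: "a $ i = b $ i"
  shows "g a p \<le> g b p"
proof -
  have "g a p \<le> g (\<chi> j. if j \<in> S then b $ j else a $ j) p" if "finite S" "i \<notin> S" for S :: "'n set"
    using that
  proof (induction S)
    case empty
    then show ?case by simp
  next
    case (insert k S)
    have "g (\<chi> j. if j \<in> S then b $ j else a $ j) p \<le> g (\<chi> j. if j \<in> insert k S then b $ j else a $ j) p"
      using mono[of k] insert.prems insert.hyps le unfolding nondecreasing_in_def agree_except_def by auto
    then show ?case using insert by auto
  qed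
  from this[of "UNIV - {i}"] have "g a p \<le> g (\<chi> j. if j \<in> UNIV - {i} then b $ j else a $ j) p" by simp
  also have "(\<chi> j. if j \<in> UNIV - {i} then b $ j else a $ j) = b" using eq by (auto simp: vec_eq_iff)
  finally show ?thesis .
qed

text \<open>The ray leaves the ball when \<open>t * (v \<bullet> v)\<close> reaches
  \<open>2 * d * (v \<bullet> n)\<close>; enlarging the denominator of the witness by 1 keeps it
  visibly positive.\<close>

lemma ball_ray:
  fixes n :: "real^'N"
  assumes "norm n = 1" "0 < d" "0 < v \<bullet> n"
  shows "\<exists>t0>0. \<forall>t. 0 < t \<and> t < t0 \<longrightarrow> b + t *\<^sub>R v \<in> ball (b + d *\<^sub>R n) d"
proof (intro exI[of _ "2 * d * (v \<bullet> n) / (v \<bullet> v + 1)"] conjI allI impI)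
  have p: "v \<bullet> v + 1 > 0" by (simp add: add_nonneg_pos)
  show "0 < 2 * d * (v \<bullet> n) / (v \<bullet> v + 1)" using assms p by simp
  fix t assume t: "0 < t \<and> t < 2 * d * (v \<bullet> n) / (v \<bullet> v + 1)"
  have nn: "n \<bullet> n = 1" using assms by (simp add: dot_square_norm)
  have "t * (v \<bullet> v + 1) < 2 * d * (v \<bullet> n)" using t p by (simp add: less_divide_eq)
  then have "t * (v \<bullet> v) < 2 * d * (v \<bullet> n)" using t by (simp add: algebra_simps)
  then have "t * (t * (v \<bullet> v)) < t * (2 * d * (v \<bullet> n))" using t by simp
  moreover have "(d *\<^sub>R n - t *\<^sub>R v) \<bullet> (d *\<^sub>R n - t *\<^sub>R v) = d\<^sup>2 - t * (2 * d * (v \<bullet> n)) + t * (t * (v \<bullet> v))"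
    by (simp add: inner_diff_left inner_diff_right nn inner_commute[of n v] power2_eq_square algebra_simps)
  ultimately have "(norm (d *\<^sub>R n - t *\<^sub>R v))\<^sup>2 < d\<^sup>2" by (simp add: power2_norm_eq_inner)
  then have "norm (d *\<^sub>R n - t *\<^sub>R v) < d" using assms(2) by (simp add: power_less_imp_less_base)
  then show "b + t *\<^sub>R v \<in> ball (b + d *\<^sub>R n) d" by (simp add: dist_norm)
qed

text \<open>Smoothness of the boundary enters in two forms: balls touching each boundary point from
  both sides, which feed the Hopf lemma and the growth estimates, and \<open>push\<close>, which
  keeps short segments in an inward direction inside the domain, uniformly near \<open>y\<close>.
  Dirichlet and Neumann data together fix the whole boundary gradient, hence the form of
  \<open>G_boundary\<close>.\<close>

locale overdetermined =
  fixes \<Omega> :: "(real^'N) set"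
    and F :: "'n::finite \<Rightarrow> real^'N \<Rightarrow> real^'N^'N \<Rightarrow> real"
    and f :: "'n \<Rightarrow> real^'n \<Rightarrow> real^'N \<Rightarrow> real"
    and u :: "'n \<Rightarrow> real^'N \<Rightarrow> real"
    and G :: "'n \<Rightarrow> real^'N \<Rightarrow> real^'N"
    and H :: "'n \<Rightarrow> real^'N \<Rightarrow> real^'N^'N"
    and c :: "'n \<Rightarrow> real"
    and nu :: "real^'N \<Rightarrow> real^'N"
  assumes open_dom: "open \<Omega>" and connected_dom: "connected \<Omega>" and nonempty_dom: "\<Omega> \<noteq> {}" and bounded_dom: "bounded \<Omega>"
    and norm_nu: "\<And>y. y \<in> frontier \<Omega> \<Longrightarrow> norm (nu y) = 1"
    and touching_balls: "\<And>y. y \<in> frontier \<Omega> \<Longrightarrow> \<exists>\<rho>>0. ball (y + \<rho> *\<^sub>R nu y) \<rho> \<subseteq> \<Omega> \<and> ball (y - \<rho> *\<^sub>R nu y) \<rho> \<inter> \<Omega> = {}"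
    and push: "\<And>y v. y \<in> frontier \<Omega> \<Longrightarrow> 0 < v \<bullet> nu y \<Longrightarrow> \<exists>r>0. \<forall>x\<in>\<Omega> \<inter> ball y r. \<forall>t\<in>{0..r}. x + t *\<^sub>R v \<in> \<Omega>"
    and jet_u: "\<And>i. jet (u i) (G i) (H i) \<Omega>"
    and cont_u: "\<And>i. continuous_on (closure \<Omega>) (u i)"
    and cont_G: "\<And>i. continuous_on (closure \<Omega>) (G i)"
    and cont_H: "\<And>i. continuous_on (closure \<Omega>) (H i)"
    and u_pos: "\<And>i x. x \<in> \<Omega> \<Longrightarrow> 0 < u i x"
    and u_zero: "\<And>i x. x \<in> frontier \<Omega> \<Longrightarrow> u i x = 0"
    and G_boundary: "\<And>i y. y \<in> frontier \<Omega> \<Longrightarrow> G i y = c i *\<^sub>R nu y"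
    and pde: "\<And>i x. x \<in> \<Omega> \<Longrightarrow> F i (G i x) (H i x) + f i (\<chi> j. u j x) (G i x) = 0"
    and H0: "\<And>i. H0 (F i) (f i)"
    and H1: "\<And>i. H1 (F i)"
    and H2: "\<And>i. H2 (f i)"
    and H4: "\<And>i. H4 i (f i)"
    and H5: "\<And>i. H5 i (f i)"
begin

section \<open>A priori bounds and the one-sided estimate for the lower order terms\<close>

lemma compact_closure_dom: "compact (closure \<Omega>)"
  using bounded_dom by simp

lemma frontier_eq: "frontier \<Omega> = closure \<Omega> - \<Omega>"
  using open_dom by (simp add: frontier_def interior_open)

lemma dom_closure: "x \<in> \<Omega> \<Longrightarrow> x \<in> closure \<Omega>"
  using closure_subset by blast

lemma bounds_ex: "\<exists>C>0. \<forall>i. \<forall>x\<in>closure \<Omega>. \<bar>u i x\<bar> \<le> C \<and> norm (G i x) \<le> C \<and> norm (H i x) \<le> C"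
proof -
  have "\<exists>C>0. \<forall>x\<in>closure \<Omega>. \<bar>u i x\<bar> \<le> C \<and> norm (G i x) \<le> C \<and> norm (H i x) \<le> C" for i
  proof -
    have bd: "\<exists>B. \<forall>x\<in>closure \<Omega>. norm (g x) \<le> B" if "continuous_on (closure \<Omega>) g" for g :: "real^'N \<Rightarrow> 'z::real_normed_vector"
      using compact_continuous_image[OF that compact_closure_dom, THEN compact_imp_bounded] unfolding bounded_iff by blast
    obtain a b d where "\<forall>x\<in>closure \<Omega>. norm (u i x) \<le> a" "\<forall>x\<in>closure \<Omega>. norm (G i x) \<le> b"
      "\<forall>x\<in>closure \<Omega>. norm (H i x) \<le> d"
      using bd[OF cont_u[of i]] bd[OF cont_G[of i]] bd[OF cont_H[of i]] by blast
    then show ?thesis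
      by (intro exI[of _ "max 1 (max a (max b d))"]) (force simp: le_max_iff_disj)
  qed
  then obtain C where C: "\<And>i. C i > 0" "\<And>i x. x \<in> closure \<Omega> \<Longrightarrow> \<bar>u i x\<bar> \<le> C i \<and> norm (G i x) \<le> C i \<and> norm (H i x) \<le> C i"
    by metis
  have le: "C i \<le> (\<Sum>i\<in>UNIV. C i)" for i
    by (intro member_le_sum) (auto intro: less_imp_le C(1))
  show ?thesis
  proof (intro exI[of _ "\<Sum>i\<in>UNIV. C i"] conjI allI ballI)
    show "0 < (\<Sum>i\<in>UNIV. C i)" using C(1) by (intro sum_pos) auto
  qed (use C(2) le order_trans in blast)+
qed

definition "CB = (SOME C. C > 0 \<and> (\<forall>i. \<forall>x\<in>closure \<Omega>. \<bar>u i x\<bar> \<le> C \<and> norm (G i x) \<le> C \<and> norm (H i x) \<le> C))"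

lemma CB: "CB > 0" "x \<in> closure \<Omega> \<Longrightarrow> \<bar>u i x\<bar> \<le> CB" "x \<in> closure \<Omega> \<Longrightarrow> norm (G i x) \<le> CB"
  "x \<in> closure \<Omega> \<Longrightarrow> norm (H i x) \<le> CB"
  using someI_ex[OF bounds_ex] unfolding CB_def by blast+

lemma H_symmetric: "x \<in> \<Omega> \<Longrightarrow> transpose (H i x) = H i x"
  using jet_symmetric[OF jet_u] .

lemma H1E:
  obtains \<alpha> \<beta> \<gamma> where "0 < \<alpha>" "\<alpha> \<le> \<beta>" "0 \<le> \<gamma>" "F i 0 0 = 0"
    "\<And>p q X Y. transpose X = X \<Longrightarrow> transpose Y = Y \<Longrightarrow>
      pucci_minus \<alpha> \<beta> (X - Y) - \<gamma> * norm (p - q) \<le> F i p X - F i q Y"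
  using H1[of i] unfolding H1_def sym_matrices_def by auto

text \<open>The conditions on \<open>f\<close> condense to one one-sided Lipschitz bound. Raising
  the components other than \<open>i\<close> costs nothing by \<open>H5\<close>; raising component
  \<open>i\<close> costs nothing in the monotone part of \<open>H4\<close> and a Lipschitz term in
  the other part; the gradient is changed by \<open>H2\<close>. As \<open>f\<close> may jump upwards
  in the unknowns, a two-sided bound cannot be expected.\<close>

lemma f_lower:
  "\<exists>K\<ge>0. \<forall>a b p q. (\<forall>j. 0 \<le> a $ j \<and> a $ j \<le> b $ j \<and> b $ j \<le> CB) \<longrightarrow> norm p \<le> CB \<longrightarrow> norm q \<le> CB \<longrightarrow>
     f i a p - K * ((b $ i - a $ i) + norm (q - p)) \<le> f i b q"
proof -
  \<comment> \<open>A radius that is large enough for the gradients and, by the bound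
    \<open>nrm\<close>, for the vectors of component values.\<close>
  define \<sigma> where "\<sigma> = real CARD('n) * CB + CB"
  have \<sigma>: "\<sigma> > 0" "CB \<le> \<sigma>" using CB(1) by (auto simp: \<sigma>_def add_nonneg_pos)
  obtain \<mu> where \<mu>: "\<mu> \<ge> 0" "\<And>p q v. p \<in> cball 0 \<sigma> \<Longrightarrow> q \<in> cball 0 \<sigma> \<Longrightarrow> v \<in> cball 0 \<sigma> \<Longrightarrow> \<bar>f i v p - f i v q\<bar> \<le> \<mu> * norm (p - q)"
    using H2[of i, unfolded H2_def, THEN spec, THEN mp, OF \<sigma>(1)] by auto
  obtain f1 f2 where f12: "\<And>v p. f i v p = f1 v p + f2 v p" "unif_loc_lipschitz_in i f1" "nondecreasing_in i f2"
    using H4[of i] unfolding H4_def by blast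
  obtain L where L: "L \<ge> 0" "\<And>p v w. p \<in> cball 0 \<sigma> \<Longrightarrow> v \<in> cball 0 \<sigma> \<Longrightarrow> w \<in> cball 0 \<sigma> \<Longrightarrow> agree_except i v w \<Longrightarrow>
      \<bar>f1 v p - f1 w p\<bar> \<le> L * \<bar>v $ i - w $ i\<bar>"
    using f12(2) bounded_cball unfolding unif_loc_lipschitz_in_def by metis
  have nrm: "norm a \<le> \<sigma>" if "\<And>j. 0 \<le> a $ j \<and> a $ j \<le> CB" for a :: "real^'n"
  proof -
    have "norm a \<le> (\<Sum>j\<in>UNIV. \<bar>a $ j\<bar>)" by (rule norm_le_l1_cart)
    also have "\<dots> \<le> (\<Sum>j\<in>(UNIV::'n set). CB)" using that by (intro sum_mono) auto
    finally show ?thesis using CB(1) by (simp add: \<sigma>_def)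
  qed
  show ?thesis
  proof (intro exI[of _ "L + \<mu>"] conjI allI impI)
    show "0 \<le> L + \<mu>" using L \<mu> by simp
    fix a b :: "real^'n" and p q :: "real^'N"
    assume ab: "\<forall>j. 0 \<le> a $ j \<and> a $ j \<le> b $ j \<and> b $ j \<le> CB" and pq: "norm p \<le> CB" "norm q \<le> CB"
    define a' where "a' = (\<chi> j. if j = i then b $ i else a $ j)"
    have na: "a \<in> cball 0 \<sigma>" "a' \<in> cball 0 \<sigma>"
    proof -
      have "0 \<le> a $ j \<and> a $ j \<le> CB" "0 \<le> a' $ j \<and> a' $ j \<le> CB" for j
        using ab[rule_format, of j] ab[rule_format, of i] by (auto simp: a'_def)
      then show "a \<in> cball 0 \<sigma>" "a' \<in> cball 0 \<sigma>" using nrm by auto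
    qed
    have np: "p \<in> cball 0 \<sigma>" "q \<in> cball 0 \<sigma>" using pq \<sigma> by auto
    have ae: "agree_except i a a'" by (auto simp: agree_except_def a'_def)
    have "f i a' q \<le> f i b q"
      by (rule nondecreasing_chain[of i]) (use H5[of i] ab in \<open>auto simp: H5_def a'_def\<close>)
    moreover have "f2 a q \<le> f2 a' q"
      using f12(3) ae ab unfolding nondecreasing_in_def by (auto simp: a'_def)
    moreover have "\<bar>f1 a q - f1 a' q\<bar> \<le> L * (b $ i - a $ i)"
      using L(2)[OF np(2) na ae] ab by (simp add: a'_def)
    moreover have "\<bar>f i a q - f i a p\<bar> \<le> \<mu> * norm (q - p)" by (rule \<mu>(2)[OF np(2,1) na(1)])
    moreover have "(L + \<mu>) * ((b $ i - a $ i) + norm (q - p)) = L * (b $ i - a $ i) + \<mu> * norm (q - p)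
        + (L * norm (q - p) + \<mu> * (b $ i - a $ i))" by (simp add: algebra_simps)
    moreover have "0 \<le> L * norm (q - p) + \<mu> * (b $ i - a $ i)" using L \<mu> ab by simp
    ultimately show "f i a p - (L + \<mu>) * ((b $ i - a $ i) + norm (q - p)) \<le> f i b q"
      using f12(1)[of a q] f12(1)[of a' q] by linarith
  qed
qed

section \<open>Mean value estimates\<close>

text \<open>The assumption concerns the open segment, so the endpoints may be boundary points, where
  \<open>u\<close>, \<open>G\<close> and \<open>H\<close> are the continuous extensions. Most
  expansions below start at the boundary.\<close>

lemma mean_value_u:
  assumes ab: "a \<in> closure \<Omega>" "b \<in> closure \<Omega>" and seg: "\<And>t. 0 < t \<Longrightarrow> t < 1 \<Longrightarrow> a + t *\<^sub>R (b - a) \<in> \<Omega>"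
  shows "\<exists>t. 0 < t \<and> t < 1 \<and> u i b - u i a = G i (a + t *\<^sub>R (b - a)) \<bullet> (b - a)"
proof -
  let ?l = "\<lambda>t::real. a + t *\<^sub>R (b - a)"
  have lc: "?l t \<in> closure \<Omega>" if "t \<in> {0..1}" for t
    using ab seg[of t] dom_closure that by (cases "t = 0 \<or> t = 1") auto
  have "continuous_on {0..1} (\<lambda>t. u i (?l t))"
    by (rule continuous_on_compose2[OF cont_u]) (use lc in \<open>auto intro!: continuous_intros\<close>)
  moreover have "((\<lambda>t. u i (?l t)) has_derivative (\<lambda>h. h * (G i (?l t) \<bullet> (b - a)))) (at t)" if "0 < t" "t < 1" for t
  proof -
    have "(?l has_derivative (\<lambda>h. h *\<^sub>R (b - a))) (at t)" by (auto intro!: derivative_eq_intros)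
    from diff_chain_at[OF this jetD(2)[OF jet_u seg[OF that]]] show ?thesis by (simp add: o_def)
  qed
  ultimately obtain t where "0 < t" "t < 1" "u i (?l 1) - u i (?l 0) = (1 - 0) * (G i (?l t) \<bullet> (b - a))"
    by (rule mvt[of 0 1, rotated]) auto
  then show ?thesis by auto
qed

lemma mean_value_G:
  assumes ab: "a \<in> closure \<Omega>" "b \<in> closure \<Omega>" and seg: "\<And>t. 0 < t \<Longrightarrow> t < 1 \<Longrightarrow> a + t *\<^sub>R (b - a) \<in> \<Omega>"
  shows "\<exists>t. 0 < t \<and> t < 1 \<and> k \<bullet> (G i b - G i a) = k \<bullet> (H i (a + t *\<^sub>R (b - a)) *v (b - a))"
proof -
  let ?l = "\<lambda>t::real. a + t *\<^sub>R (b - a)"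
  have lc: "?l t \<in> closure \<Omega>" if "t \<in> {0..1}" for t
    using ab seg[of t] dom_closure that by (cases "t = 0 \<or> t = 1") auto
  have "continuous_on {0..1} (\<lambda>t. k \<bullet> G i (?l t))"
    by (intro continuous_intros continuous_on_compose2[OF cont_G]) (use lc in \<open>auto intro!: continuous_intros\<close>)
  moreover have "((\<lambda>t. k \<bullet> G i (?l t)) has_derivative (\<lambda>h. k \<bullet> (H i (?l t) *v (h *\<^sub>R (b - a))))) (at t)" if "0 < t" "t < 1" for t
  proof -
    have "(?l has_derivative (\<lambda>h. h *\<^sub>R (b - a))) (at t)" by (auto intro!: derivative_eq_intros)
    from diff_chain_at[OF this jetD(3)[OF jet_u seg[OF that]]] show ?thesis
      unfolding o_def by (rule has_derivative_inner_right)
  qed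
  ultimately obtain t where "0 < t" "t < 1" "k \<bullet> G i (?l 1) - k \<bullet> G i (?l 0) = k \<bullet> (H i (?l t) *v ((1 - 0) *\<^sub>R (b - a)))"
    by (rule mvt[of 0 1, rotated]) auto
  then show ?thesis by (auto simp: inner_diff_right)
qed

lemma G_lipschitz:
  assumes ab: "a \<in> closure \<Omega>" "b \<in> closure \<Omega>" and seg: "\<And>t. 0 < t \<Longrightarrow> t < 1 \<Longrightarrow> a + t *\<^sub>R (b - a) \<in> \<Omega>"
  shows "norm (G i b - G i a) \<le> CB * norm (b - a)"
proof -
  let ?k = "G i b - G i a"
  obtain t where t: "0 < t" "t < 1" "?k \<bullet> ?k = ?k \<bullet> (H i (a + t *\<^sub>R (b - a)) *v (b - a))"
    using mean_value_G[OF ab seg, where k = ?k] by blast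
  have "?k \<bullet> ?k \<le> norm ?k * norm (H i (a + t *\<^sub>R (b - a)) *v (b - a))"
    unfolding t(3) by (rule norm_cauchy_schwarz)
  also have "\<dots> \<le> norm ?k * (CB * norm (b - a))"
  proof (intro mult_left_mono)
    have "norm (H i (a + t *\<^sub>R (b - a)) *v (b - a)) \<le> norm (H i (a + t *\<^sub>R (b - a))) * norm (b - a)"
      by (rule norm_matrix_vector)
    also have "\<dots> \<le> CB * norm (b - a)" using CB(4) dom_closure seg[OF t(1,2)] by (intro mult_right_mono) auto
    finally show "norm (H i (a + t *\<^sub>R (b - a)) *v (b - a)) \<le> CB * norm (b - a)" .
  qed simp
  finally have "norm ?k * norm ?k \<le> norm ?k * (CB * norm (b - a))" by (simp add: dot_square_norm power2_eq_square)
  then show ?thesis using CB(1) by (cases "norm ?k = 0") (simp_all add: mult_le_cancel_left)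
qed

lemma u_taylor:
  assumes ab: "a \<in> closure \<Omega>" "b \<in> closure \<Omega>" and seg: "\<And>t. 0 < t \<Longrightarrow> t < 1 \<Longrightarrow> a + t *\<^sub>R (b - a) \<in> \<Omega>"
  shows "\<bar>u i b - u i a - G i a \<bullet> (b - a)\<bar> \<le> CB * (norm (b - a))\<^sup>2"
proof -
  obtain t where t: "0 < t" "t < 1" "u i b - u i a = G i (a + t *\<^sub>R (b - a)) \<bullet> (b - a)"
    using mean_value_u[OF ab seg] by blast
  let ?x = "a + t *\<^sub>R (b - a)"
  have "norm (G i ?x - G i a) \<le> CB * norm (?x - a)"
  proof (rule G_lipschitz[OF ab(1) dom_closure[OF seg[OF t(1,2)]]])
    fix s :: real assume s: "0 < s" "s < 1"
    have "a + s *\<^sub>R (?x - a) = a + (s * t) *\<^sub>R (b - a)" by simp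
    moreover have "s * t < 1" using s t mult_strict_mono[of s 1 t 1] by simp
    ultimately show "a + s *\<^sub>R (?x - a) \<in> \<Omega>" using seg[of "s * t"] s t by simp
  qed
  also have "\<dots> \<le> CB * norm (b - a)" using t CB(1) by (simp add: mult_left_le_one_le)
  finally have n: "norm (G i ?x - G i a) \<le> CB * norm (b - a)" .
  have "\<bar>u i b - u i a - G i a \<bullet> (b - a)\<bar> = \<bar>(G i ?x - G i a) \<bullet> (b - a)\<bar>" using t(3) by (simp add: inner_diff_left)
  also have "\<dots> \<le> norm (G i ?x - G i a) * norm (b - a)" by (rule Cauchy_Schwarz_ineq2)
  also have "\<dots> \<le> (CB * norm (b - a)) * norm (b - a)" using n by (intro mult_right_mono) auto
  finally show ?thesis by (simp add: power2_eq_square)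
qed

section \<open>Geometry of the boundary\<close>

lemma in_dir:
  assumes "y \<in> frontier \<Omega>" "0 < v \<bullet> nu y"
  shows "\<exists>t0>0. \<forall>t. 0 < t \<and> t < t0 \<longrightarrow> y + t *\<^sub>R v \<in> \<Omega>"
proof -
  obtain \<rho> where \<rho>: "\<rho> > 0" "ball (y + \<rho> *\<^sub>R nu y) \<rho> \<subseteq> \<Omega>" using touching_balls[OF assms(1)] by blast
  then show ?thesis using ball_ray[OF norm_nu[OF assms(1)] \<rho>(1) assms(2), of y] by blast
qed

lemma out_dir:
  assumes "y \<in> frontier \<Omega>" "v \<bullet> nu y < 0"
  shows "\<exists>t0>0. \<forall>t. 0 < t \<and> t < t0 \<longrightarrow> y + t *\<^sub>R v \<notin> \<Omega>"
proof -
  obtain \<rho> where \<rho>: "\<rho> > 0" "ball (y - \<rho> *\<^sub>R nu y) \<rho> \<inter> \<Omega> = {}" using touching_balls[OF assms(1)] by blast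
  have "\<exists>t0>0. \<forall>t. 0 < t \<and> t < t0 \<longrightarrow> y + t *\<^sub>R v \<in> ball (y + \<rho> *\<^sub>R (- nu y)) \<rho>"
    using assms norm_nu by (intro ball_ray \<rho>) auto
  then show ?thesis using \<rho>(2) by (metis IntI diff_conv_add_uminus empty_iff scaleR_minus_right)
qed

text \<open>The radius at the nearest boundary point must be the normal: otherwise the direction
  \<open>n - nu b\<close> would lead from \<open>b\<close> into the ball around \<open>z\<close>,
  which lies in the domain, and at the same time out of the domain.\<close>

lemma nearest_boundary_point:
  assumes z: "z \<in> \<Omega>"
  obtains b d where "b \<in> frontier \<Omega>" "0 < d" "z = b + d *\<^sub>R nu b" "ball z d \<subseteq> \<Omega>" "\<And>b'. b' \<notin> \<Omega> \<Longrightarrow> d \<le> norm (z - b')"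
proof -
  have "\<Omega> \<noteq> UNIV" using bounded_dom not_bounded_UNIV by blast
  moreover have "closed (- \<Omega>)" using open_dom by (rule closed_Compl)
  ultimately obtain b where b: "b \<in> - \<Omega>" "\<And>b'. b' \<in> - \<Omega> \<Longrightarrow> dist z b \<le> dist z b'"
    using distance_attains_inf[of "- \<Omega>" z] by blast
  define d where "d = dist z b"
  have d: "d > 0" using b z by (auto simp: d_def)
  have bs: "ball z d \<subseteq> \<Omega>" using b(2) by (fastforce simp: d_def)
  have "b \<in> closure (ball z d)" using d by (simp add: d_def)
  then have "b \<in> closure \<Omega>" using closure_mono[OF bs] by blast
  then have bf: "b \<in> frontier \<Omega>" using b by (simp add: frontier_eq)
  define n where "n = (1/d) *\<^sub>R (z - b)"
  have n: "norm n = 1" using d by (simp add: n_def d_def dist_norm)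
  have zn: "z = b + d *\<^sub>R n" using d by (simp add: n_def)
  have "n = nu b"
  proof (rule ccontr)
    assume ne: "n \<noteq> nu b"
    have "0 < (n - nu b) \<bullet> (n - nu b)" using ne by simp
    moreover have "n \<bullet> n = 1" "nu b \<bullet> nu b = 1" using n norm_nu[OF bf] by (simp_all add: dot_square_norm)
    ultimately have lt: "n \<bullet> nu b < 1"
      by (simp add: inner_diff_left inner_diff_right inner_commute[of "nu b" n])
    have 1: "0 < (n - nu b) \<bullet> n" using lt \<open>n \<bullet> n = 1\<close> by (simp add: inner_diff_left inner_commute[of "nu b" n])
    have 2: "(n - nu b) \<bullet> nu b < 0" using lt norm_nu[OF bf] by (simp add: inner_diff_left dot_square_norm)
    obtain t1 where t1: "t1 > 0" "\<And>t. 0 < t \<Longrightarrow> t < t1 \<Longrightarrow> b + t *\<^sub>R (n - nu b) \<in> ball z d"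
      using ball_ray[OF n d 1, of b] zn by auto
    obtain t2 where t2: "t2 > 0" "\<And>t. 0 < t \<Longrightarrow> t < t2 \<Longrightarrow> b + t *\<^sub>R (n - nu b) \<notin> \<Omega>"
      using out_dir[OF bf 2] by auto
    define t where "t = min t1 t2 / 2"
    have "0 < t" "t < t1" "t < t2" using t1 t2 by (auto simp: t_def)
    then show False using t1(2) t2(2) bs by blast
  qed
  then have "z = b + d *\<^sub>R nu b" using zn by (simp only:)
  moreover have "d \<le> norm (z - b')" if "b' \<notin> \<Omega>" for b'
    using b(2)[of b'] that by (auto simp only: d_def dist_norm Compl_iff)
  ultimately show ?thesis by (rule that[OF bf d _ bs])
qed

lemma nearest_segment:
  assumes "b \<in> frontier \<Omega>" "0 < d" "z = b + d *\<^sub>R nu b" "ball z d \<subseteq> \<Omega>" "0 < t" "t < 1"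
  shows "b + t *\<^sub>R (z - b) \<in> \<Omega>"
proof -
  have "z - (b + t *\<^sub>R (z - b)) = ((1 - t) * d) *\<^sub>R nu b" using assms(3) by (simp add: algebra_simps)
  then have "dist z (b + t *\<^sub>R (z - b)) = (1 - t) * d" using norm_nu[OF assms(1)] assms by (simp add: dist_norm)
  also have "\<dots> < d" using assms by simp
  finally show ?thesis using assms(4) by auto
qed

text \<open>The segment from \<open>z\<close> to an arbitrary exterior point \<open>b'\<close> may
  leave the domain. The estimates are made along the segment to the nearest boundary point, which is
  at most as long and ends where the gradient has length \<open>\<bar>c i\<bar>\<close>.\<close>

lemma G_near_boundary:
  assumes z: "z \<in> \<Omega>" and b': "b' \<notin> \<Omega>"
  shows "norm (G i z) \<le> \<bar>c i\<bar> + CB * norm (z - b')" "c i = 0 \<Longrightarrow> u i z \<le> CB * (norm (z - b'))\<^sup>2"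
proof -
  obtain b d where b: "b \<in> frontier \<Omega>" "0 < d" "z = b + d *\<^sub>R nu b" "ball z d \<subseteq> \<Omega>" "\<And>b'. b' \<notin> \<Omega> \<Longrightarrow> d \<le> norm (z - b')"
    using nearest_boundary_point[OF z] by blast
  have bc: "b \<in> closure \<Omega>" "z \<in> closure \<Omega>" using b(1) z by (auto simp: frontier_eq dom_closure)
  have zb: "norm (z - b) = d" using b norm_nu by simp
  have dd: "d \<le> norm (z - b')" by (rule b(5)[OF b'])
  have "norm (G i z - G i b) \<le> CB * norm (z - b)"
    by (rule G_lipschitz[OF bc nearest_segment[OF b(1-4)]])
  also have "\<dots> \<le> CB * norm (z - b')" using dd zb CB(1) by simp
  finally have "norm (G i z - G i b) \<le> CB * norm (z - b')" .
  moreover have "norm (G i b) = \<bar>c i\<bar>" using G_boundary[OF b(1)] norm_nu[OF b(1)] by simp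
  moreover have "norm (G i z) \<le> norm (G i b) + norm (G i z - G i b)" by (metis add.commute diff_add_cancel norm_triangle_ineq)
  ultimately show "norm (G i z) \<le> \<bar>c i\<bar> + CB * norm (z - b')" by linarith
  assume "c i = 0"
  then have "\<bar>u i z\<bar> \<le> CB * d\<^sup>2"
    using u_taylor[OF bc nearest_segment[OF b(1-4)], where i=i] zb u_zero[OF b(1)] G_boundary[OF b(1)] by simp
  also have "\<dots> \<le> CB * (norm (z - b'))\<^sup>2" using dd b(2) CB(1) by (intro mult_left_mono power_mono) auto
  finally show "u i z \<le> CB * (norm (z - b'))\<^sup>2" by simp
qed

text \<open>Near the boundary \<open>u i\<close> is at least \<open>c i / 2\<close> times the
  distance, so the error of the gradient, linear in the distance, is paid by \<open>u i\<close>
  itself. The bound controls the slope of the reflected function in the corner with positive Neumann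
  data.\<close>

lemma G_le_u:
  assumes ci: "0 < c i"
  shows "\<exists>C\<ge>0. \<exists>r>0. \<forall>z\<in>\<Omega>. \<forall>b'. b' \<notin> \<Omega> \<longrightarrow> norm (z - b') < r \<longrightarrow> norm (G i z) \<le> c i + C * u i z"
proof -
  have "norm (G i z) \<le> c i + 2 * CB / c i * u i z"
    if z: "z \<in> \<Omega>" and b': "b' \<notin> \<Omega>" "norm (z - b') < c i / (2 * CB)" for z b'
  proof -
  obtain b d where b: "b \<in> frontier \<Omega>" "0 < d" "z = b + d *\<^sub>R nu b" "ball z d \<subseteq> \<Omega>" "\<And>b'. b' \<notin> \<Omega> \<Longrightarrow> d \<le> norm (z - b')"
    using nearest_boundary_point[OF z] by blast
  have bc: "b \<in> closure \<Omega>" "z \<in> closure \<Omega>" "b \<notin> \<Omega>" using b(1) z by (auto simp: frontier_eq dom_closure)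
  have zb: "norm (z - b) = d" using b norm_nu by simp
  have dd: "d < c i / (2 * CB)" using b(5)[OF b'(1)] b'(2) by simp
  have "\<bar>u i z - u i b - G i b \<bullet> (z - b)\<bar> \<le> CB * d\<^sup>2"
    using u_taylor[OF bc(1,2) nearest_segment[OF b(1-4)], where i=i] zb by simp
  moreover have "G i b \<bullet> (z - b) = c i * d"
    using G_boundary[OF b(1)] norm_nu[OF b(1)] b(3) by (simp add: dot_square_norm)
  ultimately have "c i * d - CB * d\<^sup>2 \<le> u i z" using u_zero[OF b(1)] by (simp add: abs_le_iff)
  moreover have "CB * d\<^sup>2 \<le> c i * d / 2"
  proof -
    have "CB * d \<le> c i / 2" using dd CB(1) by (simp add: field_simps)
    then have "CB * d * d \<le> c i / 2 * d" using b(2) by (intro mult_right_mono) auto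
    then show ?thesis by (simp add: power2_eq_square)
  qed
  ultimately have "c i * d / 2 \<le> u i z" by linarith
  then have "CB * d \<le> 2 * CB / c i * u i z" using ci CB(1) by (simp add: field_simps)
  moreover have "norm (G i z) \<le> \<bar>c i\<bar> + CB * norm (z - b)" by (rule G_near_boundary(1)[OF z bc(3)])
  ultimately show ?thesis using zb ci by simp
  qed
  moreover have "0 \<le> 2 * CB / c i" "0 < c i / (2 * CB)" using CB(1) ci by auto
  ultimately show ?thesis by blast
qed

lemma c_nonneg: "0 \<le> c i"
proof -
  obtain z where "z \<in> \<Omega>" using nonempty_dom by blast
  then obtain y where y: "y \<in> frontier \<Omega>" using nearest_boundary_point by metis
  show ?thesis
  proof (rule ccontr)
    assume neg: "\<not> 0 \<le> c i"
    have nn: "nu y \<bullet> nu y = 1" using norm_nu[OF y] by (simp add: dot_square_norm)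
    obtain t0 where t0: "t0 > 0" "\<And>t. 0 < t \<Longrightarrow> t < t0 \<Longrightarrow> y + t *\<^sub>R nu y \<in> \<Omega>" using in_dir[OF y, of "nu y"] nn by auto
    define t where "t = min (t0 / 2) (- c i / (2 * CB))"
    have t: "0 < t" "t < t0" "CB * t \<le> - c i / 2" using t0(1) neg CB(1) by (auto simp: t_def min_def field_simps)
    let ?z = "y + t *\<^sub>R nu y"
    have zD: "?z \<in> \<Omega>" using t0 t by blast
    have yc: "y \<in> closure \<Omega>" using y by (simp add: frontier_eq)
    have sg: "y + s *\<^sub>R (?z - y) \<in> \<Omega>" if "0 < s" "s < 1" for s
    proof -
      have "s * t < t0" using that t mult_strict_mono[of s 1 t t0] by simp
      then show ?thesis using t0(2)[of "s * t"] that t by simp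
    qed
    have "\<bar>u i ?z - u i y - G i y \<bullet> (?z - y)\<bar> \<le> CB * t\<^sup>2"
      using u_taylor[OF yc dom_closure[OF zD] sg, where i=i] norm_nu[OF y] t by simp
    moreover have "G i y \<bullet> (?z - y) = c i * t" using G_boundary[OF y] nn by simp
    ultimately have "u i ?z \<le> c i * t + CB * t\<^sup>2" using u_zero[OF y, of i] unfolding abs_le_iff by linarith
    also have "\<dots> = t * (c i + CB * t)" by (simp add: power2_eq_square algebra_simps)
    also have "\<dots> \<le> 0" using t neg by (intro mult_nonneg_nonpos) auto
    finally show False using u_pos[OF zD, of i] by simp
  qed
qed

end

context overdetermined
begin

section \<open>Reflected solutions\<close>

text \<open>The extension by zero gives a meaning to the comparison with a reflected point outside
  the domain, and its continuity lets the comparison pass to limits.\<close>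

definition ut :: "'n \<Rightarrow> real^'N \<Rightarrow> real" where
  "ut i x = (if x \<in> \<Omega> then u i x else 0)"

text \<open>Since \<open>ut\<close> vanishes outside the domain, this includes that the cap
  is reflected into the domain.\<close>

definition dominated :: "real^'N \<Rightarrow> real \<Rightarrow> bool" where
  "dominated e l \<longleftrightarrow> (\<forall>i x. l \<le> x \<bullet> e \<longrightarrow> ut i x \<le> ut i (mirror e l x))"

definition cap :: "real^'N \<Rightarrow> real \<Rightarrow> (real^'N) set" where
  "cap e l = {x \<in> \<Omega>. l < x \<bullet> e}"

definition wdiff :: "'n \<Rightarrow> real^'N \<Rightarrow> real \<Rightarrow> real^'N \<Rightarrow> real" where
  "wdiff i e l x = u i (mirror e l x) - u i x"

definition rG :: "'n \<Rightarrow> real^'N \<Rightarrow> real \<Rightarrow> real^'N \<Rightarrow> real^'N" where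
  "rG i e l x = mirror_mat e *v G i (mirror e l x)"

definition rH :: "'n \<Rightarrow> real^'N \<Rightarrow> real \<Rightarrow> real^'N \<Rightarrow> real^'N^'N" where
  "rH i e l x = mirror_mat e ** H i (mirror e l x) ** mirror_mat e"

lemma ut_in: "x \<in> \<Omega> \<Longrightarrow> ut i x = u i x"
  by (simp add: ut_def)

lemma ut_pos_iff: "0 < ut i x \<longleftrightarrow> x \<in> \<Omega>"
  using u_pos by (simp add: ut_def)

lemma ut_nonneg: "0 \<le> ut i x"
  using u_pos[of x i] by (simp add: ut_def less_imp_le)

lemma ut_out: "x \<notin> \<Omega> \<Longrightarrow> ut i x = 0"
  by (simp add: ut_def)

lemma continuous_ut: "continuous_on S (ut i)"
proof -
  have "closure \<Omega> \<union> - \<Omega> = UNIV" using closure_subset by blast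
  moreover have "continuous_on (closure \<Omega> \<union> - \<Omega>) (ut i)"
  proof (rule continuous_on_closed_Un)
    show "closed (- \<Omega>)" using open_dom by (rule closed_Compl)
    have "continuous_on (closure \<Omega>) (u i) = continuous_on (closure \<Omega>) (ut i)"
      using u_zero by (intro continuous_on_cong) (auto simp: ut_def frontier_eq)
    then show "continuous_on (closure \<Omega>) (ut i)" using cont_u by simp
    show "continuous_on (- \<Omega>) (ut i)"
      by (rule continuous_on_eq[where f = "\<lambda>_. 0"]) (auto simp: ut_def)
  qed simp
  ultimately show ?thesis using continuous_on_subset by (metis subset_UNIV)
qed

lemma isCont_ut: "isCont (ut i) x"
  using continuous_ut[of UNIV i] by (simp add: continuous_on_eq_continuous_at)

lemma open_cap: "open (cap e l)"
proof -
  have "cap e l = \<Omega> \<inter> {x. l < x \<bullet> e}" by (auto simp: cap_def)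
  moreover have "open {x::real^'N. l < x \<bullet> e}" by (intro open_Collect_less continuous_intros)
  ultimately show ?thesis using open_dom by auto
qed

lemma cap_subset: "cap e l \<subseteq> \<Omega>"
  by (auto simp: cap_def)

lemma dominated_mirror_in:
  assumes "dominated e l" "x \<in> \<Omega>" "l \<le> x \<bullet> e"
  shows "mirror e l x \<in> \<Omega>"
proof -
  obtain i :: 'n where True by simp
  have "0 < ut i x" "ut i x \<le> ut i (mirror e l x)"
    using assms by (auto simp: ut_pos_iff dominated_def)
  then have "0 < ut i (mirror e l x)" by linarith
  then show ?thesis by (simp add: ut_pos_iff)
qed

lemma cap_mirror_in: "dominated e l \<Longrightarrow> x \<in> cap e l \<Longrightarrow> mirror e l x \<in> \<Omega>"
  using dominated_mirror_in by (auto simp: cap_def)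

lemma cap_le:
  assumes "dominated e l" "x \<in> cap e l"
  shows "u i x \<le> u i (mirror e l x)"
proof -
  have "ut i x \<le> ut i (mirror e l x)" using assms by (auto simp: dominated_def cap_def)
  then show ?thesis using cap_mirror_in[OF assms] assms(2) by (simp add: ut_in cap_def)
qed

lemma jet_reflected:
  assumes "norm e = 1" "dominated e l"
  shows "jet (\<lambda>x. u i (mirror e l x)) (rG i e l) (rH i e l) (cap e l)"
  using jet_subset[OF jet_mirror[OF assms(1) jet_u, of i l] _ open_cap, of e l] cap_mirror_in[OF assms(2)]
  unfolding rG_def rH_def by auto

lemma jet_wdiff:
  assumes "norm e = 1" "dominated e l"
  shows "jet (wdiff i e l) (\<lambda>x. rG i e l x - G i x) (\<lambda>x. rH i e l x - H i x) (cap e l)"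
  using jet_diff[OF jet_reflected[OF assms] jet_subset[OF jet_u cap_subset open_cap]]
  unfolding wdiff_def .

lemma H0_rule:
  assumes "orthogonal_matrix Q" "transpose X = X"
  shows "F i (Q *v p) (transpose Q ** X ** Q) + f i v (Q *v p) = F i p X + f i v p"
  using H0[of i] assms unfolding H0_def sym_matrices_def by blast

lemma reflected_pde:
  assumes "norm e = 1" "mirror e l x \<in> \<Omega>"
  shows "F i (rG i e l x) (rH i e l x) + f i (\<chi> j. u j (mirror e l x)) (rG i e l x) = 0"
  using H0_rule[OF orthogonal_mirror_mat[OF assms(1)] H_symmetric[OF assms(2), of i], of i "G i (mirror e l x)"
      "\<chi> j. u j (mirror e l x)"] pde[OF assms(2), of i]
  by (simp add: rG_def rH_def transpose_mirror_mat)

lemma norm_rG: "norm e = 1 \<Longrightarrow> norm (rG i e l x) = norm (G i (mirror e l x))"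
  by (simp add: rG_def norm_mirror_mat)

text \<open>The two equations turn the difference of \<open>F\<close> into one of \<open>f\<close>,
  taken at componentwise ordered arguments because the position is dominated; so
  \<open>f_lower\<close> applies, with a constant independent of the plane.\<close>

lemma reflected_difference:
  "\<exists>K\<ge>0. \<forall>e l x. norm e = 1 \<longrightarrow> dominated e l \<longrightarrow> x \<in> cap e l \<longrightarrow>
     F i (rG i e l x) (rH i e l x) - F i (G i x) (H i x) \<le> K * (wdiff i e l x + norm (rG i e l x - G i x))"
proof -
  obtain K where K: "K \<ge> 0" "\<And>a b p q. (\<forall>j. 0 \<le> a $ j \<and> a $ j \<le> b $ j \<and> b $ j \<le> CB) \<Longrightarrow> norm p \<le> CB \<Longrightarrow> norm q \<le> CB \<Longrightarrow>
     f i a p - K * ((b $ i - a $ i) + norm (q - p)) \<le> f i b q" using f_lower[of i] by blast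
  show ?thesis
  proof (intro exI[of _ K] conjI allI impI K(1))
    fix e :: "real^'N" and l x assume e: "norm e = 1" and d: "dominated e l" and x: "x \<in> cap e l"
    have xD: "x \<in> \<Omega>" "mirror e l x \<in> \<Omega>" using x cap_mirror_in[OF d x] by (auto simp: cap_def)
    have "f i (\<chi> j. u j x) (G i x) - K * (((\<chi> j. u j (mirror e l x)) $ i - (\<chi> j. u j x) $ i) + norm (rG i e l x - G i x))
      \<le> f i (\<chi> j. u j (mirror e l x)) (rG i e l x)"
    proof (rule K(2))
      show "\<forall>j. 0 \<le> (\<chi> j. u j x) $ j \<and> (\<chi> j. u j x) $ j \<le> (\<chi> j. u j (mirror e l x)) $ j \<and> (\<chi> j. u j (mirror e l x)) $ j \<le> CB"
        using u_pos[OF xD(1)] cap_le[OF d x] CB(2)[OF dom_closure[OF xD(2)]] by (auto simp: less_imp_le abs_le_iff)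
      show "norm (G i x) \<le> CB" "norm (rG i e l x) \<le> CB"
        using CB(3) dom_closure xD norm_rG[OF e] by auto
    qed
    then show "F i (rG i e l x) (rH i e l x) - F i (G i x) (H i x) \<le> K * (wdiff i e l x + norm (rG i e l x - G i x))"
      using pde[OF xD(1), of i] reflected_pde[OF e xD(2), of i] by (simp add: wdiff_def)
  qed
qed

lemma transpose_rH: "mirror e l x \<in> \<Omega> \<Longrightarrow> transpose (rH i e l x) = rH i e l x"
  by (simp add: rH_def matrix_transpose_mul H_symmetric transpose_mirror_mat matrix_mul_assoc)

lemma wdiff_supersol:
  "\<exists>\<alpha> \<beta> K. \<forall>e l. norm e = 1 \<longrightarrow> dominated e l \<longrightarrow>
     supersol \<alpha> \<beta> K (wdiff i e l) (\<lambda>x. rG i e l x - G i x) (\<lambda>x. rH i e l x - H i x) (cap e l)"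
proof -
  obtain \<alpha> \<beta> \<gamma> where h: "0 < \<alpha>" "\<alpha> \<le> \<beta>" "0 \<le> \<gamma>"
    "\<And>p q X Y. transpose X = X \<Longrightarrow> transpose Y = Y \<Longrightarrow>
      pucci_minus \<alpha> \<beta> (X - Y) - \<gamma> * norm (p - q) \<le> F i p X - F i q Y" using H1E[of i] by metis
  obtain K where K: "K \<ge> 0" "\<And>e l x. norm e = 1 \<Longrightarrow> dominated e l \<Longrightarrow> x \<in> cap e l \<Longrightarrow>
     F i (rG i e l x) (rH i e l x) - F i (G i x) (H i x) \<le> K * (wdiff i e l x + norm (rG i e l x - G i x))"
    using reflected_difference[of i] by blast
  have "supersol \<alpha> \<beta> (K + \<gamma>) (wdiff i e l) (\<lambda>x. rG i e l x - G i x) (\<lambda>x. rH i e l x - H i x) (cap e l)"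
    if e: "norm e = 1" and d: "dominated e l" for e l
    unfolding supersol_def
  proof (intro conjI ballI jet_wdiff[OF e d])
    fix x assume x: "x \<in> cap e l"
    have xD: "x \<in> \<Omega>" "mirror e l x \<in> \<Omega>" using x cap_mirror_in[OF d x] by (auto simp: cap_def)
    show w0: "0 \<le> wdiff i e l x" using cap_le[OF d x] by (simp add: wdiff_def)
    have "pucci_minus \<alpha> \<beta> (rH i e l x - H i x) - \<gamma> * norm (rG i e l x - G i x)
      \<le> F i (rG i e l x) (rH i e l x) - F i (G i x) (H i x)"
      by (rule h(4)[OF transpose_rH[OF xD(2)] H_symmetric[OF xD(1)]])
    also note K(2)[OF e d x]
    finally have "pucci_minus \<alpha> \<beta> (rH i e l x - H i x) \<le> K * (wdiff i e l x + norm (rG i e l x - G i x)) + \<gamma> * norm (rG i e l x - G i x)"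
      by simp
    also have "\<dots> \<le> (K + \<gamma>) * (norm (rG i e l x - G i x) + wdiff i e l x)"
      using mult_nonneg_nonneg[OF h(3) w0] by (simp add: algebra_simps)
    finally show "pucci_minus \<alpha> \<beta> (rH i e l x - H i x) \<le> (K + \<gamma>) * (norm (rG i e l x - G i x) + wdiff i e l x)" .
  qed (use h K in auto)
  then show ?thesis by blast
qed

section \<open>Touching implies symmetry\<close>

text \<open>At a boundary point \<open>y\<close> of the cap whose reflection is again a boundary point,
  the Neumann condition contradicts the Hopf lemma.\<close>

lemma boundary_touching:
  assumes e: "norm e = 1" and d: "dominated e l" and y: "y \<in> frontier \<Omega>" "l < y \<bullet> e" and ry: "mirror e l y \<notin> \<Omega>"
  shows "\<exists>x\<in>cap e l. wdiff i e l x = 0"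
proof (rule ccontr)
  assume no: "\<not> (\<exists>x\<in>cap e l. wdiff i e l x = 0)"
  obtain \<alpha> \<beta> K where s: "supersol \<alpha> \<beta> K (wdiff i e l) (\<lambda>x. rG i e l x - G i x) (\<lambda>x. rH i e l x - H i x) (cap e l)"
    using wdiff_supersol[of i] e d by blast
  obtain \<rho>0 where \<rho>0: "\<rho>0 > 0" "ball (y + \<rho>0 *\<^sub>R nu y) \<rho>0 \<subseteq> \<Omega>" using touching_balls[OF y(1)] by blast
  have n1: "norm (nu y) = 1" by (rule norm_nu[OF y(1)])
  \<comment> \<open>Shrinks the touching ball so that it stays above the plane.\<close>
  define \<rho> where "\<rho> = min \<rho>0 ((y \<bullet> e - l) / 2)"
  have \<rho>: "0 < \<rho>" "\<rho> \<le> \<rho>0" "2 * \<rho> \<le> y \<bullet> e - l" using \<rho>0 y(2) by (auto simp: \<rho>_def min_def)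
  have B: "ball (y + \<rho> *\<^sub>R nu y) \<rho> \<subseteq> cap e l"
  proof
    fix x assume x: "x \<in> ball (y + \<rho> *\<^sub>R nu y) \<rho>"
    have "dist (y + \<rho>0 *\<^sub>R nu y) x \<le> dist (y + \<rho>0 *\<^sub>R nu y) (y + \<rho> *\<^sub>R nu y) + dist (y + \<rho> *\<^sub>R nu y) x"
      by (rule dist_triangle)
    also have "dist (y + \<rho>0 *\<^sub>R nu y) (y + \<rho> *\<^sub>R nu y) = \<rho>0 - \<rho>"
      using n1 \<rho> by (simp add: dist_norm flip: scaleR_diff_left)
    finally have "x \<in> \<Omega>" using x \<rho>0(2) by auto
    moreover have "l < x \<bullet> e"
    proof -
      have "norm (y - x) < 2 * \<rho>"
      proof -
        have "dist y x \<le> dist y (y + \<rho> *\<^sub>R nu y) + dist (y + \<rho> *\<^sub>R nu y) x" by (rule dist_triangle)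
        then show ?thesis using x n1 \<rho> by (simp add: dist_norm)
      qed
      moreover have "(y - x) \<bullet> e \<le> norm (y - x)" using norm_cauchy_schwarz[of "y - x" e] e by simp
      ultimately show ?thesis using \<rho>(3) by (simp add: inner_diff_left)
    qed
    ultimately show "x \<in> cap e l" by (simp add: cap_def)
  qed
  have "0 < wdiff i e l x" if "x \<in> ball (y + \<rho> *\<^sub>R nu y) \<rho>" for x
    using supersolD(6)[OF s, of x] no B that by force
  then obtain k where k: "k > 0" "\<And>t. 0 < t \<Longrightarrow> t < \<rho> \<Longrightarrow> y + t *\<^sub>R nu y \<in> cap e l \<and> k * t \<le> wdiff i e l (y + t *\<^sub>R nu y)"
    using hopf_normal[OF s B \<rho>(1) n1] by blast
  define t where "t = min (\<rho> / 2) (k / (4 * CB))"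
  have t: "0 < t" "t < \<rho>" "2 * CB * t < k" using \<rho> k CB(1) by (auto simp: t_def min_def field_simps)
  let ?z = "y + t *\<^sub>R nu y"
  have zc: "?z \<in> cap e l" and kw: "k * t \<le> wdiff i e l ?z" using k(2) t by auto
  have st: "0 < s * t" "s * t < \<rho>" if "0 < s" "s < 1" for s
    using that t mult_strict_mono[of s 1 t \<rho>] by auto
  have yc: "y \<in> closure \<Omega>" using y(1) by (simp add: frontier_eq)
  have rz: "mirror e l ?z - mirror e l y = t *\<^sub>R (mirror_mat e *v nu y)"
    using mirror_diff[OF e, of l ?z y] by (simp add: matrix_vector_mult_scaleR)
  have ryc: "mirror e l y \<in> frontier \<Omega>"
  proof -
    have "mirror e l y \<in> closure \<Omega>"
      unfolding closure_approachable
    proof (intro allI impI)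
      fix \<epsilon> :: real assume \<epsilon>: "\<epsilon> > 0"
      define s where "s = min (\<rho> / 2) (\<epsilon> / 2)"
      have s: "0 < s" "s < \<rho>" "s < \<epsilon>" using \<epsilon> \<rho> by (auto simp: s_def)
      have "y + s *\<^sub>R nu y \<in> cap e l" using k(2) s by auto
      then have "mirror e l (y + s *\<^sub>R nu y) \<in> \<Omega>" by (rule cap_mirror_in[OF d])
      moreover have "dist (mirror e l (y + s *\<^sub>R nu y)) (mirror e l y) < \<epsilon>"
        unfolding dist_mirror[OF e] using s n1 by (simp add: dist_norm)
      ultimately show "\<exists>x\<in>\<Omega>. dist x (mirror e l y) < \<epsilon>" by blast
    qed
    then show ?thesis using ry by (simp add: frontier_eq)
  qed
  have "\<bar>u i ?z - u i y - G i y \<bullet> (?z - y)\<bar> \<le> CB * (norm (?z - y))\<^sup>2"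
    by (rule u_taylor[OF yc dom_closure]) (use zc k(2) st in \<open>auto simp: cap_def\<close>)
  have "G i y \<bullet> (?z - y) = c i * t" using G_boundary[OF y(1)] n1 by (simp add: dot_square_norm)
  have 1: "c i * t - CB * t\<^sup>2 \<le> u i ?z"
  proof -
    have "norm (?z - y) = t" using t n1 by simp
    with \<open>\<bar>u i ?z - u i y - G i y \<bullet> (?z - y)\<bar> \<le> CB * (norm (?z - y))\<^sup>2\<close>
    have "\<bar>u i ?z - u i y - G i y \<bullet> (?z - y)\<bar> \<le> CB * t\<^sup>2" by metis
    then show ?thesis
      using \<open>G i y \<bullet> (?z - y) = c i * t\<close> u_zero[OF y(1), of i] unfolding abs_le_iff by linarith
  qed
  have "\<bar>u i (mirror e l ?z) - u i (mirror e l y) - G i (mirror e l y) \<bullet> (mirror e l ?z - mirror e l y)\<bar>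
     \<le> CB * (norm (mirror e l ?z - mirror e l y))\<^sup>2"
  proof (rule u_taylor)
    show "mirror e l y \<in> closure \<Omega>" using ryc by (simp add: frontier_eq)
    show "mirror e l ?z \<in> closure \<Omega>" by (rule dom_closure[OF cap_mirror_in[OF d zc]])
    fix s :: real assume s: "0 < s" "s < 1"
    have "mirror e l (y + (s * t) *\<^sub>R nu y) - mirror e l y = s *\<^sub>R (mirror e l ?z - mirror e l y)"
      unfolding rz mirror_diff[OF e] by (simp add: matrix_vector_mult_scaleR)
    then have "mirror e l y + s *\<^sub>R (mirror e l ?z - mirror e l y) = mirror e l (y + (s * t) *\<^sub>R nu y)"
      by (metis add.commute diff_add_cancel)
    then show "mirror e l y + s *\<^sub>R (mirror e l ?z - mirror e l y) \<in> \<Omega>"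
      using cap_mirror_in[OF d] k(2) st[OF s] by simp
  qed
  moreover have "norm (mirror e l ?z - mirror e l y) = t"
    unfolding rz using t n1 by (simp add: norm_mirror_mat[OF e])
  \<comment> \<open>Both boundary gradients have length \<open>c i \<ge> 0\<close>. Whatever the
    angle between the normals, the reflected function grows to first order no faster than
    \<open>u i\<close>, so the difference along the normal is at most quadratic in
    \<open>t\<close>.\<close>
  moreover have "G i (mirror e l y) \<bullet> (mirror e l ?z - mirror e l y) \<le> c i * t"
  proof -
    have "nu (mirror e l y) \<bullet> (mirror_mat e *v nu y) \<le> 1"
      using norm_cauchy_schwarz[of "nu (mirror e l y)" "mirror_mat e *v nu y"] norm_nu[OF ryc] n1 norm_mirror_mat[OF e, of "nu y"] by simp
    then have "c i * t * (nu (mirror e l y) \<bullet> (mirror_mat e *v nu y)) \<le> c i * t * 1"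
      using c_nonneg t by (intro mult_left_mono) auto
    then show ?thesis unfolding rz G_boundary[OF ryc] by (simp add: mult_ac)
  qed
  ultimately have 2: "u i (mirror e l ?z) \<le> c i * t + CB * t\<^sup>2"
    using u_zero[OF ryc, of i] unfolding abs_le_iff by simp
  have "k * t \<le> 2 * CB * t * t" using 1 2 kw by (simp add: wdiff_def power2_eq_square)
  then have "k \<le> 2 * CB * t" using t(1) by (simp add: mult_le_cancel_right)
  then show False using t(3) by simp
qed

text \<open>The equations may be uncoupled, so symmetry of one component is handed to the others
  through the domain. The connected component \<open>S\<close> of the cap on which the difference
  vanishes, its mirror image and the part of the plane between them form an open and closed subset
  of the domain, which is therefore symmetric. An extreme boundary point in direction
  \<open>e\<close> then has its reflection outside the domain, and \<open>boundary_touching\<close>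
  produces a zero of every difference.\<close>

lemma zero_imp_symmetric:
  assumes e: "norm e = 1" and d: "dominated e l" and x: "x \<in> cap e l" and wx: "wdiff i e l x = 0"
  shows "z \<in> \<Omega> \<Longrightarrow> mirror e l z \<in> \<Omega> \<and> u j (mirror e l z) = u j z"
proof -
  obtain \<alpha> \<beta> K where s: "supersol \<alpha> \<beta> K (wdiff i e l) (\<lambda>x. rG i e l x - G i x) (\<lambda>x. rH i e l x - H i x) (cap e l)"
    using wdiff_supersol[of i] e d by blast
  define S where "S = connected_component_set (cap e l) x"
  have oS: "open S" unfolding S_def by (rule open_connected_component[OF open_cap])
  have cS: "connected S" unfolding S_def by simp
  have Scap: "S \<subseteq> cap e l" unfolding S_def by (rule connected_component_subset)
  have xS: "x \<in> S" using x by (simp add: S_def)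
  have w0: "wdiff i e l z = 0" if "z \<in> S" for z
    by (rule strong_max_principle[OF supersol_subset[OF s Scap oS] cS xS wx that])
  have max: "T \<subseteq> S" if "connected T" "T \<subseteq> cap e l" "T \<inter> S \<noteq> {}" for T
    using that connected_component_maximal[of _ T "cap e l"] connected_component_eq unfolding S_def by blast
  \<comment> \<open>Half balls are convex, so \<open>S\<close> fills the upper half of any ball of
    the domain whose centre it approaches.\<close>
  have half: "ball z r \<inter> {p. l < p \<bullet> e} \<subseteq> S" if "z \<in> closure S" "ball z r \<subseteq> \<Omega>" "r > 0" for z r
  proof (rule max)
    have "convex {p::real^'N. l < p \<bullet> e}" using convex_halfspace_gt[of l e] by (simp add: inner_commute)
    then show "connected (ball z r \<inter> {p. l < p \<bullet> e})"
      by (intro convex_connected convex_Int) auto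
    show "ball z r \<inter> {p. l < p \<bullet> e} \<subseteq> cap e l" using that by (auto simp: cap_def)
    have "\<exists>p\<in>S. dist p z < r" using that(1,3) by (auto simp: closure_approachable)
    then obtain p where p: "p \<in> S" "dist p z < r" by blast
    then have "p \<in> ball z r \<inter> {p. l < p \<bullet> e} \<inter> S" using Scap by (auto simp: cap_def dist_commute)
    then show "ball z r \<inter> {p. l < p \<bullet> e} \<inter> S \<noteq> {}" by blast
  qed
  have clS: "z \<in> S" if "z \<in> closure S" "z \<in> \<Omega>" "l < z \<bullet> e" for z
  proof -
    have "\<exists>r>0. ball z r \<subseteq> \<Omega>" using open_dom that(2) open_contains_ball by blast
    then obtain r where r: "r > 0" "ball z r \<subseteq> \<Omega>" by blast
    have "z \<in> ball z r \<inter> {p. l < p \<bullet> e}" using r that(3) by simp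
    then show ?thesis using half[OF that(1) r(2,1)] by blast
  qed
  have clge: "l \<le> z \<bullet> e" if "z \<in> closure S" for z
  proof -
    have "closed {z::real^'N. l \<le> z \<bullet> e}" by (intro closed_Collect_le continuous_intros)
    moreover have "S \<subseteq> {z. l \<le> z \<bullet> e}" using Scap by (auto simp: cap_def)
    ultimately show ?thesis using closure_minimal that by blast
  qed
  define U where "U = {z\<in>\<Omega>. z \<in> S \<or> mirror e l z \<in> S \<or> (z \<bullet> e = l \<and> z \<in> closure S)}"
  have openU: "open U"
    unfolding open_contains_ball
  proof
    fix z assume z: "z \<in> U"
    then have zD: "z \<in> \<Omega>" by (simp add: U_def)
    consider "z \<in> S" | "mirror e l z \<in> S" | "z \<bullet> e = l" "z \<in> closure S" using z by (auto simp: U_def)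
    then show "\<exists>r>0. ball z r \<subseteq> U"
    proof cases
      case 1
      moreover have "S \<subseteq> U" using Scap cap_subset by (auto simp: U_def)
      ultimately show ?thesis using oS open_contains_ball by (metis subset_trans)
    next
      case 2
      have "open (mirror e l -` S)" using continuous_mirror[OF e, of UNIV] oS by (simp add: continuous_on_open_vimage)
      moreover have "mirror e l -` S \<subseteq> U"
      proof
        fix p assume "p \<in> mirror e l -` S"
        then have p: "mirror e l p \<in> S" by simp
        then have "mirror e l (mirror e l p) \<in> \<Omega>" using cap_mirror_in[OF d] Scap by blast
        then show "p \<in> U" using p e by (simp add: U_def)
      qed
      ultimately show ?thesis using 2 open_contains_ball by (metis subset_trans vimage_eq)
    next
      case 3
      obtain r where r: "r > 0" "ball z r \<subseteq> \<Omega>" using open_dom zD open_contains_ball by blast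
      note h = half[OF 3(2) r(2,1)]
      have "ball z r \<subseteq> U"
      proof
        fix p assume p: "p \<in> ball z r"
        have rp: "mirror e l p \<in> ball z r"
          using p dist_mirror[OF e, of l z p] mirror_fixed[OF e 3(1)] by simp
        consider "l < p \<bullet> e" | "p \<bullet> e < l" | "p \<bullet> e = l" by linarith
        then show "p \<in> U"
        proof cases
          case 1 then show ?thesis using h p r by (auto simp: U_def)
        next
          case 2
          then have "l < mirror e l p \<bullet> e" by (simp add: mirror_inner[OF e])
          then show ?thesis using h p rp r by (auto simp: U_def)
        next
          case pl: 3
          have "p \<in> closure S"
            unfolding closure_approachable
          proof (intro allI impI)
            fix \<epsilon> :: real assume \<epsilon>: "\<epsilon> > 0"
            define t where "t = min (\<epsilon> / 2) ((r - dist z p) / 2)"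
            have t: "0 < t" "t < \<epsilon>" "t < r - dist z p" using \<epsilon> p by (auto simp: t_def min_def)
            have "dist z (p + t *\<^sub>R e) \<le> dist z p + dist p (p + t *\<^sub>R e)" by (rule dist_triangle)
            also have "\<dots> < r" using t e by (simp add: dist_norm)
            finally have "p + t *\<^sub>R e \<in> ball z r" by simp
            moreover have "l < (p + t *\<^sub>R e) \<bullet> e" using pl t ee[OF e] by (simp add: inner_add_left)
            ultimately have "p + t *\<^sub>R e \<in> S" using h by blast
            moreover have "dist (p + t *\<^sub>R e) p < \<epsilon>" using t e by (simp add: dist_norm)
            ultimately show "\<exists>q\<in>S. dist q p < \<epsilon>" by blast
          qed
          then show ?thesis using pl p r by (auto simp: U_def)
        qed
      qed
      then show ?thesis using r by blast
    qed
  qed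
  have closedU: "z \<in> U" if z: "z \<in> \<Omega>" "z \<in> closure S \<or> mirror e l z \<in> closure S" for z
  proof -
    have A: "z \<in> U" if "z \<in> closure S"
      using clge[OF that] clS[OF that z(1)] z(1) that by (cases "z \<bullet> e = l") (auto simp: U_def)
    moreover have "z \<in> U" if rz: "mirror e l z \<in> closure S"
    proof (cases "mirror e l z \<bullet> e = l")
      case True
      then have "z \<bullet> e = l" by (simp add: mirror_inner[OF e])
      then show ?thesis using A rz mirror_fixed[OF e] by simp
    next
      case False
      then have gt: "l < mirror e l z \<bullet> e" using clge[OF rz] by simp
      \<comment> \<open>The identity between \<open>ut i\<close> and its reflection extends to the
        closure of \<open>S\<close>. Together with positivity of \<open>ut i\<close> at
        \<open>z\<close> it shows that \<open>mirror e l z\<close> is an interior point, not a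
        boundary point.\<close>
      have "closed {p. ut i (mirror e l p) = ut i p}"
        by (intro closed_Collect_eq continuous_ut continuous_on_compose2[OF continuous_ut continuous_mirror[OF e]]) auto
      moreover have "S \<subseteq> {p. ut i (mirror e l p) = ut i p}"
      proof
        fix p assume p: "p \<in> S"
        then have "p \<in> \<Omega>" "mirror e l p \<in> \<Omega>" using Scap cap_mirror_in[OF d] cap_subset by blast+
        then show "p \<in> {p. ut i (mirror e l p) = ut i p}" using w0[OF p] by (simp add: ut_in wdiff_def)
      qed
      ultimately have "ut i (mirror e l (mirror e l z)) = ut i (mirror e l z)" using closure_minimal rz by blast
      then have "0 < ut i (mirror e l z)" using z(1) by (metis ut_pos_iff mirror_mirror[OF e])
      then have "mirror e l z \<in> \<Omega>" by (simp add: ut_pos_iff)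
      then show ?thesis using clS[OF rz _ gt] z by (simp add: U_def)
    qed
    ultimately show ?thesis using z by blast
  qed
  have "U = \<Omega>"
  proof -
    have "openin (top_of_set \<Omega>) U" using openU by (auto simp: U_def intro: open_subset)
    moreover have "closedin (top_of_set \<Omega>) U"
    proof -
      have "U = \<Omega> \<inter> (closure S \<union> mirror e l -` closure S)"
      proof
        show "U \<subseteq> \<Omega> \<inter> (closure S \<union> mirror e l -` closure S)"
          using closure_subset[of S] by (auto simp: U_def)
        show "\<Omega> \<inter> (closure S \<union> mirror e l -` closure S) \<subseteq> U" using closedU by auto
      qed
      moreover have "closed (closure S \<union> mirror e l -` closure S)"
        using continuous_mirror[OF e, of UNIV] by (intro closed_Un) (auto simp: continuous_on_closed_vimage)
      ultimately show ?thesis unfolding closedin_closed by blast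
    qed
    moreover have "x \<in> U" using x xS by (auto simp: U_def cap_def)
    then have "U \<noteq> {}" by blast
    ultimately show ?thesis using connected_dom unfolding connected_clopen by blast
  qed
  then have capS: "cap e l = S"
  proof -
    have "z \<in> S" if "z \<in> cap e l" for z
    proof -
      have "z \<in> U" using \<open>U = \<Omega>\<close> that cap_subset by blast
      moreover have "mirror e l z \<notin> S"
      proof
        assume "mirror e l z \<in> S"
        then have "l < mirror e l z \<bullet> e" using Scap by (auto simp: cap_def)
        then show False using that by (simp add: mirror_inner[OF e] cap_def)
      qed
      ultimately show ?thesis using that by (auto simp: U_def cap_def)
    qed
    then show ?thesis using Scap by blast
  qed
  have symD: "mirror e l z \<in> \<Omega>" if "z \<in> \<Omega>" for z
  proof -
    have "z \<in> U" using that \<open>U = \<Omega>\<close> by simp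
    then consider "z \<in> S" | "mirror e l z \<in> S" | "z \<bullet> e = l" by (auto simp: U_def)
    then show ?thesis
      using cap_mirror_in[OF d] Scap cap_subset mirror_fixed[OF e, of z l] that by cases (blast, blast, simp)
  qed
  \<comment> \<open>A point of the closure that is extreme in direction \<open>e\<close>; it lies on
    the boundary and strictly above the plane.\<close>
  obtain y where y: "y \<in> closure \<Omega>" "\<And>z. z \<in> closure \<Omega> \<Longrightarrow> z \<bullet> e \<le> y \<bullet> e"
  proof -
    have "continuous_on (closure \<Omega>) (\<lambda>z. z \<bullet> e)" by (intro continuous_intros)
    then have "\<exists>y\<in>closure \<Omega>. \<forall>z\<in>closure \<Omega>. z \<bullet> e \<le> y \<bullet> e"
      using nonempty_dom by (intro continuous_attains_sup compact_closure_dom) auto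
    then show ?thesis using that by blast
  qed
  have yl: "l < y \<bullet> e" using y(2)[OF dom_closure, of x] x by (auto simp: cap_def)
  have yn: "y \<notin> \<Omega>"
  proof
    assume "y \<in> \<Omega>"
    then obtain r where r: "r > 0" "ball y r \<subseteq> \<Omega>" using open_dom open_contains_ball by blast
    have "y + (r/2) *\<^sub>R e \<in> ball y r" using r e by (simp add: dist_norm)
    then have "(y + (r/2) *\<^sub>R e) \<bullet> e \<le> y \<bullet> e" using y(2) r dom_closure by blast
    then show False using r ee[OF e] by (simp add: inner_add_left)
  qed
  then have yf: "y \<in> frontier \<Omega>" using y by (simp add: frontier_eq)
  have ry: "mirror e l y \<notin> \<Omega>" using symD[of "mirror e l y"] yn e by auto
  obtain x' where x': "x' \<in> cap e l" "wdiff j e l x' = 0" using boundary_touching[OF e d yf yl ry] by blast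
  obtain \<alpha> \<beta> K where s': "supersol \<alpha> \<beta> K (wdiff j e l) (\<lambda>x. rG j e l x - G j x) (\<lambda>x. rH j e l x - H j x) (cap e l)"
    using wdiff_supersol[of j] e d by blast
  have wj: "u j (mirror e l z) = u j z" if "z \<in> cap e l" for z
    using strong_max_principle[OF s' _ x' that] capS cS by (simp add: wdiff_def)
  show "mirror e l z \<in> \<Omega> \<and> u j (mirror e l z) = u j z" if z: "z \<in> \<Omega>"
  proof -
    consider "l < z \<bullet> e" | "z \<bullet> e < l" | "z \<bullet> e = l" by linarith
    then have "u j (mirror e l z) = u j z"
    proof cases
      case 1 then show ?thesis using wj z by (simp add: cap_def)
    next
      case 2
      then have "mirror e l z \<in> cap e l" using symD[OF z] by (simp add: cap_def mirror_inner[OF e])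
      from wj[OF this] show ?thesis using e by simp
    next
      case 3 then show ?thesis using mirror_fixed[OF e, of z l] by simp
    qed
    then show ?thesis using symD[OF z] by simp
  qed
qed

section \<open>Strict positions of the plane\<close>

definition strict :: "real^'N \<Rightarrow> real \<Rightarrow> bool" where
  "strict e l \<longleftrightarrow> norm e = 1 \<and> dominated e l \<and> (\<forall>i. \<forall>x\<in>cap e l. 0 < wdiff i e l x)"

lemma strict_boundary:
  assumes "strict e l" "y \<in> frontier \<Omega>" "l < y \<bullet> e"
  shows "mirror e l y \<in> \<Omega>"
proof (rule ccontr)
  assume n: "mirror e l y \<notin> \<Omega>"
  obtain i :: 'n where True by simp
  obtain x where "x \<in> cap e l" "wdiff i e l x = 0"
    using boundary_touching[OF _ _ assms(2,3) n, of i] assms(1) unfolding strict_def by blast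
  then show False using assms(1) unfolding strict_def by (metis less_irrefl)
qed

text \<open>Seen from the cap, \<open>x\<close> is a boundary zero of the difference with inner
  normal \<open>e\<close>. Hopf gives linear growth in this direction, while to first order the
  difference is \<open>- 2 * t\<close> times the slope of \<open>u i\<close>.\<close>

lemma strict_plane:
  assumes s: "strict e l" and x: "x \<in> \<Omega>" "x \<bullet> e = l"
  shows "G i x \<bullet> e < 0"
proof (rule ccontr)
  assume neg: "\<not> G i x \<bullet> e < 0"
  have e: "norm e = 1" and d: "dominated e l" using s by (auto simp: strict_def)
  obtain \<alpha> \<beta> K where ss: "supersol \<alpha> \<beta> K (wdiff i e l) (\<lambda>x. rG i e l x - G i x) (\<lambda>x. rH i e l x - H i x) (cap e l)"
    using wdiff_supersol[of i] e d by blast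
  obtain r where r: "r > 0" "ball x r \<subseteq> \<Omega>" using open_dom x open_contains_ball by blast
  define \<rho> where "\<rho> = r / 2"
  have \<rho>: "\<rho> > 0" using r by (simp add: \<rho>_def)
  have B: "ball (x + \<rho> *\<^sub>R e) \<rho> \<subseteq> cap e l"
  proof
    fix p assume p: "p \<in> ball (x + \<rho> *\<^sub>R e) \<rho>"
    have "dist x p \<le> dist x (x + \<rho> *\<^sub>R e) + dist (x + \<rho> *\<^sub>R e) p" by (rule dist_triangle)
    also have "\<dots> < r" using p e \<rho> by (simp add: dist_norm \<rho>_def)
    finally have "p \<in> \<Omega>" using r by auto
    moreover have "(x + \<rho> *\<^sub>R e - p) \<bullet> e \<le> norm (x + \<rho> *\<^sub>R e - p)" using norm_cauchy_schwarz[of "x + \<rho> *\<^sub>R e - p" e] e by simp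
    then have "l < p \<bullet> e" using p x ee[OF e] by (simp add: inner_diff_left inner_add_left dist_norm)
    ultimately show "p \<in> cap e l" by (simp add: cap_def)
  qed
  obtain k where k: "k > 0" "\<And>t. 0 < t \<Longrightarrow> t < \<rho> \<Longrightarrow> k * t \<le> wdiff i e l (x + t *\<^sub>R e)"
    using hopf_normal[OF ss B \<rho> e] B s unfolding strict_def by blast
  define t where "t = min (\<rho> / 2) (k / (4 * CB))"
  have t: "0 < t" "t < \<rho>" "2 * CB * t < k" using \<rho> k CB(1) by (auto simp: t_def min_def field_simps)
  have inb: "x + s *\<^sub>R e \<in> \<Omega>" if "\<bar>s\<bar> \<le> t" for s
    using that t r e \<rho>_def by (intro subsetD[OF r(2)]) (simp add: dist_norm)
  have ta: "\<bar>u i (x + s *\<^sub>R e) - u i x - s * (G i x \<bullet> e)\<bar> \<le> CB * t\<^sup>2" if "\<bar>s\<bar> = t" for s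
  proof -
    have "\<bar>u i (x + s *\<^sub>R e) - u i x - G i x \<bullet> (x + s *\<^sub>R e - x)\<bar> \<le> CB * (norm (x + s *\<^sub>R e - x))\<^sup>2"
    proof (rule u_taylor)
      show "x \<in> closure \<Omega>" "x + s *\<^sub>R e \<in> closure \<Omega>" using x inb[of s] that by (auto intro: dom_closure)
      fix r :: real assume "0 < r" "r < 1"
      then show "x + r *\<^sub>R (x + s *\<^sub>R e - x) \<in> \<Omega>"
        using inb[of "r * s"] that t mult_left_le_one_le[of "\<bar>s\<bar>" r] by (simp add: abs_mult)
    qed
    then show ?thesis using e that by (simp add: power2_abs[of s, symmetric])
  qed
  have "mirror e l (x + t *\<^sub>R e) = x + (- t) *\<^sub>R e"
    using x ee[OF e] by (simp add: mirror_def inner_add_left algebra_simps flip: scaleR_add_left)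
  then have "wdiff i e l (x + t *\<^sub>R e) = u i (x + (- t) *\<^sub>R e) - u i (x + t *\<^sub>R e)" by (simp add: wdiff_def)
  also have "\<dots> \<le> - 2 * t * (G i x \<bullet> e) + 2 * CB * t\<^sup>2"
    using ta[of t] ta[of "- t"] t unfolding abs_le_iff by simp
  also have "\<dots> \<le> 2 * CB * t\<^sup>2" using neg t by simp
  finally have "k * t \<le> 2 * CB * t * t" using k(2)[OF t(1,2)] by (simp add: power2_eq_square)
  then have "k \<le> 2 * CB * t" using t(1) by (simp add: mult_le_cancel_right)
  then show False using t(3) by simp
qed

text \<open>Otherwise a short step along \<open>e\<close> would lead into the domain while its
  mirror image, the step along \<open>- e\<close>, leads out of it.\<close>

lemma dominated_nu:
  assumes e: "norm e = 1" and d: "dominated e l" and y: "y \<in> frontier \<Omega>" "y \<bullet> e = l"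
  shows "nu y \<bullet> e \<le> 0"
proof (rule ccontr)
  assume "\<not> nu y \<bullet> e \<le> 0"
  then have p: "0 < e \<bullet> nu y" "(- e) \<bullet> nu y < 0" by (auto simp: inner_commute)
  obtain t1 where t1: "t1 > 0" "\<And>t. 0 < t \<Longrightarrow> t < t1 \<Longrightarrow> y + t *\<^sub>R e \<in> \<Omega>" using in_dir[OF y(1) p(1)] by auto
  obtain t2 where t2: "t2 > 0" "\<And>t. 0 < t \<Longrightarrow> t < t2 \<Longrightarrow> y + t *\<^sub>R (- e) \<notin> \<Omega>" using out_dir[OF y(1) p(2)] by auto
  define t where "t = min t1 t2 / 2"
  have t: "0 < t" "t < t1" "t < t2" using t1 t2 by (auto simp: t_def)
  have "y + t *\<^sub>R e \<in> cap e l" using t1(2) t y ee[OF e] by (simp add: cap_def inner_add_left)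
  then have "mirror e l (y + t *\<^sub>R e) \<in> \<Omega>" by (rule cap_mirror_in[OF d])
  moreover have "mirror e l (y + t *\<^sub>R e) = y + t *\<^sub>R (- e)"
    using y ee[OF e] by (simp add: mirror_def inner_add_left algebra_simps flip: scaleR_add_left)
  ultimately show False using t2(2) t by simp
qed

text \<open>Near a plane point inside the domain the growth comes from \<open>strict_plane\<close>;
  above the plane the difference is positive even at boundary points; compactness unites both.
  Corners are kept out of \<open>K\<close>. The bound supplies the comparison on the outer spheres
  of the corner regions.\<close>

lemma strict_linear_growth:
  assumes s: "strict e l" and K: "compact K" "K \<subseteq> closure \<Omega>" "\<And>x. x \<in> K \<Longrightarrow> l \<le> x \<bullet> e"
    "\<And>x. x \<in> K \<Longrightarrow> x \<bullet> e = l \<Longrightarrow> x \<in> \<Omega>"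
  shows "\<exists>k>0. \<forall>x\<in>K. k * (x \<bullet> e - l) \<le> ut i (mirror e l x) - ut i x"
proof (rule ccontr)
  assume no: "\<not> ?thesis"
  have e: "norm e = 1" using s by (simp add: strict_def)
  let ?D = "\<lambda>x. ut i (mirror e l x) - ut i x"
  have contD: "isCont ?D p" for p
    using isCont_ut continuous_mirror[OF e, of UNIV]
    by (intro continuous_intros isCont_o2[OF _ isCont_ut]) (simp add: continuous_on_eq_continuous_at)
  have "\<exists>x\<in>K. ?D x < 1 / real (Suc n) * (x \<bullet> e - l)" for n
    using no by (metis not_less of_nat_0_less_iff zero_less_Suc zero_less_divide_1_iff)
  then obtain X where X: "\<And>n. X n \<in> K" "\<And>n. ?D (X n) < 1 / real (Suc n) * (X n \<bullet> e - l)" by metis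
  obtain p r where p: "p \<in> K" "strict_mono r" "(X \<circ> r) \<longlonglongrightarrow> p"
    using K(1) X(1) unfolding compact_def by metis
  have "\<exists>k>0. \<forall>\<^sub>F x in nhds p. l \<le> x \<bullet> e \<longrightarrow> k * (x \<bullet> e - l) \<le> ?D x"
  proof (cases "p \<bullet> e = l")
    case True
    then have pD: "p \<in> \<Omega>" using K(4) p(1) by blast
    define \<eta> where "\<eta> = - (G i p \<bullet> e) / 2"
    have \<eta>: "\<eta> > 0" using strict_plane[OF s pD True, of i] by (simp add: \<eta>_def)
    have "continuous_on \<Omega> (\<lambda>x. G i x \<bullet> e)"
      using continuous_on_subset[OF cont_G closure_subset] by (intro continuous_intros)
    then have "isCont (\<lambda>x. G i x \<bullet> e) p" using open_dom pD by (simp add: continuous_on_eq_continuous_at)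
    then have "\<forall>\<^sub>F x in nhds p. G i x \<bullet> e < - \<eta>"
      unfolding continuous_at tendsto_at_iff_tendsto_nhds[of "\<lambda>x. G i x \<bullet> e"]
      by (rule order_tendstoD(2)) (use \<eta> in \<open>auto simp: \<eta>_def\<close>)
    then obtain r1 where r1: "r1 > 0" "\<And>x. dist x p < r1 \<Longrightarrow> G i x \<bullet> e < - \<eta>"
      unfolding eventually_nhds_metric by blast
    obtain r2 where r2: "r2 > 0" "ball p r2 \<subseteq> \<Omega>" using open_dom pD open_contains_ball by blast
    define r where "r = min r1 r2"
    have "\<eta> * 2 * (x \<bullet> e - l) \<le> ?D x" if x: "dist x p < r" "l \<le> x \<bullet> e" for x
    proof -
      have rx: "mirror e l x \<in> ball p r" using x dist_mirror[OF e, of l x p] mirror_fixed[OF e True] by (simp add: dist_commute)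
      have seg: "x + t *\<^sub>R (mirror e l x - x) \<in> ball p r" if "0 \<le> t" "t \<le> 1" for t
      proof -
        have "(1 - t) *\<^sub>R x + t *\<^sub>R mirror e l x \<in> ball p r"
          using convexD[OF convex_ball, of x p r "mirror e l x" "1 - t" t] x rx that by (simp add: dist_commute)
        then show ?thesis by (simp add: algebra_simps)
      qed
      have bD: "ball p r \<subseteq> \<Omega>" using r2 by (auto simp: r_def)
      have xD: "x \<in> \<Omega>" "mirror e l x \<in> \<Omega>" using x rx bD by (auto simp: dist_commute)
      obtain t where t: "0 < t" "t < 1" "u i (mirror e l x) - u i x = G i (x + t *\<^sub>R (mirror e l x - x)) \<bullet> (mirror e l x - x)"
        using mean_value_u[OF dom_closure[OF xD(1)] dom_closure[OF xD(2)]] seg bD by (meson less_imp_le subsetD)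
      have "mirror e l x - x = (- (2 * (x \<bullet> e - l))) *\<^sub>R e" unfolding mirror_def scaleR_minus_left by simp
      moreover define q where "q = G i (x + t *\<^sub>R (mirror e l x - x))"
      ultimately have "u i (mirror e l x) - u i x = q \<bullet> ((- (2 * (x \<bullet> e - l))) *\<^sub>R e)"
        using t(3) by (simp only:)
      then have "?D x = (2 * (x \<bullet> e - l)) * - (q \<bullet> e)"
        using xD by (simp add: ut_in algebra_simps)
      moreover have "q \<bullet> e < - \<eta>"
        unfolding q_def using seg[of t] t by (intro r1(2)) (simp add: r_def dist_commute)
      then have "(2 * (x \<bullet> e - l)) * \<eta> \<le> (2 * (x \<bullet> e - l)) * - (q \<bullet> e)"
        using x by (intro mult_left_mono) auto
      ultimately show ?thesis by (simp add: mult_ac)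
    qed
    moreover have "r > 0" using r1 r2 by (simp add: r_def)
    ultimately show ?thesis using \<eta> unfolding eventually_nhds_metric
      by (intro exI[of _ "\<eta> * 2"] conjI exI[of _ r]) auto
  next
    case False
    then have pl: "l < p \<bullet> e" using K(3)[OF p(1)] by simp
    have Dp: "0 < ?D p"
    proof (cases "p \<in> \<Omega>")
      case True
      then have "p \<in> cap e l" using pl by (simp add: cap_def)
      then show ?thesis using s cap_mirror_in[of e l p] True unfolding strict_def by (auto simp: wdiff_def ut_in)
    next
      case False
      then have "p \<in> frontier \<Omega>" using K(2) p(1) by (auto simp: frontier_eq)
      then show ?thesis using strict_boundary[OF s _ pl] False u_pos by (simp add: ut_def)
    qed
    let ?k = "?D p / 2 / (p \<bullet> e - l + 1)"
    have ev1: "\<forall>\<^sub>F x in nhds p. ?D p / 2 < ?D x"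
      using contD[of p] unfolding continuous_at tendsto_at_iff_tendsto_nhds[of ?D]
      by (rule order_tendstoD(1)) (use Dp in auto)
    have "isCont (\<lambda>x. x \<bullet> e) p" by (intro continuous_intros)
    then have ev2: "\<forall>\<^sub>F x in nhds p. x \<bullet> e < p \<bullet> e + 1"
      unfolding continuous_at tendsto_at_iff_tendsto_nhds[of "\<lambda>x. x \<bullet> e"] by (rule order_tendstoD(2)) auto
    show ?thesis
    proof (intro exI[of _ ?k] conjI)
      show "0 < ?k" using Dp pl by simp
      show "\<forall>\<^sub>F x in nhds p. l \<le> x \<bullet> e \<longrightarrow> ?k * (x \<bullet> e - l) \<le> ?D x"
        using ev1 ev2
      proof eventually_elim
        case (elim x)
        show ?case
        proof
          assume "l \<le> x \<bullet> e"
          then have "?k * (x \<bullet> e - l) \<le> ?k * (p \<bullet> e - l + 1)" using elim Dp pl by (intro mult_left_mono) auto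
          also have "\<dots> = ?D p / 2"
          proof -
            have "p \<bullet> e - l + 1 \<noteq> 0" using pl by simp
            then show ?thesis by (metis nonzero_divide_eq_eq)
          qed
          finally show "?k * (x \<bullet> e - l) \<le> ?D x" using elim by linarith
        qed
      qed
    qed
  qed
  then obtain k where k: "k > 0" "\<forall>\<^sub>F x in nhds p. l \<le> x \<bullet> e \<longrightarrow> k * (x \<bullet> e - l) \<le> ?D x" by blast
  have 1: "\<forall>\<^sub>F n in sequentially. l \<le> (X \<circ> r) n \<bullet> e \<longrightarrow> k * ((X \<circ> r) n \<bullet> e - l) \<le> ?D ((X \<circ> r) n)"
    using p(3) k(2) by (rule eventually_compose_filterlim[rotated])
  have "(\<lambda>n. 1 / real (Suc n)) \<longlonglongrightarrow> 0" using LIMSEQ_inverse_real_of_nat by (simp add: inverse_eq_divide)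
  then have "\<forall>\<^sub>F n in sequentially. 1 / real (Suc n) < k" using k(1) by (rule order_tendstoD(2))
  then have "\<forall>\<^sub>F n in sequentially. 1 / real (Suc (r n)) < k" using eventually_subseq[OF p(2)] by blast
  with 1 have "\<forall>\<^sub>F n in sequentially. False"
  proof eventually_elim
    case (elim n)
    have "l \<le> X (r n) \<bullet> e" using K(3) X(1) by blast
    then have "1 / real (Suc (r n)) * (X (r n) \<bullet> e - l) \<le> k * (X (r n) \<bullet> e - l)" using elim(2) by (intro mult_right_mono) auto
    then show False using elim(1) X(2)[of "r n"] \<open>l \<le> X (r n) \<bullet> e\<close> by simp
  qed
  then show False by simp
qed

end

lemma ball_coords:
  fixes y :: "real^'N"
  assumes "norm \<tau> = 1" "norm \<nu> = 1" "\<tau> \<bullet> \<nu> = 0" "\<rho> > 0"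
  shows "y + a *\<^sub>R \<tau> + b *\<^sub>R \<nu> \<in> ball (y + \<rho> *\<^sub>R \<nu>) \<rho> \<longleftrightarrow> a\<^sup>2 + b\<^sup>2 < 2 * b * \<rho>"
proof -
  have i: "\<tau> \<bullet> \<tau> = 1" "\<nu> \<bullet> \<nu> = 1" "\<nu> \<bullet> \<tau> = 0"
    using assms by (simp_all add: dot_square_norm inner_commute)
  have "(norm (a *\<^sub>R \<tau> + (b - \<rho>) *\<^sub>R \<nu>))\<^sup>2 = a\<^sup>2 + (b - \<rho>)\<^sup>2"
    unfolding power2_norm_eq_inner by (simp add: inner_add_left inner_add_right i assms(3) power2_eq_square)
  moreover have "dist (y + \<rho> *\<^sub>R \<nu>) (y + a *\<^sub>R \<tau> + b *\<^sub>R \<nu>) = norm (a *\<^sub>R \<tau> + (b - \<rho>) *\<^sub>R \<nu>)"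
  proof -
    have "y + a *\<^sub>R \<tau> + b *\<^sub>R \<nu> - (y + \<rho> *\<^sub>R \<nu>) = a *\<^sub>R \<tau> + (b - \<rho>) *\<^sub>R \<nu>"
      by (simp add: scaleR_diff_left)
    then show ?thesis by (metis dist_commute dist_norm)
  qed
  ultimately have d: "(dist (y + \<rho> *\<^sub>R \<nu>) (y + a *\<^sub>R \<tau> + b *\<^sub>R \<nu>))\<^sup>2 = a\<^sup>2 + (b - \<rho>)\<^sup>2" by simp
  have "y + a *\<^sub>R \<tau> + b *\<^sub>R \<nu> \<in> ball (y + \<rho> *\<^sub>R \<nu>) \<rho> \<longleftrightarrow>
      (dist (y + \<rho> *\<^sub>R \<nu>) (y + a *\<^sub>R \<tau> + b *\<^sub>R \<nu>))\<^sup>2 < \<rho>\<^sup>2"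
    using assms(4) by (auto intro: power_strict_mono power2_less_imp_less[of "dist _ _"])
  also have "\<dots> \<longleftrightarrow> a\<^sup>2 + b\<^sup>2 < 2 * b * \<rho>"
    unfolding d by (auto simp: power2_eq_square algebra_simps)
  finally show ?thesis .
qed

section \<open>Rotations of a plane\<close>

lemma matrix_mult_add_left: "(A + B) ** C = A ** C + B ** (C :: real^'N^'N)"
  by (simp add: matrix_matrix_mult_def vec_eq_iff sum.distrib distrib_right)

lemma matrix_mult_scaleR_left: "(c *\<^sub>R A) ** B = c *\<^sub>R (A ** (B :: real^'N^'N))"
  by (simp add: matrix_matrix_mult_def vec_eq_iff sum_distrib_left mult_ac)

text \<open>For orthonormal \<open>e\<close> and \<open>\<nu>\<close> the rotation of their plane
  with sine \<open>\<tau>\<close>, the identity on the orthogonal complement. Taking the sine as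
  parameter makes the first order term exactly linear.\<close>

definition rotation :: "real^'N \<Rightarrow> real^'N \<Rightarrow> real \<Rightarrow> real^'N^'N" where
  "rotation e \<nu> \<tau> = mat 1 + (sqrt (1 - \<tau>\<^sup>2) - 1) *\<^sub>R (outer e e + outer \<nu> \<nu>) + \<tau> *\<^sub>R (outer e \<nu> - outer \<nu> e)"

lemma rotation_mult:
  "rotation e \<nu> \<tau> *v h = h + ((sqrt (1 - \<tau>\<^sup>2) - 1) * (e \<bullet> h) + \<tau> * (\<nu> \<bullet> h)) *\<^sub>R e
     + ((sqrt (1 - \<tau>\<^sup>2) - 1) * (\<nu> \<bullet> h) - \<tau> * (e \<bullet> h)) *\<^sub>R \<nu>"
  by (simp add: rotation_def matrix_vector_mult_add_rdistrib matrix_vector_mult_diff_rdistrib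
      matrix_vector_scaleR_left outer_mult scaleR_add_left scaleR_diff_left scaleR_add_right scaleR_diff_right
      left_diff_distrib)

lemma transpose_rotation: "transpose (rotation e \<nu> \<tau>) = rotation e \<nu> (- \<tau>)"
  by (simp add: rotation_def transpose_def vec_eq_iff outer_def mat_def algebra_simps)

context
  fixes e \<nu> :: "real^'N" and \<tau> :: real
  assumes en: "norm e = 1" "norm \<nu> = 1" "e \<bullet> \<nu> = 0" and \<tau>: "0 \<le> \<tau>" "\<tau> \<le> 1"
begin

lemma en_inner: "e \<bullet> e = 1" "\<nu> \<bullet> \<nu> = 1" "\<nu> \<bullet> e = 0"
  using en by (simp_all add: dot_square_norm inner_commute)

lemma cos_bounds: "0 \<le> sqrt (1 - \<tau>\<^sup>2)" "1 - \<tau>\<^sup>2 \<le> sqrt (1 - \<tau>\<^sup>2)" "sqrt (1 - \<tau>\<^sup>2) \<le> 1" "(sqrt (1 - \<tau>\<^sup>2))\<^sup>2 = 1 - \<tau>\<^sup>2"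
  "1 - \<tau> \<le> sqrt (1 - \<tau>\<^sup>2)"
proof -
  have t: "\<tau>\<^sup>2 \<le> 1" "\<tau>\<^sup>2 \<le> \<tau>" using \<tau> power_le_one[of \<tau> 2] by (auto simp: power2_eq_square mult_left_le)
  show a: "0 \<le> sqrt (1 - \<tau>\<^sup>2)" "sqrt (1 - \<tau>\<^sup>2) \<le> 1" "(sqrt (1 - \<tau>\<^sup>2))\<^sup>2 = 1 - \<tau>\<^sup>2"
    using t by auto
  have "(sqrt (1 - \<tau>\<^sup>2)) * (sqrt (1 - \<tau>\<^sup>2)) \<le> 1 * sqrt (1 - \<tau>\<^sup>2)" using a by (intro mult_right_mono) auto
  then show "1 - \<tau>\<^sup>2 \<le> sqrt (1 - \<tau>\<^sup>2)" using a(3) by (simp add: power2_eq_square)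
  then show "1 - \<tau> \<le> sqrt (1 - \<tau>\<^sup>2)" using t by linarith
qed

lemma orthogonal_rotation: "orthogonal_matrix (rotation e \<nu> \<tau>)"
proof -
  let ?c = "sqrt (1 - \<tau>\<^sup>2)"
  have c2: "?c * ?c = 1 - \<tau> * \<tau>" using cos_bounds(4) by (simp add: power2_eq_square)
  have "rotation e \<nu> (- \<tau>) *v (rotation e \<nu> \<tau> *v h) = h" for h
  proof -
    let ?a = "e \<bullet> h" and ?b = "\<nu> \<bullet> h" and ?g = "rotation e \<nu> \<tau> *v h"
    have g: "e \<bullet> ?g = ?c * ?a + \<tau> * ?b" "\<nu> \<bullet> ?g = ?c * ?b - \<tau> * ?a"
      by (simp_all add: rotation_mult inner_add_right en en_inner algebra_simps)
    have "rotation e \<nu> (- \<tau>) *v ?g = ?g + ((?c - 1) * (?c * ?a + \<tau> * ?b) - \<tau> * (?c * ?b - \<tau> * ?a)) *\<^sub>R e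
      + ((?c - 1) * (?c * ?b - \<tau> * ?a) + \<tau> * (?c * ?a + \<tau> * ?b)) *\<^sub>R \<nu>"
      unfolding rotation_mult[of e \<nu> "- \<tau>"] g by simp
    also have "(?c - 1) * (?c * ?a + \<tau> * ?b) - \<tau> * (?c * ?b - \<tau> * ?a) = (?c * ?c) * ?a - ?c * ?a - \<tau> * ?b + \<tau> * \<tau> * ?a"
      by (simp add: algebra_simps)
    also have "\<dots> = - ((?c - 1) * ?a + \<tau> * ?b)" unfolding c2 by (simp add: algebra_simps)
    also have "(?c - 1) * (?c * ?b - \<tau> * ?a) + \<tau> * (?c * ?a + \<tau> * ?b) = (?c * ?c) * ?b - ?c * ?b + \<tau> * ?a + \<tau> * \<tau> * ?b"
      by (simp add: algebra_simps)
    also have "\<dots> = - ((?c - 1) * ?b - \<tau> * ?a)" unfolding c2 by (simp add: algebra_simps)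
    also have "?g + (- ((?c - 1) * ?a + \<tau> * ?b)) *\<^sub>R e + (- ((?c - 1) * ?b - \<tau> * ?a)) *\<^sub>R \<nu> = h"
      unfolding rotation_mult scaleR_minus_left by simp
    finally show ?thesis .
  qed
  then show ?thesis
    by (simp add: orthogonal_matrix transpose_rotation matrix_eq flip: matrix_vector_mul_assoc)
qed

lemma norm_rotation_diff: "norm (rotation e \<nu> \<tau> - mat 1) \<le> 4 * \<tau>"
proof -
  let ?c = "sqrt (1 - \<tau>\<^sup>2)"
  have "rotation e \<nu> \<tau> - mat 1 = (?c - 1) *\<^sub>R (outer e e + outer \<nu> \<nu>) + \<tau> *\<^sub>R (outer e \<nu> - outer \<nu> e)"
    by (simp add: rotation_def)
  also have "norm \<dots> \<le> \<bar>?c - 1\<bar> * norm (outer e e + outer \<nu> \<nu>) + \<bar>\<tau>\<bar> * norm (outer e \<nu> - outer \<nu> e)"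
    by (rule order_trans[OF norm_triangle_ineq]) simp
  also have "\<dots> \<le> \<tau> * 2 + \<tau> * 2"
  proof (intro add_mono mult_mono)
    show "\<bar>?c - 1\<bar> \<le> \<tau>" using cos_bounds by simp
    show "norm (outer e e + outer \<nu> \<nu>) \<le> 2"
      using norm_triangle_ineq[of "outer e e" "outer \<nu> \<nu>"] by (simp add: norm_outer en)
    show "norm (outer e \<nu> - outer \<nu> e) \<le> 2"
      using norm_triangle_ineq4[of "outer e \<nu>" "outer \<nu> e"] by (simp add: norm_outer en)
  qed (use \<tau> in auto)
  finally show ?thesis by simp
qed

lemma norm_rotation_vec: "norm (rotation e \<nu> \<tau> *v h - h) \<le> 4 * \<tau> * norm h"
proof -
  have "rotation e \<nu> \<tau> *v h - h = (rotation e \<nu> \<tau> - mat 1) *v h"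
    by (simp add: matrix_vector_mult_diff_rdistrib)
  also have "norm \<dots> \<le> norm (rotation e \<nu> \<tau> - mat 1) * norm h" by (rule norm_matrix_vector)
  also have "\<dots> \<le> 4 * \<tau> * norm h" using norm_rotation_diff by (intro mult_right_mono) auto
  finally show ?thesis .
qed

lemma rotation_conj_outer:
  fixes Q :: "real^'N^'N"
  shows "Q ** outer a b ** transpose Q = outer (Q *v a) (Q *v b)"
proof -
  have "(Q ** outer a b ** transpose Q) *v h = outer (Q *v a) (Q *v b) *v h" for h
    unfolding matrix_vector_mul_assoc[symmetric] outer_mult matrix_vector_mult_scaleR inner_transpose
    by simp
  then show ?thesis by (simp add: matrix_eq)
qed

text \<open>First order effect of the rotation on a matrix close to \<open>b \<nu> \<otimes> \<nu>\<close>: only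
  the mixed coefficient of \<open>A\<close> enters.\<close>

lemma trace_rotation_diff:
  assumes A: "A \<in> pucci_class \<alpha> \<beta>" "0 < \<alpha>" and b: "0 \<le> b" and Y: "norm (Y - b *\<^sub>R outer \<nu> \<nu>) \<le> \<eta>"
  shows "- b * (2 * \<tau> * (e \<bullet> (A *v \<nu>)) + 3 * \<tau>\<^sup>2 * \<beta>)
      - 4 * (real CARD('N))\<^sup>2 * (norm (mat 1 :: real^'N^'N) + 5) * \<beta> * \<tau> * \<eta>
    \<le> trace (A ** (Y - rotation e \<nu> \<tau> ** Y ** transpose (rotation e \<nu> \<tau>)))"
proof -
  let ?Q = "rotation e \<nu> \<tau>" and ?c = "sqrt (1 - \<tau>\<^sup>2)"
  \<comment> \<open>Only the small remainder \<open>Y'\<close> is estimated by norms; the rank one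
    part is computed exactly.\<close>
  define Y' where "Y' = Y - b *\<^sub>R outer \<nu> \<nu>"
  define J where "J = ?Q - mat 1"
  define I where "I = (mat 1 :: real^'N^'N)"
  have Yeq: "Y = Y' + b *\<^sub>R outer \<nu> \<nu>" by (simp add: Y'_def)
  have conj: "?Q ** Y ** transpose ?Q = ?Q ** Y' ** transpose ?Q + b *\<^sub>R outer (?Q *v \<nu>) (?Q *v \<nu>)"
    unfolding Yeq rotation_conj_outer[symmetric]
    by (simp add: matrix_add_ldistrib matrix_mult_add_left matrix_mult_scaleR_right matrix_mult_scaleR_left)
  have Y'J: "Y' - ?Q ** Y' ** transpose ?Q = - (J ** Y' ** transpose ?Q + Y' ** transpose J)"
  proof -
    have "J ** Y' ** transpose ?Q = ?Q ** Y' ** transpose ?Q - Y' ** transpose ?Q"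
      by (simp add: J_def matrix_mult_diff_left)
    moreover have "Y' ** transpose J = Y' ** transpose ?Q - Y'"
    proof -
      have "transpose J = transpose ?Q - mat 1" by (simp add: J_def transpose_def vec_eq_iff mat_def)
      then show ?thesis by (simp add: matrix_mult_diff_right)
    qed
    ultimately show ?thesis by simp
  qed
  have nJ: "norm J \<le> 4 * \<tau>" unfolding J_def by (rule norm_rotation_diff)
  have nQ: "norm ?Q \<le> norm I + 4"
  proof -
    have "?Q = I + J" by (simp add: J_def I_def)
    then show ?thesis using norm_triangle_ineq[of I J] nJ \<tau> by simp
  qed
  have \<eta>0: "0 \<le> \<eta>" using Y norm_ge_zero order_trans by blast
  have \<beta>0: "0 \<le> \<beta>"
    using pucci_classD(2,3)[OF A(1), of e] A(2) by (simp add: en_inner)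
  have "norm (Y' - ?Q ** Y' ** transpose ?Q) \<le> 4 * \<tau> * \<eta> * (norm I + 5)"
  proof -
    have "norm (J ** Y' ** transpose ?Q) \<le> norm J * norm Y' * norm ?Q"
      using norm_matrix_mult[of "J ** Y'" "transpose ?Q"] mult_right_mono[OF norm_matrix_mult[of J Y'] norm_ge_zero[of ?Q]]
      by (simp add: norm_transpose)
    also have "\<dots> \<le> (4 * \<tau>) * \<eta> * (norm I + 4)"
      using nJ Y nQ \<tau> \<eta>0 by (intro mult_mono) (auto simp: Y'_def)
    finally have 1: "norm (J ** Y' ** transpose ?Q) \<le> (4 * \<tau>) * \<eta> * (norm I + 4)" .
    have "norm (Y' ** transpose J) \<le> norm Y' * norm J" using norm_matrix_mult[of Y' "transpose J"] by (simp add: norm_transpose)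
    also have "\<dots> \<le> \<eta> * (4 * \<tau>)" using nJ Y \<tau> \<eta>0 by (intro mult_mono) (auto simp: Y'_def)
    finally have 2: "norm (Y' ** transpose J) \<le> \<eta> * (4 * \<tau>)" .
    have "norm (Y' - ?Q ** Y' ** transpose ?Q) \<le> norm (J ** Y' ** transpose ?Q) + norm (Y' ** transpose J)"
      unfolding Y'J norm_minus_cancel by (rule norm_triangle_ineq)
    also have "\<dots> \<le> (4 * \<tau>) * \<eta> * (norm I + 4) + \<eta> * (4 * \<tau>)" using 1 2 by (rule add_mono)
    finally show ?thesis by (simp add: algebra_simps)
  qed
  then have "(real CARD('N))\<^sup>2 * \<beta> * norm (Y' - ?Q ** Y' ** transpose ?Q) \<le> (real CARD('N))\<^sup>2 * \<beta> * (4 * \<tau> * \<eta> * (norm I + 5))"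
    using \<beta>0 by (intro mult_left_mono) auto
  then have t1: "- (4 * (real CARD('N))\<^sup>2 * (norm I + 5) * \<beta> * \<tau> * \<eta>) \<le> trace (A ** (Y' - ?Q ** Y' ** transpose ?Q))"
  proof -
    have "4 * (real CARD('N))\<^sup>2 * (norm I + 5) * \<beta> * \<tau> * \<eta> = (real CARD('N))\<^sup>2 * \<beta> * (4 * \<tau> * \<eta> * (norm I + 5))"
      by simp
    with \<open>_ \<le> (real CARD('N))\<^sup>2 * \<beta> * (4 * \<tau> * \<eta> * (norm I + 5))\<close> show ?thesis
      using pucci_class_trace[OF A, of "Y' - ?Q ** Y' ** transpose ?Q"] by linarith
  qed
  have Qn: "?Q *v \<nu> = ?c *\<^sub>R \<nu> + \<tau> *\<^sub>R e"
    by (simp add: rotation_mult en en_inner algebra_simps)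
  have a21: "\<nu> \<bullet> (A *v e) = e \<bullet> (A *v \<nu>)" by (rule pucci_classD(4)[OF A(1)])
  have qq: "(?Q *v \<nu>) \<bullet> (A *v (?Q *v \<nu>)) = ?c\<^sup>2 * (\<nu> \<bullet> (A *v \<nu>)) + 2 * ?c * \<tau> * (e \<bullet> (A *v \<nu>)) + \<tau>\<^sup>2 * (e \<bullet> (A *v e))"
    unfolding Qn by (simp add: matrix_vector_right_distrib matrix_vector_mult_scaleR inner_add_left inner_add_right a21
        power2_eq_square algebra_simps)
  have "\<bar>e \<bullet> (A *v \<nu>)\<bar> \<le> \<beta>" using pucci_class_bilinear[OF A, of e \<nu>] en by simp
  \<comment> \<open>Replacing the cosine by 1 in the mixed term costs
    \<open>2 * \<tau>\<^sup>2 * \<beta>\<close> and the entry at \<open>e\<close> another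
    \<open>\<tau>\<^sup>2 * \<beta>\<close>, hence the factor 3. The change in the entry at
    \<open>\<nu>\<close> has the good sign.\<close>
  have "\<bar>2 * \<tau> * ((1 - ?c) * (e \<bullet> (A *v \<nu>)))\<bar> \<le> 2 * \<tau> * (\<tau> * \<beta>)"
  proof -
    have "\<bar>(1 - ?c) * (e \<bullet> (A *v \<nu>))\<bar> \<le> \<tau> * \<beta>"
      unfolding abs_mult using \<open>\<bar>e \<bullet> (A *v \<nu>)\<bar> \<le> \<beta>\<close> cos_bounds \<tau> by (intro mult_mono) auto
    then have "2 * \<tau> * \<bar>(1 - ?c) * (e \<bullet> (A *v \<nu>))\<bar> \<le> 2 * \<tau> * (\<tau> * \<beta>)" using \<tau> by (intro mult_left_mono) auto
    then show ?thesis using \<tau> by (simp add: abs_mult)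
  qed
  then have "- (2 * \<tau>\<^sup>2 * \<beta>) \<le> 2 * \<tau> * ((1 - ?c) * (e \<bullet> (A *v \<nu>)))" by (simp add: abs_le_iff power2_eq_square)
  moreover have "\<tau>\<^sup>2 * (e \<bullet> (A *v e)) \<le> \<tau>\<^sup>2 * \<beta>"
    using pucci_classD(3)[OF A(1), of e] by (intro mult_left_mono) (auto simp: en_inner)
  moreover have "0 \<le> \<tau>\<^sup>2 * (\<nu> \<bullet> (A *v \<nu>))"
    using pucci_classD(2)[OF A(1), of \<nu>] A(2) by (intro mult_nonneg_nonneg) (auto simp: en_inner)
  moreover have "\<nu> \<bullet> (A *v \<nu>) - (?Q *v \<nu>) \<bullet> (A *v (?Q *v \<nu>)) =
    \<tau>\<^sup>2 * (\<nu> \<bullet> (A *v \<nu>)) - 2 * \<tau> * (e \<bullet> (A *v \<nu>)) + 2 * \<tau> * ((1 - ?c) * (e \<bullet> (A *v \<nu>))) - \<tau>\<^sup>2 * (e \<bullet> (A *v e))"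
    unfolding qq cos_bounds(4) by (simp add: algebra_simps)
  ultimately have "- (2 * \<tau> * (e \<bullet> (A *v \<nu>)) + 3 * \<tau>\<^sup>2 * \<beta>) \<le> \<nu> \<bullet> (A *v \<nu>) - (?Q *v \<nu>) \<bullet> (A *v (?Q *v \<nu>))"
    by linarith
  then have t2: "b * (- (2 * \<tau> * (e \<bullet> (A *v \<nu>)) + 3 * \<tau>\<^sup>2 * \<beta>)) \<le> b * (\<nu> \<bullet> (A *v \<nu>) - (?Q *v \<nu>) \<bullet> (A *v (?Q *v \<nu>)))"
    using b by (intro mult_left_mono)
  have "trace (A ** (Y - ?Q ** Y ** transpose ?Q)) = trace (A ** (Y' - ?Q ** Y' ** transpose ?Q))
    + b * (\<nu> \<bullet> (A *v \<nu>) - (?Q *v \<nu>) \<bullet> (A *v (?Q *v \<nu>)))"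
    unfolding conj unfolding Yeq by (simp add: trace_simps algebra_simps)
  moreover have "- b * (2 * \<tau> * (e \<bullet> (A *v \<nu>)) + 3 * \<tau>\<^sup>2 * \<beta>) = b * (- (2 * \<tau> * (e \<bullet> (A *v \<nu>)) + 3 * \<tau>\<^sup>2 * \<beta>))"
    by (simp only: mult_minus_left mult_minus_right)
  ultimately show ?thesis using t1 t2 unfolding I_def by linarith
qed

end

context overdetermined
begin

section \<open>The Hessian at the boundary when the Neumann data vanish\<close>

lemma transpose_H_closure:
  assumes "x \<in> closure \<Omega>"
  shows "transpose (H i x) = H i x"
proof -
  have "H i x $ a $ b = H i x $ b $ a" for a b
  proof -
    have "closed {x \<in> closure \<Omega>. H i x $ a $ b - H i x $ b $ a = 0}"
      by (intro continuous_closed_preimage_constant continuous_intros cont_H closed_closure)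
    moreover have "\<Omega> \<subseteq> {x \<in> closure \<Omega>. H i x $ a $ b - H i x $ b $ a = 0}"
    proof
      fix x assume x: "x \<in> \<Omega>"
      have "transpose (H i x) $ a $ b = H i x $ a $ b" using H_symmetric[OF x] by simp
      then show "x \<in> {x \<in> closure \<Omega>. H i x $ a $ b - H i x $ b $ a = 0}" using dom_closure[OF x] by (simp add: transpose_def)
    qed
    ultimately have "closure \<Omega> \<subseteq> {x \<in> closure \<Omega>. H i x $ a $ b - H i x $ b $ a = 0}" by (intro closure_minimal)
    then show ?thesis using assms by auto
  qed
  then show ?thesis by (simp add: transpose_def vec_eq_iff)
qed

lemma H_near:
  assumes "y \<in> closure \<Omega>" "\<epsilon> > 0"
  shows "\<exists>d>0. \<forall>x\<in>closure \<Omega>. norm (x - y) < d \<longrightarrow> norm (H i x - H i y) \<le> \<epsilon>"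
  using cont_H[of i] assms unfolding continuous_on_iff dist_norm by (meson less_imp_le)

text \<open>Moving by \<open>t\<close> along a tangent changes the distance to the boundary by order
  \<open>t\<^sup>2\<close>. With vanishing Neumann data the gradient there is of order
  \<open>t\<^sup>2\<close> too, so its derivative along \<open>\<tau>\<close> is zero.\<close>

lemma H_tangent:
  assumes ci: "c i = 0" and y: "y \<in> frontier \<Omega>" and \<tau>: "norm \<tau> = 1" "\<tau> \<bullet> nu y = 0"
  shows "H i y *v \<tau> = 0"
proof -
  let ?\<nu> = "nu y"
  have n: "norm ?\<nu> = 1" by (rule norm_nu[OF y])
  have yc: "y \<in> closure \<Omega>" using y by (simp add: frontier_eq)
  obtain \<rho> where \<rho>: "\<rho> > 0" "ball (y + \<rho> *\<^sub>R ?\<nu>) \<rho> \<subseteq> \<Omega>" "ball (y - \<rho> *\<^sub>R ?\<nu>) \<rho> \<inter> \<Omega> = {}"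
    using touching_balls[OF y] by blast
  have inn: "y + a *\<^sub>R \<tau> + b *\<^sub>R ?\<nu> \<in> \<Omega>" if "a\<^sup>2 + b\<^sup>2 < 2 * b * \<rho>" for a b
    using ball_coords[OF \<tau>(1) n \<tau>(2) \<rho>(1), of y a b] that \<rho>(2) by blast
  have out: "y + a *\<^sub>R \<tau> - b *\<^sub>R ?\<nu> \<notin> \<Omega>" if "a\<^sup>2 + b\<^sup>2 < 2 * b * \<rho>" for a b
    using ball_coords[of \<tau> "- ?\<nu>" \<rho> y a b] \<tau> n \<rho> that by auto
  have "norm (H i y *v \<tau>) \<le> 0 + \<epsilon>" if \<epsilon>: "\<epsilon> > 0" for \<epsilon>
  proof -
    obtain d where d: "d > 0" "\<And>x. x \<in> closure \<Omega> \<Longrightarrow> norm (x - y) < d \<Longrightarrow> norm (H i x - H i y) \<le> \<epsilon> / 2"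
      using H_near[OF yc half_gt_zero[OF \<epsilon>], of i] by blast
    define t where "t = min (min (\<rho> / 2) (d / 4)) (\<epsilon> * \<rho> / (6 * CB))"
    have t: "0 < t" "t < \<rho>" "2 * t < d" "3 * CB * t / \<rho> \<le> \<epsilon> / 2"
    proof -
      show "0 < t" "t < \<rho>" "2 * t < d" using \<rho> d CB(1) \<epsilon> by (auto simp: t_def min_def)
      have "t \<le> \<epsilon> * \<rho> / (6 * CB)" by (simp add: t_def)
      then show "3 * CB * t / \<rho> \<le> \<epsilon> / 2" using CB(1) \<rho>(1) by (simp add: field_simps)
    qed
    \<comment> \<open>At this height above the tangent plane the point lies in the interior touching
      ball, at the same depth below it in the exterior one; the two points are \<open>2 * b\<close>
      apart.\<close>
    define b where "b = t\<^sup>2 / \<rho>"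
    have b: "0 < b" "b < t" "t\<^sup>2 = b * \<rho>" using t \<rho>(1) by (auto simp: b_def power2_eq_square field_simps)
    let ?v = "t *\<^sub>R \<tau> + b *\<^sub>R ?\<nu>"
    have bb: "t\<^sup>2 + b\<^sup>2 < 2 * b * \<rho>"
      using b t mult_strict_left_mono[of b \<rho> b] by (simp add: power2_eq_square)
    have zD: "y + ?v \<in> \<Omega>" using inn[OF bb] by (simp add: add.assoc)
    have seg: "y + s *\<^sub>R (y + ?v - y) \<in> \<Omega>" if s: "0 < s" "s < 1" for s
    proof -
      have "(s * t)\<^sup>2 + (s * b)\<^sup>2 = s * (s * (t\<^sup>2 + b\<^sup>2))" by (simp add: power2_eq_square algebra_simps)
      also have "\<dots> \<le> s * (t\<^sup>2 + b\<^sup>2)" using s by (intro mult_left_mono mult_left_le_one_le) auto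
      also have "\<dots> < s * (2 * b * \<rho>)" using s bb by simp
      finally have "y + (s * t) *\<^sub>R \<tau> + (s * b) *\<^sub>R ?\<nu> \<in> \<Omega>" by (intro inn) simp
      then show ?thesis by (simp add: scaleR_add_right add.assoc)
    qed
    let ?k = "H i y *v \<tau>"
    obtain s where s: "0 < s" "s < 1" "?k \<bullet> (G i (y + ?v) - G i y) = ?k \<bullet> (H i (y + s *\<^sub>R (y + ?v - y)) *v (y + ?v - y))"
      using mean_value_G[OF yc dom_closure[OF zD] seg] by blast
    define \<xi> where "\<xi> = y + s *\<^sub>R (y + ?v - y)"
    have \<xi>c: "\<xi> \<in> closure \<Omega>" using seg[OF s(1,2)] by (simp add: \<xi>_def dom_closure)
    have nv: "norm ?v \<le> 2 * t" using norm_triangle_ineq[of "t *\<^sub>R \<tau>" "b *\<^sub>R ?\<nu>"] \<tau> n t b by simp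
    have "norm (\<xi> - y) \<le> norm ?v" using s by (simp add: \<xi>_def mult_left_le_one_le)
    then have H\<xi>: "norm (H i \<xi> - H i y) \<le> \<epsilon> / 2" using nv t by (intro d(2)[OF \<xi>c]) simp
    have nG0: "norm (G i (y + ?v)) \<le> \<bar>c i\<bar> + CB * norm (y + ?v - (y + t *\<^sub>R \<tau> - b *\<^sub>R ?\<nu>))"
      by (rule G_near_boundary(1)[OF zD out[OF bb]])
    have "y + ?v - (y + t *\<^sub>R \<tau> - b *\<^sub>R ?\<nu>) = (b + b) *\<^sub>R ?\<nu>" unfolding scaleR_add_left by (simp only: add_diff_eq diff_diff_eq2 add_diff_cancel_left' add.assoc) simp
    moreover have "norm ((b + b) *\<^sub>R ?\<nu>) = 2 * b" using n b(1) by simp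
    ultimately have "norm (y + ?v - (y + t *\<^sub>R \<tau> - b *\<^sub>R ?\<nu>)) = 2 * b" by (simp only:)
    then have nG: "norm (G i (y + ?v)) \<le> CB * (2 * b)" using nG0 ci by (simp only: abs_zero add_0)
    have Gy: "G i y = 0" using G_boundary[OF y] ci by simp
    have "?k \<bullet> G i (y + ?v) = t * (?k \<bullet> (H i \<xi> *v \<tau>)) + b * (?k \<bullet> (H i \<xi> *v ?\<nu>))"
      using s(3) Gy unfolding \<xi>_def[symmetric]
      by (simp add: matrix_vector_right_distrib matrix_vector_mult_scaleR inner_add_right)
    moreover have "?k \<bullet> (H i \<xi> *v \<tau>) = ?k \<bullet> ?k + ?k \<bullet> ((H i \<xi> - H i y) *v \<tau>)"
      by (simp add: matrix_vector_mult_diff_rdistrib inner_diff_right)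
    then have "t * (?k \<bullet> (H i \<xi> *v \<tau>)) = t * (?k \<bullet> ?k) + t * (?k \<bullet> ((H i \<xi> - H i y) *v \<tau>))"
      by (simp only: distrib_left)
    ultimately have "t * (?k \<bullet> ?k) = ?k \<bullet> G i (y + ?v) - t * (?k \<bullet> ((H i \<xi> - H i y) *v \<tau>)) - b * (?k \<bullet> (H i \<xi> *v ?\<nu>))"
      by linarith
    also have "\<dots> \<le> norm ?k * (CB * (2 * b)) + t * (norm ?k * (\<epsilon> / 2)) + b * (norm ?k * CB)"
    proof -
      have "\<bar>?k \<bullet> G i (y + ?v)\<bar> \<le> norm ?k * (CB * (2 * b))"
        by (rule order_trans[OF Cauchy_Schwarz_ineq2 mult_left_mono[OF nG]]) simp
      moreover have "\<bar>?k \<bullet> ((H i \<xi> - H i y) *v \<tau>)\<bar> \<le> norm ?k * (\<epsilon> / 2)"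
      proof -
        have "norm ((H i \<xi> - H i y) *v \<tau>) \<le> \<epsilon> / 2" using norm_matrix_vector[of "H i \<xi> - H i y" \<tau>] H\<xi> \<tau> by simp
        then show ?thesis by (intro order_trans[OF Cauchy_Schwarz_ineq2 mult_left_mono]) auto
      qed
      then have "t * \<bar>?k \<bullet> ((H i \<xi> - H i y) *v \<tau>)\<bar> \<le> t * (norm ?k * (\<epsilon> / 2))" using t by (intro mult_left_mono) auto
      moreover have "\<bar>?k \<bullet> (H i \<xi> *v ?\<nu>)\<bar> \<le> norm ?k * CB"
      proof -
        have "norm (H i \<xi> *v ?\<nu>) \<le> CB" using norm_matrix_vector[of "H i \<xi>" ?\<nu>] CB(4)[OF \<xi>c, of i] n by simp
        then show ?thesis by (intro order_trans[OF Cauchy_Schwarz_ineq2 mult_left_mono]) auto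
      qed
      then have "b * \<bar>?k \<bullet> (H i \<xi> *v ?\<nu>)\<bar> \<le> b * (norm ?k * CB)" using b by (intro mult_left_mono) auto
      moreover have "- (a * r) \<le> a * \<bar>r\<bar>" if "0 < a" for a r :: real
        using that by (metis abs_ge_minus_self abs_mult abs_of_pos)
      note this[OF t(1), of "?k \<bullet> ((H i \<xi> - H i y) *v \<tau>)"] this[OF b(1), of "?k \<bullet> (H i \<xi> *v ?\<nu>)"]
      ultimately show ?thesis by linarith
    qed
    also have "\<dots> = t * (norm ?k * (3 * CB * t / \<rho> + \<epsilon> / 2))" using \<rho>(1) by (simp add: b_def power2_eq_square field_simps)
    also have "\<dots> \<le> t * (norm ?k * \<epsilon>)" using t by (intro mult_left_mono) auto
    finally have "norm ?k * norm ?k \<le> norm ?k * \<epsilon>" using t(1) by (simp add: dot_square_norm power2_eq_square)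
    then show ?thesis using \<epsilon> by (cases "norm ?k = 0") (auto simp: mult_le_cancel_left)
  qed
  then have "norm (H i y *v \<tau>) \<le> 0" by (rule field_le_epsilon)
  then show ?thesis by simp
qed

lemma H_boundary_form:
  assumes ci: "c i = 0" and y: "y \<in> frontier \<Omega>"
  shows "\<exists>b. H i y = b *\<^sub>R outer (nu y) (nu y)"
proof -
  let ?\<nu> = "nu y"
  have nn: "?\<nu> \<bullet> ?\<nu> = 1" using norm_nu[OF y] by (simp add: dot_square_norm)
  have yc: "y \<in> closure \<Omega>" using y by (simp add: frontier_eq)
  have z: "H i y *v \<tau> = 0" if "\<tau> \<bullet> ?\<nu> = 0" for \<tau>
  proof (cases "\<tau> = 0")
    case False
    have "H i y *v sgn \<tau> = 0" using False that by (intro H_tangent[OF ci y]) (auto simp: norm_sgn sgn_div_norm)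
    moreover have "\<tau> = norm \<tau> *\<^sub>R sgn \<tau>" using False by (simp add: sgn_div_norm)
    ultimately show ?thesis by (metis matrix_vector_mult_scaleR scaleR_zero_right)
  qed simp
  have sym: "a \<bullet> (H i y *v d) = d \<bullet> (H i y *v a)" for a d
    by (metis inner_commute inner_transpose transpose_H_closure[OF yc])
  let ?h = "H i y *v ?\<nu>"
  define b where "b = ?h \<bullet> ?\<nu>"
  have o: "(?h - b *\<^sub>R ?\<nu>) \<bullet> ?\<nu> = 0" by (simp add: inner_diff_left nn b_def)
  then have "?\<nu> \<bullet> (H i y *v (?h - b *\<^sub>R ?\<nu>)) = 0" using z by simp
  then have "(?h - b *\<^sub>R ?\<nu>) \<bullet> ?h = 0" by (metis sym)
  then have "(?h - b *\<^sub>R ?\<nu>) \<bullet> (?h - b *\<^sub>R ?\<nu>) = 0" using o by (simp add: inner_diff_right)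
  then have h: "?h = b *\<^sub>R ?\<nu>" by simp
  have "H i y *v v = (b *\<^sub>R outer ?\<nu> ?\<nu>) *v v" for v
  proof -
    have "(v - (v \<bullet> ?\<nu>) *\<^sub>R ?\<nu>) \<bullet> ?\<nu> = 0" by (simp add: inner_diff_left nn)
    then have "H i y *v (v - (v \<bullet> ?\<nu>) *\<^sub>R ?\<nu>) = 0" by (rule z)
    then show ?thesis
      by (simp add: matrix_vector_mult_diff_distrib matrix_vector_mult_scaleR h matrix_vector_scaleR_left outer_mult inner_commute mult.commute)
  qed
  then show ?thesis by (intro exI[of _ b]) (simp add: matrix_eq)
qed

text \<open>If the normal second derivative \<open>b\<close> were not positive, monotonicity of \<open>f\<close> in the
  unknowns would make \<open>u i\<close> a supersolution, and the Hopf lemma would give \<open>c i > 0\<close>.\<close>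

lemma H_boundary_pos:
  assumes ci: "c i = 0" and y: "y \<in> frontier \<Omega>"
  shows "\<exists>b>0. H i y = b *\<^sub>R outer (nu y) (nu y)"
proof (rule ccontr)
  assume no: "\<not> ?thesis"
  obtain b where b: "H i y = b *\<^sub>R outer (nu y) (nu y)" using H_boundary_form[OF ci y] by blast
  have b0: "b \<le> 0" using no b by (metis not_less)
  have yc: "y \<in> closure \<Omega>" "y \<notin> \<Omega>" using y by (auto simp: frontier_eq)
  obtain \<alpha> \<beta> \<gamma> where h: "0 < \<alpha>" "\<alpha> \<le> \<beta>" "0 \<le> \<gamma>" "F i 0 0 = 0"
    "\<And>p q X Y. transpose X = X \<Longrightarrow> transpose Y = Y \<Longrightarrow>
      pucci_minus \<alpha> \<beta> (X - Y) - \<gamma> * norm (p - q) \<le> F i p X - F i q Y" using H1E[of i] by metis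
  obtain K where K: "K \<ge> 0" "\<And>a b p q. (\<forall>j. 0 \<le> a $ j \<and> a $ j \<le> b $ j \<and> b $ j \<le> CB) \<Longrightarrow> norm p \<le> CB \<Longrightarrow> norm q \<le> CB \<Longrightarrow>
     f i a p - K * ((b $ i - a $ i) + norm (q - p)) \<le> f i b q" using f_lower[of i] by blast
  define C where "C = (real CARD('N))\<^sup>2 * \<beta>"
  have t0: "transpose (0::real^'N^'N) = 0" by (simp add: transpose_def vec_eq_iff)
  have FH: "F i 0 (H i y) \<le> 0"
  proof -
    have "0 \<le> pucci_minus \<alpha> \<beta> (0 - H i y)"
    proof (rule pucci_minus_ge[OF h(2)])
      fix A :: "real^'N^'N" assume A: "A \<in> pucci_class \<alpha> \<beta>"
      have "0 \<le> nu y \<bullet> (A *v nu y)"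
        using pucci_classD(2)[OF A, of "nu y"] h(1) norm_nu[OF y] by (simp add: dot_square_norm)
      then have "0 \<le> (- b) * (nu y \<bullet> (A *v nu y))" using b0 by (intro mult_nonneg_nonneg) auto
      moreover have "0 - H i y = (- b) *\<^sub>R outer (nu y) (nu y)" by (simp add: b)
      ultimately show "0 \<le> trace (A ** (0 - H i y))" by (simp only: trace_simps)
    qed
    then show ?thesis using h(5)[OF t0 transpose_H_closure[OF yc(1), of i], of 0 0] h(4) by simp
  qed
  \<comment> \<open>Since \<open>f i\<close> may be discontinuous in the unknowns, its value at the
    boundary data is of no use. The equation is taken at points \<open>x'\<close> tending to
    \<open>y\<close>, where all components are eventually smaller than at \<open>x\<close>, and only
    the resulting inequality passes to the limit.\<close>
  have lower: "- K * (u i x + norm (G i x)) \<le> f i (\<chi> j. u j x) (G i x)" if x: "x \<in> \<Omega>" for x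
  proof -
    let ?R = "\<lambda>x'. - (C * norm (H i y - H i x') + \<gamma> * norm (G i x')) - K * ((u i x - u i x') + norm (G i x - G i x'))"
    have nt: "at y within \<Omega> \<noteq> bot"
      using yc by (auto simp: trivial_limit_within islimpt_in_closure)
    have lim: "(g \<longlongrightarrow> g y) (at y within \<Omega>)" if "continuous_on (closure \<Omega>) g" for g :: "real^'N \<Rightarrow> 'z::topological_space"
      using that yc(1) closure_subset[of \<Omega>] unfolding continuous_on_def by (metis tendsto_within_subset)
    have Gy: "G i y = 0" using G_boundary[OF y] ci by simp
    have "(?R \<longlongrightarrow> - (C * norm (H i y - H i y) + \<gamma> * norm (G i y)) - K * ((u i x - u i y) + norm (G i x - G i y))) (at y within \<Omega>)"
      by (intro tendsto_intros lim cont_u cont_G cont_H)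
    then have limR: "(?R \<longlongrightarrow> - K * (u i x + norm (G i x))) (at y within \<Omega>)"
      using u_zero[OF y] Gy by simp
    have ev: "\<forall>\<^sub>F x' in at y within \<Omega>. \<forall>j. u j x' < u j x"
    proof (rule eventually_all_finite)
      fix j
      show "\<forall>\<^sub>F x' in at y within \<Omega>. u j x' < u j x"
        using lim[OF cont_u[of j]] u_zero[OF y] u_pos[OF x] by (intro order_tendstoD(2)[of _ "u j y"]) auto
    qed
    have "\<forall>\<^sub>F x' in at y within \<Omega>. x' \<in> \<Omega>" by (simp add: eventually_at_filter)
    then have "\<forall>\<^sub>F x' in at y within \<Omega>. ?R x' \<le> f i (\<chi> j. u j x) (G i x)"
      using ev
    proof eventually_elim
      case (elim x')
      have "f i (\<chi> j. u j x') (G i x') - K * (((\<chi> j. u j x) $ i - (\<chi> j. u j x') $ i) + norm (G i x - G i x')) \<le> f i (\<chi> j. u j x) (G i x)"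
      proof (rule K(2))
        show "\<forall>j. 0 \<le> (\<chi> j. u j x') $ j \<and> (\<chi> j. u j x') $ j \<le> (\<chi> j. u j x) $ j \<and> (\<chi> j. u j x) $ j \<le> CB"
          using elim u_pos[OF elim(1)] CB(2)[OF dom_closure[OF x]] by (auto simp: less_imp_le abs_le_iff)
        show "norm (G i x') \<le> CB" "norm (G i x) \<le> CB" using CB(3) dom_closure x elim(1) by auto
      qed
      moreover have "pucci_minus \<alpha> \<beta> (H i y - H i x') - \<gamma> * norm (0 - G i x') \<le> F i 0 (H i y) - F i (G i x') (H i x')"
        by (rule h(5)[OF transpose_H_closure[OF yc(1)] H_symmetric[OF elim(1)]])
      moreover have "- (C * norm (H i y - H i x')) \<le> pucci_minus \<alpha> \<beta> (H i y - H i x')"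
        unfolding C_def by (rule pucci_minus_ge_norm[OF h(1,2)])
      ultimately show ?case using pde[OF elim(1), of i] FH by simp
    qed
    then show ?thesis using tendsto_upperbound[OF limR _ nt] by blast
  qed
  have s: "supersol \<alpha> \<beta> (K + \<gamma>) (u i) (G i) (H i) \<Omega>"
    unfolding supersol_def
  proof (intro conjI ballI jet_u)
    fix x assume x: "x \<in> \<Omega>"
    show u0: "0 \<le> u i x" using u_pos[OF x, of i] by simp
    have "pucci_minus \<alpha> \<beta> (H i x) \<le> F i (G i x) (H i x) + \<gamma> * norm (G i x)"
      using h(5)[OF H_symmetric[OF x, of i] t0, of "G i x" 0] h(4) by simp
    also have "F i (G i x) (H i x) \<le> K * (u i x + norm (G i x))" using lower[OF x] pde[OF x, of i] by simp
    finally have "pucci_minus \<alpha> \<beta> (H i x) \<le> K * (u i x + norm (G i x)) + \<gamma> * norm (G i x)" by simp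
    also have "\<dots> \<le> (K + \<gamma>) * (norm (G i x) + u i x)" using mult_nonneg_nonneg[OF h(3) u0] by (simp add: algebra_simps)
    finally show "pucci_minus \<alpha> \<beta> (H i x) \<le> (K + \<gamma>) * (norm (G i x) + u i x)" .
  qed (use h K in auto)
  obtain \<rho> where \<rho>: "\<rho> > 0" "ball (y + \<rho> *\<^sub>R nu y) \<rho> \<subseteq> \<Omega>" using touching_balls[OF y] by blast
  obtain k where k: "k > 0" "\<And>t. 0 < t \<Longrightarrow> t < \<rho> \<Longrightarrow> y + t *\<^sub>R nu y \<in> \<Omega> \<and> k * t \<le> u i (y + t *\<^sub>R nu y)"
    using hopf_normal[OF s \<rho>(2,1) norm_nu[OF y]] u_pos \<rho>(2) by blast
  define t where "t = min (\<rho> / 2) (k / (2 * CB))"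
  have t: "0 < t" "t < \<rho>" "CB * t < k" using \<rho> k CB(1) by (auto simp: t_def min_def field_simps)
  have "u i (y + t *\<^sub>R nu y) \<le> CB * (norm (y + t *\<^sub>R nu y - y))\<^sup>2"
    using G_near_boundary(2)[OF _ yc(2) ci] k(2) t by blast
  also have "\<dots> = CB * t * t" using norm_nu[OF y] t by (simp add: power2_eq_square)
  finally have "k * t \<le> CB * t * t" using k(2)[OF t(1,2)] by linarith
  then have "k \<le> CB * t" using t(1) by (simp add: mult_le_cancel_right)
  then show False using t(3) by simp
qed

end

context overdetermined
begin

section \<open>Corners with vanishing Neumann data\<close>

lemma jet_powr:
  assumes "jet w p X D" "\<And>x. x \<in> D \<Longrightarrow> 0 < w x"
  shows "jet (\<lambda>x. w x powr a) (\<lambda>x. (a * w x powr (a - 1)) *\<^sub>R p x)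
    (\<lambda>x. (a * w x powr (a - 1)) *\<^sub>R X x + (a * (a - 1) * w x powr (a - 2)) *\<^sub>R outer (p x) (p x)) D"
proof (rule jet_compose[OF assms(1)])
  fix x assume x: "x \<in> D"
  show "((\<lambda>m. m powr a) has_real_derivative a * w x powr (a - 1)) (at (w x))"
    by (rule has_real_derivative_powr[OF assms(2)[OF x]])
  have "((\<lambda>m. a * m powr (a - 1)) has_real_derivative a * ((a - 1) * w x powr (a - 1 - 1))) (at (w x))"
    by (rule DERIV_cmult[OF has_real_derivative_powr[OF assms(2)[OF x]]])
  then show "((\<lambda>m. a * m powr (a - 1)) has_real_derivative a * (a - 1) * w x powr (a - 2)) (at (w x))"
    by (simp add: mult.assoc)
qed

text \<open>Comparison of \<open>u i\<close> with its reflection, where the reflected equation is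
  additionally rotated by \<open>Q\<close>.\<close>

lemma no_touching_rotated:
  "\<exists>\<alpha> \<beta> K. 0 < \<alpha> \<and> \<alpha> \<le> \<beta> \<and> 0 \<le> K \<and>
    (\<forall>e l D \<phi> q Z x \<epsilon> Q t. norm e = 1 \<longrightarrow> dominated e l \<longrightarrow> D \<subseteq> cap e l \<longrightarrow> jet \<phi> q Z D \<longrightarrow> x \<in> D \<longrightarrow> 0 < \<epsilon> \<longrightarrow>
      (\<forall>y\<in>D. wdiff i e l x - \<epsilon> * \<phi> x \<le> wdiff i e l y - \<epsilon> * \<phi> y) \<longrightarrow> wdiff i e l x \<le> \<epsilon> * \<phi> x \<longrightarrow>
      orthogonal_matrix Q \<longrightarrow>
      (\<forall>A\<in>pucci_class \<alpha> \<beta>. t \<le> \<epsilon> * trace (A ** Z x) + trace (A ** (H i x - Q ** H i x ** transpose Q))) \<longrightarrow>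
      t \<le> K * (\<epsilon> * \<phi> x + \<epsilon> * norm (q x) + norm (Q *v rG i e l x - rG i e l x)))"
proof -
  obtain \<alpha> \<beta> \<gamma> where h: "0 < \<alpha>" "\<alpha> \<le> \<beta>" "0 \<le> \<gamma>"
    "\<And>p q X Y. transpose X = X \<Longrightarrow> transpose Y = Y \<Longrightarrow>
      pucci_minus \<alpha> \<beta> (X - Y) - \<gamma> * norm (p - q) \<le> F i p X - F i q Y" using H1E[of i] by metis
  obtain K where K: "K \<ge> 0" "\<And>e l x. norm e = 1 \<Longrightarrow> dominated e l \<Longrightarrow> x \<in> cap e l \<Longrightarrow>
     F i (rG i e l x) (rH i e l x) - F i (G i x) (H i x) \<le> K * (wdiff i e l x + norm (rG i e l x - G i x))"
    using reflected_difference[of i] by blast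
  obtain L where L: "L \<ge> 0" "\<And>a b p q. (\<forall>j. 0 \<le> a $ j \<and> a $ j \<le> b $ j \<and> b $ j \<le> CB) \<Longrightarrow> norm p \<le> CB \<Longrightarrow> norm q \<le> CB \<Longrightarrow>
     f i a p - L * ((b $ i - a $ i) + norm (q - p)) \<le> f i b q" using f_lower[of i] by blast
  have "t \<le> (K + L + \<gamma>) * (\<epsilon> * \<phi> x + \<epsilon> * norm (q x) + norm (Q *v rG i e l x - rG i e l x))"
    if e: "norm e = 1" and d: "dominated e l" and D: "D \<subseteq> cap e l" and j: "jet \<phi> q Z D" and x: "x \<in> D" and \<epsilon>: "0 < \<epsilon>"
      and min: "\<forall>y\<in>D. wdiff i e l x - \<epsilon> * \<phi> x \<le> wdiff i e l y - \<epsilon> * \<phi> y" and below: "wdiff i e l x \<le> \<epsilon> * \<phi> x"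
      and Q: "orthogonal_matrix Q"
      and t: "\<forall>A\<in>pucci_class \<alpha> \<beta>. t \<le> \<epsilon> * trace (A ** Z x) + trace (A ** (H i x - Q ** H i x ** transpose Q))"
    for e l D \<phi> q Z x \<epsilon> Q t
  proof -
    have xc: "x \<in> cap e l" using x D by blast
    have xD: "x \<in> \<Omega>" "mirror e l x \<in> \<Omega>" using xc cap_mirror_in[OF d xc] by (auto simp: cap_def)
    have oD: "open D" using j by (rule jetD)
    note m = jet_local_min[OF jet_diff[OF jet_subset[OF jet_wdiff[OF e d, of i] D oD] jet_cmult[OF j, of \<epsilon>]] x min[rule_format]]
    let ?p = "G i x" and ?q = "rG i e l x" and ?Y = "H i x" and ?X = "rH i e l x" and ?v = "\<chi> j. u j (mirror e l x)"
    have pq: "?q - ?p = \<epsilon> *\<^sub>R q x" using m(1) by simp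
    have w0: "0 \<le> wdiff i e l x" using cap_le[OF d xc, of i] by (simp add: wdiff_def)
    have nq: "norm ?q \<le> CB" using norm_rG[OF e, of i l x] CB(3)[OF dom_closure[OF xD(2)], of i] by simp
    have Qiso: "norm (Q *v ?q) = norm ?q" using Q by (simp add: orthogonal_transformation_matrix orthogonal_transformation_norm)
    have QX: "transpose (transpose Q ** ?X ** Q) = transpose Q ** ?X ** Q"
      by (simp add: matrix_transpose_mul transpose_rH[OF xD(2)] matrix_mul_assoc)
    \<comment> \<open>After conjugation the test matrix meets \<open>rH\<close> minus the rotated
      Hessian of \<open>u i\<close>. This splits into the Hessian of the difference, which dominates
      that of the barrier, and the rotation defect that appears in the hypothesis on
      \<open>t\<close>.\<close>
    have "t \<le> pucci_minus \<alpha> \<beta> (transpose Q ** ?X ** Q - ?Y)"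
    proof (rule pucci_minus_ge[OF h(2)])
      fix A :: "real^'N^'N" assume A: "A \<in> pucci_class \<alpha> \<beta>"
      let ?A' = "Q ** A ** transpose Q"
      have A': "?A' \<in> pucci_class \<alpha> \<beta>" by (rule pucci_class_conj[OF A Q])
      have QQ: "transpose Q ** Q = mat 1" using Q by (simp add: orthogonal_matrix_def)
      have "trace (A ** (transpose Q ** ?X ** Q)) = trace (?A' ** ?X)"
      proof -
        have "trace (A ** (transpose Q ** ?X ** Q)) = trace ((A ** transpose Q ** ?X) ** Q)" by (simp only: matrix_mul_assoc)
        also have "\<dots> = trace (Q ** (A ** transpose Q ** ?X))" by (rule trace_mul_sym)
        finally show ?thesis by (simp only: matrix_mul_assoc)
      qed
      moreover have "trace (?A' ** (Q ** ?Y ** transpose Q)) = trace (A ** ?Y)"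
      proof -
        have "?A' ** (Q ** ?Y ** transpose Q) = Q ** (A ** (transpose Q ** Q) ** ?Y ** transpose Q)"
          by (simp only: matrix_mul_assoc)
        then have "trace (?A' ** (Q ** ?Y ** transpose Q)) = trace (Q ** (A ** ?Y ** transpose Q))" by (simp add: QQ)
        also have "\<dots> = trace (A ** ?Y ** transpose Q ** Q)" by (rule trace_mul_sym)
        also have "A ** ?Y ** transpose Q ** Q = A ** ?Y" by (simp add: QQ flip: matrix_mul_assoc)
        finally show ?thesis .
      qed
      moreover have "trace (?A' ** (\<epsilon> *\<^sub>R Z x)) \<le> trace (?A' ** (?X - ?Y))"
      proof (rule trace_class_mono[OF A' h(1)])
        show "h \<bullet> (\<epsilon> *\<^sub>R Z x *v h) \<le> h \<bullet> ((?X - ?Y) *v h)" for h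
          using m(2)[of h] by (simp add: matrix_vector_mult_diff_rdistrib inner_diff_right)
      qed
      moreover have "t \<le> \<epsilon> * trace (?A' ** Z x) + trace (?A' ** (?Y - Q ** ?Y ** transpose Q))" using t A' by blast
      ultimately show "t \<le> trace (A ** (transpose Q ** ?X ** Q - ?Y))" by (simp add: trace_simps)
    qed
    also have "\<dots> \<le> F i (Q *v ?q) (transpose Q ** ?X ** Q) - F i ?p ?Y + \<gamma> * norm (Q *v ?q - ?p)"
      using h(4)[OF QX H_symmetric[OF xD(1), of i], of "Q *v ?q" ?p] by simp
    finally have t1: "t \<le> F i (Q *v ?q) (transpose Q ** ?X ** Q) - F i ?p ?Y + \<gamma> * norm (Q *v ?q - ?p)" .
    have t2: "F i (Q *v ?q) (transpose Q ** ?X ** Q) = F i ?q ?X + f i ?v ?q - f i ?v (Q *v ?q)"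
      using H0_rule[OF Q transpose_rH[OF xD(2), of i], of i ?q ?v] by simp
    \<comment> \<open>Invariance holds only for the sum of \<open>F i\<close> and
      \<open>f i\<close>. The change of \<open>f i\<close> under rotation of the gradient is bounded
      by \<open>f_lower\<close> with equal component values.\<close>
    have t3: "f i ?v ?q - L * ((?v $ i - ?v $ i) + norm (Q *v ?q - ?q)) \<le> f i ?v (Q *v ?q)"
    proof (rule L(2))
      show "\<forall>j. 0 \<le> ?v $ j \<and> ?v $ j \<le> ?v $ j \<and> ?v $ j \<le> CB"
        using u_pos[OF xD(2)] CB(2)[OF dom_closure[OF xD(2)]] by (auto simp: less_imp_le abs_le_iff)
    qed (use nq Qiso in auto)
    have "t \<le> F i ?q ?X - F i ?p ?Y + L * norm (Q *v ?q - ?q) + \<gamma> * norm (Q *v ?q - ?p)"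
      using t1 t2 t3 by simp
    also have "F i ?q ?X - F i ?p ?Y \<le> K * (wdiff i e l x + norm (?q - ?p))" by (rule K(2)[OF e d xc])
    finally have "t \<le> K * (wdiff i e l x + \<epsilon> * norm (q x)) + L * norm (Q *v ?q - ?q) + \<gamma> * norm (Q *v ?q - ?p)"
      using \<epsilon> by (simp add: pq)
    also have "\<dots> \<le> K * (\<epsilon> * \<phi> x + \<epsilon> * norm (q x)) + L * norm (Q *v ?q - ?q) + \<gamma> * (norm (Q *v ?q - ?q) + \<epsilon> * norm (q x))"
    proof -
      have "norm (Q *v ?q - ?p) \<le> norm (Q *v ?q - ?q) + norm (?q - ?p)" by (metis dist_norm dist_triangle)
      then have "norm (Q *v ?q - ?p) \<le> norm (Q *v ?q - ?q) + \<epsilon> * norm (q x)" using \<epsilon> by (simp add: pq)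
      then have "\<gamma> * norm (Q *v ?q - ?p) \<le> \<gamma> * (norm (Q *v ?q - ?q) + \<epsilon> * norm (q x))" using h(3) by (rule mult_left_mono)
      moreover have "K * (wdiff i e l x + \<epsilon> * norm (q x)) \<le> K * (\<epsilon> * \<phi> x + \<epsilon> * norm (q x))"
        using K(1) below by (intro mult_left_mono) auto
      ultimately show ?thesis by linarith
    qed
    also have "\<dots> \<le> (K + L + \<gamma>) * (\<epsilon> * \<phi> x + \<epsilon> * norm (q x) + norm (Q *v ?q - ?q))"
    proof -
      define a b c where "a = \<epsilon> * \<phi> x" "b = \<epsilon> * norm (q x)" "c = norm (Q *v ?q - ?q)"
      have "0 \<le> a" "0 \<le> b" "0 \<le> c" using w0 below \<epsilon> by (auto simp: a_b_c_def)
      then have "0 \<le> L * a" "0 \<le> L * b" "0 \<le> \<gamma> * a" "0 \<le> K * c" using L(1) h(3) K(1) by auto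
      then have "K * (a + b) + L * c + \<gamma> * (c + b) \<le> (K + L + \<gamma>) * (a + b + c)" by (simp add: algebra_simps)
      then show ?thesis by (simp add: a_b_c_def)
    qed
    finally show ?thesis .
  qed
  then show ?thesis using h K L
    by (intro exI[of _ \<alpha>] exI[of _ \<beta>] exI[of _ "K + L + \<gamma>"] conjI allI impI) auto
qed

text \<open>The barrier is \<open>(x\<^sub>1 s)\<^bsup>5/4\<^esup>\<close> with \<open>x\<^sub>1 = (x - y) \<bullet> e\<close> and \<open>s = (x - y) \<bullet> \<nu> - \<kappa> |x - y|\<^sup>2\<close>. Its degree
  \<open>5/2\<close> at the corner leads to a contradiction along the curve \<open>x\<^sub>1 = t, s \<approx> t\<^sup>2\<close>,
  on which \<open>u\<close> is of order \<open>t\<^sup>4\<close>.\<close>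

lemma corner_degenerate:
  assumes st: "strict e l" and ci: "c i = 0" and y: "y \<in> frontier \<Omega>" "y \<bullet> e = l" "nu y \<bullet> e = 0"
  shows False
proof -
  define \<nu> where "\<nu> = nu y"
  have e: "norm e = 1" and d: "dominated e l" using st by (auto simp: strict_def)
  have n: "norm \<nu> = 1" using norm_nu[OF y(1)] by (simp add: \<nu>_def)
  have en: "e \<bullet> \<nu> = 0" "\<nu> \<bullet> e = 0" using y(3) by (auto simp: \<nu>_def inner_commute)
  have ii: "e \<bullet> e = 1" "\<nu> \<bullet> \<nu> = 1" using e n by (simp_all add: dot_square_norm)
  have yc: "y \<in> closure \<Omega>" "y \<notin> \<Omega>" using y(1) by (auto simp: frontier_eq)
  obtain b where b: "0 < b" "H i y = b *\<^sub>R outer \<nu> \<nu>" using H_boundary_pos[OF ci y(1)] by (auto simp: \<nu>_def)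
  obtain \<rho> where \<rho>: "\<rho> > 0" "ball (y + \<rho> *\<^sub>R \<nu>) \<rho> \<subseteq> \<Omega>" "ball (y - \<rho> *\<^sub>R \<nu>) \<rho> \<inter> \<Omega> = {}"
    using touching_balls[OF y(1)] by (auto simp: \<nu>_def)
  \<comment> \<open>With this \<open>\<kappa>\<close> the set where \<open>s \<ge> 0\<close> is the
    closed ball of radius \<open>\<rho> / 2\<close> that touches at \<open>y\<close>; all its points
    other than \<open>y\<close> lie in the domain.\<close>
  define \<kappa> where "\<kappa> = 1 / \<rho>"
  have \<kappa>: "\<kappa> > 0" using \<rho> by (simp add: \<kappa>_def)
  obtain \<alpha> \<beta> K where K: "0 < \<alpha>" "\<alpha> \<le> \<beta>" "0 \<le> K"
    "\<And>e l D \<phi> q Z x \<epsilon> Q t. norm e = 1 \<Longrightarrow> dominated e l \<Longrightarrow> D \<subseteq> cap e l \<Longrightarrow> jet \<phi> q Z D \<Longrightarrow> x \<in> D \<Longrightarrow> 0 < \<epsilon> \<Longrightarrow>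
      (\<forall>y\<in>D. wdiff i e l x - \<epsilon> * \<phi> x \<le> wdiff i e l y - \<epsilon> * \<phi> y) \<Longrightarrow> wdiff i e l x \<le> \<epsilon> * \<phi> x \<Longrightarrow>
      orthogonal_matrix Q \<Longrightarrow>
      (\<forall>A\<in>pucci_class \<alpha> \<beta>. t \<le> \<epsilon> * trace (A ** Z x) + trace (A ** (H i x - Q ** H i x ** transpose Q))) \<Longrightarrow>
      t \<le> K * (\<epsilon> * \<phi> x + \<epsilon> * norm (q x) + norm (Q *v rG i e l x - rG i e l x))"
    using no_touching_rotated[of i] by blast
  have \<beta>0: "\<beta> > 0" using K by simp
  define N where "N = real CARD('N)"
  have N1: "N \<ge> 1" unfolding N_def by (simp add: Suc_leI)
  define C1 where "C1 = 4 * N\<^sup>2 * (norm (mat 1 :: real^'N^'N) + 5) * \<beta>"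
  have C10: "C1 > 0" unfolding C1_def using N1 \<beta>0 by (intro mult_pos_pos) (auto simp: add_nonneg_pos)
  define C2 where "C2 = 2 * \<kappa> * (N * \<beta>) + 4 * \<kappa> * \<beta> + 4 * K + 4 * K * CB / b"
  have C20: "C2 > 0" unfolding C2_def using \<kappa> N1 \<beta>0 K(3) CB(1) b by (intro add_pos_nonneg) auto
  define \<eta> where "\<eta> = \<alpha> * b / (32 * C1)"
  have \<eta>: "\<eta> > 0" "C1 * \<eta> / b = \<alpha> / 32" using K C10 b by (auto simp: \<eta>_def)
  obtain d0 where d0: "d0 > 0" "\<And>x. x \<in> closure \<Omega> \<Longrightarrow> norm (x - y) < d0 \<Longrightarrow> norm (H i x - H i y) \<le> \<eta>"
    using H_near[OF yc(1) \<eta>(1), of i] by blast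
  \<comment> \<open>Convexity of the power in the barrier will yield a gain
    \<open>\<alpha> / 4\<close>. The errors from lower order terms, from the size of
    \<open>\<tau>\<close> and from \<open>\<eta>\<close> are each given the share
    \<open>\<alpha> / 32\<close>.\<close>
  define r where "r = min (min 1 (1 / (8 * \<kappa>))) (min (d0 / 2) (\<alpha> / (32 * C2)))"
  have r: "0 < r" "r \<le> 1" "8 * \<kappa> * r \<le> 1" "r < d0" "C2 * r \<le> \<alpha> / 32"
  proof -
    have "r \<le> 1 / (8 * \<kappa>)" "r \<le> \<alpha> / (32 * C2)" by (simp_all add: r_def)
    then show "8 * \<kappa> * r \<le> 1" "C2 * r \<le> \<alpha> / 32" using \<kappa> C20 by (simp_all add: field_simps)
    show "0 < r" using \<kappa> d0(1) K(1) C20 by (simp add: r_def)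
    show "r \<le> 1" by (simp add: r_def)
    have "r \<le> d0 / 2" by (simp add: r_def)
    then show "r < d0" using d0(1) by simp
  qed
  define s where "s = (\<lambda>x. (x - y) \<bullet> \<nu> - \<kappa> * ((x - y) \<bullet> (x - y)))"
  define m where "m = (\<lambda>x. ((x - y) \<bullet> e) * s x)"
  let ?\<phi> = "\<lambda>x. m x powr (5/4)"
  have sball: "x \<in> \<Omega>" if "0 \<le> s x" "x \<noteq> y" for x
  proof -
    let ?h = "x - y"
    have p: "0 < ?h \<bullet> ?h" using that by simp
    have "?h \<bullet> ?h \<le> \<rho> * (?h \<bullet> \<nu>)" using that(1) \<rho>(1) by (simp add: s_def \<kappa>_def field_simps)
    moreover have "(norm (h - \<rho> *\<^sub>R \<nu>))\<^sup>2 = h \<bullet> h - 2 * (\<rho> * (h \<bullet> \<nu>)) + \<rho>\<^sup>2" for h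
      unfolding power2_norm_eq_inner
      by (simp add: inner_diff_left inner_diff_right ii inner_commute[of \<nu> h] power2_eq_square right_diff_distrib)
    note this[of ?h]
    ultimately have "(norm (?h - \<rho> *\<^sub>R \<nu>))\<^sup>2 < \<rho>\<^sup>2" using p by linarith
    then have "norm (?h - \<rho> *\<^sub>R \<nu>) < \<rho>" using \<rho>(1) by (simp add: power2_less_imp_less)
    then have "dist (y + \<rho> *\<^sub>R \<nu>) x < \<rho>" by (metis (no_types, lifting) diff_diff_add dist_commute dist_norm)
    then show ?thesis using \<rho>(2) by auto
  qed
  have sle: "s x \<le> norm (x - y)" for x
  proof -
    have "(x - y) \<bullet> \<nu> \<le> norm (x - y)" using norm_cauchy_schwarz[of "x - y" \<nu>] n by simp
    moreover have "0 \<le> \<kappa> * ((x - y) \<bullet> (x - y))" using \<kappa> by simp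
    ultimately show ?thesis by (simp add: s_def)
  qed
  have x1le: "(x - y) \<bullet> e \<le> norm (x - y)" for x using norm_cauchy_schwarz[of "x - y" e] e by simp
  have mle: "m x \<le> norm (x - y)" if "norm (x - y) \<le> r" "0 \<le> (x - y) \<bullet> e" "0 \<le> s x" for x
  proof -
    have "m x \<le> norm (x - y) * norm (x - y)" unfolding m_def using x1le[of x] sle[of x] that by (intro mult_mono) auto
    also have "\<dots> \<le> norm (x - y) * 1" using that r by (intro mult_left_mono) auto
    finally show ?thesis by simp
  qed
  define Kc where "Kc = cball y r \<inter> ({x. 0 \<le> (x - y) \<bullet> e} \<inter> {x. 0 \<le> s x})"
  have cs: "continuous_on UNIV s" unfolding s_def by (intro continuous_intros)
  have "closed ({x. 0 \<le> (x - y) \<bullet> e} \<inter> {x. 0 \<le> s x})"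
    by (intro closed_Int closed_Collect_le continuous_intros cs)
  then have compKc: "compact Kc" unfolding Kc_def by (intro compact_Int_closed compact_cball)
  define K1 where "K1 = Kc \<inter> sphere y r"
  have compK1: "compact K1" unfolding K1_def using compKc by (intro compact_Int_closed closed_sphere)
  have K1\<Omega>: "x \<in> \<Omega>" if "x \<in> K1" for x
    using that sball[of x] r by (auto simp: K1_def Kc_def)
  have K1l: "l \<le> x \<bullet> e" if "x \<in> K1" for x using that y(2) by (auto simp: K1_def Kc_def inner_diff_left)
  obtain k where k: "k > 0" "\<And>x. x \<in> K1 \<Longrightarrow> k * (x \<bullet> e - l) \<le> ut i (mirror e l x) - ut i x"
    using strict_linear_growth[OF st compK1, of i] K1\<Omega> K1l dom_closure by blast
  \<comment> \<open>The bound by \<open>k\<close> settles the sphere; the other one keeps the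
    rotation parameter \<open>\<tau>\<close> below \<open>\<alpha> / (96 * \<beta>)\<close>.\<close>
  define \<epsilon> where "\<epsilon> = min k (b * (4 / 5) * (\<alpha> / (96 * \<beta>)))"
  have \<epsilon>: "\<epsilon> > 0" "\<epsilon> \<le> k" "\<epsilon> * (5 / 4) / b \<le> \<alpha> / (96 * \<beta>)"
  proof -
    show "\<epsilon> > 0" "\<epsilon> \<le> k" using k(1) b(1) K(1) \<beta>0 by (auto simp: \<epsilon>_def)
    have "\<epsilon> \<le> b * (4 / 5) * (\<alpha> / (96 * \<beta>))" by (simp add: \<epsilon>_def)
    then have "\<epsilon> * (5 / 4) / b \<le> b * (4 / 5) * (\<alpha> / (96 * \<beta>)) * (5 / 4) / b" using b by (intro divide_right_mono mult_right_mono) auto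
    also have "\<dots> = \<alpha> / (96 * \<beta>)" using b by simp
    finally show "\<epsilon> * (5 / 4) / b \<le> \<alpha> / (96 * \<beta>)" .
  qed
  let ?g = "\<lambda>x. ut i (mirror e l x) - ut i x - \<epsilon> * ?\<phi> x"
  have m0: "0 \<le> m x" if "x \<in> Kc" for x using that by (simp add: m_def Kc_def)
  have cm: "continuous_on S m" for S unfolding m_def using cs continuous_on_subset by (intro continuous_intros) blast
  have cg: "continuous_on Kc ?g"
    using m0 by (intro continuous_intros continuous_on_powr' cm continuous_ut continuous_on_compose2[OF continuous_ut[of UNIV] continuous_mirror[OF e]]) auto
  have "y \<in> Kc" using r by (simp add: Kc_def s_def)
  then have "Kc \<noteq> {}" by blast
  then obtain x where x: "x \<in> Kc" "\<And>z. z \<in> Kc \<Longrightarrow> ?g x \<le> ?g z" using continuous_attains_inf[OF compKc _ cg] by blast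
  \<comment> \<open>Where \<open>m\<close> vanishes so does the barrier, and domination suffices; on
    the sphere \<open>strict_linear_growth\<close> applies. What remains is a negative minimum in
    the open region, which \<open>no_touching_rotated\<close> excludes.\<close>
  have nonneg: "0 \<le> ?g x"
  proof (rule ccontr)
    assume neg: "\<not> 0 \<le> ?g x"
    have "ut i x \<le> ut i (mirror e l x)" using d x(1) y(2) by (auto simp: dominated_def Kc_def inner_diff_left)
    then have "0 < \<epsilon> * ?\<phi> x" using neg by linarith
    then have "m x \<noteq> 0" using \<epsilon>(1) by auto
    then have mx: "0 < m x" using m0[OF x(1)] by simp
    then have pos: "0 < (x - y) \<bullet> e" "0 < s x" using x(1) by (auto simp: m_def Kc_def zero_less_mult_iff)
    have xr: "norm (x - y) \<le> r" using x(1) by (simp add: Kc_def dist_norm norm_minus_commute)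
    have m1: "m x \<le> norm (x - y)" using mle[OF xr] pos by simp
    have "x \<notin> K1"
    proof
      assume xK: "x \<in> K1"
      have "?\<phi> x \<le> (x - y) \<bullet> e"
      proof -
        have "?\<phi> x \<le> m x powr 1" using mx m1 xr r by (intro powr_mono') auto
        also have "\<dots> = ((x - y) \<bullet> e) * s x" using mx by (simp add: m_def)
        also have "\<dots> \<le> ((x - y) \<bullet> e) * 1" using pos sle[of x] xr r by (intro mult_left_mono) auto
        finally show ?thesis by simp
      qed
      then have "\<epsilon> * ?\<phi> x \<le> k * ((x - y) \<bullet> e)" using \<epsilon> k(1) by (intro mult_mono) auto
      also have "\<dots> \<le> ut i (mirror e l x) - ut i x" using k(2)[OF xK] y(2) by (simp add: inner_diff_left)
      finally show False using neg by simp
    qed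
    then have xr': "norm (x - y) < r" using x(1) xr by (auto simp: K1_def dist_norm norm_minus_commute)
    define D where "D = ball y r \<inter> ({x. 0 < (x - y) \<bullet> e} \<inter> {x. 0 < s x})"
    have oD: "open D" unfolding D_def by (intro open_Int open_Collect_less continuous_intros cs open_ball)
    have xD: "x \<in> D" using pos xr' by (simp add: D_def dist_norm norm_minus_commute)
    have DKc: "D \<subseteq> Kc" by (auto simp: D_def Kc_def)
    have Dcap: "D \<subseteq> cap e l"
    proof
      fix z assume z: "z \<in> D"
      then have "z \<noteq> y" by (auto simp: D_def)
      then have "z \<in> \<Omega>" using z by (intro sball) (auto simp: D_def)
      then show "z \<in> cap e l" using z y(2) by (simp add: cap_def D_def inner_diff_left)
    qed
    have wD: "ut i (mirror e l z) - ut i z = wdiff i e l z" if "z \<in> D" for z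
    proof -
      have "z \<in> cap e l" using that Dcap by blast
      then show ?thesis using cap_mirror_in[OF d] by (auto simp: wdiff_def ut_in cap_def)
    qed
    define gs where "gs = \<nu> - \<kappa> *\<^sub>R (2 *\<^sub>R (x - y))"
    define x1 where "x1 = (x - y) \<bullet> e"
    define Dm where "Dm = x1 *\<^sub>R gs + s x *\<^sub>R e"
    define \<psi>1 where "\<psi>1 = 5/4 * m x powr (5/4 - 1)"
    define \<psi>2 where "\<psi>2 = 5/4 * (5/4 - 1) * m x powr (5/4 - 2)"
    define Z where "Z = \<psi>1 *\<^sub>R (x1 *\<^sub>R (0 - \<kappa> *\<^sub>R mat 2) + s x *\<^sub>R 0 + outer gs e + outer e gs) + \<psi>2 *\<^sub>R outer Dm Dm"
    have mD: "0 < m z" if "z \<in> D" for z using that by (auto simp: D_def m_def)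
    have js: "jet s (\<lambda>x. \<nu> - \<kappa> *\<^sub>R (2 *\<^sub>R (x - y))) (\<lambda>x. 0 - \<kappa> *\<^sub>R mat 2) D"
      unfolding s_def by (rule jet_diff[OF jet_affine[OF oD] jet_cmult[OF jet_sq[OF oD]]])
    note jm = jet_mult[OF jet_affine[OF oD, of y e] js]
    note j = jet_powr[OF jm[folded m_def] mD, of "5/4"]
    \<comment> \<open>The relation \<open>\<psi>2 * m x = \<psi>1 / 4\<close> is the effect of the
      exponent 5/4: combined with \<open>m x \<le> Dm \<bullet> Dm\<close> it produces the gain
      \<open>\<alpha> / 4\<close>.\<close>
    have \<psi>: "0 < \<psi>1" "\<psi>1 \<le> 5/4" "\<psi>2 * m x = \<psi>1 / 4" "0 < \<psi>2" "?\<phi> x \<le> \<psi>1 * m x"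
    proof -
      show "0 < \<psi>1" "0 < \<psi>2" using mx by (simp_all add: \<psi>1_def \<psi>2_def)
      have "m x powr (1/4) \<le> 1" using mx m1 xr r by (intro powr_le1) auto
      then show "\<psi>1 \<le> 5/4" by (simp add: \<psi>1_def)
      have a: "m x powr (-3/4) * m x = m x powr (1/4)" "m x powr (1/4) * m x = m x powr (5/4)"
        using mx powr_add[of "m x" "-3/4" 1] powr_add[of "m x" "1/4" 1] by simp_all
      then show "\<psi>2 * m x = \<psi>1 / 4" by (simp add: \<psi>1_def \<psi>2_def)
      have "\<psi>1 * m x = 5/4 * ?\<phi> x" using a(2) by (simp add: \<psi>1_def)
      then show "?\<phi> x \<le> \<psi>1 * m x" using powr_ge_zero[of "m x" "5/4"] by linarith
    qed
    let ?h = "x - y"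
    define X2 where "X2 = ?h \<bullet> \<nu>"
    have X2: "0 \<le> X2" "X2 \<le> norm ?h"
    proof -
      have "0 \<le> \<kappa> * (?h \<bullet> ?h)" using \<kappa> by simp
      then show "0 \<le> X2" using pos(2) by (simp add: s_def X2_def)
      show "X2 \<le> norm ?h" unfolding X2_def using norm_cauchy_schwarz[of ?h \<nu>] n by simp
    qed
    have x1: "0 < x1" "x1 \<le> norm ?h" using pos x1le[of x] by (auto simp: x1_def)
    have sx: "0 < s x" "s x \<le> norm ?h" using pos sle by auto
    have \<kappa>r: "2 * \<kappa> * norm ?h \<le> 1 / 4" using mult_left_mono[OF xr, of "8 * \<kappa>"] \<kappa> r(3) by linarith
    \<comment> \<open>To leading order \<open>Dm\<close> is
      \<open>x1 *\<^sub>R \<nu> + s x *\<^sub>R e\<close>, whose squared length is at least twice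
      \<open>m x\<close>. Claiming only \<open>m x\<close> leaves room for the curvature terms of
      relative size \<open>th\<close>.\<close>
    have Dm2: "m x \<le> Dm \<bullet> Dm"
    proof -
      have Dme: "Dm \<bullet> e = s x - 2 * \<kappa> * x1 * x1" "Dm \<bullet> \<nu> = x1 * (1 - 2 * \<kappa> * X2)"
        unfolding Dm_def gs_def by (simp_all add: inner_add_left inner_diff_left ii en x1_def X2_def algebra_simps)
      define th where "th = 2 * \<kappa> * x1"
      have th: "0 \<le> th" "th \<le> 1/4"
        unfolding th_def using \<kappa> x1 mult_left_mono[OF x1(2), of "2 * \<kappa>"] \<kappa>r by (simp, linarith)
      have "Dm = (Dm \<bullet> e) *\<^sub>R e + (Dm \<bullet> \<nu>) *\<^sub>R \<nu> + (Dm - (Dm \<bullet> e) *\<^sub>R e - (Dm \<bullet> \<nu>) *\<^sub>R \<nu>)" by simp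
      have "0 \<le> (Dm - (Dm \<bullet> e) *\<^sub>R e - (Dm \<bullet> \<nu>) *\<^sub>R \<nu>) \<bullet> (Dm - (Dm \<bullet> e) *\<^sub>R e - (Dm \<bullet> \<nu>) *\<^sub>R \<nu>)" by simp
      also have "\<dots> = Dm \<bullet> Dm - (Dm \<bullet> e)\<^sup>2 - (Dm \<bullet> \<nu>)\<^sup>2"
        by (simp only: inner_diff_left inner_diff_right inner_scaleR_left inner_scaleR_right ii en inner_commute[of e Dm] inner_commute[of \<nu> Dm])
          (simp add: power2_eq_square)
      finally have "(s x - th * x1)\<^sup>2 + (x1 * (1 - 2 * \<kappa> * X2))\<^sup>2 \<le> Dm \<bullet> Dm" unfolding Dme th_def by simp
      moreover have "(x1 * (3/4))\<^sup>2 \<le> (x1 * (1 - 2 * \<kappa> * X2))\<^sup>2"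
      proof (intro power_mono mult_left_mono)
        have "2 * \<kappa> * X2 \<le> 2 * \<kappa> * norm ?h" using X2 \<kappa> by (intro mult_left_mono) auto
        then show "3/4 \<le> 1 - 2 * \<kappa> * X2" using \<kappa>r by linarith
      qed (use x1 in auto)
      moreover have "x1 * s x \<le> (s x - th * x1)\<^sup>2 + (x1 * (3/4))\<^sup>2"
      proof -
        have "(s x - th * x1)\<^sup>2 + (x1 * (3/4))\<^sup>2 - x1 * s x = (s x - 3/4 * x1)\<^sup>2 + (1/2 - 2 * th) * (x1 * s x) + (th * x1)\<^sup>2"
          by (simp add: power2_eq_square algebra_simps)
        moreover have "0 \<le> (1/2 - 2 * th) * (x1 * s x)" using th x1 sx by (intro mult_nonneg_nonneg) auto
        ultimately show ?thesis using zero_le_power2[of "s x - 3/4 * x1"] zero_le_power2[of "th * x1"] by linarith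
      qed
      ultimately show ?thesis unfolding m_def x1_def by linarith
    qed
    have nDm: "norm Dm \<le> 3 * norm ?h"
    proof -
      have ng: "norm gs \<le> 2"
      proof -
        have "norm gs \<le> norm \<nu> + norm (\<kappa> *\<^sub>R (2 *\<^sub>R ?h))" unfolding gs_def by (rule norm_triangle_ineq4)
        also have "norm (\<kappa> *\<^sub>R (2 *\<^sub>R ?h)) = 2 * \<kappa> * norm ?h" using \<kappa> by simp
        finally show ?thesis using \<kappa>r n by simp
      qed
      have "norm Dm \<le> x1 * norm gs + s x * norm e"
        unfolding Dm_def using norm_triangle_ineq[of "x1 *\<^sub>R gs" "s x *\<^sub>R e"] x1 sx by simp
      also have "\<dots> \<le> norm ?h * 2 + norm ?h * 1" using ng x1 sx e by (intro add_mono mult_mono) auto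
      finally show ?thesis by simp
    qed
    \<comment> \<open>Tuned so that the first order effect \<open>- 2 * b * \<tau> * a12\<close> of
      the rotation cancels the mixed term \<open>2 * \<epsilon> * \<psi>1 * a12\<close> of the
      barrier for every \<open>A\<close>.\<close>
    define \<tau> where "\<tau> = \<epsilon> * \<psi>1 / b"
    have \<tau>: "0 \<le> \<tau>" "\<tau> \<le> \<alpha> / (96 * \<beta>)" "\<tau> \<le> 1" "b * \<tau> = \<epsilon> * \<psi>1"
    proof -
      show "0 \<le> \<tau>" "b * \<tau> = \<epsilon> * \<psi>1" using \<epsilon> \<psi> b by (auto simp: \<tau>_def)
      have "\<tau> \<le> \<epsilon> * (5/4) / b" unfolding \<tau>_def using \<epsilon> \<psi> b by (intro divide_right_mono mult_left_mono) auto
      then show t: "\<tau> \<le> \<alpha> / (96 * \<beta>)" using \<epsilon>(3) by linarith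
      have "\<alpha> / (96 * \<beta>) \<le> 1" using K \<beta>0 by (simp add: field_simps)
      then show "\<tau> \<le> 1" using t by linarith
    qed
    let ?Q = "rotation e \<nu> \<tau>"
    define t where "t = \<epsilon> * \<psi>1 * (\<alpha> / 4 - (2 * \<kappa> * (N * \<beta>) + 4 * \<kappa> * \<beta>) * norm ?h - 3 * \<tau> * \<beta> - C1 * \<eta> / b)"
    have xcl: "x \<in> closure \<Omega>" using xD Dcap cap_subset dom_closure by blast
    have Yn: "norm (H i x - b *\<^sub>R outer \<nu> \<nu>) \<le> \<eta>" using d0(2)[OF xcl] xr' r b by simp
    have tA: "t \<le> \<epsilon> * trace (A ** Z) + trace (A ** (H i x - ?Q ** H i x ** transpose ?Q))"
      if A: "A \<in> pucci_class \<alpha> \<beta>" for A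
    proof -
      define a12 where "a12 = e \<bullet> (A *v \<nu>)"
      have 1: "- b * (2 * \<tau> * a12 + 3 * \<tau>\<^sup>2 * \<beta>) - C1 * \<tau> * \<eta> \<le> trace (A ** (H i x - ?Q ** H i x ** transpose ?Q))"
        using trace_rotation_diff[OF e n en(1) \<tau>(1,3) A K(1) less_imp_le[OF b(1)] Yn]
        unfolding a12_def C1_def N_def by simp
      have ge: "gs \<bullet> (A *v e) = e \<bullet> (A *v gs)" by (rule pucci_classD(4)[OF A])
      have tZ: "trace (A ** Z) = \<psi>1 * (2 * (e \<bullet> (A *v gs)) - 2 * \<kappa> * x1 * trace A) + \<psi>2 * (Dm \<bullet> (A *v Dm))"
      proof -
        have "(0 - \<kappa> *\<^sub>R mat 2 :: real^'N^'N) = (- (2 * \<kappa>)) *\<^sub>R mat 1" by (simp add: vec_eq_iff mat_def)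
        then show ?thesis
          unfolding Z_def by (simp only: trace_simps matrix_mul_rid scaleR_zero_right add_0_right ge) (simp add: algebra_simps)
      qed
      have "e \<bullet> (A *v gs) = a12 - 2 * \<kappa> * (e \<bullet> (A *v ?h))"
        unfolding gs_def a12_def by (simp only: matrix_vector_mult_diff_distrib matrix_vector_mult_scaleR inner_diff_right inner_scaleR_right)
      moreover have "2 * \<kappa> * (e \<bullet> (A *v ?h)) \<le> 2 * \<kappa> * (\<beta> * norm ?h)"
        using pucci_class_bilinear[OF A K(1), of e ?h] e \<kappa> by (intro mult_left_mono) (auto simp: abs_le_iff)
      ultimately have 2: "2 * a12 - 4 * \<kappa> * \<beta> * norm ?h \<le> 2 * (e \<bullet> (A *v gs))" by linarith
      have 3: "2 * \<kappa> * x1 * trace A \<le> 2 * \<kappa> * (N * \<beta>) * norm ?h"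
      proof -
        have "2 * \<kappa> * x1 * trace A \<le> 2 * \<kappa> * x1 * (N * \<beta>)" using pucci_class_trace_id[OF A] \<kappa> x1 by (intro mult_left_mono) (auto simp: N_def)
        also have "\<dots> = 2 * \<kappa> * (N * \<beta>) * x1" by simp
        also have "\<dots> \<le> 2 * \<kappa> * (N * \<beta>) * norm ?h" using x1 \<kappa> N1 \<beta>0 by (intro mult_left_mono) auto
        finally show ?thesis .
      qed
      have 4: "\<psi>1 * (\<alpha> / 4) \<le> \<psi>2 * (Dm \<bullet> (A *v Dm))"
      proof -
        have "\<alpha> * m x \<le> Dm \<bullet> (A *v Dm)"
          using pucci_classD(2)[OF A, of Dm] mult_left_mono[OF Dm2, of \<alpha>] K by linarith
        then have "\<psi>2 * (\<alpha> * m x) \<le> \<psi>2 * (Dm \<bullet> (A *v Dm))" using \<psi> by (intro mult_left_mono) auto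
        moreover have "\<psi>2 * (\<alpha> * m x) = \<psi>1 * (\<alpha> / 4)" using \<psi>(3) by (simp add: mult_ac)
        ultimately show ?thesis by linarith
      qed
      have "\<psi>1 * (2 * a12 - (2 * \<kappa> * (N * \<beta>) + 4 * \<kappa> * \<beta>) * norm ?h) \<le> \<psi>1 * (2 * (e \<bullet> (A *v gs)) - 2 * \<kappa> * x1 * trace A)"
        using 2 3 \<psi>(1) by (intro mult_left_mono) (auto simp: distrib_right)
      then have "\<psi>1 * (\<alpha> / 4) + \<psi>1 * (2 * a12 - (2 * \<kappa> * (N * \<beta>) + 4 * \<kappa> * \<beta>) * norm ?h) \<le> trace (A ** Z)"
        unfolding tZ using 4 by linarith
      then have 5: "\<epsilon> * (\<psi>1 * (\<alpha> / 4) + \<psi>1 * (2 * a12 - (2 * \<kappa> * (N * \<beta>) + 4 * \<kappa> * \<beta>) * norm ?h)) \<le> \<epsilon> * trace (A ** Z)"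
        using \<epsilon>(1) by (intro mult_left_mono) auto
      have 6: "- b * (2 * \<tau> * a12 + 3 * \<tau>\<^sup>2 * \<beta>) - C1 * \<tau> * \<eta> = - (\<epsilon> * \<psi>1 * (2 * a12 + 3 * \<tau> * \<beta> + C1 * \<eta> / b))"
      proof -
        have "- b * (2 * \<tau> * a12 + 3 * \<tau>\<^sup>2 * \<beta>) - C1 * \<tau> * \<eta> = - (b * \<tau>) * (2 * a12 + 3 * \<tau> * \<beta> + C1 * \<eta> / b)"
          using b(1) by (simp add: power2_eq_square field_simps)
        then show ?thesis by (simp only: \<tau>(4) mult_minus_left)
      qed
      have "t = \<epsilon> * (\<psi>1 * (\<alpha> / 4) + \<psi>1 * (2 * a12 - (2 * \<kappa> * (N * \<beta>) + 4 * \<kappa> * \<beta>) * norm ?h)) - (\<epsilon> * \<psi>1) * (2 * a12 + 3 * \<tau> * \<beta> + C1 * \<eta> / b)"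
        unfolding t_def by (simp add: right_diff_distrib distrib_left mult.assoc)
      then show ?thesis using 1[unfolded 6] 5 by linarith
    qed
    have "t \<le> K * (\<epsilon> * ?\<phi> x + \<epsilon> * norm (\<psi>1 *\<^sub>R Dm) + norm (?Q *v rG i e l x - rG i e l x))"
    proof (rule K(4)[OF e d Dcap j xD \<epsilon>(1), of ?Q t, folded x1_def gs_def, folded Dm_def \<psi>1_def \<psi>2_def, folded Z_def])
      show "\<forall>z\<in>D. wdiff i e l x - \<epsilon> * ?\<phi> x \<le> wdiff i e l z - \<epsilon> * ?\<phi> z"
        using x(2) DKc wD xD by (metis subsetD)
      show "wdiff i e l x \<le> \<epsilon> * ?\<phi> x" using neg wD[OF xD] by linarith
      show "orthogonal_matrix ?Q" by (rule orthogonal_rotation[OF e n en(1) \<tau>(1,3)])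
      show "\<forall>A\<in>pucci_class \<alpha> \<beta>. t \<le> \<epsilon> * trace (A ** Z) + trace (A ** (H i x - ?Q ** H i x ** transpose ?Q))" using tA by blast
    qed
    also have "\<dots> \<le> K * (\<epsilon> * (\<psi>1 * norm ?h) + \<epsilon> * (\<psi>1 * (3 * norm ?h)) + \<epsilon> * \<psi>1 * (4 * CB / b * norm ?h))"
    proof (intro mult_left_mono add_mono K(3))
      show "?\<phi> x \<le> \<psi>1 * norm ?h" using \<psi>(5) mult_left_mono[OF m1, of \<psi>1] \<psi>(1) by linarith
      show "norm (\<psi>1 *\<^sub>R Dm) \<le> \<psi>1 * (3 * norm ?h)" using nDm \<psi>(1) by simp
      have "norm (G i (mirror e l x)) \<le> \<bar>c i\<bar> + CB * norm (mirror e l x - y)"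
        using xD Dcap cap_mirror_in[OF d] by (intro G_near_boundary(1) yc) blast
      also have "norm (mirror e l x - y) = norm ?h"
        using dist_mirror[OF e, of l x y] mirror_fixed[OF e y(2)] by (simp add: dist_norm)
      finally have nG: "norm (rG i e l x) \<le> CB * norm ?h" using ci by (simp add: norm_rG[OF e])
      have "norm (?Q *v rG i e l x - rG i e l x) \<le> 4 * \<tau> * norm (rG i e l x)"
        by (rule norm_rotation_vec[OF e n en(1) \<tau>(1,3)])
      also have "\<dots> \<le> 4 * \<tau> * (CB * norm ?h)" using nG \<tau>(1) by (intro mult_left_mono) auto
      also have "\<dots> = \<epsilon> * \<psi>1 * (4 * CB / b * norm ?h)" by (simp add: \<tau>_def)
      finally show "norm (?Q *v rG i e l x - rG i e l x) \<le> \<epsilon> * \<psi>1 * (4 * CB / b * norm ?h)" .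
    qed (use \<epsilon> in auto)
    also have "\<dots> = \<epsilon> * \<psi>1 * ((4 * K + 4 * K * CB / b) * norm ?h)" by (simp add: algebra_simps)
    finally have "\<epsilon> * \<psi>1 * (\<alpha> / 4 - (2 * \<kappa> * (N * \<beta>) + 4 * \<kappa> * \<beta>) * norm ?h - 3 * \<tau> * \<beta> - C1 * \<eta> / b)
      \<le> \<epsilon> * \<psi>1 * ((4 * K + 4 * K * CB / b) * norm ?h)" unfolding t_def .
    moreover have "0 < \<epsilon> * \<psi>1" using \<epsilon>(1) \<psi>(1) by simp
    ultimately have "\<alpha> / 4 - (2 * \<kappa> * (N * \<beta>) + 4 * \<kappa> * \<beta>) * norm ?h - 3 * \<tau> * \<beta> - C1 * \<eta> / b \<le> (4 * K + 4 * K * CB / b) * norm ?h"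
      by (simp only: mult_le_cancel_left_pos)
    then have "\<alpha> / 4 \<le> C2 * norm ?h + 3 * \<tau> * \<beta> + C1 * \<eta> / b" unfolding C2_def by (simp only: distrib_right)
    moreover have "C2 * norm ?h \<le> \<alpha> / 32" using mult_left_mono[OF xr, of C2] C20 r(5) by linarith
    moreover have "3 * \<tau> * \<beta> \<le> \<alpha> / 32"
    proof -
      have "3 * \<tau> * \<beta> \<le> 3 * (\<alpha> / (96 * \<beta>)) * \<beta>" using \<tau>(2) \<beta>0 by (intro mult_right_mono) auto
      then show ?thesis using \<beta>0 by simp
    qed
    ultimately show False using \<eta>(2) K(1) by linarith
  qed
  \<comment> \<open>The comparison at \<open>z\<close> ends in
    \<open>\<epsilon> * q \<le> 25 * CB * \<kappa> * t\<close> with \<open>q\<close> of order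
    t^(3/4); its fourth power fails for the \<open>t\<close> chosen next.\<close>
  define B where "B = (25 * CB * \<kappa>) ^ 4"
  have B0: "B > 0" using CB(1) \<kappa> by (simp add: B_def)
  define t where "t = min (r / 2) (\<epsilon> ^ 4 * \<kappa> / (2 * B))"
  have t: "0 < t" "2 * t \<le> r" "B * t < \<epsilon> ^ 4 * \<kappa>"
  proof -
    show "0 < t" "2 * t \<le> r" using r \<epsilon> \<kappa> B0 by (auto simp: t_def)
    have "t \<le> \<epsilon> ^ 4 * \<kappa> / (2 * B)" by (simp add: t_def)
    then have "B * t \<le> \<epsilon> ^ 4 * \<kappa> / 2" using B0 by (simp add: field_simps)
    moreover have "0 < \<epsilon> ^ 4 * \<kappa>" using \<epsilon> \<kappa> by simp
    ultimately show "B * t < \<epsilon> ^ 4 * \<kappa>" by linarith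
  qed
  have \<kappa>t: "16 * \<kappa> * t \<le> 1" using mult_left_mono[OF t(2), of "8 * \<kappa>"] \<kappa> r(3) by linarith
  \<comment> \<open>At normal height \<open>4 * \<kappa> * t\<^sup>2\<close> the value of
    \<open>s\<close> is still at least \<open>\<kappa> * t\<^sup>2\<close>, whereas the reflected
    point is within \<open>5 * \<kappa> * t\<^sup>2\<close> of the exterior point \<open>b'\<close>.
    So the barrier is at least of order t^(15/4), but \<open>u i\<close> at the reflected point at
    most of order t^4.\<close>
  define z where "z = y + t *\<^sub>R e + (4 * \<kappa> * t\<^sup>2) *\<^sub>R \<nu>"
  have zy: "z - y = t *\<^sub>R e + (4 * \<kappa> * t\<^sup>2) *\<^sub>R \<nu>" by (simp add: z_def)
  have zi: "(z - y) \<bullet> e = t" "(z - y) \<bullet> \<nu> = 4 * \<kappa> * t\<^sup>2" "(z - y) \<bullet> (z - y) = t\<^sup>2 + (4 * \<kappa> * t\<^sup>2)\<^sup>2"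
    unfolding zy by (simp_all add: inner_add_left inner_add_right ii en power2_eq_square)
  have nz: "norm (z - y) \<le> r"
  proof -
    have "norm (z - y) \<le> t + 4 * \<kappa> * t\<^sup>2" unfolding zy using norm_triangle_ineq[of "t *\<^sub>R e" "(4 * \<kappa> * t\<^sup>2) *\<^sub>R \<nu>"] e n t \<kappa> by simp
    also have "4 * \<kappa> * t\<^sup>2 = (4 * \<kappa> * t) * t" by (simp add: power2_eq_square)
    also have "(4 * \<kappa> * t) * t \<le> 1 * t" using \<kappa>t t \<kappa> by (intro mult_right_mono) auto
    finally show ?thesis using t by simp
  qed
  have sz: "\<kappa> * t\<^sup>2 \<le> s z"
  proof -
    have "(4 * \<kappa> * t\<^sup>2)\<^sup>2 = (16 * \<kappa> * t) * (\<kappa> * t) * t\<^sup>2" by (simp add: power2_eq_square)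
    also have "\<dots> \<le> (1 * 1) * t\<^sup>2" using \<kappa>t t \<kappa> by (intro mult_right_mono mult_mono) auto
    finally have "\<kappa> * (t\<^sup>2 + (4 * \<kappa> * t\<^sup>2)\<^sup>2) \<le> \<kappa> * (2 * t\<^sup>2)" using \<kappa> by (intro mult_left_mono) auto
    moreover have "0 \<le> \<kappa> * t\<^sup>2" using \<kappa> by simp
    ultimately show ?thesis unfolding s_def zi by linarith
  qed
  then have zK: "z \<in> Kc" using nz zi(1) t \<kappa> order_trans[OF _ sz] by (simp add: Kc_def dist_norm norm_minus_commute)
  have zn: "z \<in> \<Omega>"
  proof (rule sball)
    show "0 \<le> s z" using sz \<kappa> order_trans[OF _ sz] by simp
    show "z \<noteq> y" using zi(1) t by auto
  qed
  have zl: "l \<le> z \<bullet> e" using zi(1) t y(2) by (simp add: inner_diff_left)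
  have Rz: "mirror e l z \<in> \<Omega>" by (rule dominated_mirror_in[OF d zn zl])
  have Rzeq: "mirror e l z = y - t *\<^sub>R e + (4 * \<kappa> * t\<^sup>2) *\<^sub>R \<nu>"
  proof -
    have "z \<bullet> e - l = t" using zi(1) y(2) by (simp add: inner_diff_left)
    then have "mirror e l z = z - (2 * t) *\<^sub>R e" by (simp only: mirror_def)
    then have "mirror e l z = z - (t *\<^sub>R e + t *\<^sub>R e)" by (simp only: mult_2 scaleR_add_left)
    then show ?thesis by (simp add: z_def)
  qed
  define b' where "b' = y - t *\<^sub>R e - (\<kappa> * t\<^sup>2) *\<^sub>R \<nu>"
  have b': "b' \<notin> \<Omega>"
  proof -
    have "b' = y + t *\<^sub>R (- e) + (\<kappa> * t\<^sup>2) *\<^sub>R (- \<nu>)" by (simp add: b'_def)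
    moreover have "t\<^sup>2 + (\<kappa> * t\<^sup>2)\<^sup>2 < 2 * (\<kappa> * t\<^sup>2) * \<rho>"
    proof -
      have "(\<kappa> * t\<^sup>2)\<^sup>2 = (\<kappa> * t) * (\<kappa> * t) * t\<^sup>2" by (simp add: power2_eq_square)
      also have "\<dots> < 1 * t\<^sup>2"
      proof (rule mult_strict_right_mono)
        have "\<kappa> * t < 1" "0 \<le> \<kappa> * t" using \<kappa>t t \<kappa> by auto
        then show "\<kappa> * t * (\<kappa> * t) < 1" using mult_strict_mono'[of "\<kappa> * t" 1 "\<kappa> * t" 1] by simp
      qed (use t in simp)
      finally show ?thesis using \<rho>(1) by (simp add: \<kappa>_def)
    qed
    ultimately have "b' \<in> ball (y + \<rho> *\<^sub>R (- \<nu>)) \<rho>"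
      using ball_coords[of "- e" "- \<nu>" \<rho> y t "\<kappa> * t\<^sup>2"] e n en \<rho>(1) by simp
    then show ?thesis using \<rho>(3) by auto
  qed
  have "mirror e l z - b' = (5 * \<kappa> * t\<^sup>2) *\<^sub>R \<nu>"
  proof -
    have "mirror e l z - b' = (4 * \<kappa> * t\<^sup>2) *\<^sub>R \<nu> + (\<kappa> * t\<^sup>2) *\<^sub>R \<nu>" by (simp add: Rzeq b'_def)
    then show ?thesis by (simp flip: scaleR_add_left)
  qed
  then have "u i (mirror e l z) \<le> CB * (5 * \<kappa> * t\<^sup>2)\<^sup>2"
    using G_near_boundary(2)[OF Rz b' ci] n \<kappa> by simp
  moreover have "0 \<le> ?g z" using nonneg x(2)[OF zK] by linarith
  ultimately have up: "\<epsilon> * ?\<phi> z \<le> CB * (5 * \<kappa> * t\<^sup>2)\<^sup>2" using ut_nonneg[of i z] ut_in[OF Rz, of i] by linarith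
  have mz: "\<kappa> * t ^ 3 \<le> m z"
  proof -
    have "t * (\<kappa> * t\<^sup>2) \<le> t * s z" using sz t by (intro mult_left_mono) auto
    then show ?thesis unfolding m_def zi by (simp add: power2_eq_square power3_eq_cube mult_ac)
  qed
  define q where "q = (\<kappa> * t ^ 3) powr (1/4)"
  have kt3: "0 < \<kappa> * t ^ 3" using \<kappa> t by simp
  have q: "0 < q" "q ^ 4 = \<kappa> * t ^ 3" "(\<kappa> * t ^ 3) powr (5/4) = q * (\<kappa> * t ^ 3)"
  proof -
    show "0 < q" using kt3 \<kappa> t(1) by (simp add: q_def)
    show "q ^ 4 = \<kappa> * t ^ 3" unfolding q_def using kt3 \<kappa> t(1) by (simp add: powr_power)
    show "(\<kappa> * t ^ 3) powr (5/4) = q * (\<kappa> * t ^ 3)" unfolding q_def using powr_add[of "\<kappa> * t ^ 3" "1/4" 1] kt3 by simp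
  qed
  have "\<epsilon> * (q * (\<kappa> * t ^ 3)) \<le> \<epsilon> * ?\<phi> z"
    unfolding q(3)[symmetric] using mz kt3 \<epsilon>(1) by (intro mult_left_mono powr_mono2) auto
  also note up
  also have "CB * (5 * \<kappa> * t\<^sup>2)\<^sup>2 = (\<kappa> * t ^ 3) * (25 * CB * \<kappa> * t)" by (simp add: power2_eq_square power3_eq_cube)
  finally have "(\<kappa> * t ^ 3) * (\<epsilon> * q) \<le> (\<kappa> * t ^ 3) * (25 * CB * \<kappa> * t)" by (simp only: mult_ac)
  then have "\<epsilon> * q \<le> 25 * CB * \<kappa> * t" using kt3 by (simp only: mult_le_cancel_left_pos)
  then have "(\<epsilon> * q) ^ 4 \<le> (25 * CB * \<kappa> * t) ^ 4" using \<epsilon>(1) q(1) by (intro power_mono) auto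
  then have "\<epsilon> ^ 4 * (\<kappa> * t ^ 3) \<le> B * t ^ 4" by (simp add: power_mult_distrib q(2) B_def)
  then have "t ^ 3 * (\<epsilon> ^ 4 * \<kappa>) \<le> t ^ 3 * (B * t)" by (simp add: power_numeral_reduce mult_ac)
  then have "\<epsilon> ^ 4 * \<kappa> \<le> B * t" using t(1) by (simp add: mult_le_cancel_left_pos)
  then show False using t(3) by simp
qed

end

context overdetermined
begin

section \<open>Corners with positive Neumann data\<close>

lemma u_near_boundary:
  assumes z: "z \<in> \<Omega>" and b': "b' \<notin> \<Omega>"
  shows "u i z \<le> (c i + CB * norm (z - b')) * norm (z - b')"
proof -
  obtain b d where b: "b \<in> frontier \<Omega>" "0 < d" "z = b + d *\<^sub>R nu b" "ball z d \<subseteq> \<Omega>" "\<And>b'. b' \<notin> \<Omega> \<Longrightarrow> d \<le> norm (z - b')"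
    using nearest_boundary_point[OF z] by blast
  have bc: "b \<in> closure \<Omega>" "z \<in> closure \<Omega>" using b(1) z by (auto simp: frontier_eq dom_closure)
  have zb: "norm (z - b) = d" using b norm_nu by simp
  have dd: "d \<le> norm (z - b')" by (rule b(5)[OF b'])
  have "\<bar>u i z - u i b - G i b \<bullet> (z - b)\<bar> \<le> CB * d\<^sup>2"
    using u_taylor[OF bc nearest_segment[OF b(1-4)], where i=i] zb by simp
  moreover have "G i b \<bullet> (z - b) = c i * d"
    using G_boundary[OF b(1)] norm_nu[OF b(1)] b(3) by (simp add: dot_square_norm)
  ultimately have "u i z \<le> c i * d + CB * d\<^sup>2" using u_zero[OF b(1), of i] unfolding abs_le_iff by linarith
  also have "\<dots> = (c i + CB * d) * d" by (simp add: power2_eq_square algebra_simps)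
  also have "\<dots> \<le> (c i + CB * norm (z - b')) * norm (z - b')"
    using dd b(2) CB(1) c_nonneg[of i] by (intro mult_mono add_mono mult_left_mono) auto
  finally show ?thesis .
qed

lemma u_ray:
  assumes y: "y \<in> frontier \<Omega>" and t: "0 < t" and ray: "\<And>s. 0 < s \<Longrightarrow> s \<le> t \<Longrightarrow> y + s *\<^sub>R v \<in> \<Omega>"
  shows "\<bar>u i (y + t *\<^sub>R v) - c i * t * (nu y \<bullet> v)\<bar> \<le> CB * (norm v)\<^sup>2 * t\<^sup>2"
proof -
  have yc: "y \<in> closure \<Omega>" using y by (simp add: frontier_eq)
  have "\<bar>u i (y + t *\<^sub>R v) - u i y - G i y \<bullet> (y + t *\<^sub>R v - y)\<bar> \<le> CB * (norm (y + t *\<^sub>R v - y))\<^sup>2"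
  proof (rule u_taylor[OF yc dom_closure[OF ray[OF t order_refl]]])
    fix s :: real assume "0 < s" "s < 1"
    then show "y + s *\<^sub>R (y + t *\<^sub>R v - y) \<in> \<Omega>" using ray[of "s * t"] t by (simp add: mult_left_le_one_le)
  qed
  then show ?thesis using u_zero[OF y, of i] t by (simp add: G_boundary[OF y] power_mult_distrib mult_ac)
qed

text \<open>The Neumann condition makes the corner barrier \<open>x\<^sub>1 (u / c + k x\<^sub>1) |x - y|\<^bsup>-2\<delta>\<^esup>\<close> admissible: it has
  degree \<open>2 - 2\<delta>\<close>, whereas the difference of \<open>u\<close> and its reflection is of second order at \<open>y\<close>. Since the matrix
  of second derivatives of \<open>x\<^sub>1 (u / c + k x\<^sub>1)\<close> is dominated by its \<open>e\<close>-\<open>e\<close> entry \<open>2 k\<close>, no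
  information on the coefficients beyond ellipticity is needed. The term \<open>x\<^sub>1 |x - y|\<^sup>2\<close> is
  subtracted to localize near \<open>y\<close>.\<close>

lemma corner_nondegenerate:
  assumes st: "strict e l" and dom: "\<And>l'. l \<le> l' \<Longrightarrow> dominated e l'" and ci: "0 < c i"
    and y: "y \<in> frontier \<Omega>" "y \<bullet> e = l" "nu y \<bullet> e = 0"
  shows False
proof -
  have e: "norm e = 1" and d: "dominated e l" using st by (auto simp: strict_def)
  have ii: "e \<bullet> e = 1" using e by (simp add: dot_square_norm)
  have ny: "nu y \<bullet> nu y = 1" "norm (nu y) = 1" using norm_nu[OF y(1)] by (simp_all add: dot_square_norm)
  have yc: "y \<in> closure \<Omega>" "y \<notin> \<Omega>" using y(1) by (auto simp: frontier_eq)
  obtain \<alpha> \<beta> K where ss: "supersol \<alpha> \<beta> K (wdiff i e l) (\<lambda>x. rG i e l x - G i x) (\<lambda>x. rH i e l x - H i x) (cap e l)"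
    using wdiff_supersol[of i] e d by blast
  note K = supersolD(1,2,3)[OF ss]
  have \<beta>0: "\<beta> > 0" using K by simp
  define N where "N = real CARD('N)"
  have N1: "N \<ge> 1" unfolding N_def by (simp add: Suc_leI)
  \<comment> \<open>The summand \<open>k * x1\<close> of \<open>a\<close> contributes
    \<open>k * (e \<bullet> (A *v e)) \<ge> 3 * \<beta>\<close>. This beats the mixed term of the
    gradient of \<open>u i\<close> over \<open>c i\<close>, at most \<open>2 * \<beta>\<close> since
    the gradient is bounded by \<open>2 * c i\<close> near \<open>y\<close>.\<close>
  define k where "k = 3 * \<beta> / \<alpha>"
  have k: "3 \<le> k" "k * \<alpha> = 3 * \<beta>" using K by (simp_all add: k_def field_simps)
  \<comment> \<open>With \<open>\<delta> = 1 / P\<close> the cost of differentiating the weight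
    \<open>R x powr (- \<delta>)\<close> in the interior is at most \<open>\<beta> / 2\<close> times
    the weight; \<open>8 * k * \<delta> \<le> 1\<close> limits its normal derivative at boundary
    points.\<close>
  define P where "P = 8 * (2 + k) * (N + 4)"
  define \<delta> where "\<delta> = 1 / P"
  have \<delta>: "0 < \<delta>" "\<delta> \<le> 1/4" "8 * k * \<delta> \<le> 1" "\<delta> * (2 + k) * (2 * N * \<beta> + 8 * \<beta>) \<le> \<beta> / 2"
  proof -
    have p: "0 < P" using k N1 by (simp add: P_def)
    show "0 < \<delta>" using p by (simp add: \<delta>_def)
    have "8 * k * 1 \<le> P" unfolding P_def using k N1 by (intro mult_mono) auto
    then show "8 * k * \<delta> \<le> 1" using p by (simp add: \<delta>_def)
    moreover have "3 * (8 * \<delta>) \<le> k * (8 * \<delta>)" using k(1) \<open>0 < \<delta>\<close> by (intro mult_right_mono) auto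
    moreover have "k * (8 * \<delta>) = 8 * k * \<delta>" by simp
    ultimately have "24 * \<delta> \<le> 1" by linarith
    then show "\<delta> \<le> 1/4" by simp
    have "\<delta> * (2 + k) * (2 * N * \<beta> + 8 * \<beta>) = \<delta> * P * (\<beta> / 4)" by (simp add: P_def algebra_simps)
    also have "\<delta> * P = 1" using p by (simp add: \<delta>_def)
    finally show "\<delta> * (2 + k) * (2 * N * \<beta> + 8 * \<beta>) \<le> \<beta> / 2" using \<beta>0 by simp
  qed
  obtain C rB where C: "0 \<le> C" "0 < rB" "\<And>z b'. z \<in> \<Omega> \<Longrightarrow> b' \<notin> \<Omega> \<Longrightarrow> norm (z - b') < rB \<Longrightarrow> norm (G i z) \<le> c i + C * u i z"
    using G_le_u[OF ci] by blast
  obtain dG where dG: "0 < dG" "\<And>x. x \<in> closure \<Omega> \<Longrightarrow> norm (x - y) < dG \<Longrightarrow> norm (G i x - G i y) < c i / (8 * k)"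
  proof -
    have "0 < c i / (8 * k)" using ci k by simp
    then show ?thesis using cont_G[of i] yc(1) that unfolding continuous_on_iff dist_norm by blast
  qed
  define C3 where "C3 = (real CARD('N))\<^sup>2 * \<beta> * CB / c i"
  have C30: "C3 > 0" using \<beta>0 CB(1) ci by (simp add: C3_def)
  define C4 where "C4 = C3 + \<beta> * (2 * N + 4) + K * (5 * k + 13)"
  have C40: "C4 > 0" unfolding C4_def using C30 \<beta>0 N1 K(3) k by (intro add_pos_nonneg) auto
  define r where "r = min (min (1/8) (min (rB / 2) (dG / 2))) (min (c i / CB) (min (\<beta> / (4 * C4)) (1 / (8 * (C * k + 1)))))"
  have Ck: "0 \<le> C * k" using C(1) k by simp
  have r: "0 < r" "r \<le> 1/8" "r < rB" "r < dG" "CB * r \<le> c i" "C4 * r \<le> \<beta> / 4" "C * k * r < 1/4"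
  proof -
    show r0: "0 < r" using C dG ci CB(1) \<beta>0 C40 Ck by (simp add: r_def)
    show "r \<le> 1/8" by (simp only: r_def min_le_iff_disj order_refl simp_thms)
    have "r \<le> rB / 2" "r \<le> dG / 2" "r \<le> c i / CB" "r \<le> \<beta> / (4 * C4)" "r \<le> 1 / (8 * (C * k + 1))"
      by (simp_all only: r_def min_le_iff_disj order_refl simp_thms)
    then have a: "r < rB" "r < dG" "CB * r \<le> c i" "C4 * r \<le> \<beta> / 4" "(C * k + 1) * r \<le> 1/8"
      using C(2) dG(1) CB(1) C40 Ck by (simp_all add: field_simps)
    then show "r < rB" "r < dG" "CB * r \<le> c i" "C4 * r \<le> \<beta> / 4" by auto
    show "C * k * r < 1/4" using a(5) r0 by (simp add: distrib_right)
  qed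
  define x1 where "x1 = (\<lambda>x. (x - y) \<bullet> e)"
  define R where "R = (\<lambda>x. (x - y) \<bullet> (x - y))"
  define a where "a = (\<lambda>x. (1 / c i) * ut i x + k * x1 x)"
  define \<phi> where "\<phi> = (\<lambda>x. x1 x * a x * R x powr (- \<delta>) - x1 x * R x)"
  let ?V = "\<lambda>x. ut i (mirror e l x) - ut i x"
  have Rn: "R x = (norm (x - y))\<^sup>2" for x by (simp add: R_def power2_norm_eq_inner)
  have R0: "0 < R x" if "x \<noteq> y" for x using that by (simp add: R_def)
  have x1n: "\<bar>x1 x\<bar> \<le> norm (x - y)" for x using Cauchy_Schwarz_ineq2[of "x - y" e] e by (simp add: x1_def)
  have x1l: "x1 x = x \<bullet> e - l" for x using y(2) by (simp add: x1_def inner_diff_left)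
  have CBn: "CB * norm (x - y) \<le> c i" if "norm (x - y) \<le> r" for x
    using order_trans[OF mult_left_mono[OF that] r(5)] CB(1) by simp
  have au: "ut i x \<le> 2 * c i * norm (x - y)" if "norm (x - y) \<le> r" for x
  proof (cases "x \<in> \<Omega>")
    case True
    have "u i x \<le> (c i + CB * norm (x - y)) * norm (x - y)" by (rule u_near_boundary[OF True yc(2)])
    also have "\<dots> \<le> (c i + c i) * norm (x - y)"
      using CBn[OF that] by (intro mult_right_mono) auto
    finally show ?thesis using True by (simp add: ut_in)
  qed (use ci in \<open>simp add: ut_out\<close>)
  have a0: "0 \<le> a x" "a x \<le> (2 + k) * norm (x - y)" if "norm (x - y) \<le> r" "0 \<le> x1 x" for x
  proof -
    show "0 \<le> a x" using ut_nonneg[of i x] ci k that by (simp add: a_def)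
    have "(1 / c i) * ut i x \<le> 2 * norm (x - y)" using au[OF that(1)] ci by (simp add: field_simps)
    moreover have "k * x1 x \<le> k * norm (x - y)" using x1n[of x] k by (intro mult_left_mono) auto
    ultimately show "a x \<le> (2 + k) * norm (x - y)" unfolding a_def distrib_right by linarith
  qed
  have g1: "1 \<le> R x powr (- \<delta>)" "norm (x - y) * R x powr (- \<delta>) \<le> 1" "norm (x - y) * norm (x - y) * R x powr (- \<delta>) \<le> norm (x - y)"
    if "norm (x - y) \<le> r" "x \<noteq> y" for x
  proof -
    have R1: "0 < R x" "R x \<le> 1" using R0[OF that(2)] that(1) r(2) unfolding Rn by (auto simp: power_le_one)
    show "1 \<le> R x powr (- \<delta>)" using powr_mono2'[of "- \<delta>" "R x" 1] R1 \<delta> by simp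
    have n: "norm (x - y) = R x powr (1/2)" using R1 by (simp add: Rn powr_half_sqrt)
    have "norm (x - y) * R x powr (- \<delta>) = R x powr (1/2 - \<delta>)" unfolding n by (simp flip: powr_add)
    also have "\<dots> \<le> 1" using R1 \<delta> by (intro powr_le1) auto
    finally show *: "norm (x - y) * R x powr (- \<delta>) \<le> 1" .
    show "norm (x - y) * norm (x - y) * R x powr (- \<delta>) \<le> norm (x - y)"
      using mult_left_mono[OF *, of "norm (x - y)"] by (simp add: mult.assoc)
  qed
  have \<phi>le: "\<phi> x \<le> (2 + k) * x1 x" if "norm (x - y) \<le> r" "x \<noteq> y" "0 \<le> x1 x" for x
  proof -
    have "a x * R x powr (- \<delta>) \<le> (2 + k) * norm (x - y) * R x powr (- \<delta>)" using a0[OF that(1,3)] by (intro mult_right_mono) auto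
    also have "\<dots> \<le> (2 + k) * 1" unfolding mult.assoc using g1[OF that(1,2)] k by (intro mult_left_mono) auto
    finally have "x1 x * (a x * R x powr (- \<delta>)) \<le> x1 x * (2 + k)" using that by (intro mult_left_mono) auto
    moreover have "0 \<le> x1 x * R x" using that by (simp add: R_def)
    ultimately show ?thesis by (simp add: \<phi>_def mult_ac)
  qed
  define Kc where "Kc = closure \<Omega> \<inter> (cball y r \<inter> {x. 0 \<le> x1 x})"
  have cx1: "continuous_on S x1" for S unfolding x1_def by (intro continuous_intros)
  have cR: "continuous_on S R" for S unfolding R_def by (intro continuous_intros)
  have ca: "continuous_on S a" for S unfolding a_def by (intro continuous_intros cx1 continuous_ut)
  have cV: "continuous_on S ?V" for S
    by (intro continuous_intros continuous_ut continuous_on_compose2[OF continuous_ut[of UNIV] continuous_mirror[OF e]]) auto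
  have compKc: "compact Kc"
    unfolding Kc_def by (intro compact_Int_closed compact_closure_dom closed_Int closed_cball closed_Collect_le cx1 continuous_intros)
  have Kcn: "norm (x - y) \<le> r" "0 \<le> x1 x" "x \<in> closure \<Omega>" if "x \<in> Kc" for x
    using that by (auto simp: Kc_def dist_norm norm_minus_commute)
  have V0: "0 \<le> ?V x" if "0 \<le> x1 x" for x using d that by (simp add: dominated_def x1l)
  \<comment> \<open>The part of the sphere where the barrier can be positive. There \<open>a\<close>
    is bounded below, so a point on the plane has \<open>ut i > 0\<close> and lies in the domain, as
    \<open>strict_linear_growth\<close> requires.\<close>
  define K2 where "K2 = Kc \<inter> (sphere y r \<inter> {x. (r\<^sup>2) powr (1 + \<delta>) \<le> a x})"
  have compK2: "compact K2"
    unfolding K2_def by (intro compact_Int_closed compKc closed_Int closed_sphere closed_Collect_le ca continuous_intros)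
  obtain k2 where k2: "k2 > 0" "\<And>x. x \<in> K2 \<Longrightarrow> k2 * (x \<bullet> e - l) \<le> ?V x"
  proof -
    have "\<exists>k2>0. \<forall>x\<in>K2. k2 * (x \<bullet> e - l) \<le> ?V x"
    proof (rule strict_linear_growth[OF st compK2])
      show "K2 \<subseteq> closure \<Omega>" by (auto simp: K2_def Kc_def)
      show "l \<le> x \<bullet> e" if "x \<in> K2" for x using that x1l[of x] by (auto simp: K2_def Kc_def)
      fix x assume x: "x \<in> K2" "x \<bullet> e = l"
      have "0 < (r\<^sup>2) powr (1 + \<delta>)" using r(1) by simp
      moreover have "(r\<^sup>2) powr (1 + \<delta>) \<le> a x" using x(1) by (simp add: K2_def)
      moreover have "a x = (1 / c i) * ut i x" using x(2) x1l[of x] by (simp add: a_def)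
      ultimately have "0 < (1 / c i) * ut i x" by linarith
      then show "x \<in> \<Omega>" using ci ut_pos_iff[of i x] by (simp add: zero_less_divide_iff)
    qed
    then show ?thesis using that by blast
  qed
  define \<epsilon> where "\<epsilon> = k2 / (2 + k)"
  have \<epsilon>: "0 < \<epsilon>" using k2 k by (simp add: \<epsilon>_def)
  have main: "\<epsilon> * \<phi> x \<le> ?V x" if x: "x \<in> Kc" "x \<noteq> y" for x
  proof (rule ccontr)
    assume neg0: "\<not> \<epsilon> * \<phi> x \<le> ?V x"
    define \<mu> where "\<mu> = \<epsilon> * \<phi> x - ?V x"
    have \<mu>: "0 < \<mu>" using neg0 by (simp add: \<mu>_def)
    \<comment> \<open>The weight is singular at \<open>y\<close>. Within distance
      \<open>\<sigma>\<close> of \<open>y\<close> the bound \<open>\<phi>le\<close> keeps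
      \<open>?V - \<epsilon> * \<phi>\<close> above \<open>- \<mu>\<close>, so the minimum may be
      sought on the compact set \<open>Ks\<close>.\<close>
    define \<sigma> where "\<sigma> = \<mu> / (\<epsilon> * (2 + k))"
    have \<sigma>: "0 < \<sigma>" "\<epsilon> * ((2 + k) * \<sigma>) = \<mu>" using \<mu> \<epsilon> k by (auto simp: \<sigma>_def)
    have small: "- \<mu> < ?V z - \<epsilon> * \<phi> z" if z: "z \<in> Kc" "z \<noteq> y" "norm (z - y) < \<sigma>" for z
    proof -
      have "\<phi> z \<le> (2 + k) * x1 z" using Kcn[OF z(1)] z by (intro \<phi>le) auto
      also have "\<dots> < (2 + k) * \<sigma>" using x1n[of z] z k by (intro mult_strict_left_mono) auto
      finally have "\<epsilon> * \<phi> z < \<epsilon> * ((2 + k) * \<sigma>)" using \<epsilon> by simp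
      then show ?thesis using V0[OF Kcn(2)[OF z(1)]] \<sigma>(2) by linarith
    qed
    define Ks where "Ks = Kc \<inter> {x. \<sigma> \<le> norm (x - y)}"
    have compKs: "compact Ks" unfolding Ks_def by (intro compact_Int_closed compKc closed_Collect_le continuous_intros)
    have "\<sigma> \<le> norm (x - y)" using small[OF x] by (force simp: \<mu>_def)
    then have xKs: "x \<in> Ks" using x by (simp add: Ks_def)
    have Ksy: "z \<noteq> y" if "z \<in> Ks" for z using that \<sigma>(1) by (auto simp: Ks_def)
    have "R z \<noteq> 0" if "z \<in> Ks" for z using R0[OF Ksy[OF that]] by simp
    then have "continuous_on Ks (\<lambda>z. ?V z - \<epsilon> * \<phi> z)"
      unfolding \<phi>_def by (intro continuous_intros cV cx1 ca cR continuous_on_powr) auto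
    then obtain p where p: "p \<in> Ks" "\<And>z. z \<in> Ks \<Longrightarrow> ?V p - \<epsilon> * \<phi> p \<le> ?V z - \<epsilon> * \<phi> z"
      using continuous_attains_inf[OF compKs] xKs by blast
    have pK: "p \<in> Kc" "p \<noteq> y" using p(1) Ksy by (auto simp: Ks_def)
    have pneg: "?V p - \<epsilon> * \<phi> p \<le> - \<mu>" using p(2)[OF xKs] by (simp add: \<mu>_def)
    have min: "?V p - \<epsilon> * \<phi> p \<le> ?V z - \<epsilon> * \<phi> z" if "z \<in> Kc" "z \<noteq> y" for z
      using p(2)[of z] small[OF that] pneg that by (cases "norm (z - y) < \<sigma>") (auto simp: Ks_def)
    note pn = Kcn[OF pK(1)]
    have Vp: "0 \<le> ?V p" by (rule V0[OF pn(2)])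
    have below: "?V p < \<epsilon> * \<phi> p" using pneg \<mu> by linarith
    then have \<phi>p: "0 < \<phi> p" using Vp \<epsilon> by (meson le_less_trans zero_less_mult_pos)
    let ?h = "p - y" and ?g = "R p powr (- \<delta>)"
    have \<phi>p': "\<phi> p = x1 p * (a p * ?g - R p)" by (simp add: \<phi>_def right_diff_distrib mult.assoc)
    have x1p: "0 < x1 p" using \<phi>p pn(2) by (cases "x1 p = 0") (auto simp: \<phi>_def)
    have Rp: "0 < R p" "R p \<le> 1" using R0[OF pK(2)] pn(1) r(2) unfolding Rn by (auto simp: power_le_one)
    note gp = g1[OF pn(1) pK(2)]
    have agR: "R p < a p * ?g" using \<phi>p x1p unfolding \<phi>p' by (simp add: zero_less_mult_iff)
    have pr: "norm ?h < r"
    proof (rule ccontr)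
      assume "\<not> norm ?h < r"
      then have nr: "norm ?h = r" using pn(1) by simp
      then have Rr: "R p = r\<^sup>2" by (simp add: Rn)
      have "R p * R p powr \<delta> \<le> a p * ?g * R p powr \<delta>" using agR by (intro mult_right_mono) auto
      also have "\<dots> = a p" using Rp by (simp add: mult.assoc flip: powr_add)
      finally have "(r\<^sup>2) powr (1 + \<delta>) \<le> a p" using Rp by (simp add: Rr powr_add)
      then have "p \<in> K2" using pK nr by (simp add: K2_def dist_norm norm_minus_commute)
      then have "k2 * x1 p \<le> ?V p" using k2(2) by (simp add: x1l)
      moreover have "\<epsilon> * \<phi> p \<le> \<epsilon> * ((2 + k) * x1 p)" using \<phi>le[OF pn(1) pK(2) pn(2)] \<epsilon> by simp
      moreover have "\<epsilon> * ((2 + k) * x1 p) = k2 * x1 p" using k by (simp add: \<epsilon>_def)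
      ultimately show False using below by linarith
    qed
    show False
    proof (cases "p \<in> \<Omega>")
      case True
      define D where "D = \<Omega> \<inter> (ball y r \<inter> {x. 0 < x1 x})"
      have oD: "open D" unfolding D_def by (intro open_Int open_dom open_ball open_Collect_less cx1 continuous_intros)
      have pD: "p \<in> D" using True pr x1p by (simp add: D_def dist_norm norm_minus_commute)
      have DK: "D \<subseteq> Kc" by (auto simp: D_def Kc_def dom_closure)
      have Dy: "z \<noteq> y" if "z \<in> D" for z using that by (auto simp: D_def x1_def)
      have Dcap: "D \<subseteq> cap e l" by (auto simp: D_def cap_def x1l)
      have Vw: "?V z = wdiff i e l z" if "z \<in> D" for z
      proof -
        have "z \<in> cap e l" using that Dcap by blast
        then show ?thesis using cap_mirror_in[OF d] by (auto simp: wdiff_def ut_in cap_def)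
      qed
      have ju: "jet (ut i) (G i) (H i) D"
      proof -
        have "jet (u i) (G i) (H i) D" by (rule jet_subset[OF jet_u _ oD]) (auto simp: D_def)
        moreover have "(ut i has_derivative f') (at x)" if "(u i has_derivative f') (at x)" "x \<in> D" for f' x
          using that(1) oD that(2) by (rule has_derivative_transform_within_open) (auto simp: D_def ut_in)
        ultimately show ?thesis unfolding jet_def by blast
      qed
      have jx: "jet x1 (\<lambda>x. e) (\<lambda>x. 0) D" unfolding x1_def by (rule jet_affine[OF oD])
      have jR: "jet R (\<lambda>x. 2 *\<^sub>R (x - y)) (\<lambda>x. mat 2) D" unfolding R_def by (rule jet_sq[OF oD])
      have ja: "jet a (\<lambda>x. (1 / c i) *\<^sub>R G i x + k *\<^sub>R e) (\<lambda>x. (1 / c i) *\<^sub>R H i x + k *\<^sub>R 0) D"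
        unfolding a_def by (rule jet_add[OF jet_cmult[OF ju] jet_cmult[OF jx]])
      note jg = jet_powr[OF jR R0[OF Dy], of "- \<delta>"]
      note j = jet_diff[OF jet_mult[OF jet_mult[OF jx ja] jg] jet_mult[OF jx jR], folded \<phi>_def]
      define ga where "ga = (1 / c i) *\<^sub>R G i p + k *\<^sub>R e"
      define q where "q = - \<delta> * R p powr (- \<delta> - 1)"
      define q2 where "q2 = - \<delta> * (- \<delta> - 1) * R p powr (- \<delta> - 2)"
      define gm where "gm = x1 p *\<^sub>R ga + a p *\<^sub>R e"
      define gg where "gg = q *\<^sub>R (2 *\<^sub>R ?h)"
      define Hm where "Hm = x1 p *\<^sub>R ((1 / c i) *\<^sub>R H i p + k *\<^sub>R 0) + a p *\<^sub>R 0 + outer ga e + outer e ga"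
      define Hg where "Hg = q *\<^sub>R mat 2 + q2 *\<^sub>R outer (2 *\<^sub>R ?h) (2 *\<^sub>R ?h)"
      define Hc where "Hc = x1 p *\<^sub>R mat 2 + R p *\<^sub>R 0 + outer (2 *\<^sub>R ?h) e + outer e (2 *\<^sub>R ?h)"
      define Dphi where "Dphi = ((x1 p * a p) *\<^sub>R gg + ?g *\<^sub>R gm) - (x1 p *\<^sub>R (2 *\<^sub>R ?h) + R p *\<^sub>R e)"
      define Hphi where "Hphi = ((x1 p * a p) *\<^sub>R Hg + ?g *\<^sub>R Hm + outer gg gm + outer gm gg) - Hc"
      have q: "q \<le> 0" "0 \<le> q2" "R p * (- q) = \<delta> * ?g"
      proof -
        show "q \<le> 0" using \<delta>(1) by (simp add: q_def)
        have "0 \<le> (- \<delta>) * (- \<delta> - 1)" using \<delta>(1) by (intro mult_nonpos_nonpos) auto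
        then show "0 \<le> q2" unfolding q2_def by (rule mult_nonneg_nonneg) (rule powr_ge_zero)
        have "R p * R p powr (- \<delta> - 1) = ?g" using Rp powr_add[of "R p" "- \<delta> - 1" 1] by simp
        then show "R p * (- q) = \<delta> * ?g" by (simp add: q_def)
      qed
      have hh: "norm ?h * norm ?h = R p" by (simp add: Rn power2_eq_square)
      have ap: "0 \<le> a p" "a p \<le> (2 + k) * norm ?h" using a0[OF pn(1,2)] by auto
      have x1h: "x1 p \<le> norm ?h" using x1n[of p] by simp
      have nG: "norm (G i p) \<le> 2 * c i"
      proof -
        have "norm (G i p) \<le> \<bar>c i\<bar> + CB * norm ?h" by (rule G_near_boundary(1)[OF True yc(2)])
        then show ?thesis using CBn[OF pn(1)] ci by simp
      qed
      have nga: "norm ga \<le> 2 + k"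
      proof -
        have "norm ga \<le> norm ((1 / c i) *\<^sub>R G i p) + norm (k *\<^sub>R e)" unfolding ga_def by (rule norm_triangle_ineq)
        also have "norm ((1 / c i) *\<^sub>R G i p) \<le> 2" using nG ci by (simp add: field_simps)
        finally show ?thesis using e k by simp
      qed
      have ngm: "norm gm \<le> 2 * (2 + k) * norm ?h"
      proof -
        have "norm gm \<le> x1 p * norm ga + a p * norm e"
          unfolding gm_def using norm_triangle_ineq[of "x1 p *\<^sub>R ga" "a p *\<^sub>R e"] x1p ap by simp
        also have "\<dots> \<le> norm ?h * (2 + k) + ((2 + k) * norm ?h) * 1" using nga x1h x1p ap e k by (intro add_mono mult_mono) auto
        finally show ?thesis by (simp add: algebra_simps)
      qed
      have mm: "0 \<le> x1 p * a p" "x1 p * a p \<le> (2 + k) * R p"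
      proof -
        show "0 \<le> x1 p * a p" using x1p ap by simp
        have "x1 p * a p \<le> norm ?h * ((2 + k) * norm ?h)" using x1h ap x1p by (intro mult_mono) auto
        then show "x1 p * a p \<le> (2 + k) * R p" by (simp add: hh[symmetric] mult_ac)
      qed
      have mq: "x1 p * a p * (- q) \<le> (2 + k) * \<delta> * ?g"
      proof -
        have "x1 p * a p * (- q) \<le> (2 + k) * R p * (- q)" using mm q by (intro mult_right_mono) auto
        then show ?thesis by (simp only: mult.assoc q(3))
      qed
      have ngg: "norm gg = 2 * (- q) * norm ?h" using q(1) by (simp add: gg_def)
      define t where "t = ?g * (\<beta> / 2 - (C3 + \<beta> * (2 * N + 4)) * norm ?h)"
      \<comment> \<open>The gain sits in \<open>Hm\<close>. The terms with \<open>Hg\<close> and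
        with \<open>gg\<close>, \<open>gm\<close> are the cost of the weight, \<open>Hc\<close> that
        of the localising term; all are measured in multiples of \<open>?g \<ge> 1\<close>.\<close>
      have tA: "t \<le> trace (A ** Hphi)" if A: "A \<in> pucci_class \<alpha> \<beta>" for A
      proof -
        have ea: "ga \<bullet> (A *v e) = e \<bullet> (A *v ga)" "?h \<bullet> (A *v e) = e \<bullet> (A *v ?h)" "gg \<bullet> (A *v gm) = gm \<bullet> (A *v gg)"
          by (rule pucci_classD(4)[OF A])+
        have tM: "\<beta> + \<beta> - C3 * norm ?h \<le> trace (A ** Hm)"
        proof -
          have "trace (A ** Hm) = x1 p * ((1 / c i) * trace (A ** H i p)) + 2 * (e \<bullet> (A *v ga))"
            unfolding Hm_def by (simp only: trace_simps scaleR_zero_right add_0_right ea(1))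
          moreover have "- (C3 * norm ?h) \<le> x1 p * ((1 / c i) * trace (A ** H i p))"
          proof -
            have "\<bar>trace (A ** H i p)\<bar> \<le> (real CARD('N))\<^sup>2 * \<beta> * norm (H i p)" by (rule pucci_class_trace[OF A K(1)])
            also have "\<dots> \<le> (real CARD('N))\<^sup>2 * \<beta> * CB" using CB(4)[OF pn(3)] \<beta>0 by (intro mult_left_mono) auto
            finally have "\<bar>(1 / c i) * trace (A ** H i p)\<bar> \<le> C3" using ci by (simp add: C3_def abs_mult field_simps)
            then have "\<bar>x1 p * ((1 / c i) * trace (A ** H i p))\<bar> \<le> norm ?h * C3"
              unfolding abs_mult[of "x1 p"] using x1n[of p] by (intro mult_mono) auto
            then show ?thesis unfolding abs_le_iff mult.commute[of "norm ?h" C3] by linarith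
          qed
          moreover have "\<beta> \<le> e \<bullet> (A *v ga)"
          proof -
            have "e \<bullet> (A *v ga) = (1 / c i) * (e \<bullet> (A *v G i p)) + k * (e \<bullet> (A *v e))"
              unfolding ga_def by (simp only: matrix_vector_right_distrib matrix_vector_mult_scaleR inner_add_right inner_scaleR_right)
            moreover have "3 * \<beta> \<le> k * (e \<bullet> (A *v e))"
              using mult_left_mono[OF pucci_classD(2)[OF A, of e], of k] k by (simp add: ii)
            moreover have "\<bar>(1 / c i) * (e \<bullet> (A *v G i p))\<bar> \<le> 2 * \<beta>"
            proof -
              have "\<bar>e \<bullet> (A *v G i p)\<bar> \<le> \<beta> * norm e * norm (G i p)" by (rule pucci_class_bilinear[OF A K(1)])
              also have "\<dots> \<le> \<beta> * 1 * (2 * c i)" using nG e \<beta>0 by (intro mult_mono) auto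
              finally show ?thesis using ci by (simp add: abs_mult field_simps)
            qed
            ultimately show ?thesis unfolding abs_le_iff by linarith
          qed
          ultimately show ?thesis by linarith
        qed
        have tG: "- (2 * (2 + k) * \<delta> * (N * \<beta>) * ?g) \<le> x1 p * a p * trace (A ** Hg)"
        proof -
          have "trace (A ** Hg) = q * (2 * trace A) + q2 * ((2 *\<^sub>R ?h) \<bullet> (A *v (2 *\<^sub>R ?h)))"
            unfolding Hg_def by (simp only: trace_simps trace_mult_mat)
          moreover have "0 \<le> (2 *\<^sub>R ?h) \<bullet> (A *v (2 *\<^sub>R ?h))"
            using pucci_classD(2)[OF A] K(1) by (meson inner_ge_zero mult_nonneg_nonneg less_imp_le order_trans)
          then have "0 \<le> q2 * ((2 *\<^sub>R ?h) \<bullet> (A *v (2 *\<^sub>R ?h)))" using q by simp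
          moreover have "(- q) * (2 * trace A) \<le> (- q) * (2 * (N * \<beta>))"
            using pucci_class_trace_id[OF A] q by (intro mult_left_mono) (auto simp: N_def)
          moreover have "(- q) * (2 * trace A) = - (q * (2 * trace A))" by simp
          ultimately have "- ((- q) * (2 * (N * \<beta>))) \<le> trace (A ** Hg)" by linarith
          then have "x1 p * a p * - ((- q) * (2 * (N * \<beta>))) \<le> x1 p * a p * trace (A ** Hg)"
            using mm by (intro mult_left_mono) auto
          moreover have "x1 p * a p * (- q) * (2 * (N * \<beta>)) \<le> (2 + k) * \<delta> * ?g * (2 * (N * \<beta>))"
            using mq N1 \<beta>0 by (intro mult_right_mono) auto
          moreover have "x1 p * a p * - ((- q) * (2 * (N * \<beta>))) = - (x1 p * a p * (- q) * (2 * (N * \<beta>)))"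
            "(2 + k) * \<delta> * ?g * (2 * (N * \<beta>)) = 2 * (2 + k) * \<delta> * (N * \<beta>) * ?g" by simp_all
          ultimately show ?thesis by linarith
        qed
        have tX: "- (4 * (2 + k) * \<delta> * \<beta> * ?g) \<le> gm \<bullet> (A *v gg)"
        proof -
          have "\<bar>gm \<bullet> (A *v gg)\<bar> \<le> \<beta> * norm gm * norm gg" by (rule pucci_class_bilinear[OF A K(1)])
          also have "\<dots> \<le> \<beta> * (2 * (2 + k) * norm ?h) * (2 * (- q) * norm ?h)"
            unfolding ngg using ngm \<beta>0 mult_nonpos_nonneg[OF q(1) norm_ge_zero[of ?h]] by (intro mult_right_mono mult_left_mono) auto
          also have "\<dots> = 4 * (2 + k) * \<beta> * (norm ?h * norm ?h * (- q))" by simp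
          also have "norm ?h * norm ?h * (- q) = \<delta> * ?g" using hh q(3) by simp
          finally show ?thesis by (simp add: abs_le_iff mult_ac)
        qed
        have tC: "trace (A ** Hc) \<le> \<beta> * (2 * N + 4) * norm ?h"
        proof -
          have "trace (A ** Hc) = x1 p * (2 * trace A) + 4 * (e \<bullet> (A *v ?h))"
            unfolding Hc_def by (simp only: trace_simps trace_mult_mat scaleR_zero_right add_0_right matrix_vector_mult_scaleR inner_scaleR_left inner_scaleR_right ea(2))
          also have "x1 p * (2 * trace A) \<le> norm ?h * (2 * (N * \<beta>))"
          proof -
            have "x1 p * (2 * trace A) \<le> x1 p * (2 * (N * \<beta>))" using pucci_class_trace_id[OF A] x1p by (intro mult_left_mono) (auto simp: N_def)
            also have "\<dots> \<le> norm ?h * (2 * (N * \<beta>))" using x1h N1 \<beta>0 by (intro mult_right_mono) auto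
            finally show ?thesis .
          qed
          also have "e \<bullet> (A *v ?h) \<le> \<beta> * norm ?h" using pucci_class_bilinear[OF A K(1), of e ?h] e by (simp add: abs_le_iff)
          finally show ?thesis by (simp add: algebra_simps)
        qed
        have tot: "trace (A ** Hphi) = x1 p * a p * trace (A ** Hg) + ?g * trace (A ** Hm) + 2 * (gm \<bullet> (A *v gg)) - trace (A ** Hc)"
          unfolding Hphi_def by (simp only: trace_simps ea(3))
        have g0: "0 \<le> ?g" by simp
        have "?g * (\<beta> + \<beta> - C3 * norm ?h) \<le> ?g * trace (A ** Hm)" using tM g0 by (rule mult_left_mono)
        moreover have "\<beta> * (2 * N + 4) * norm ?h * 1 \<le> \<beta> * (2 * N + 4) * norm ?h * ?g" using gp(1) \<beta>0 N1 by (intro mult_left_mono) auto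
        moreover have "\<delta> * (2 + k) * (2 * N * \<beta> + 8 * \<beta>) * ?g \<le> \<beta> / 2 * ?g" using \<delta>(4) g0 by (rule mult_right_mono)
        moreover have "\<delta> * (2 + k) * (2 * N * \<beta> + 8 * \<beta>) * ?g = 2 * (2 + k) * \<delta> * (N * \<beta>) * ?g + 2 * (4 * (2 + k) * \<delta> * \<beta> * ?g)"
          by (simp add: algebra_simps)
        moreover have "0 \<le> \<beta> * ?g" using \<beta>0 by simp
        moreover have "t = \<beta> / 2 * ?g - ?g * (C3 * norm ?h) - \<beta> * (2 * N + 4) * norm ?h * ?g"
          unfolding t_def by (simp add: algebra_simps)
        moreover have "?g * (\<beta> + \<beta> - C3 * norm ?h) = \<beta> * ?g + \<beta> * ?g - ?g * (C3 * norm ?h)" by (simp add: algebra_simps)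
        moreover have "\<beta> / 2 * ?g = \<beta> * ?g / 2" by simp
        ultimately show ?thesis unfolding tot using tG tX tC by linarith
      qed
      have nD: "norm Dphi + \<phi> p \<le> (5 * k + 13) * norm ?h * ?g"
      proof -
        have n1: "norm ((x1 p * a p) *\<^sub>R gg) \<le> (2 + k) * norm ?h * ?g"
        proof -
          have "norm ((x1 p * a p) *\<^sub>R gg) = x1 p * a p * (- q) * (2 * norm ?h)" using mm ngg by simp
          also have "\<dots> \<le> (2 + k) * \<delta> * ?g * (2 * norm ?h)" using mq by (intro mult_right_mono) auto
          also have "\<dots> = (2 * \<delta>) * ((2 + k) * norm ?h * ?g)" by simp
          also have "\<dots> \<le> 1 * ((2 + k) * norm ?h * ?g)" using \<delta> k by (intro mult_right_mono) auto
          finally show ?thesis by simp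
        qed
        have n2: "norm (?g *\<^sub>R gm) \<le> 2 * (2 + k) * norm ?h * ?g"
          using mult_left_mono[OF ngm, of ?g] by (simp add: mult_ac)
        have n3: "norm (x1 p *\<^sub>R (2 *\<^sub>R ?h) + R p *\<^sub>R e) \<le> 3 * norm ?h * ?g"
        proof -
          have "norm (x1 p *\<^sub>R (2 *\<^sub>R ?h) + R p *\<^sub>R e) \<le> x1 p * (2 * norm ?h) + R p"
            using norm_triangle_ineq[of "x1 p *\<^sub>R (2 *\<^sub>R ?h)" "R p *\<^sub>R e"] x1p Rp e by simp
          also have "\<dots> \<le> norm ?h * (2 * norm ?h) + norm ?h * norm ?h" using x1h by (intro add_mono mult_right_mono) (auto simp: hh)
          also have "\<dots> = 3 * norm ?h * norm ?h" by simp
          also have "\<dots> \<le> 3 * norm ?h * ?g" using pn(1) r(2) gp(1) by (intro mult_left_mono) auto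
          finally show ?thesis .
        qed
        have n4: "\<phi> p \<le> (2 + k) * norm ?h * ?g"
        proof -
          have "\<phi> p \<le> x1 p * a p * ?g" using x1p Rp by (simp add: \<phi>_def)
          also have "\<dots> \<le> (2 + k) * R p * ?g" using mm by (intro mult_right_mono) auto
          also have "\<dots> = (2 + k) * (norm ?h * norm ?h) * ?g" by (simp add: hh)
          also have "\<dots> \<le> (2 + k) * (norm ?h * 1) * ?g" using k pn(1) r(2) by (intro mult_right_mono mult_left_mono) auto
          finally show ?thesis by simp
        qed
        have "norm Dphi \<le> norm ((x1 p * a p) *\<^sub>R gg) + norm (?g *\<^sub>R gm) + norm (x1 p *\<^sub>R (2 *\<^sub>R ?h) + R p *\<^sub>R e)"
          unfolding Dphi_def
          using norm_triangle_ineq4[of "(x1 p * a p) *\<^sub>R gg + ?g *\<^sub>R gm" "x1 p *\<^sub>R (2 *\<^sub>R ?h) + R p *\<^sub>R e"]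
            norm_triangle_ineq[of "(x1 p * a p) *\<^sub>R gg" "?g *\<^sub>R gm"] by linarith
        moreover have "(5 * k + 13) * norm ?h * ?g = (2 + k) * norm ?h * ?g + 2 * (2 + k) * norm ?h * ?g + 3 * norm ?h * ?g
            + (2 + k) * norm ?h * ?g + (k + 2) * norm ?h * ?g" by (simp add: algebra_simps)
        moreover have "0 \<le> (k + 2) * norm ?h * ?g" using k by simp
        ultimately show ?thesis using n1 n2 n3 n4 by linarith
      qed
      show False
      proof (rule no_touching[OF supersol_subset[OF ss Dcap oD] j pD \<epsilon>, of t, folded ga_def q_def q2_def, folded gm_def gg_def Hm_def Hg_def Hc_def, folded Dphi_def Hphi_def])
        show "wdiff i e l p - \<epsilon> * \<phi> p \<le> wdiff i e l z - \<epsilon> * \<phi> z" if "z \<in> D" for z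
          using min[of z] that DK Dy Vw[OF that] Vw[OF pD] by auto
        show "wdiff i e l p \<le> \<epsilon> * \<phi> p" using below Vw[OF pD] by simp
        have "K * (norm Dphi + \<phi> p) \<le> K * ((5 * k + 13) * norm ?h * ?g)" using nD K(3) by (rule mult_left_mono)
        also have "\<dots> < t"
        proof -
          have "C4 * norm ?h \<le> \<beta> / 4" using mult_left_mono[OF pn(1), of C4] C40 r(6) by linarith
          then have "K * (5 * k + 13) * norm ?h < \<beta> / 2 - (C3 + \<beta> * (2 * N + 4)) * norm ?h"
            using \<beta>0 unfolding C4_def distrib_right by linarith
          then have "?g * (K * (5 * k + 13) * norm ?h) < t" unfolding t_def using gp(1) by (intro mult_strict_left_mono) auto
          then show ?thesis by (simp add: mult_ac)
        qed
        finally show "K * (norm Dphi + \<phi> p) < t" .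
        show "t \<le> trace (A ** Hphi)" if "A \<in> pucci_class \<alpha> \<beta>" for A by (rule tA[OF that])
      qed
    next
      case False
      \<comment> \<open>At a boundary minimum the slopes along the inner normal are compared. That
        of \<open>?V\<close> is at most \<open>C * ?V p\<close>, because \<open>u i\<close> has
        slope \<open>c i\<close> and its reflection at most \<open>c i + C * ?V p\<close>; that of
        \<open>\<phi>\<close> is at least a quarter of \<open>x1 p * ?g\<close>. Since
        \<open>?V p < \<epsilon> * \<phi> p\<close> and \<open>\<phi> p\<close> is quadratic in
        \<open>x1 p\<close>, this fails near \<open>y\<close>.\<close>
      then have pf: "p \<in> frontier \<Omega>" using pn(3) by (simp add: frontier_eq)
      let ?n = "nu p"
      have n1: "norm ?n = 1" "?n \<bullet> ?n = 1" using norm_nu[OF pf] by (simp_all add: dot_square_norm)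
      have utp: "ut i p = 0" using False by (simp add: ut_out)
      have app: "a p = k * x1 p" by (simp add: a_def utp)
      define s where "s = ?n \<bullet> e"
      \<comment> \<open>The point \<open>p\<close> lies on a parallel plane above the given one;
        this is where domination by all higher planes enters.\<close>
      have s0: "s \<le> 0" unfolding s_def by (rule dominated_nu[OF e dom pf refl]) (use x1p x1l[of p] in simp)
      \<comment> \<open>The normal is orthogonal to \<open>e\<close> at \<open>y\<close> and turns
        little nearby; as \<open>c i > 0\<close>, this can be read off from the continuous boundary
        values of \<open>G i\<close>.\<close>
      have s1: "- 1 \<le> 8 * k * s"
      proof -
        have "norm (G i p - G i y) < c i / (8 * k)" using dG(2)[OF pn(3)] pr r(4) by simp
        moreover have "\<bar>(G i p - G i y) \<bullet> e\<bar> \<le> norm (G i p - G i y)" using Cauchy_Schwarz_ineq2[of "G i p - G i y" e] e by simp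
        moreover have "(G i p - G i y) \<bullet> e = c i * s"
          using y(3) by (simp add: inner_diff_left G_boundary[OF pf] G_boundary[OF y(1)] s_def)
        ultimately have "- (c i / (8 * k)) \<le> c i * s" by (simp add: abs_le_iff)
        then have "c i * - (1 / (8 * k)) \<le> c i * s" by simp
        then have "- (1 / (8 * k)) \<le> s" using ci by (simp only: mult_le_cancel_left_pos)
        then show ?thesis using k by (simp add: field_simps)
      qed
      have mp: "mirror e l p \<in> \<Omega>" by (rule strict_boundary[OF st pf]) (use x1p x1l[of p] in simp)
      have Vpu: "?V p = u i (mirror e l p)" by (simp add: utp ut_in[OF mp])
      have dist: "norm (mirror e l p - y) = norm ?h" using dist_mirror[OF e, of l p y] mirror_fixed[OF e y(2)] by (simp add: dist_norm)
      have GR: "norm (G i (mirror e l p)) \<le> c i + C * ?V p"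
        unfolding Vpu using pr r(3) dist by (intro C(3)[OF mp yc(2)]) simp
      obtain t1 where t1: "t1 > 0" "\<And>t. 0 < t \<Longrightarrow> t < t1 \<Longrightarrow> p + t *\<^sub>R ?n \<in> \<Omega>" using in_dir[OF pf, of ?n] n1 by auto
      obtain t2 where t2: "t2 > 0" "ball (mirror e l p) t2 \<subseteq> \<Omega>" using open_dom mp open_contains_ball by blast
      \<comment> \<open>A lower bound for the barrier along the normal ray: \<open>ut i\<close> is
        replaced by its Taylor bound \<open>c i * t - CB * t\<^sup>2\<close>, which leaves an
        explicit function with derivative \<open>dp\<close> at 0.\<close>
      define psi where "psi = (\<lambda>t. (x1 p + t * s) * (((t - CB / c i * t\<^sup>2) + k * (x1 p + t * s)) * (R p + t * (2 * (?h \<bullet> ?n)) + t\<^sup>2) powr (- \<delta>))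
          - (x1 p + t * s) * (R p + t * (2 * (?h \<bullet> ?n)) + t\<^sup>2))"
      define dp where "dp = s * (k * x1 p * ?g - R p) + x1 p * ((1 + k * s) * ?g + k * x1 p * (- \<delta> * R p powr (- \<delta> - 1) * (2 * (?h \<bullet> ?n)))) - x1 p * (2 * (?h \<bullet> ?n))"
      have psi0: "psi 0 = \<phi> p" by (simp add: psi_def \<phi>_def app mult_ac)
      have R_t: "R (p + t *\<^sub>R ?n) = R p + t * (2 * (?h \<bullet> ?n)) + t\<^sup>2" for t
      proof -
        have "p + t *\<^sub>R ?n - y = ?h + t *\<^sub>R ?n" by simp
        then show ?thesis unfolding R_def by (simp only: inner_add_left inner_add_right inner_scaleR_left inner_scaleR_right n1(2) inner_commute[of ?n ?h])
          (simp add: power2_eq_square distrib_left)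
      qed
      have x1_t: "x1 (p + t *\<^sub>R ?n) = x1 p + t * s" for t by (simp add: x1_def s_def inner_diff_left inner_add_left)
      have der: "(psi has_real_derivative dp) (at 0)"
        unfolding psi_def dp_def using Rp ci
        by (auto intro!: derivative_eq_intros simp: algebra_simps)
      have ev: "\<forall>\<^sub>F t in at_right 0. \<epsilon> * ((psi t - psi 0) / t) \<le> C * ?V p + 2 * CB * t"
      proof -
        have c1: "\<forall>\<^sub>F t in at_right 0. t < t1" using t1(1) by (intro order_tendstoD(2)[OF tendsto_ident_at])
        have c2: "\<forall>\<^sub>F t in at_right 0. t < t2" using t2(1) by (intro order_tendstoD(2)[OF tendsto_ident_at])
        have c3: "\<forall>\<^sub>F t in at_right 0. t < r - norm ?h" using pr by (intro order_tendstoD(2)[OF tendsto_ident_at]) simp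
        have c4: "\<forall>\<^sub>F t in at_right 0. 0 < x1 p + t * s"
        proof (rule order_tendstoD(1))
          show "((\<lambda>t. x1 p + t * s) \<longlongrightarrow> x1 p + 0 * s) (at_right 0)" by (intro tendsto_intros)
        qed (use x1p in simp)
        have c5: "\<forall>\<^sub>F t in at_right 0. (0::real) < t" by (simp add: eventually_at_right_less)
        show ?thesis using c1 c2 c3 c4 c5
        proof eventually_elim
          case (elim t)
          let ?z = "p + t *\<^sub>R ?n"
          have zD: "?z \<in> \<Omega>" using t1(2) elim by simp
          have zx: "0 < x1 ?z" using elim by (simp add: x1_t)
          have zy: "?z \<noteq> y" using zx by (auto simp: x1_def)
          have "norm (?z - y) \<le> r"
          proof -
            have "norm (?z - y) = norm (?h + t *\<^sub>R ?n)" by (simp add: algebra_simps)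
            also have "\<dots> \<le> norm ?h + t" using norm_triangle_ineq[of ?h "t *\<^sub>R ?n"] n1 elim by simp
            finally show ?thesis using elim by simp
          qed
          then have zK: "?z \<in> Kc" using zD zx by (simp add: Kc_def dom_closure dist_norm norm_minus_commute)
          have m1: "?V p - \<epsilon> * \<phi> p \<le> ?V ?z - \<epsilon> * \<phi> ?z" by (rule min[OF zK zy])
          have uz: "c i * t - CB * t\<^sup>2 \<le> ut i ?z"
            using u_ray[OF pf, of t ?n i] t1(2) elim n1 zD by (simp add: ut_in abs_le_iff)
          have "psi t \<le> \<phi> ?z"
          proof -
            have "t - CB / c i * t\<^sup>2 \<le> (1 / c i) * ut i ?z"
            proof -
              have "(c i * t - CB * t\<^sup>2) / c i \<le> ut i ?z / c i" using uz ci by (intro divide_right_mono) auto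
              then show ?thesis using ci by (simp add: diff_divide_distrib)
            qed
            then have "x1 ?z * (((t - CB / c i * t\<^sup>2) + k * x1 ?z) * R ?z powr (- \<delta>)) \<le> x1 ?z * (a ?z * R ?z powr (- \<delta>))"
              using zx unfolding a_def by (intro mult_left_mono mult_right_mono add_right_mono) auto
            then show ?thesis unfolding psi_def \<phi>_def R_t[symmetric] x1_t[symmetric] by (simp add: mult.assoc)
          qed
          then have "\<epsilon> * psi t \<le> \<epsilon> * \<phi> ?z" using \<epsilon> by simp
          moreover have "?V ?z \<le> ?V p + t * (C * ?V p) + 2 * CB * t\<^sup>2"
          proof -
            have mz: "mirror e l ?z - mirror e l p = t *\<^sub>R (mirror_mat e *v ?n)"
              using mirror_diff[OF e, of l ?z p] by (simp add: matrix_vector_mult_scaleR)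
            have nm: "norm (mirror_mat e *v ?n) = 1" using norm_mirror_mat[OF e] n1 by simp
            have mb: "mirror e l p + s *\<^sub>R (mirror e l ?z - mirror e l p) \<in> \<Omega>" if "0 \<le> s" "s \<le> 1" for s
            proof -
              have "dist (mirror e l p) (mirror e l p + s *\<^sub>R (mirror e l ?z - mirror e l p)) = s * t"
                unfolding mz using that elim nm by (simp add: dist_norm)
              also have "\<dots> < t2" using that elim by (smt (verit) mult_left_le_one_le)
              finally show ?thesis using t2(2) by auto
            qed
            have mzD: "mirror e l ?z \<in> \<Omega>" using mb[of 1] by simp
            have "\<bar>u i (mirror e l ?z) - u i (mirror e l p) - G i (mirror e l p) \<bullet> (mirror e l ?z - mirror e l p)\<bar> \<le> CB * (norm (mirror e l ?z - mirror e l p))\<^sup>2"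
              by (rule u_taylor[OF dom_closure[OF mp] dom_closure[OF mzD]]) (use mb in auto)
            moreover have "norm (mirror e l ?z - mirror e l p) = t" unfolding mz using nm elim by simp
            moreover have "G i (mirror e l p) \<bullet> (mirror e l ?z - mirror e l p) \<le> t * (c i + C * ?V p)"
            proof -
              have "G i (mirror e l p) \<bullet> (mirror_mat e *v ?n) \<le> norm (G i (mirror e l p)) * norm (mirror_mat e *v ?n)" by (rule norm_cauchy_schwarz)
              then have "G i (mirror e l p) \<bullet> (mirror_mat e *v ?n) \<le> c i + C * ?V p" using GR nm by simp
              then show ?thesis unfolding mz using elim by (simp add: mult_left_mono)
            qed
            ultimately have "u i (mirror e l ?z) \<le> u i (mirror e l p) + t * (c i + C * ?V p) + CB * t\<^sup>2"
              unfolding abs_le_iff by simp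
            then have "?V ?z \<le> ?V p + t * (c i + C * ?V p) + CB * t\<^sup>2 - (c i * t - CB * t\<^sup>2)"
              using uz unfolding Vpu ut_in[OF mzD] by linarith
            moreover have "t * (c i + C * ?V p) = c i * t + t * (C * ?V p)" by (simp add: distrib_left)
            ultimately show ?thesis by linarith
          qed
          ultimately have "\<epsilon> * psi t - \<epsilon> * psi 0 \<le> t * (C * ?V p + 2 * CB * t)"
            using m1 unfolding psi0 by (simp add: power2_eq_square algebra_simps)
          then have "\<epsilon> * (psi t - psi 0) \<le> (C * ?V p + 2 * CB * t) * t" by (simp add: algebra_simps)
          then have "\<epsilon> * (psi t - psi 0) / t \<le> C * ?V p + 2 * CB * t" using elim by (simp add: divide_le_eq)
          then show ?case by simp
        qed
      qed
      have "((\<lambda>t. (psi t - psi 0) / t) \<longlongrightarrow> dp) (at_right 0)"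
        using DERIV_subset[OF der, of "{0<..}"] by (simp add: has_field_derivative_iff)
      then have lim: "((\<lambda>t. \<epsilon> * ((psi t - psi 0) / t)) \<longlongrightarrow> \<epsilon> * dp) (at_right 0)" by (intro tendsto_intros)
      have lim2: "((\<lambda>t. C * ?V p + 2 * CB * t) \<longlongrightarrow> C * ?V p + 2 * CB * 0) (at_right 0)" by (intro tendsto_intros)
      have "\<epsilon> * dp \<le> C * ?V p + 2 * CB * 0" by (rule tendsto_le[OF _ lim2 lim ev]) simp
      also have "\<dots> \<le> C * (\<epsilon> * \<phi> p)" using below C(1) by (simp add: mult_left_mono)
      also have "\<dots> = \<epsilon> * (C * \<phi> p)" by simp
      finally have dple: "dp \<le> C * \<phi> p" using \<epsilon> by (simp only: mult_le_cancel_left_pos)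
      have "x1 p * ?g * (1/4) \<le> dp"
      proof -
        have hn: "\<bar>?h \<bullet> ?n\<bar> \<le> norm ?h" using Cauchy_Schwarz_ineq2[of ?h ?n] n1 by simp
        have e1: "dp = x1 p * ?g * (1 + 2 * k * s) - s * R p - k * x1 p * x1 p * (\<delta> * R p powr (- \<delta> - 1) * (2 * (?h \<bullet> ?n))) - x1 p * (2 * (?h \<bullet> ?n))"
          unfolding dp_def by (simp add: algebra_simps)
        have e2: "x1 p * ?g * (3/4) \<le> x1 p * ?g * (1 + 2 * k * s)" using s1 x1p by (intro mult_left_mono) auto
        have e3: "0 \<le> - (s * R p)" using s0 Rp by (simp add: mult_nonpos_nonneg)
        have e4: "k * x1 p * x1 p * (\<delta> * R p powr (- \<delta> - 1) * (2 * (?h \<bullet> ?n))) \<le> x1 p * ?g * (1/4)"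
        proof -
          have "k * x1 p * x1 p * (\<delta> * R p powr (- \<delta> - 1) * (2 * (?h \<bullet> ?n))) \<le> k * x1 p * norm ?h * (\<delta> * R p powr (- \<delta> - 1) * (2 * norm ?h))"
          proof (rule order_trans[of _ "k * x1 p * x1 p * (\<delta> * R p powr (- \<delta> - 1) * (2 * norm ?h))"])
            show "k * x1 p * x1 p * (\<delta> * R p powr (- \<delta> - 1) * (2 * (?h \<bullet> ?n))) \<le> k * x1 p * x1 p * (\<delta> * R p powr (- \<delta> - 1) * (2 * norm ?h))"
              using hn k x1p \<delta> by (intro mult_left_mono) auto
            show "k * x1 p * x1 p * (\<delta> * R p powr (- \<delta> - 1) * (2 * norm ?h)) \<le> k * x1 p * norm ?h * (\<delta> * R p powr (- \<delta> - 1) * (2 * norm ?h))"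
              using x1n[of p] k x1p \<delta> by (intro mult_right_mono mult_left_mono) auto
          qed
          also have "\<dots> = 2 * (k * \<delta>) * (x1 p * (norm ?h * norm ?h * R p powr (- \<delta> - 1)))" by simp
          also have "norm ?h * norm ?h * R p powr (- \<delta> - 1) = ?g"
            using Rp powr_add[of "R p" "- \<delta> - 1" 1] by (simp add: Rn power2_eq_square mult_ac)
          also have "2 * (k * \<delta>) * (x1 p * ?g) \<le> (1/4) * (x1 p * ?g)" using \<delta>(3) x1p by (intro mult_right_mono) auto
          finally show ?thesis by simp
        qed
        have e5: "x1 p * (2 * (?h \<bullet> ?n)) \<le> x1 p * ?g * (1/4)"
        proof -
          have "2 * (?h \<bullet> ?n) \<le> 1/4" using hn pn(1) r(2) by (simp add: abs_le_iff)
          also have "\<dots> \<le> ?g * (1/4)" using gp(1) by simp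
          finally show ?thesis using x1p by (simp add: mult.assoc mult_left_mono)
        qed
        show ?thesis unfolding e1 using e2 e3 e4 e5 by linarith
      qed
      also note dple
      also have "C * \<phi> p \<le> C * (x1 p * (k * x1 p * ?g))"
        using C(1) x1p Rp unfolding \<phi>p' app by (intro mult_left_mono) auto
      also have "\<dots> = x1 p * ?g * (C * k * x1 p)" by simp
      finally have "x1 p * ?g * (1/4) \<le> x1 p * ?g * (C * k * x1 p)" .
      moreover have "0 < x1 p * ?g" using x1p Rp by simp
      ultimately have "1/4 \<le> C * k * x1 p" by (simp only: mult_le_cancel_left_pos)
      moreover have "C * k * x1 p \<le> C * k * r" using x1n[of p] pn(1) Ck by (intro mult_left_mono) auto
      ultimately show False using r(7) by linarith
    qed
  qed
  have vn: "0 < (e + nu y) \<bullet> nu y" "0 < (- e + nu y) \<bullet> nu y"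
    using y(3) ny by (simp_all add: inner_add_left inner_diff_left inner_commute[of e])
  obtain t1 where t1: "t1 > 0" "\<And>t. 0 < t \<Longrightarrow> t < t1 \<Longrightarrow> y + t *\<^sub>R (e + nu y) \<in> \<Omega>" using in_dir[OF y(1) vn(1)] by auto
  obtain t2 where t2: "t2 > 0" "\<And>t. 0 < t \<Longrightarrow> t < t2 \<Longrightarrow> y + t *\<^sub>R (- e + nu y) \<in> \<Omega>" using in_dir[OF y(1) vn(2)] by auto
  \<comment> \<open>Close to \<open>y\<close> the weight exceeds \<open>M\<close>. On the diagonal
    \<open>e + nu y\<close> the barrier is then at least \<open>t\<^sup>2 * (k * M - 2 * t)\<close>,
    whereas \<open>?V\<close> is at most \<open>4 * CB * t\<^sup>2\<close>; \<open>M\<close> makes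
    the former, multiplied by \<open>\<epsilon>\<close>, the larger one.\<close>
  define M where "M = (4 * CB + 2 * \<epsilon>) / (\<epsilon> * k) + 1"
  have M0: "0 < M" using CB(1) \<epsilon> k by (simp add: M_def add_nonneg_pos)
  define t where "t = min (min 1 (min (t1 / 2) (t2 / 2))) (min (r / 2) (sqrt (M powr (- 1 / \<delta>) / 2)))"
  have t: "0 < t" "t \<le> 1" "t < t1" "t < t2" "2 * t \<le> r" "2 * t\<^sup>2 \<le> M powr (- 1 / \<delta>)"
  proof -
    show t0: "0 < t" using t1(1) t2(1) r(1) M0 by (simp add: t_def)
    have "t \<le> t1 / 2" "t \<le> t2 / 2" "t \<le> r / 2" by (simp_all only: t_def min_le_iff_disj order_refl simp_thms)
    then show "t < t1" "t < t2" "2 * t \<le> r" using t1(1) t2(1) by auto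
    show "t \<le> 1" by (simp only: t_def min_le_iff_disj order_refl simp_thms)
    have "t \<le> sqrt (M powr (- 1 / \<delta>) / 2)" by (simp only: t_def min_le_iff_disj order_refl simp_thms)
    then have "t\<^sup>2 \<le> (sqrt (M powr (- 1 / \<delta>) / 2))\<^sup>2" using t0 by (intro power_mono) auto
    then show "2 * t\<^sup>2 \<le> M powr (- 1 / \<delta>)" by simp
  qed
  define z where "z = y + t *\<^sub>R (e + nu y)"
  have nv: "(norm (e + nu y))\<^sup>2 = 2" "(norm (- e + nu y))\<^sup>2 = 2"
    unfolding power2_norm_eq_inner using y(3) ny ii by (simp_all add: inner_add_left inner_add_right inner_diff_left inner_diff_right inner_commute[of e "nu y"])
  have zD: "z \<in> \<Omega>" unfolding z_def by (rule t1(2)) (use t in auto)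
  have zi: "x1 z = t" "R z = 2 * t\<^sup>2"
  proof -
    show "x1 z = t" using y(3) ii by (simp add: z_def x1_def inner_add_left)
    have "R z = (norm (e + nu y))\<^sup>2 * t\<^sup>2" unfolding Rn using t by (simp add: z_def power_mult_distrib)
    then show "R z = 2 * t\<^sup>2" using nv by simp
  qed
  have mz: "mirror e l z = y + t *\<^sub>R (- e + nu y)"
  proof -
    have "z \<bullet> e - l = t" using zi(1) x1l[of z] by simp
    then have "mirror e l z = z - (2 * t) *\<^sub>R e" by (simp only: mirror_def)
    then have "mirror e l z = z - (t *\<^sub>R e + t *\<^sub>R e)" by (simp only: mult_2 scaleR_add_left)
    moreover have "a + (p + q) - (p + p) = a + (- p + q)" for a p q :: "real^'N" by (simp add: vec_eq_iff)
    ultimately show ?thesis by (simp only: z_def scaleR_add_right scaleR_minus_right)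
  qed
  have mzD: "mirror e l z \<in> \<Omega>" unfolding mz by (rule t2(2)) (use t in auto)
  have "u i (mirror e l z) \<le> c i * t + 2 * CB * t\<^sup>2"
    using u_ray[OF y(1) t(1), of "- e + nu y" i] t2(2) t(4) nv y(3) ny unfolding mz by (simp add: abs_le_iff inner_diff_right inner_commute)
  moreover have "c i * t - 2 * CB * t\<^sup>2 \<le> u i z"
    using u_ray[OF y(1) t(1), of "e + nu y" i] t1(2) t(3) nv y(3) ny unfolding z_def by (simp add: abs_le_iff inner_add_right)
  ultimately have Vz: "?V z \<le> 4 * CB * t\<^sup>2" by (simp add: ut_in zD mzD)
  have nz: "norm (z - y) \<le> r"
  proof -
    have "norm (z - y) \<le> t * (norm e + norm (nu y))" using norm_triangle_ineq[of e "nu y"] t by (simp add: z_def)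
    then show ?thesis using e ny t by simp
  qed
  have "\<epsilon> * \<phi> z \<le> ?V z"
  proof (rule main)
    show "z \<in> Kc" using zD nz zi t by (simp add: Kc_def dom_closure dist_norm norm_minus_commute)
    show "z \<noteq> y" using zi t by (auto simp: x1_def)
  qed
  moreover have "t\<^sup>2 * (k * M - 2 * t) \<le> \<phi> z"
  proof -
    have "M = (M powr (- 1 / \<delta>)) powr (- \<delta>)" using M0 \<delta>(1) by (simp add: powr_powr)
    also have "\<dots> \<le> (2 * t\<^sup>2) powr (- \<delta>)" using t \<delta>(1) by (intro powr_mono2') auto
    finally have gM: "M \<le> (2 * t\<^sup>2) powr (- \<delta>)" .
    have "k * t \<le> a z" using ut_nonneg[of i z] ci by (simp add: a_def zi)
    then have "k * t * M \<le> a z * (2 * t\<^sup>2) powr (- \<delta>)" using gM M0 a0(1)[OF nz] zi(1) t(1) by (intro mult_mono) auto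
    then have "t * (k * t * M) \<le> t * (a z * (2 * t\<^sup>2) powr (- \<delta>))" using t by (intro mult_left_mono) auto
    then show ?thesis by (simp add: \<phi>_def zi power2_eq_square algebra_simps)
  qed
  ultimately have "\<epsilon> * (t\<^sup>2 * (k * M - 2 * t)) \<le> 4 * CB * t\<^sup>2" using Vz \<epsilon> by (meson mult_left_mono less_imp_le order_trans)
  then have "t\<^sup>2 * (\<epsilon> * (k * M - 2 * t)) \<le> t\<^sup>2 * (4 * CB)" by (simp only: mult_ac)
  then have "\<epsilon> * (k * M - 2 * t) \<le> 4 * CB" using t(1) by (simp only: mult_le_cancel_left_pos zero_less_power)
  moreover have "\<epsilon> * (k * M) = 4 * CB + 2 * \<epsilon> + \<epsilon> * k" using \<epsilon> k by (simp add: M_def field_simps)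
  moreover have "\<epsilon> * (2 * t) \<le> \<epsilon> * 2" "0 < \<epsilon> * k" using \<epsilon> t k by auto
  ultimately show False by (simp add: right_diff_distrib)
qed

end

context overdetermined
begin

section \<open>Moving the plane\<close>

text \<open>If \<open>c i = 0\<close>, the gradient vanishes at the point where the ray from \<open>z\<close> in direction \<open>e\<close> leaves the
  domain. The second derivative in direction \<open>e\<close> is positive near \<open>y\<close>, so the slope at \<open>z\<close> is negative.\<close>

lemma slope_near_boundary:
  assumes e: "norm e = 1" and y: "y \<in> frontier \<Omega>" "nu y \<bullet> e < 0"
  shows "\<exists>r>0. \<forall>z\<in>\<Omega> \<inter> ball y r. G i z \<bullet> e < 0"
proof (cases "c i = 0")
  case False
  then have ci: "0 < c i" using c_nonneg[of i] by simp
  have yc: "y \<in> closure \<Omega>" using y(1) by (simp add: frontier_eq)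
  have "0 < - (c i * (nu y \<bullet> e))" using ci y(2) by (simp add: mult_pos_neg)
  then obtain r where r: "r > 0" "\<And>x. x \<in> closure \<Omega> \<Longrightarrow> dist x y < r \<Longrightarrow> dist (G i x) (G i y) < - (c i * (nu y \<bullet> e))"
    using cont_G[of i] yc unfolding continuous_on_iff by blast
  have "G i z \<bullet> e < 0" if z: "z \<in> \<Omega> \<inter> ball y r" for z
  proof -
    have "dist (G i z) (G i y) < - (c i * (nu y \<bullet> e))" using z by (intro r(2) dom_closure) (auto simp: dist_commute)
    moreover have "(G i z - G i y) \<bullet> e \<le> dist (G i z) (G i y)" using norm_cauchy_schwarz[of "G i z - G i y" e] e by (simp add: dist_norm)
    ultimately show ?thesis by (simp add: inner_diff_left G_boundary[OF y(1)])
  qed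
  then show ?thesis using r(1) by blast
next
  case ci: True
  let ?s = "nu y \<bullet> e"
  have yc: "y \<in> closure \<Omega>" using y(1) by (simp add: frontier_eq)
  obtain b where b: "0 < b" "H i y = b *\<^sub>R outer (nu y) (nu y)" using H_boundary_pos[OF ci y(1)] by blast
  have bs: "0 < b * ?s\<^sup>2" using b y(2) by simp
  then have "0 < b * ?s\<^sup>2 / 2" by simp
  then obtain d where d: "d > 0" "\<And>x. x \<in> closure \<Omega> \<Longrightarrow> norm (x - y) < d \<Longrightarrow> norm (H i x - H i y) \<le> b * ?s\<^sup>2 / 2"
    using H_near[OF yc, of _ i] by blast
  have pos: "0 < e \<bullet> (H i x *v e)" if "x \<in> closure \<Omega>" "norm (x - y) < d" for x
  proof -
    have "\<bar>e \<bullet> ((H i x - H i y) *v e)\<bar> \<le> norm e * norm ((H i x - H i y) *v e)" by (rule Cauchy_Schwarz_ineq2)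
    also have "\<dots> \<le> norm (H i x - H i y)" using norm_matrix_vector[of "H i x - H i y" e] e by simp
    also have "\<dots> \<le> b * ?s\<^sup>2 / 2" by (rule d(2)[OF that])
    finally have "\<bar>e \<bullet> (H i x *v e) - e \<bullet> (H i y *v e)\<bar> \<le> b * ?s\<^sup>2 / 2"
      by (simp add: matrix_vector_mult_diff_rdistrib inner_diff_right)
    moreover have "e \<bullet> (H i y *v e) = b * ?s\<^sup>2"
      by (simp add: b(2) matrix_vector_scaleR_left outer_mult power2_eq_square inner_commute)
    ultimately show ?thesis using bs by linarith
  qed
  obtain \<rho> where \<rho>: "\<rho> > 0" "ball (y - \<rho> *\<^sub>R nu y) \<rho> \<inter> \<Omega> = {}" using touching_balls[OF y(1)] by blast
  obtain t1 where t1: "t1 > 0" "\<And>t. 0 < t \<Longrightarrow> t < t1 \<Longrightarrow> y + t *\<^sub>R e \<in> ball (y + \<rho> *\<^sub>R (- nu y)) \<rho>"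
    using ball_ray[of "- nu y" \<rho> e y] norm_nu[OF y(1)] \<rho>(1) y(2) by (auto simp: inner_commute)
  \<comment> \<open>At time \<open>t0\<close> the ray from \<open>y\<close> in direction
    \<open>e\<close> is inside the exterior ball, and so are the rays from all points
    \<open>z\<close> close to \<open>y\<close>; hence they have left the domain by then.\<close>
  define t0 where "t0 = min t1 d / 2"
  have t0: "0 < t0" "t0 < t1" "2 * t0 \<le> d" using t1 d by (auto simp: t0_def)
  obtain r0 where r0: "r0 > 0" "ball (y + t0 *\<^sub>R e) r0 \<subseteq> ball (y + \<rho> *\<^sub>R (- nu y)) \<rho>"
    using t1(2)[OF t0(1,2)] open_ball open_contains_ball by blast
  define r where "r = min r0 (d / 2)"
  have r: "r > 0" "r \<le> r0" "r \<le> d / 2" using r0 d by (auto simp: r_def)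
  have "G i z \<bullet> e < 0" if z: "z \<in> \<Omega> \<inter> ball y r" for z
  proof -
    have zD: "z \<in> \<Omega>" and zy: "norm (z - y) < r" using z by (auto simp: dist_norm norm_minus_commute)
    let ?l = "\<lambda>s. z + s *\<^sub>R e"
    let ?S = "{0..t0} \<inter> ?l -` (- \<Omega>)"
    have "closed (?l -` (- \<Omega>))"
      using open_dom by (intro continuous_closed_vimage closed_Compl continuous_intros)
    then have cS: "compact ?S" by (intro compact_Int_closed) auto
    have "z + t0 *\<^sub>R e \<in> ball (y + t0 *\<^sub>R e) r0" using zy r by (simp add: dist_norm norm_minus_commute)
    then have "z + t0 *\<^sub>R e \<in> ball (y + \<rho> *\<^sub>R (- nu y)) \<rho>" by (rule subsetD[OF r0(2)])
    moreover have "y + \<rho> *\<^sub>R (- nu y) = y - \<rho> *\<^sub>R nu y" by simp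
    ultimately have "z + t0 *\<^sub>R e \<in> ball (y - \<rho> *\<^sub>R nu y) \<rho>" by (simp only:)
    then have "z + t0 *\<^sub>R e \<notin> \<Omega>" using \<rho>(2) by blast
    then have "t0 \<in> ?S" using t0 by simp
    then obtain s1 where s1: "s1 \<in> ?S" "\<And>s. s \<in> ?S \<Longrightarrow> s1 \<le> s" using compact_attains_inf[OF cS] by blast
    have s1p: "0 < s1" "s1 \<le> t0" "?l s1 \<notin> \<Omega>" using s1(1) zD by (auto simp: less_le)
    have before: "?l s \<in> \<Omega>" if "0 \<le> s" "s < s1" for s
    proof (rule ccontr)
      assume "?l s \<notin> \<Omega>"
      then have "s1 \<le> s" using that s1p by (intro s1(2)) auto
      then show False using that by simp
    qed
    have bc: "?l s1 \<in> closure \<Omega>"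
      unfolding closure_approachable
    proof (intro allI impI)
      fix \<epsilon> :: real assume \<epsilon>: "\<epsilon> > 0"
      define s where "s = max 0 (s1 - \<epsilon> / 2)"
      have s: "0 \<le> s" "s < s1" "s1 - s < \<epsilon>" using \<epsilon> s1p by (auto simp: s_def)
      have "dist (?l s) (?l s1) = \<bar>s - s1\<bar> * norm e" by (simp add: dist_norm flip: scaleR_diff_left)
      also have "\<dots> = s1 - s" using s e by simp
      finally have "dist (?l s) (?l s1) < \<epsilon>" using s(3) by simp
      then show "\<exists>x\<in>\<Omega>. dist x (?l s1) < \<epsilon>" using before[OF s(1,2)] by blast
    qed
    then have bf: "?l s1 \<in> frontier \<Omega>" using s1p by (simp add: frontier_eq)
    have seg: "z + t *\<^sub>R (?l s1 - z) \<in> \<Omega>" if "0 < t" "t < 1" for t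
      using before[of "t * s1"] that s1p by simp
    obtain t where t: "0 < t" "t < 1" "e \<bullet> (G i (?l s1) - G i z) = e \<bullet> (H i (z + t *\<^sub>R (?l s1 - z)) *v (?l s1 - z))"
      using mean_value_G[OF dom_closure[OF zD] bc seg] by blast
    let ?\<xi> = "z + t *\<^sub>R (?l s1 - z)"
    have "norm (?\<xi> - y) \<le> norm (z - y) + norm (t *\<^sub>R (?l s1 - z))"
      using norm_triangle_ineq[of "z - y" "t *\<^sub>R (?l s1 - z)"] by (simp add: algebra_simps)
    also have "norm (t *\<^sub>R (?l s1 - z)) \<le> 1 * s1" using t s1p e by simp
    finally have "norm (?\<xi> - y) < d" using zy r s1p t0 by simp
    then have "0 < e \<bullet> (H i ?\<xi> *v e)" using seg[OF t(1,2)] by (intro pos dom_closure)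
    then have "0 < s1 * (e \<bullet> (H i ?\<xi> *v e))" using s1p by simp
    also have "\<dots> = e \<bullet> (H i ?\<xi> *v (?l s1 - z))" by (simp add: matrix_vector_mult_scaleR)
    also have "\<dots> = - (e \<bullet> G i z)" using t(3) G_boundary[OF bf, of i] ci by simp
    finally show ?thesis by (simp add: inner_commute)
  qed
  then show ?thesis using r(1) by blast
qed

text \<open>\<open>push\<close> in direction \<open>- e\<close> keeps the whole segment in the
  domain, and the slope along it is negative by \<open>slope_near_boundary\<close>.\<close>

lemma monotone_near_boundary:
  assumes e: "norm e = 1" and y: "y \<in> frontier \<Omega>" "nu y \<bullet> e < 0"
  shows "\<exists>r>0. \<forall>z\<in>\<Omega> \<inter> ball y r. \<forall>t\<in>{0..r}. z - t *\<^sub>R e \<in> \<Omega> \<and> u i z \<le> u i (z - t *\<^sub>R e)"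
proof -
  obtain r1 where r1: "r1 > 0" "\<And>z. z \<in> \<Omega> \<inter> ball y r1 \<Longrightarrow> G i z \<bullet> e < 0"
    using slope_near_boundary[OF e y, of i] by blast
  obtain r2 where r2: "r2 > 0" "\<And>z t. z \<in> \<Omega> \<inter> ball y r2 \<Longrightarrow> t \<in> {0..r2} \<Longrightarrow> z + t *\<^sub>R (- e) \<in> \<Omega>"
    using push[OF y(1), of "- e"] y(2) by (auto simp: inner_commute)
  define r where "r = min (r1 / 2) r2"
  have "z - t *\<^sub>R e \<in> \<Omega> \<and> u i z \<le> u i (z - t *\<^sub>R e)" if z: "z \<in> \<Omega> \<inter> ball y r" and t: "t \<in> {0..r}" for z t
  proof -
    have inD: "z - s *\<^sub>R e \<in> \<Omega>" if "0 \<le> s" "s \<le> t" for s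
      using r2(2)[of z s] z t that by (auto simp: r_def)
    have zt: "z \<in> \<Omega>" "z - t *\<^sub>R e \<in> \<Omega>" using z inD[of t] t by auto
    have seg: "z + s *\<^sub>R (z - t *\<^sub>R e - z) \<in> \<Omega>" if "0 < s" "s < 1" for s
      using inD[of "s * t"] that t by (simp add: mult_left_le_one_le)
    obtain s where s: "0 < s" "s < 1" "u i (z - t *\<^sub>R e) - u i z = G i (z + s *\<^sub>R (z - t *\<^sub>R e - z)) \<bullet> (z - t *\<^sub>R e - z)"
      using mean_value_u[OF dom_closure[OF zt(1)] dom_closure[OF zt(2)] seg] by blast
    have "dist y (z + s *\<^sub>R (z - t *\<^sub>R e - z)) \<le> dist y z + dist z (z + s *\<^sub>R (z - t *\<^sub>R e - z))" by (rule dist_triangle)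
    also have "dist z (z + s *\<^sub>R (z - t *\<^sub>R e - z)) = s * t" using e s t by (simp add: dist_norm)
    also have "s * t \<le> t" using s t by (simp add: mult_left_le_one_le)
    finally have "z + s *\<^sub>R (z - t *\<^sub>R e - z) \<in> \<Omega> \<inter> ball y r1" using z t seg[OF s(1,2)] by (simp add: r_def)
    from r1(2)[OF this] have "0 \<le> t * - (G i (z + s *\<^sub>R (z - t *\<^sub>R e - z)) \<bullet> e)" using t by (intro mult_nonneg_nonneg) auto
    then show ?thesis using s(3) zt by simp
  qed
  moreover have "r > 0" using r1 r2 by (simp add: r_def)
  ultimately show ?thesis by blast
qed

text \<open>Stated for one component, because the treatment of corners depends on whether
  \<open>c i\<close> vanishes; the finitely many thresholds are combined in
  \<open>critical_position\<close>.\<close>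

lemma plane_step:
  assumes st: "strict e l" and dom: "\<And>l'. l \<le> l' \<Longrightarrow> dominated e l'"
  shows "\<exists>\<eta>>0. \<forall>l'. l - \<eta> < l' \<longrightarrow> l' < l \<longrightarrow> (\<forall>x. l' \<le> x \<bullet> e \<longrightarrow> ut i x \<le> ut i (mirror e l' x))"
proof (rule ccontr)
  assume no: "\<not> ?thesis"
  have e: "norm e = 1" and d: "dominated e l" using st by (auto simp: strict_def)
  have "\<exists>l' x. l - 1 / real (Suc n) < l' \<and> l' < l \<and> l' \<le> x \<bullet> e \<and> ut i (mirror e l' x) < ut i x" for n
    using no by (metis not_le of_nat_0_less_iff zero_less_Suc zero_less_divide_1_iff)
  then obtain L X where LX: "\<And>n. l - 1 / real (Suc n) < L n" "\<And>n. L n < l" "\<And>n. L n \<le> X n \<bullet> e"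
    "\<And>n. ut i (mirror e (L n) (X n)) < ut i (X n)" by metis
  have XD: "X n \<in> \<Omega>" for n
    using LX(4)[of n] ut_nonneg[of i "mirror e (L n) (X n)"] ut_pos_iff[of i "X n"] by linarith
  obtain p r where p: "p \<in> closure \<Omega>" "strict_mono r" "(X \<circ> r) \<longlonglongrightarrow> p"
    using compact_closure_dom XD dom_closure unfolding compact_def by metis
  have Ll: "L \<longlonglongrightarrow> l"
  proof (rule tendsto_sandwich[OF _ _ _ tendsto_const])
    show "\<forall>\<^sub>F n in sequentially. l - 1 / real (Suc n) \<le> L n"
      by (intro always_eventually allI less_imp_le LX(1))
    show "\<forall>\<^sub>F n in sequentially. L n \<le> l" by (intro always_eventually allI less_imp_le LX(2))
    have "(\<lambda>n. l - 1 / real (Suc n)) \<longlonglongrightarrow> l - 0"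
      using LIMSEQ_inverse_real_of_nat by (intro tendsto_intros) (simp add: inverse_eq_divide)
    then show "(\<lambda>n. l - 1 / real (Suc n)) \<longlonglongrightarrow> l" by simp
  qed
  define Y where "Y = X \<circ> r"
  define M where "M = L \<circ> r"
  have Yp: "Y \<longlonglongrightarrow> p" and Ml: "M \<longlonglongrightarrow> l" using p(3) LIMSEQ_subseq_LIMSEQ[OF Ll p(2)] by (auto simp: Y_def M_def)
  have YM: "Y n \<in> \<Omega>" "M n \<le> Y n \<bullet> e" "ut i (mirror e (M n) (Y n)) < ut i (Y n)" for n
    using XD LX by (auto simp: Y_def M_def)
  have mlim: "(\<lambda>n. mirror e (M n) (Y n)) \<longlonglongrightarrow> mirror e l p"
    unfolding mirror_def by (intro tendsto_intros Yp Ml)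
  have pe: "l \<le> p \<bullet> e"
    by (rule tendsto_le[OF _ tendsto_inner[OF Yp tendsto_const] Ml]) (use YM(2) in auto)
  \<comment> \<open>The strict inequality weakens in the limit. Off the plane this still contradicts
    strictness; on the plane it is trivial, and the exact position of \<open>p\<close> has to be
    examined.\<close>
  have le: "ut i (mirror e l p) \<le> ut i p"
  proof (rule tendsto_le[OF _ isCont_tendsto_compose[OF isCont_ut Yp] isCont_tendsto_compose[OF isCont_ut mlim]])
    show "\<forall>\<^sub>F n in sequentially. ut i (mirror e (M n) (Y n)) \<le> ut i (Y n)"
      by (intro always_eventually allI less_imp_le YM(3))
  qed simp
  show False
  proof (cases "p \<bullet> e = l")
    case False
    then have gt: "l < p \<bullet> e" using pe by simp
    show False
    proof (cases "p \<in> \<Omega>")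
      case True
      then have pc: "p \<in> cap e l" using gt by (simp add: cap_def)
      then have "0 < wdiff i e l p" using st by (simp add: strict_def)
      then show False using le True cap_mirror_in[OF d pc] by (simp add: wdiff_def ut_in)
    next
      case out: False
      then have "p \<in> frontier \<Omega>" using p(1) by (simp add: frontier_eq)
      from strict_boundary[OF st this gt] have "0 < ut i (mirror e l p)" by (simp add: ut_pos_iff)
      then show False using le out by (simp add: ut_out)
    qed
  next
    case pl: True
    have mp: "mirror e l p = p" by (rule mirror_fixed[OF e pl])
    show False
    proof (cases "p \<in> \<Omega>")
      case True
      have "continuous_on \<Omega> (\<lambda>x. G i x \<bullet> e)"
        using continuous_on_subset[OF cont_G closure_subset] by (intro continuous_intros)
      then have "open (\<Omega> \<inter> (\<lambda>x. G i x \<bullet> e) -` {..<0})" using open_dom by (intro continuous_open_preimage) auto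
      moreover have "p \<in> \<Omega> \<inter> (\<lambda>x. G i x \<bullet> e) -` {..<0}" using strict_plane[OF st True pl, of i] True by simp
      ultimately obtain s where s: "s > 0" "ball p s \<subseteq> \<Omega> \<inter> (\<lambda>x. G i x \<bullet> e) -` {..<0}"
        unfolding open_contains_ball by blast
      have "\<forall>\<^sub>F n in sequentially. Y n \<in> ball p s"
        using tendstoD[OF Yp s(1)] by (simp add: dist_commute)
      moreover have "\<forall>\<^sub>F n in sequentially. mirror e (M n) (Y n) \<in> ball p s"
        using tendstoD[OF mlim s(1)] mp by (simp add: dist_commute)
      ultimately have "\<forall>\<^sub>F n in sequentially. False"
      proof eventually_elim
        case (elim n)
        let ?y = "Y n" and ?z = "mirror e (M n) (Y n)"
        have seg: "?y + t *\<^sub>R (?z - ?y) \<in> ball p s" if "0 \<le> t" "t \<le> 1" for t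
        proof -
          have "(1 - t) *\<^sub>R ?y + t *\<^sub>R ?z \<in> ball p s"
            using convexD[OF convex_ball elim, of "1 - t" t] that by simp
          then show ?thesis by (simp add: algebra_simps)
        qed
        have yz: "?y \<in> \<Omega>" "?z \<in> \<Omega>" using elim s(2) by auto
        have seg': "?y + t *\<^sub>R (?z - ?y) \<in> \<Omega>" if "0 < t" "t < 1" for t
          using subsetD[OF s(2) seg[of t]] that by simp
        obtain t where t: "0 < t" "t < 1" "u i ?z - u i ?y = G i (?y + t *\<^sub>R (?z - ?y)) \<bullet> (?z - ?y)"
          using mean_value_u[OF dom_closure[OF yz(1)] dom_closure[OF yz(2)] seg'] by blast
        define q where "q = G i (?y + t *\<^sub>R (?z - ?y)) \<bullet> e"
        have q0: "q < 0" using subsetD[OF s(2) seg[of t]] t(1,2) by (simp add: q_def)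
        have "?z - ?y = (- (2 * (?y \<bullet> e - M n))) *\<^sub>R e" unfolding mirror_def scaleR_minus_left by simp
        then have "u i ?z - u i ?y = (2 * (?y \<bullet> e - M n)) * (- q)"
          using t(3) unfolding q_def by (metis inner_scaleR_right mult_minus_left mult_minus_right)
        moreover have "0 \<le> (2 * (?y \<bullet> e - M n)) * (- q)" using YM(2)[of n] q0 by (intro mult_nonneg_nonneg) auto
        ultimately show False using YM(3)[of n] yz by (simp add: ut_in)
      qed
      then show False by simp
    next
      case False
      then have pf: "p \<in> frontier \<Omega>" using p(1) by (simp add: frontier_eq)
      have "nu p \<bullet> e \<le> 0" by (rule dominated_nu[OF e d pf pl])
      moreover have "nu p \<bullet> e \<noteq> 0"
      proof
        assume z: "nu p \<bullet> e = 0"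
        show False
        proof (cases "c i = 0")
          case True
          show False by (rule corner_degenerate[OF st True pf pl z])
        next
          case False
          then have "0 < c i" using c_nonneg[of i] by simp
          then show False by (intro corner_nondegenerate[OF st _ _ pf pl z] dom)
        qed
      qed
      ultimately have "nu p \<bullet> e < 0" by simp
      then obtain s where s: "s > 0" "\<And>z t. z \<in> \<Omega> \<inter> ball p s \<Longrightarrow> t \<in> {0..s} \<Longrightarrow> z - t *\<^sub>R e \<in> \<Omega> \<and> u i z \<le> u i (z - t *\<^sub>R e)"
        using monotone_near_boundary[OF e pf, of i] by blast
      have "(\<lambda>n. 2 * (Y n \<bullet> e - M n)) \<longlonglongrightarrow> 2 * (p \<bullet> e - l)" by (intro tendsto_intros Yp Ml)
      then have "\<forall>\<^sub>F n in sequentially. 2 * (Y n \<bullet> e - M n) < s" using s(1) pl by (intro order_tendstoD(2)) auto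
      moreover have "\<forall>\<^sub>F n in sequentially. Y n \<in> ball p s"
        using tendstoD[OF Yp s(1)] by (simp add: dist_commute)
      ultimately have "\<forall>\<^sub>F n in sequentially. False"
      proof eventually_elim
        case (elim n)
        have "mirror e (M n) (Y n) \<in> \<Omega> \<and> u i (Y n) \<le> u i (mirror e (M n) (Y n))"
          unfolding mirror_def using elim YM(1,2)[of n] by (intro s(2)) auto
        then show False using YM(1,3)[of n] by (simp add: ut_in)
      qed
      then show False by simp
    qed
  qed
qed

section \<open>Symmetry in every direction\<close>

definition symmetric :: "real^'N \<Rightarrow> real \<Rightarrow> bool" where
  "symmetric e l \<longleftrightarrow> (\<forall>z\<in>\<Omega>. mirror e l z \<in> \<Omega> \<and> (\<forall>j. u j (mirror e l z) = u j z))"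

text \<open>Reflections in two distinct parallel planes compose to a translation, and iterating it
  leads out of the bounded domain.\<close>

lemma symmetric_unique_le:
  assumes e: "norm e = 1" and s: "symmetric e l" "symmetric e l'"
  shows "l' \<le> l"
proof (rule ccontr)
  assume "\<not> l' \<le> l"
  then have lt: "l < l'" by simp
  have tr: "mirror e l' (mirror e l x) = x + (2 * (l' - l)) *\<^sub>R e" for x
  proof -
    have "mirror e l' (mirror e l x) = x - (2 * (x \<bullet> e - l)) *\<^sub>R e - (2 * (2 * l - x \<bullet> e - l')) *\<^sub>R e"
      unfolding mirror_def[of e l' "mirror e l x"] mirror_inner[OF e] unfolding mirror_def by simp
    also have "\<dots> = x - (2 * (x \<bullet> e - l) + 2 * (2 * l - x \<bullet> e - l')) *\<^sub>R e" by (simp only: scaleR_add_left diff_diff_eq)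
    also have "2 * (x \<bullet> e - l) + 2 * (2 * l - x \<bullet> e - l') = - (2 * (l' - l))" by simp
    finally show ?thesis by (simp only: scaleR_minus_left diff_minus_eq_add)
  qed
  obtain x where x: "x \<in> \<Omega>" using nonempty_dom by blast
  have it: "x + (real n * (2 * (l' - l))) *\<^sub>R e \<in> \<Omega>" for n
  proof (induction n)
    case (Suc n)
    have "mirror e l' (mirror e l (x + (real n * (2 * (l' - l))) *\<^sub>R e)) \<in> \<Omega>" using Suc s by (simp add: symmetric_def)
    moreover have "real (Suc n) * (2 * (l' - l)) = real n * (2 * (l' - l)) + 2 * (l' - l)" by (simp add: algebra_simps)
    ultimately show ?case unfolding tr by (simp only: scaleR_add_left add.assoc)
  qed (use x in simp)
  obtain B where B: "\<And>z. z \<in> \<Omega> \<Longrightarrow> norm z \<le> B" using bounded_dom bounded_iff by blast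
  obtain n where n: "B + norm x < real n * (2 * (l' - l))" using reals_Archimedean3[of "2 * (l' - l)"] lt by auto
  have "real n * (2 * (l' - l)) = norm ((real n * (2 * (l' - l))) *\<^sub>R e)" using e lt by simp
  also have "\<dots> \<le> norm (x + (real n * (2 * (l' - l))) *\<^sub>R e) + norm x"
    using norm_triangle_ineq4[of "x + (real n * (2 * (l' - l))) *\<^sub>R e" x] by simp
  also have "\<dots> \<le> B + norm x" using B[OF it] by simp
  finally show False using n by simp
qed

lemma symmetric_unique: "norm e = 1 \<Longrightarrow> symmetric e l \<Longrightarrow> symmetric e l' \<Longrightarrow> l = l'"
  using symmetric_unique_le by (metis order_antisym)

lemma not_strict_symmetric:
  assumes e: "norm e = 1" and d: "dominated e l" and n: "\<not> strict e l"
  shows "symmetric e l"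
proof -
  obtain i x where x: "x \<in> cap e l" "\<not> 0 < wdiff i e l x" using n e d unfolding strict_def by blast
  then have "wdiff i e l x = 0" using cap_le[OF d x(1), of i] by (simp add: wdiff_def)
  then show ?thesis using zero_imp_symmetric[OF e d x(1)] unfolding symmetric_def by blast
qed

lemma critical_position:
  assumes e: "norm e = 1"
  shows "\<exists>l. symmetric e l \<and> (\<forall>l'>l. strict e l')"
proof -
  obtain B where B: "\<And>z. z \<in> \<Omega> \<Longrightarrow> norm z \<le> B" using bounded_dom bounded_iff by blast
  have Be: "\<bar>z \<bullet> e\<bar> \<le> B" if "z \<in> \<Omega>" for z
    using Cauchy_Schwarz_ineq2[of z e] e B[OF that] by simp
  \<comment> \<open>Demanding domination for all higher planes makes \<open>S\<close> closed
    upwards; the corner argument needs this as well.\<close>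
  define S where "S = {l. \<forall>l'\<ge>l. dominated e l'}"
  have "B + 1 \<in> S"
  proof -
    have "dominated e l'" if l': "B + 1 \<le> l'" for l'
      unfolding dominated_def
    proof (intro allI impI)
      fix i x assume "l' \<le> x \<bullet> e"
      then have "x \<notin> \<Omega>" using Be[of x] l' by auto
      then show "ut i x \<le> ut i (mirror e l' x)" using ut_nonneg by (simp add: ut_out)
    qed
    then show ?thesis by (simp add: S_def)
  qed
  then have Sne: "S \<noteq> {}" by blast
  have bdd: "bdd_below S"
  proof (rule bdd_belowI)
    fix l assume l: "l \<in> S"
    obtain x where x: "x \<in> \<Omega>" using nonempty_dom by blast
    show "- B \<le> l"
    proof (rule ccontr)
      assume "\<not> - B \<le> l"
      then have lt: "l < - B" by simp
      have "mirror e l x \<in> \<Omega>" using l lt Be[OF x] by (intro dominated_mirror_in x) (auto simp: S_def)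
      from Be[OF this] show False using lt Be[OF x] by (simp add: mirror_inner[OF e])
    qed
  qed
  define l where "l = Inf S"
  have above: "dominated e l'" if "l < l'" for l'
  proof -
    obtain s where "s \<in> S" "s < l'" using cInf_lessD[OF Sne] \<open>l < l'\<close> by (auto simp: l_def)
    then show ?thesis by (simp add: S_def)
  qed
  \<comment> \<open>For points strictly above the plane the inequality passes to the limit from
    higher positions; points on the plane are fixed by the reflection.\<close>
  have at: "dominated e l"
    unfolding dominated_def
  proof (intro allI impI)
    fix i x assume x: "l \<le> x \<bullet> e"
    show "ut i x \<le> ut i (mirror e l x)"
    proof (cases "x \<bullet> e = l")
      case True then show ?thesis using mirror_fixed[OF e True] by simp
    next
      case False
      then have lt: "l < x \<bullet> e" using x by simp
      have "((\<lambda>l'. mirror e l' x) \<longlongrightarrow> mirror e l x) (at_right l)" unfolding mirror_def by (intro tendsto_intros)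
      then have lim: "((\<lambda>l'. ut i (mirror e l' x)) \<longlongrightarrow> ut i (mirror e l x)) (at_right l)" by (rule isCont_tendsto_compose[OF isCont_ut])
      have "\<forall>\<^sub>F l' in at_right l. l' \<in> {l<..<x \<bullet> e}" using lt by (intro eventually_at_rightI) auto
      then have "\<forall>\<^sub>F l' in at_right l. ut i x \<le> ut i (mirror e l' x)"
        by eventually_elim (use above in \<open>auto simp: dominated_def\<close>)
      with lim show ?thesis by (rule tendsto_lowerbound) simp
    qed
  qed
  have ge: "dominated e l'" if "l \<le> l'" for l' using above at that by (cases "l = l'") auto
  have "\<not> strict e l"
  proof
    assume st: "strict e l"
    obtain \<eta> where \<eta>: "\<And>i. \<eta> i > 0" "\<And>i l' x. l - \<eta> i < l' \<Longrightarrow> l' < l \<Longrightarrow> l' \<le> x \<bullet> e \<Longrightarrow> ut i x \<le> ut i (mirror e l' x)"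
      using plane_step[OF st ge] by metis
    define m where "m = Min (range \<eta>)"
    have m: "m > 0" "m \<le> \<eta> i" for i using \<eta>(1) by (auto simp: m_def)
    have "dominated e l'" if "l - m / 2 \<le> l'" for l'
    proof (cases "l \<le> l'")
      case False
      have "ut i x \<le> ut i (mirror e l' x)" if "l' \<le> x \<bullet> e" for i x
        using \<eta>(2)[of i l' x] m(1) m(2)[of i] False \<open>l - m / 2 \<le> l'\<close> that by linarith
      then show ?thesis by (simp add: dominated_def)
    qed (rule ge)
    then have "l - m / 2 \<in> S" by (simp add: S_def)
    then have "l \<le> l - m / 2" unfolding l_def by (rule cInf_lower[OF _ bdd])
    then show False using m(1) by simp
  qed
  then have sym: "symmetric e l" by (rule not_strict_symmetric[OF e at])
  \<comment> \<open>A higher position that is not strict would be a second plane of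
    symmetry.\<close>
  moreover have "strict e l'" if "l < l'" for l'
    using not_strict_symmetric[OF e above[OF that]] symmetric_unique[OF e sym] that by fastforce
  ultimately show ?thesis by blast
qed

text \<open>All planes of symmetry pass through any maximum point of \<open>u i\<close>.\<close>

lemma common_center:
  "\<exists>x0\<in>\<Omega>. \<forall>e. norm e = 1 \<longrightarrow> symmetric e (x0 \<bullet> e) \<and> (\<forall>l'>x0 \<bullet> e. strict e l')"
proof -
  obtain i :: 'n where True by simp
  have "closure \<Omega> \<noteq> {}" using nonempty_dom by simp
  then obtain x0 where x0: "x0 \<in> closure \<Omega>" "\<And>x. x \<in> closure \<Omega> \<Longrightarrow> u i x \<le> u i x0"
    using continuous_attains_sup[OF compact_closure_dom _ cont_u[of i]] by blast
  have x0D: "x0 \<in> \<Omega>"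
  proof (rule ccontr)
    assume "x0 \<notin> \<Omega>"
    then have "u i x0 = 0" using x0 by (intro u_zero) (simp add: frontier_eq)
    moreover obtain z where "z \<in> \<Omega>" using nonempty_dom by blast
    ultimately show False using x0(2)[OF dom_closure[OF \<open>z \<in> \<Omega>\<close>]] u_pos[OF \<open>z \<in> \<Omega>\<close>, of i] by simp
  qed
  have "(-1) *\<^sub>R G i x0 = 0"
    by (rule jet_local_min(1)[OF jet_cmult[OF jet_u] x0D]) (use x0 dom_closure in auto)
  then have G0: "G i x0 = 0" by simp
  \<comment> \<open>A strict plane through \<open>x0\<close> would force a negative slope at a
    critical point.\<close>
  have half: "x0 \<bullet> e \<le> l" if "norm e = 1" "\<forall>l'>l. strict e l'" for e l
  proof (rule ccontr)
    assume "\<not> x0 \<bullet> e \<le> l"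
    then have "strict e (x0 \<bullet> e)" using that by simp
    from strict_plane[OF this x0D refl, of i] show False by (simp add: G0)
  qed
  have "symmetric e (x0 \<bullet> e) \<and> (\<forall>l'>x0 \<bullet> e. strict e l')" if e: "norm e = 1" for e
  proof -
    obtain l where l: "symmetric e l" "\<forall>l'>l. strict e l'" using critical_position[OF e] by blast
    \<comment> \<open>Moving the plane from the opposite side also stops at a plane of symmetry
      orthogonal to \<open>e\<close>, hence at the same one; the two inequalities from
      \<open>half\<close> place \<open>x0\<close> on it.\<close>
    obtain l2 where l2: "symmetric (- e) l2" "\<forall>l'>l2. strict (- e) l'" using critical_position[of "- e"] e by auto
    have "mirror (- e) l2 = mirror e (- l2)"
    proof
      fix x
      have "2 * (x \<bullet> (- e) - l2) = - (2 * (x \<bullet> e - - l2))" by simp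
      then show "mirror (- e) l2 x = mirror e (- l2) x"
        by (simp only: mirror_def scaleR_minus_left scaleR_minus_right minus_minus)
    qed
    then have "symmetric e (- l2)" using l2(1) by (simp add: symmetric_def)
    then have "l = - l2" using symmetric_unique[OF e l(1)] by simp
    moreover have "x0 \<bullet> e \<le> l" by (rule half[OF e l(2)])
    moreover have "x0 \<bullet> (- e) \<le> l2" using e by (intro half[OF _ l2(2)]) simp
    ultimately have "x0 \<bullet> e = l" by simp
    then show ?thesis using l by simp
  qed
  then show ?thesis using x0D by blast
qed

text \<open>Reflections in planes through \<open>x0\<close> exchange any two points at equal
  distance from it, so the domain is a union of spheres. That no smaller radius is missing comes
  from domination by the planes above \<open>x0\<close>, as in \<open>star\<close>.\<close>

theorem radial:
  "\<exists>x0 R. R > 0 \<and> \<Omega> = ball x0 R \<and>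
     (\<forall>i. radially_symmetric_on (closure \<Omega>) x0 (u i) \<and> (\<forall>x\<in>\<Omega> - {x0}. \<exists>d<0. has_radial_deriv x0 (u i) x d))"
proof -
  obtain x0 where x0: "x0 \<in> \<Omega>" "\<And>e. norm e = 1 \<Longrightarrow> symmetric e (x0 \<bullet> e)" "\<And>e l'. norm e = 1 \<Longrightarrow> x0 \<bullet> e < l' \<Longrightarrow> strict e l'"
    using common_center by blast
  have inv: "b \<in> \<Omega> \<and> u i b = u i a" if a: "a \<in> \<Omega>" and ab: "norm (a - x0) = norm (b - x0)" for a b i
  proof (cases "a = b")
    case False
    define e where "e = sgn (a - b)"
    have e: "norm e = 1" using False by (simp add: e_def norm_sgn)
    have abe: "a - b = norm (a - b) *\<^sub>R e" using False by (simp add: e_def sgn_div_norm)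
    have "(a - x0) \<bullet> (a - x0) = (b - x0) \<bullet> (b - x0)" using ab by (simp add: dot_square_norm)
    moreover have "(a - b) \<bullet> (a - b) = 2 * ((a - x0) \<bullet> (a - b)) - ((a - x0) \<bullet> (a - x0) - (b - x0) \<bullet> (b - x0))"
      by (simp add: inner_diff_left inner_diff_right inner_commute algebra_simps)
    ultimately have "norm (a - b) * norm (a - b) = 2 * ((a - x0) \<bullet> (a - b))" by (simp add: dot_square_norm power2_eq_square)
    also have "(a - x0) \<bullet> (a - b) = norm (a - b) * ((a - x0) \<bullet> e)" by (subst abe) simp
    finally have "norm (a - b) = 2 * ((a - x0) \<bullet> e)" using False by simp
    then have "mirror e (x0 \<bullet> e) a = a - norm (a - b) *\<^sub>R e" by (simp add: mirror_def inner_diff_left)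
    also have "\<dots> = b" using abe by (metis add_diff_cancel_left' diff_add_cancel)
    finally have "mirror e (x0 \<bullet> e) a = b" .
    then show ?thesis using x0(2)[OF e] a unfolding symmetric_def by metis
  qed (use a in simp)
  have dir: "norm (sgn (a - x0)) = 1" "(a - x0) \<bullet> sgn (a - x0) = norm (a - x0)" "a = x0 + norm (a - x0) *\<^sub>R sgn (a - x0)"
    "0 < norm (a - x0)" if "a \<noteq> x0" for a
    using that by (auto simp: norm_sgn sgn_div_norm dot_square_norm power2_eq_square)
  have star: "x0 + s *\<^sub>R sgn (a - x0) \<in> \<Omega>" if a: "a \<in> \<Omega>" "a \<noteq> x0" and s: "0 \<le> s" "s \<le> norm (a - x0)" for a s
  proof -
    define e where "e = sgn (a - x0)"
    note ed = dir[OF a(2), folded e_def]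
    define \<tau> where "\<tau> = norm (a - x0) - s"
    \<comment> \<open>The plane halfway between \<open>a\<close> and the target point; it lies above
      \<open>x0\<close> and reflects one point to the other.\<close>
    let ?l = "a \<bullet> e - \<tau> / 2"
    have "a \<bullet> e - x0 \<bullet> e = norm (a - x0)" using ed(2) by (simp add: inner_diff_left)
    moreover have "X < A - (n - s) / 2" if "A - X = n" "0 < n" for A X n :: real using that s(1) by (simp add: field_simps)
    ultimately have "x0 \<bullet> e < ?l" unfolding \<tau>_def using ed(4) by blast
    then have "dominated e ?l" using x0(3)[OF ed(1)] by (simp add: strict_def)
    then have "mirror e ?l a \<in> \<Omega>" using s by (intro dominated_mirror_in a) (auto simp: \<tau>_def)
    moreover have "mirror e ?l a = a - \<tau> *\<^sub>R e" by (simp add: mirror_def)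
    moreover have "a - \<tau> *\<^sub>R e = x0 + s *\<^sub>R e"
    proof -
      have "(x0 + norm (a - x0) *\<^sub>R e) - \<tau> *\<^sub>R e = x0 + (norm (a - x0) - \<tau>) *\<^sub>R e"
        by (simp only: scaleR_diff_left add_diff_eq)
      moreover have "norm (a - x0) - \<tau> = s" by (simp add: \<tau>_def)
      ultimately show ?thesis using ed(3) by (simp only: flip: ed(3))
    qed
    ultimately have "x0 + s *\<^sub>R e \<in> \<Omega>" by (simp only:)
    then show ?thesis by (simp only: e_def)
  qed
  define R where "R = (SUP x\<in>\<Omega>. dist x x0)"
  have bdd: "bdd_above ((\<lambda>x. dist x x0) ` \<Omega>)"
    using bounded_dom by (metis bounded_any_center bdd_above.I2 dist_commute)
  have up: "dist x x0 \<le> R" if "x \<in> \<Omega>" for x unfolding R_def by (rule cSUP_upper[OF that bdd])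
  have lt: "dist x x0 < R" if x: "x \<in> \<Omega>" for x
  proof -
    obtain r where r: "r > 0" "ball x r \<subseteq> \<Omega>" using open_dom x open_contains_ball by blast
    \<comment> \<open>The outward radial direction; at the centre any unit vector serves.\<close>
    define e where "e = (if x = x0 then axis undefined 1 else sgn (x - x0))"
    have e: "norm e = 1" using dir(1)[of x] by (simp add: e_def)
    have "x + (r/2) *\<^sub>R e \<in> ball x r" using r e by (simp add: dist_norm)
    then have "dist (x + (r/2) *\<^sub>R e) x0 \<le> R" using up r by blast
    moreover have "dist (x + (r/2) *\<^sub>R e) x0 = dist x x0 + r / 2"
    proof (cases "x = x0")
      case True then show ?thesis using e r by (simp add: dist_norm)
    next
      case False
      have "x + (r/2) *\<^sub>R e - x0 = (norm (x - x0) + r/2) *\<^sub>R e"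
        using dir(3)[OF False] False by (simp add: e_def scaleR_add_left algebra_simps)
      then show ?thesis using e r by (simp add: dist_norm)
    qed
    ultimately show ?thesis using r by simp
  qed
  have R0: "0 < R" using lt[OF x0(1)] by simp
  have ball: "\<Omega> = ball x0 R"
  proof
    show "\<Omega> \<subseteq> ball x0 R" using lt by (auto simp: dist_commute)
    show "ball x0 R \<subseteq> \<Omega>"
    proof
      fix b assume "b \<in> ball x0 R"
      then have "dist b x0 < R" by (simp add: dist_commute)
      then obtain a where a: "a \<in> \<Omega>" "dist b x0 < dist a x0"
        unfolding R_def using less_cSUP_iff[OF nonempty_dom bdd] by blast
      then have ax: "a \<noteq> x0" by auto
      let ?a = "x0 + norm (b - x0) *\<^sub>R sgn (a - x0)"
      have "?a \<in> \<Omega>" using a by (intro star[OF a(1) ax]) (auto simp: dist_norm)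
      moreover have "norm (?a - x0) = norm (b - x0)" using dir(1)[OF ax] by simp
      ultimately show "b \<in> \<Omega>" using inv by blast
    qed
  qed
  have clo: "closure \<Omega> = cball x0 R" unfolding ball using R0 by simp
  have fro: "x \<in> frontier \<Omega>" if "dist x x0 = R" for x
    unfolding ball using that R0 by (simp add: dist_commute frontier_ball)
  have rad: "radially_symmetric_on (closure \<Omega>) x0 (u i)" for i
  proof -
    \<comment> \<open>The profile evaluates \<open>u i\<close> at some chosen point of each radius.
      For the outer radius \<open>inv\<close> gives nothing, and the zero boundary values are
      used.\<close>
    define \<phi> where "\<phi> = (\<lambda>\<rho>. u i (SOME x. x \<in> closure \<Omega> \<and> dist x x0 = \<rho>))"
    have "u i x = \<phi> (dist x x0)" if x: "x \<in> closure \<Omega>" for x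
    proof -
      define z where "z = (SOME z. z \<in> closure \<Omega> \<and> dist z x0 = dist x x0)"
      have z: "z \<in> closure \<Omega> \<and> dist z x0 = dist x x0" unfolding z_def by (rule someI[of _ x]) (use x in simp)
      have "u i x = u i z"
      proof (cases "dist x x0 < R")
        case True
        then have "x \<in> \<Omega>" by (simp add: ball dist_commute)
        then show ?thesis using inv[of x z i] z by (simp add: dist_norm)
      next
        case False
        then have "dist x x0 = R" using x clo by (simp add: dist_commute)
        then show ?thesis using fro[of x] fro[of z] z u_zero by simp
      qed
      then show ?thesis by (simp add: \<phi>_def z_def)
    qed
    then show ?thesis unfolding radially_symmetric_on_def by blast
  qed
  have der: "\<exists>d<0. has_radial_deriv x0 (u i) x d" if x: "x \<in> \<Omega> - {x0}" for i x
  proof -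
    define e where "e = sgn (x - x0)"
    have xD: "x \<in> \<Omega>" "x \<noteq> x0" using x by auto
    note ed = dir[OF xD(2), folded e_def]
    have "0 < x \<bullet> e - x0 \<bullet> e" using ed(4) unfolding ed(2)[symmetric] inner_diff_left .
    then have "x0 \<bullet> e < x \<bullet> e" by linarith
    then have "G i x \<bullet> e < 0" using strict_plane[OF x0(3)[OF ed(1)] xD(1) refl] by simp
    moreover have "has_radial_deriv x0 (u i) x (G i x \<bullet> e)"
    proof -
      have l: "((\<lambda>r. x0 + r *\<^sub>R e) has_derivative (\<lambda>h. h *\<^sub>R e)) (at (dist x x0))" by (auto intro!: derivative_eq_intros)
      have xe: "x0 + dist x x0 *\<^sub>R e = x" using ed(3) by (simp add: dist_norm)
      have "(u i has_derivative (\<lambda>h. G i x \<bullet> h)) (at (x0 + dist x x0 *\<^sub>R e))" unfolding xe by (rule jetD(2)[OF jet_u xD(1)])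
      from diff_chain_at[OF l this] show ?thesis
        unfolding has_radial_deriv_def e_def[symmetric] has_field_derivative_def o_def
        by (rule has_derivative_eq_rhs) (auto simp: fun_eq_iff)
    qed
    ultimately show ?thesis by blast
  qed
  show ?thesis using R0 ball rad der by blast
qed

end

section \<open>Domains of class \<open>C\<^sup>2\<close>\<close>

lemma jet_of_C2_on:
  assumes "C2_on S w"
  shows "jet w (grad w) (hessian w) S"
  unfolding jet_def
proof (intro conjI ballI)
  show "open S" using assms by (simp add: C2_on_def)
  fix x assume x: "x \<in> S"
  have d: "w differentiable at x" "grad w differentiable at x" using assms x by (auto simp: C2_on_def)
  have fd: "(w has_derivative frechet_derivative w (at x)) (at x)" using d(1) by (simp add: frechet_derivative_works)
  then have lin: "linear (frechet_derivative w (at x))" by (rule has_derivative_linear)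
  have "frechet_derivative w (at x) h = grad w x \<bullet> h" for h
  proof -
    have "frechet_derivative w (at x) h = frechet_derivative w (at x) (\<Sum>k\<in>UNIV. h $ k *\<^sub>R axis k 1)"
      using basis_expansion[of h] by (simp add: scalar_mult_eq_scaleR)
    also have "\<dots> = (\<Sum>k\<in>UNIV. h $ k * frechet_derivative w (at x) (axis k 1))"
      using lin by (simp add: linear_sum linear_cmul)
    finally show ?thesis by (simp add: grad_def inner_vec_def mult.commute)
  qed
  then have "frechet_derivative w (at x) = (\<bullet>) (grad w x)" by (rule ext)
  then show "(w has_derivative (\<bullet>) (grad w x)) (at x)" using fd by simp
  show "(grad w has_derivative (*v) (hessian w x)) (at x)"
    using d(2) jacobian_works[of "grad w" "at x"] by (simp add: hessian_def)
qed

lemma C2_taylor: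
  fixes y :: "real^'N"
  assumes j: "jet w p X UNIV" and cX: "continuous_on UNIV X"
  shows "\<exists>B\<ge>0. \<forall>a\<in>cball y r. \<forall>b\<in>cball y r. norm (p b - p a) \<le> B * norm (b - a) \<and>
    \<bar>w b - w a - p a \<bullet> (b - a)\<bar> \<le> B * (norm (b - a))\<^sup>2"
proof -
  have "compact (X ` cball y r)" by (intro compact_continuous_image continuous_on_subset[OF cX]) auto
  then have "bounded (X ` cball y r)" by (rule compact_imp_bounded)
  then obtain B0 where B0: "\<And>x. x \<in> cball y r \<Longrightarrow> norm (X x) \<le> B0"
    unfolding bounded_iff image_iff by blast
  define B where "B = max 0 B0"
  have lip: "norm (p b - p a) \<le> B * norm (b - a)" if "a \<in> cball y r" "b \<in> cball y r" for a b
  proof (rule differentiable_bound[OF convex_cball[of y r]])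
    fix x assume x: "x \<in> cball y r"
    show "(p has_derivative (*v) (X x)) (at x within cball y r)"
      using jetD(3)[OF j] by (simp add: has_derivative_at_withinI)
    show "onorm ((*v) (X x)) \<le> B"
    proof (rule onorm_le)
      have "norm (X x) \<le> B" using B0[OF x] by (simp add: B_def)
      then show "norm (X x *v h) \<le> B * norm h" for h
        using norm_matrix_vector[of "X x" h] mult_right_mono[of "norm (X x)" B "norm h"] by (metis norm_ge_zero order_trans)
    qed
  qed (use that in auto)
  have "\<bar>w b - w a - p a \<bullet> (b - a)\<bar> \<le> B * (norm (b - a))\<^sup>2" if ab: "a \<in> cball y r" "b \<in> cball y r" for a b
  proof -
    let ?l = "\<lambda>t::real. a + t *\<^sub>R (b - a)"
    have der: "((\<lambda>t. w (?l t)) has_derivative (\<lambda>h. h * (p (?l t) \<bullet> (b - a)))) (at t)" for t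
    proof -
      have "(?l has_derivative (\<lambda>h. h *\<^sub>R (b - a))) (at t)" by (auto intro!: derivative_eq_intros)
      from diff_chain_at[OF this jetD(2)[OF j UNIV_I]] show ?thesis by (simp add: o_def)
    qed
    have "continuous_on {0..1} (\<lambda>t. w (?l t))"
      by (intro continuous_at_imp_continuous_on ballI has_derivative_continuous[OF der])
    then obtain t where t: "0 < t" "t < 1" "w (?l 1) - w (?l 0) = (1 - 0) * (p (?l t) \<bullet> (b - a))"
      using mvt[OF zero_less_one _ der] by (metis greaterThanLessThan_iff)
    have lt: "?l t \<in> cball y r"
    proof -
      have "(1 - t) *\<^sub>R a + t *\<^sub>R b \<in> cball y r" using convexD[OF convex_cball ab, of "1 - t" t] t by simp
      then show ?thesis by (simp add: algebra_simps)
    qed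
    have "w b - w a - p a \<bullet> (b - a) = (p (?l t) - p a) \<bullet> (b - a)" using t(3) by (simp add: inner_diff_left)
    then have "\<bar>w b - w a - p a \<bullet> (b - a)\<bar> \<le> norm (p (?l t) - p a) * norm (b - a)" by (simp add: Cauchy_Schwarz_ineq2)
    also have "\<dots> \<le> (B * norm (b - a)) * norm (b - a)"
    proof (intro mult_right_mono)
      have "norm (p (?l t) - p a) \<le> B * norm (?l t - a)" by (rule lip[OF ab(1) lt])
      also have "\<dots> \<le> B * norm (b - a)" using t by (intro mult_left_mono) (auto simp: B_def mult_left_le_one_le)
      finally show "norm (p (?l t) - p a) \<le> B * norm (b - a)" .
    qed simp
    finally show ?thesis by (simp add: power2_eq_square)
  qed
  then show ?thesis using lip by (intro exI[of _ B]) (auto simp: B_def)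
qed

text \<open>A local defining function: the difference of the height above the
  boundary graph and the graph function.\<close>

lemma C2_boundary_defining:
  fixes \<Omega> :: "(real^'N) set"
  assumes "open \<Omega>" "C2_boundary \<Omega>" "y \<in> frontier \<Omega>"
  shows "\<exists>r>0. \<exists>L\<ge>0. \<exists>s ds. (\<forall>x\<in>ball y r. x \<in> \<Omega> \<longleftrightarrow> 0 < s x) \<and> (\<forall>x\<in>ball y r \<inter> frontier \<Omega>. s x = 0) \<and> ds y \<noteq> 0 \<and>
    (s has_derivative (\<lambda>h. ds y \<bullet> h)) (at y) \<and>
    (\<forall>a\<in>ball y r. \<forall>b\<in>ball y r. norm (ds b - ds a) \<le> L * norm (b - a) \<and> \<bar>s b - s a - ds a \<bullet> (b - a)\<bar> \<le> L * (norm (b - a))\<^sup>2)"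
proof -
  obtain e r \<phi> where e: "norm e = 1" and r: "r > 0" and C: "C2_on UNIV \<phi>"
    and eq: "\<Omega> \<inter> ball y r = {x \<in> ball y r. \<phi> (x - (x \<bullet> e) *\<^sub>R e) < x \<bullet> e}"
    using assms(2,3) unfolding C2_boundary_def by blast
  have ee: "e \<bullet> e = 1" using e by (simp add: dot_square_norm)
  define P where "P = (\<lambda>x. x - (x \<bullet> e) *\<^sub>R e)"
  define s where "s = (\<lambda>x. x \<bullet> e - \<phi> (P x))"
  \<comment> \<open>The gradient of \<open>s\<close> by the chain rule, the projection
    \<open>P\<close> being self-adjoint.\<close>
  define ds where "ds = (\<lambda>x. e - P (grad \<phi> (P x)))"
  have j: "jet \<phi> (grad \<phi>) (hessian \<phi>) UNIV" by (rule jet_of_C2_on[OF C])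
  have cH: "continuous_on UNIV (hessian \<phi>)" using C by (simp add: C2_on_def)
  obtain B where B: "B \<ge> 0" "\<And>a b. a \<in> cball (P y) r \<Longrightarrow> b \<in> cball (P y) r \<Longrightarrow>
     norm (grad \<phi> b - grad \<phi> a) \<le> B * norm (b - a) \<and> \<bar>\<phi> b - \<phi> a - grad \<phi> a \<bullet> (b - a)\<bar> \<le> B * (norm (b - a))\<^sup>2"
    using C2_taylor[OF j cH, of "P y" r] by blast
  have Pd: "P a - P b = P (a - b)" for a b by (simp add: P_def inner_diff_left scaleR_diff_left)
  have nP: "norm (P a) \<le> norm a" for a
  proof -
    have "P a \<bullet> P a = a \<bullet> a - (a \<bullet> e) * (a \<bullet> e)"
      by (simp add: P_def inner_diff_left inner_diff_right ee inner_commute)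
    then have "P a \<bullet> P a \<le> a \<bullet> a" by simp
    then show ?thesis by (simp add: norm_le)
  qed
  have Psa: "P a \<bullet> b = a \<bullet> P b" for a b by (simp add: P_def inner_diff_left inner_diff_right inner_commute)
  have Pball: "P x \<in> cball (P y) r" if "x \<in> ball y r" for x
    using that nP[of "y - x"] by (simp add: dist_norm Pd)
  have dsh: "ds x \<bullet> h = h \<bullet> e - grad \<phi> (P x) \<bullet> P h" for x h
    by (simp only: ds_def inner_diff_left Psa inner_commute[of e h])
  have iff: "x \<in> \<Omega> \<longleftrightarrow> 0 < s x" if "x \<in> ball y r" for x
  proof -
    have "x \<in> \<Omega> \<longleftrightarrow> x \<in> {x \<in> ball y r. \<phi> (x - (x \<bullet> e) *\<^sub>R e) < x \<bullet> e}" using that by (simp only: flip: eq) simp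
    then show ?thesis using that by (simp add: s_def P_def)
  qed
  have cs: "continuous_on UNIV s"
  proof -
    have "continuous_on UNIV \<phi>" using j jet_continuous_on by blast
    then have "continuous_on UNIV (\<lambda>x. \<phi> (P x))"
      by (rule continuous_on_compose2) (auto simp: P_def intro!: continuous_intros)
    then show ?thesis unfolding s_def by (intro continuous_intros)
  qed
  have fz: "s x = 0" if x: "x \<in> ball y r \<inter> frontier \<Omega>" for x
  proof -
    have xo: "x \<notin> \<Omega>" "x \<in> closure \<Omega>" using x assms(1) by (auto simp: frontier_def interior_open)
    then have "s x \<le> 0" using iff x by (simp add: not_less)
    moreover have "\<not> s x < 0"
    proof
      assume "s x < 0"
      moreover have "open {z. s z < 0}" using cs by (intro open_Collect_less continuous_intros)
      ultimately have "open ({z. s z < 0} \<inter> ball y r)" "x \<in> {z. s z < 0} \<inter> ball y r" using x by auto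
      then obtain z where "z \<in> \<Omega>" "z \<in> {z. s z < 0} \<inter> ball y r"
        using xo(2) by (meson closure_iff_nhds_not_empty disjoint_iff subset_refl)
      then show False using iff by auto
    qed
    ultimately show ?thesis by simp
  qed
  have "ds y \<bullet> e = 1" by (simp add: dsh ee P_def)
  then have dy: "ds y \<noteq> 0" by auto
  have der: "(s has_derivative (\<lambda>h. ds y \<bullet> h)) (at y)"
  proof -
    have "(P has_derivative P) (at y)" unfolding P_def by (auto intro!: derivative_eq_intros)
    from diff_chain_at[OF this jetD(2)[OF j UNIV_I]]
    have "((\<lambda>x. \<phi> (P x)) has_derivative (\<lambda>h. grad \<phi> (P y) \<bullet> P h)) (at y)" by (simp add: o_def)
    then have "(s has_derivative (\<lambda>h. h \<bullet> e - grad \<phi> (P y) \<bullet> P h)) (at y)"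
      unfolding s_def by (auto intro!: derivative_eq_intros)
    then show ?thesis by (simp add: dsh[abs_def])
  qed
  have est: "norm (ds b - ds a) \<le> B * norm (b - a) \<and> \<bar>s b - s a - ds a \<bullet> (b - a)\<bar> \<le> B * (norm (b - a))\<^sup>2"
    if ab: "a \<in> ball y r" "b \<in> ball y r" for a b
  proof -
    note b' = B(2)[OF Pball[OF ab(1)] Pball[OF ab(2)]]
    have n: "norm (P b - P a) \<le> norm (b - a)" using nP[of "b - a"] by (simp add: Pd)
    have "norm (ds b - ds a) \<le> norm (grad \<phi> (P b) - grad \<phi> (P a))"
    proof -
      have "ds b - ds a = - P (grad \<phi> (P b) - grad \<phi> (P a))" by (simp add: ds_def flip: Pd)
      then show ?thesis using nP by simp
    qed
    also have "\<dots> \<le> B * norm (P b - P a)" using b' by blast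
    also have "\<dots> \<le> B * norm (b - a)" using n B(1) by (intro mult_left_mono) auto
    finally have 1: "norm (ds b - ds a) \<le> B * norm (b - a)" .
    have "s b - s a - ds a \<bullet> (b - a) = - (\<phi> (P b) - \<phi> (P a) - grad \<phi> (P a) \<bullet> (P b - P a))"
      by (simp add: s_def dsh Pd inner_diff_left)
    then have "\<bar>s b - s a - ds a \<bullet> (b - a)\<bar> \<le> B * (norm (P b - P a))\<^sup>2" using b' by (simp only: abs_minus_cancel)
    also have "\<dots> \<le> B * (norm (b - a))\<^sup>2" using n B(1) by (intro mult_left_mono power_mono) auto
    finally show ?thesis using 1 by blast
  qed
  show ?thesis
    using r B(1) iff fz dy der est by (intro exI[of _ r] conjI exI[of _ B] exI[of _ s] exI[of _ ds] ballI) auto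
qed

text \<open>All three properties come from one defining function. Its linear part at
  \<open>y\<close> dominates the quadratic error in balls of radius \<open>\<rho>\<close> tangent to
  the boundary, which gives the touching balls; its derivative along \<open>v\<close> stays positive
  near \<open>y\<close>, which gives the uniform statement about segments.\<close>

lemma C2_boundary_normal:
  fixes \<Omega> :: "(real^'N) set"
  assumes "open \<Omega>" "C2_boundary \<Omega>" and y: "y \<in> frontier \<Omega>"
  shows "\<exists>\<nu>. interior_unit_normal \<Omega> y \<nu> \<and>
    (\<exists>\<rho>>0. ball (y + \<rho> *\<^sub>R \<nu>) \<rho> \<subseteq> \<Omega> \<and> ball (y - \<rho> *\<^sub>R \<nu>) \<rho> \<inter> \<Omega> = {}) \<and>
    (\<forall>v. 0 < v \<bullet> \<nu> \<longrightarrow> (\<exists>r>0. \<forall>x\<in>\<Omega> \<inter> ball y r. \<forall>t\<in>{0..r}. x + t *\<^sub>R v \<in> \<Omega>))"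
proof -
  obtain r L s ds where r: "r > 0" and L: "L \<ge> 0" and iff': "\<forall>x\<in>ball y r. x \<in> \<Omega> \<longleftrightarrow> 0 < s x"
    and fz': "\<forall>x\<in>ball y r \<inter> frontier \<Omega>. s x = 0" and d0: "ds y \<noteq> 0"
    and der: "(s has_derivative (\<lambda>h. ds y \<bullet> h)) (at y)"
    and est: "\<forall>a\<in>ball y r. \<forall>b\<in>ball y r. norm (ds b - ds a) \<le> L * norm (b - a) \<and> \<bar>s b - s a - ds a \<bullet> (b - a)\<bar> \<le> L * (norm (b - a))\<^sup>2"
    using C2_boundary_defining[OF assms] by blast
  note iff = iff'[rule_format] and fz = fz'[rule_format, OF IntI]
    and lip = est[rule_format, THEN conjunct1] and tay = est[rule_format, THEN conjunct2]
  define m where "m = norm (ds y)"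
  define \<nu> where "\<nu> = (1 / m) *\<^sub>R ds y"
  have m: "m > 0" using d0 by (simp add: m_def)
  have \<nu>: "norm \<nu> = 1" "ds y = m *\<^sub>R \<nu>" using m by (simp_all add: \<nu>_def m_def)
  have nn: "\<nu> \<bullet> \<nu> = 1" using \<nu>(1) by (simp add: dot_square_norm)
  have yr: "y \<in> ball y r" using r by simp
  have sy: "s y = 0" by (rule fz[OF yr y])
  have sx: "\<bar>s x - m * (\<nu> \<bullet> (x - y))\<bar> \<le> L * ((x - y) \<bullet> (x - y))" if "x \<in> ball y r" for x
    using tay[OF yr that] sy by (simp add: \<nu>(2) power2_norm_eq_inner)
  define \<rho> where "\<rho> = min (r / 2) (m / (2 * (L + 1)))"
  have \<rho>: "\<rho> > 0" "2 * \<rho> \<le> r" "2 * \<rho> * (L + 1) \<le> m"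
  proof -
    show "\<rho> > 0" "2 * \<rho> \<le> r" using r m L by (auto simp: \<rho>_def)
    have "\<rho> \<le> m / (2 * (L + 1))" by (simp add: \<rho>_def)
    then show "2 * \<rho> * (L + 1) \<le> m" using L by (simp add: field_simps)
  qed
  have bl: "x \<in> ball y r \<and> (x - y) \<bullet> (x - y) < 2 * \<rho> * (\<mu> \<bullet> (x - y))"
    if x: "x \<in> ball (y + \<rho> *\<^sub>R \<mu>) \<rho>" and \<mu>: "norm \<mu> = 1" for x \<mu>
  proof
    have "dist y x \<le> dist y (y + \<rho> *\<^sub>R \<mu>) + dist (y + \<rho> *\<^sub>R \<mu>) x" by (rule dist_triangle)
    then show "x \<in> ball y r" using x \<mu> \<rho> by (simp add: dist_norm)
    have "norm (h - \<rho> *\<^sub>R \<mu>) = dist (y + \<rho> *\<^sub>R \<mu>) x" if "h = x - y" for h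
      by (simp add: that dist_norm norm_minus_commute algebra_simps)
    then have "norm ((x - y) - \<rho> *\<^sub>R \<mu>) < \<rho>" using x by simp
    then have "(norm ((x - y) - \<rho> *\<^sub>R \<mu>))\<^sup>2 < \<rho>\<^sup>2" by (intro power_strict_mono) auto
    moreover have "(norm (h - \<rho> *\<^sub>R \<mu>))\<^sup>2 = h \<bullet> h - 2 * \<rho> * (\<mu> \<bullet> h) + \<rho>\<^sup>2" for h
    proof -
      have "\<mu> \<bullet> \<mu> = 1" using \<mu> by (simp add: dot_square_norm)
      then show ?thesis unfolding power2_norm_eq_inner
        by (simp add: inner_diff_left inner_diff_right inner_commute[of h \<mu>] power2_eq_square right_diff_distrib)
    qed
    ultimately show "(x - y) \<bullet> (x - y) < 2 * \<rho> * (\<mu> \<bullet> (x - y))" by simp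
  qed
  \<comment> \<open>In a tangent ball the squared distance \<open>q\<close> to \<open>y\<close> is
    below \<open>2 * \<rho>\<close> times the height \<open>z\<close>, so the Taylor error
    \<open>L * q\<close> is beaten by the linear term \<open>m * z\<close>.\<close>
  have Lm: "L * q < m * z" if "0 \<le> q" "q < 2 * \<rho> * z" for q z
  proof -
    have z: "0 < z" using that \<rho>(1) by (smt (verit) mult_nonneg_nonpos mult_pos_pos)
    have "L * q \<le> (L + 1) * q" using that by (simp add: mult_right_mono)
    also have "\<dots> < (L + 1) * (2 * \<rho> * z)" using that L by (intro mult_strict_left_mono) auto
    also have "\<dots> = (2 * \<rho> * (L + 1)) * z" by simp
    also have "\<dots> \<le> m * z" using \<rho>(3) z by (intro mult_right_mono) auto
    finally show ?thesis .
  qed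
  have inside: "ball (y + \<rho> *\<^sub>R \<nu>) \<rho> \<subseteq> \<Omega>"
  proof
    fix x assume "x \<in> ball (y + \<rho> *\<^sub>R \<nu>) \<rho>"
    from bl[OF this \<nu>(1)] have x: "x \<in> ball y r" "(x - y) \<bullet> (x - y) < 2 * \<rho> * (\<nu> \<bullet> (x - y))" by auto
    then have "0 < s x" using sx[OF x(1)] Lm[OF inner_ge_zero x(2)] by linarith
    then show "x \<in> \<Omega>" using iff[OF x(1)] by simp
  qed
  have outside: "ball (y - \<rho> *\<^sub>R \<nu>) \<rho> \<inter> \<Omega> = {}"
  proof -
    have "x \<notin> \<Omega>" if x0: "x \<in> ball (y + \<rho> *\<^sub>R (- \<nu>)) \<rho>" for x
    proof -
      from bl[OF x0] have x: "x \<in> ball y r" "(x - y) \<bullet> (x - y) < 2 * \<rho> * ((- \<nu>) \<bullet> (x - y))" using \<nu>(1) by auto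
      have "L * ((x - y) \<bullet> (x - y)) < m * ((- \<nu>) \<bullet> (x - y))" by (rule Lm[OF inner_ge_zero x(2)])
      then have "s x < 0" using sx[OF x(1)] by simp
      then show ?thesis using iff[OF x(1)] by simp
    qed
    then show ?thesis by auto
  qed
  have push: "\<exists>r'>0. \<forall>x\<in>\<Omega> \<inter> ball y r'. \<forall>t\<in>{0..r'}. x + t *\<^sub>R v \<in> \<Omega>" if v: "0 < v \<bullet> \<nu>" for v
  proof -
    define k where "k = m * (v \<bullet> \<nu>)"
    define n where "n = norm v + 1"
    have k: "k > 0" using m v by (simp add: k_def)
    have n: "n \<ge> 1" "norm v \<le> n" by (auto simp: n_def)
    \<comment> \<open>Between \<open>y\<close> and \<open>x\<close> the derivative of
      \<open>s\<close> along \<open>v\<close> changes by at most half of \<open>k\<close>; the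
      quadratic error along the segment uses up at most the other half.\<close>
    define r' where "r' = min (r / (2 * n)) (k / (2 * (L + 1) * n\<^sup>2))"
    have r': "0 < r'" "2 * (r' * n) \<le> r" "2 * (L + 1) * n\<^sup>2 * r' \<le> k"
    proof -
      show "0 < r'" using r k n L by (simp add: r'_def)
      have "r' \<le> r / (2 * n)" "r' \<le> k / (2 * (L + 1) * n\<^sup>2)" by (simp_all add: r'_def)
      moreover have "0 < 2 * n" "0 < 2 * (L + 1) * n\<^sup>2" using n L by auto
      ultimately have "r' * (2 * n) \<le> r" "r' * (2 * (L + 1) * n\<^sup>2) \<le> k" by (simp_all only: pos_le_divide_eq)
      then show "2 * (r' * n) \<le> r" "2 * (L + 1) * n\<^sup>2 * r' \<le> k" by (simp_all add: mult_ac)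
    qed
    have r'n: "r' \<le> r' * n" using r' n by simp
    have Lr: "L * (r' * n\<^sup>2) \<le> k / 2"
    proof -
      have "L * (r' * n\<^sup>2) \<le> (L + 1) * (r' * n\<^sup>2)" using r' by (intro mult_right_mono) auto
      moreover have "2 * ((L + 1) * (r' * n\<^sup>2)) \<le> k" using r'(3) by (simp only: mult_ac)
      ultimately show ?thesis by linarith
    qed
    have "x + t *\<^sub>R v \<in> \<Omega>" if x: "x \<in> \<Omega> \<inter> ball y r'" and t: "t \<in> {0..r'}" for x t
    proof -
      have xr: "norm (x - y) < r'" using x by (simp add: dist_norm norm_minus_commute)
      have tv: "norm (t *\<^sub>R v) \<le> r' * n" using t n by (auto intro!: mult_mono)
      have "norm (x - y) < r" using xr r'n r'(2) r by linarith
      then have xb: "x \<in> ball y r" by (simp add: dist_norm norm_minus_commute)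
      have xtb: "x + t *\<^sub>R v \<in> ball y r"
      proof -
        have "norm (x + t *\<^sub>R v - y) \<le> norm (x - y) + norm (t *\<^sub>R v)"
          using norm_triangle_ineq[of "x - y" "t *\<^sub>R v"] by (simp add: algebra_simps)
        then show ?thesis using xr tv r'n r'(2) by (simp add: dist_norm norm_minus_commute)
      qed
      have "\<bar>(ds x - ds y) \<bullet> v\<bar> \<le> k / 2"
      proof -
        have "\<bar>(ds x - ds y) \<bullet> v\<bar> \<le> norm (ds x - ds y) * norm v" by (rule Cauchy_Schwarz_ineq2)
        also have "\<dots> \<le> (L * r') * n\<^sup>2"
        proof (intro mult_mono)
          show "norm (ds x - ds y) \<le> L * r'" using lip[OF yr xb] mult_left_mono[OF less_imp_le[OF xr] L] by linarith
          show "norm v \<le> n\<^sup>2" using n mult_left_mono[of 1 n n] unfolding power2_eq_square by linarith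
        qed (use L r' in auto)
        finally show ?thesis using Lr by (simp add: mult.assoc)
      qed
      moreover have "ds y \<bullet> v = k" by (simp add: \<nu>(2) k_def inner_commute)
      ultimately have dx: "k / 2 \<le> ds x \<bullet> v" unfolding inner_diff_left by linarith
      have "\<bar>s (x + t *\<^sub>R v) - s x - ds x \<bullet> (x + t *\<^sub>R v - x)\<bar> \<le> L * (norm (x + t *\<^sub>R v - x))\<^sup>2" by (rule tay[OF xb xtb])
      then have "s x + t * (ds x \<bullet> v) - L * (norm (t *\<^sub>R v))\<^sup>2 \<le> s (x + t *\<^sub>R v)" by (simp add: abs_le_iff)
      moreover have "L * (norm (t *\<^sub>R v))\<^sup>2 \<le> t * (k / 2)"
      proof -
        have "(norm (t *\<^sub>R v))\<^sup>2 = t * (t * (norm v)\<^sup>2)" by (simp add: power_mult_distrib power2_eq_square)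
        also have "\<dots> \<le> t * (r' * n\<^sup>2)" using t n by (intro mult_left_mono mult_mono power_mono) auto
        finally have "L * (norm (t *\<^sub>R v))\<^sup>2 \<le> L * (t * (r' * n\<^sup>2))" using L by (rule mult_left_mono)
        also have "\<dots> = t * (L * (r' * n\<^sup>2))" by simp
        also have "\<dots> \<le> t * (k / 2)" using Lr t by (intro mult_left_mono) auto
        finally show ?thesis .
      qed
      moreover have "t * (k / 2) \<le> t * (ds x \<bullet> v)" using dx t by (intro mult_left_mono) auto
      moreover have "0 < s x" using iff[OF xb] x by simp
      ultimately have "0 < s (x + t *\<^sub>R v)" by linarith
      then show ?thesis using iff[OF xtb] by simp
    qed
    then show ?thesis using r'(1) by blast
  qed
  have inner: "interior_unit_normal \<Omega> y \<nu>"
    unfolding interior_unit_normal_def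
  proof (intro conjI allI impI)
    show "norm \<nu> = 1" by (rule \<nu>(1))
    fix g v assume g: "g (0::real) = y" "range g \<subseteq> frontier \<Omega>" "(g has_vector_derivative v) (at 0)"
    have "(s has_derivative (\<lambda>h. ds y \<bullet> h)) (at (g 0))" using der g(1) by simp
    from diff_chain_at[OF g(3)[unfolded has_vector_derivative_def] this]
    have 1: "((\<lambda>t. s (g t)) has_derivative (\<lambda>h. ds y \<bullet> (h *\<^sub>R v))) (at 0)" by (simp add: o_def)
    have "isCont g 0" using g(3) has_vector_derivative_continuous by blast
    then obtain \<delta> where \<delta>: "\<delta> > 0" "\<And>t. dist t 0 < \<delta> \<Longrightarrow> dist (g t) (g 0) < r"
      using r unfolding continuous_at_eps_delta by (auto simp: dist_norm)
    have z: "s (g t) = 0" if "t \<in> ball 0 \<delta>" for t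
      using that \<delta>(2)[of t] g(1,2) by (intro fz) (auto simp: dist_commute)
    \<comment> \<open>A curve in the boundary keeps \<open>s\<close> at zero, so \<open>ds y\<close>
      annihilates its velocity.\<close>
    have "((\<lambda>t. 0) has_derivative (\<lambda>h. ds y \<bullet> (h *\<^sub>R v))) (at (0::real))"
      by (rule has_derivative_transform_within_open[OF 1 open_ball[of 0 \<delta>]]) (use \<delta>(1) z in auto)
    then have "(\<lambda>h::real. ds y \<bullet> (h *\<^sub>R v)) = (\<lambda>h. 0)" using has_derivative_unique[OF _ has_derivative_const] by blast
    then have "ds y \<bullet> (1 *\<^sub>R v) = 0" by metis
    then show "v \<bullet> \<nu> = 0" using m by (simp add: \<nu>(2) inner_commute)
  next
    obtain t0 where "t0 > 0" "\<And>t. 0 < t \<Longrightarrow> t < t0 \<Longrightarrow> y + t *\<^sub>R \<nu> \<in> ball (y + \<rho> *\<^sub>R \<nu>) \<rho>"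
      using ball_ray[OF \<nu>(1) \<rho>(1), of \<nu> y] nn by auto
    then show "\<exists>\<delta>>0. \<forall>t. 0 < t \<and> t < \<delta> \<longrightarrow> y + t *\<^sub>R \<nu> \<in> \<Omega>" using inside by blast
  qed
  show ?thesis using inner \<rho>(1) inside outside push by blast
qed

section \<open>Gradient at the boundary and reduction to the abstract setting\<close>

text \<open>Only the normal derivative is prescribed; the tangential part \<open>\<tau>\<close>
  vanishes by positivity. The difference quotients of \<open>u\<close> in inward directions are
  positive, so \<open>0 \<le> G y \<bullet> v\<close> on an open half space, and letting
  \<open>v\<close> tend to \<open>- \<tau>\<close> yields
  \<open>\<tau> \<bullet> \<tau> \<le> 0\<close>.\<close>

lemma boundary_gradient:
  fixes G :: "real^'N \<Rightarrow> real^'N"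
  assumes j: "jet u G H \<Omega>" and cu: "continuous_on (closure \<Omega>) u" and cG: "continuous_on (closure \<Omega>) G"
    and pos: "\<And>x. x \<in> \<Omega> \<Longrightarrow> 0 < u x" and y: "y \<in> closure \<Omega>" "u y = 0"
    and \<nu>: "norm \<nu> = 1" "\<And>v. 0 < v \<bullet> \<nu> \<Longrightarrow> \<exists>t0>0. \<forall>t. 0 < t \<and> t < t0 \<longrightarrow> y + t *\<^sub>R v \<in> \<Omega>"
    and der: "((\<lambda>t. u (y + t *\<^sub>R \<nu>)) has_real_derivative c) (at_right 0)"
  shows "G y = c *\<^sub>R \<nu>"
proof -
  have nn: "\<nu> \<bullet> \<nu> = 1" using \<nu>(1) by (simp add: dot_square_norm)
  have lim: "((\<lambda>t. u (y + t *\<^sub>R v) / t) \<longlongrightarrow> G y \<bullet> v) (at_right 0)" if v: "0 < v \<bullet> \<nu>" for v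
  proof (rule tendstoI)
    fix \<epsilon> :: real assume \<epsilon>: "\<epsilon> > 0"
    define n where "n = norm v + 1"
    have n: "n > 0" "norm v < n" by (auto simp: n_def add_nonneg_pos)
    have "\<epsilon> / n > 0" using \<epsilon> n by simp
    then obtain d where d: "d > 0" "\<And>x. x \<in> closure \<Omega> \<Longrightarrow> dist x y < d \<Longrightarrow> dist (G x) (G y) < \<epsilon> / n"
      using cG y(1) unfolding continuous_on_iff by blast
    obtain t0 where t0: "t0 > 0" "\<And>t. 0 < t \<Longrightarrow> t < t0 \<Longrightarrow> y + t *\<^sub>R v \<in> \<Omega>" using \<nu>(2)[OF v] by auto
    have "\<forall>\<^sub>F t in at_right 0. t \<in> {0<..<min t0 (d / n)}" using t0 d n by (intro eventually_at_rightI[of 0 "min t0 (d / n)"]) auto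
    then show "\<forall>\<^sub>F t in at_right 0. dist (u (y + t *\<^sub>R v) / t) (G y \<bullet> v) < \<epsilon>"
    proof eventually_elim
      case (elim t)
      have inD: "y + s *\<^sub>R v \<in> \<Omega>" if "0 < s" "s \<le> t" for s using t0(2)[of s] that elim by simp
      have "continuous_on {0..t} (\<lambda>s. u (y + s *\<^sub>R v))"
      proof (rule continuous_on_compose2[OF cu])
        show "(\<lambda>s. y + s *\<^sub>R v) ` {0..t} \<subseteq> closure \<Omega>"
        proof
          fix z assume "z \<in> (\<lambda>s. y + s *\<^sub>R v) ` {0..t}"
          then obtain s where "0 \<le> s" "s \<le> t" "z = y + s *\<^sub>R v" by auto
          then show "z \<in> closure \<Omega>" using inD[of s] y(1) closure_subset[of \<Omega>] by (cases "s = 0") auto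
        qed
      qed (intro continuous_intros)
      moreover have "((\<lambda>s. u (y + s *\<^sub>R v)) has_derivative (\<lambda>h. h * (G (y + s *\<^sub>R v) \<bullet> v))) (at s)" if "0 < s" "s < t" for s
      proof -
        have l: "((\<lambda>s. y + s *\<^sub>R v) has_derivative (\<lambda>h. h *\<^sub>R v)) (at s)" by (auto intro!: derivative_eq_intros)
        have "y + s *\<^sub>R v \<in> \<Omega>" using inD that by simp
        from diff_chain_at[OF l jetD(2)[OF j this]] show ?thesis by (simp add: o_def)
      qed
      moreover have "0 < t" using elim by simp
      ultimately obtain s where s: "0 < s" "s < t" "u (y + t *\<^sub>R v) - u (y + 0 *\<^sub>R v) = (t - 0) * (G (y + s *\<^sub>R v) \<bullet> v)"
        using mvt[of 0 t "\<lambda>s. u (y + s *\<^sub>R v)" "\<lambda>s h. h * (G (y + s *\<^sub>R v) \<bullet> v)"] by blast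
      then have eq: "u (y + t *\<^sub>R v) / t = G (y + s *\<^sub>R v) \<bullet> v" using y(2) elim by simp
      have "dist (y + s *\<^sub>R v) y = s * norm v" using s by (simp add: dist_norm)
      also have "\<dots> \<le> t * n" using s n by (intro mult_mono) auto
      also have "\<dots> < d" using elim n by (simp add: less_divide_eq)
      finally have "dist (G (y + s *\<^sub>R v)) (G y) < \<epsilon> / n" using inD[of s] s closure_subset[of \<Omega>] by (intro d(2)) auto
      then have "norm (G (y + s *\<^sub>R v) - G y) * n < \<epsilon>" using n by (simp add: dist_norm less_divide_eq)
      moreover have "\<bar>(G (y + s *\<^sub>R v) - G y) \<bullet> v\<bar> \<le> norm (G (y + s *\<^sub>R v) - G y) * n"
        using Cauchy_Schwarz_ineq2[of "G (y + s *\<^sub>R v) - G y" v] mult_left_mono[of "norm v" n "norm (G (y + s *\<^sub>R v) - G y)"] n by simp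
      ultimately show ?case unfolding eq by (simp add: dist_real_def inner_diff_left)
    qed
  qed
  have nonneg: "0 \<le> G y \<bullet> v" if v: "0 < v \<bullet> \<nu>" for v
  proof -
    obtain t0 where t0: "t0 > 0" "\<And>t. 0 < t \<Longrightarrow> t < t0 \<Longrightarrow> y + t *\<^sub>R v \<in> \<Omega>" using \<nu>(2)[OF v] by auto
    have "\<forall>\<^sub>F t in at_right 0. t \<in> {0<..<t0}" using t0 by (intro eventually_at_rightI) auto
    then have "\<forall>\<^sub>F t in at_right 0. 0 \<le> u (y + t *\<^sub>R v) / t"
      by eventually_elim (use pos t0(2) in \<open>auto intro!: divide_nonneg_pos less_imp_le\<close>)
    with lim[OF v] show ?thesis by (rule tendsto_lowerbound) simp
  qed
  have "((\<lambda>t. u (y + t *\<^sub>R \<nu>) / t) \<longlongrightarrow> c) (at_right 0)"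
    using der y(2) by (simp add: has_field_derivative_iff)
  then have c: "G y \<bullet> \<nu> = c" using tendsto_unique[OF _ lim[of \<nu>]] nn by simp
  define \<tau> where "\<tau> = G y - c *\<^sub>R \<nu>"
  have \<tau>n: "\<tau> \<bullet> \<nu> = 0" by (simp add: \<tau>_def inner_diff_left c nn)
  have "G y = \<tau> + c *\<^sub>R \<nu>" by (simp add: \<tau>_def)
  then have G\<tau>: "G y \<bullet> \<tau> = \<tau> \<bullet> \<tau>" using \<tau>n by (simp add: inner_add_left inner_add_right inner_commute)
  have "\<tau> \<bullet> \<tau> \<le> 0 + \<epsilon>" if \<epsilon>: "\<epsilon> > 0" for \<epsilon>
  proof -
    define d where "d = \<epsilon> / (\<bar>c\<bar> + 1)"
    have d: "d > 0" "d * c \<le> \<epsilon>"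
    proof -
      have p: "\<bar>c\<bar> + 1 > 0" by simp
      then show "d > 0" using \<epsilon> by (simp add: d_def)
      then have "d * c \<le> d * (\<bar>c\<bar> + 1)" by (intro mult_left_mono) auto
      also have "\<dots> = \<epsilon>" using p by (simp add: d_def)
      finally show "d * c \<le> \<epsilon>" .
    qed
    have "0 < (- \<tau> + d *\<^sub>R \<nu>) \<bullet> \<nu>" using \<tau>n nn d by (simp add: inner_diff_left)
    from nonneg[OF this] have "\<tau> \<bullet> \<tau> \<le> d * c" by (simp add: inner_diff_right G\<tau> c)
    then show ?thesis using d by simp
  qed
  then have "\<tau> \<bullet> \<tau> \<le> 0" by (rule field_le_epsilon)
  then have "\<tau> = 0" by (metis inner_ge_zero inner_eq_zero_iff order_antisym)
  then show ?thesis by (simp add: \<tau>_def)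
qed

theorem theorem1p2:
  fixes \<Omega> :: "(real^'N) set"
    and F :: "'n::finite \<Rightarrow> real^'N \<Rightarrow> real^'N^'N \<Rightarrow> real"
    and f :: "'n \<Rightarrow> real^'n \<Rightarrow> real^'N \<Rightarrow> real"
    and u :: "'n \<Rightarrow> real^'N \<Rightarrow> real"
  assumes "bounded_C2_domain \<Omega>"
    and "\<And>i. C1_in_matrix (F i)"
    and "\<And>i. H0 (F i) (f i)"
    and "\<And>i. H1 (F i)"
    and "\<And>i. H2 (f i)"
    and "\<And>i. H4 i (f i)"
    and "\<And>i. H5 i (f i)"
    and "\<And>i. C2_closure \<Omega> (u i)"
    and "\<And>i x. x \<in> \<Omega> \<Longrightarrow>
           F i (grad (u i) x) (hessian (u i) x) + f i (\<chi> j. u j x) (grad (u i) x) = 0"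
    and "\<And>i x. x \<in> \<Omega> \<Longrightarrow> u i x > 0"
    and "\<And>i x. x \<in> frontier \<Omega> \<Longrightarrow> u i x = 0"
    and "\<And>i. \<exists>c. \<forall>x\<in>frontier \<Omega>. has_normal_deriv \<Omega> (u i) x c"
  shows "\<exists>x0 R. R > 0 \<and> \<Omega> = ball x0 R \<and>
           (\<forall>i. radially_symmetric_on (closure \<Omega>) x0 (u i) \<and>
                (\<forall>x\<in>\<Omega> - {x0}. \<exists>d<0. has_radial_deriv x0 (u i) x d))"
proof -
  have dom: "open \<Omega>" "connected \<Omega>" "\<Omega> \<noteq> {}" "bounded \<Omega>" "C2_boundary \<Omega>"
    using assms(1) by (auto simp: bounded_C2_domain_def)
  obtain c where c: "\<And>i x. x \<in> frontier \<Omega> \<Longrightarrow> has_normal_deriv \<Omega> (u i) x (c i)" using assms(12) by metis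
  obtain nu where nu: "\<And>y. y \<in> frontier \<Omega> \<Longrightarrow> interior_unit_normal \<Omega> y (nu y)"
    "\<And>y. y \<in> frontier \<Omega> \<Longrightarrow> \<exists>\<rho>>0. ball (y + \<rho> *\<^sub>R nu y) \<rho> \<subseteq> \<Omega> \<and> ball (y - \<rho> *\<^sub>R nu y) \<rho> \<inter> \<Omega> = {}"
    "\<And>y v. y \<in> frontier \<Omega> \<Longrightarrow> 0 < v \<bullet> nu y \<Longrightarrow> \<exists>r>0. \<forall>x\<in>\<Omega> \<inter> ball y r. \<forall>t\<in>{0..r}. x + t *\<^sub>R v \<in> \<Omega>"
    using C2_boundary_normal[OF dom(1,5)] by metis
  have n1: "norm (nu y) = 1" if "y \<in> frontier \<Omega>" for y using nu(1)[OF that] by (simp add: interior_unit_normal_def)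
  have reg: "C2_on \<Omega> (u i)" "continuous_on (closure \<Omega>) (u i)" for i using assms(8)[of i] by (auto simp: C2_closure_def)
  obtain G H where GH: "\<And>i. continuous_on (closure \<Omega>) (G i)" "\<And>i x. x \<in> \<Omega> \<Longrightarrow> G i x = grad (u i) x"
    "\<And>i. continuous_on (closure \<Omega>) (H i)" "\<And>i x. x \<in> \<Omega> \<Longrightarrow> H i x = hessian (u i) x"
    using assms(8) unfolding C2_closure_def by metis
  have jet: "jet (u i) (G i) (H i) \<Omega>" for i
    unfolding jet_def
  proof (intro conjI ballI dom(1))
    fix x assume x: "x \<in> \<Omega>"
    note j = jetD(2,3)[OF jet_of_C2_on[OF reg(1)[of i]] x]
    show "(u i has_derivative (\<bullet>) (G i x)) (at x)" using j(1) by (simp add: GH(2)[OF x])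
    show "(G i has_derivative (*v) (H i x)) (at x)"
      unfolding GH(4)[OF x] by (rule has_derivative_transform_within_open[OF j(2) dom(1) x]) (simp add: GH(2))
  qed
  have bg: "G i y = c i *\<^sub>R nu y" if y: "y \<in> frontier \<Omega>" for i y
  proof (rule boundary_gradient[OF jet reg(2) GH(1) assms(10) _ assms(11)[OF y] n1[OF y]])
    show "y \<in> closure \<Omega>" using y by (simp add: frontier_def)
    \<comment> \<open>\<open>has_normal_deriv\<close> quantifies over all interior unit normals, so
      it applies to the normal \<open>nu y\<close> chosen above.\<close>
    show "((\<lambda>t. u i (y + t *\<^sub>R nu y)) has_real_derivative c i) (at_right 0)"
      using c[OF y, of i] nu(1)[OF y] unfolding has_normal_deriv_def by blast
    fix v assume v: "0 < v \<bullet> nu y"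
    obtain \<rho> where \<rho>: "\<rho> > 0" "ball (y + \<rho> *\<^sub>R nu y) \<rho> \<subseteq> \<Omega>" using nu(2)[OF y] by blast
    show "\<exists>t0>0. \<forall>t. 0 < t \<and> t < t0 \<longrightarrow> y + t *\<^sub>R v \<in> \<Omega>"
      using ball_ray[OF n1[OF y] \<rho>(1) v, of y] \<rho>(2) by (meson subsetD)
  qed
  interpret overdetermined \<Omega> F f u G H c nu
    by unfold_locales (use dom n1 nu(2,3) jet reg(2) GH assms(3-7,9-11) bg in auto)
  show ?thesis by (rule radial)
qed

end
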